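(* Let $S$ be a spray on a manifold $M$ of dimension $n\ge2$, and let $c\colon I\to M$ be a geodesic of $S$, where $I$ is a compact interval containing $0$ and $c$ does not intersect itself (i.e. $c$ is injective). Suppose $J$ is an invertible Jacobi tensor along $c$. Then there exist an open interval $I^\ast\supset I$, an $\varepsilon>0$ and a map $V\colon I^\ast\times(-\varepsilon,\varepsilon)^{n-1}\to M$ such that (1) $V(t,0,\ldots,0)=c(t)$ for $t\in I$; (2) $V$ is a diffeomorphism onto its range, that is, $I^\ast\times(-\varepsilon,\varepsilon)^{n-1}$ are local coordinates around $c(I)$; (3) for every $(s^1,\ldots,s^{n-1})\in(-\varepsilon,\varepsilon)^{n-1}$ the curve $t\mapsto V(t,s^1,\ldots,s^{n-1})$, $t\in I^\ast$, is a geodesic of $S$.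
   Context: $M$ is a smooth manifold (Hausdorff, countable base, without boundary); all objects are $C^\infty$-smooth. $TM\setminus\{0\}$ is the set of nonzero tangent vectors. A semispray on $M$ is a vector field $S$ on $TM\setminus\{0\}$ with $D\pi\circ S=\mathrm{id}$, where $\pi\colon TM\to M$ is the projection; locally $S=y^i\frac{\partial}{\partial x^i}-2G^i(x,y)\frac{\partial}{\partial y^i}$ in induced coordinates $(x^i,y^i)$ of $TM$. $S$ is a spray if moreover $[\mathbb{C},S]=S$, where $\mathbb{C}=y^i\frac{\partial}{\partial y^i}$ is the Liouville vector field (so each $G^i$ is positively $2$-homogeneous in $y$). A curve $c\colon I\to M$ with $c'(t)\ne0$ for all $t$ is a geodesic of $S$ if $c''=S\circ c'$, i.e. locally $\ddot x^i+2G^i(c')=0$. A curve on a closed interval is a geodesic if it extends to a geodesic on an open interval. Put $N^i_j=\partial G^i/\partial y^j$. Along a geodesic $c$ the dynamical covariant derivative $\nabla$ is defined by: $\nabla X=\left(\frac{dX^i}{dt}+N^i_j(c')X^j\right)\frac{\partial}{\partial x^i}$ for a vector field $X=X^i(t)\frac{\partial}{\partial x^i}|_{c(t)}$ along $c$; $\nabla\alpha=\left(\frac{d\alpha_i}{dt}-N^j_i(c')\alpha_j\right)dx^i$ for a $(0,1)$-tensor $\alpha$ along $c$; $\nabla f=df/dt$ for functions; and it extends to all tensors along $c$ by the Leibniz rule, so that for a $(1,1)$-tensor $J$ along $c$, $\nabla(J\circ v)=(\nabla J)\circ v+J\circ\nabla v$. A tensor $T$ along $c$ is parallel if $\nabla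 T=0$. The Jacobi endomorphism is the $(1,1)$-tensor along $c$ given by $\Phi=\Phi^i_j(c')\frac{\partial}{\partial x^i}\otimes dx^j|_{c(t)}$ with $\Phi^i_j=2\frac{\partial G^i}{\partial x^j}-S\left(\frac{\partial G^i}{\partial y^j}\right)-\frac{\partial G^i}{\partial y^r}\frac{\partial G^r}{\partial y^j}$. A Jacobi tensor along $c$ is a $(1,1)$-tensor $J$ along $c$ with $\nabla^2J+\Phi\circ J=0$. Given an $(n-1)$-dimensional subspace $W\subset T_{c(0)}M$ with $c'(0)\notin W$, a basis of $W$ extends uniquely to parallel vector fields $e_1(t),\ldots,e_{n-1}(t)$ along $c$; $W_t=\operatorname{span}\{e_1(t),\ldots,e_{n-1}(t)\}$ is independent of the basis and $T_{c(t)}M=\operatorname{span}\{c'(t)\}\oplus W_t$. A $(1,1)$-tensor $J$ along $c$ is transversal with respect to $W_t$ if $J\circ c'(t)=0$ and $\operatorname{Im}J(t)\subset W_t$ for all $t\in I$. $J$ is invertible if, for some such $W$, $J$ is transversal with respect to $W_t$ and $J|_{W_t}\colon W_t\to W_t$ is an invertible linear map for each $t\in I$. *)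

theory Defs
  imports "HOL-Analysis.Analysis" "HOL-Library.Function_Algebras"
begin

section \<open>Pointwise real vector space structure on functions\<close>

instantiation "fun" :: (type, real_vector) real_vector
begin

definition scaleR_fun :: "real \<Rightarrow> ('a \<Rightarrow> 'b) \<Rightarrow> 'a \<Rightarrow> 'b"
  where "scaleR_fun r f = (\<lambda>x. r *\<^sub>R f x)"

instance
  by standard (auto simp: scaleR_fun_def fun_eq_iff algebra_simps)

end


section \<open>Smooth maps between subsets of normed spaces\<close>

text \<open>Derivatives are taken within \<open>U\<close>. They are unique, so that this is the usual notion, when
  \<open>U\<close> is open and when \<open>U\<close> is a relatively open subset of a nondegenerate real interval (one-sided
  derivatives at end points); it is applied to such \<open>U\<close> only. By recursion, \<open>Ck_on k U f\<close> says
  that all iterated directional derivatives of order at most \<open>k\<close> exist and are continuous.\<close>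

primrec Ck_on :: "nat \<Rightarrow> 'a set \<Rightarrow> ('a::real_normed_vector \<Rightarrow> 'b::real_normed_vector) \<Rightarrow> bool" where
  "Ck_on 0 U f \<longleftrightarrow> continuous_on U f"
| "Ck_on (Suc k) U f \<longleftrightarrow>
     f differentiable_on U \<and> (\<forall>v. Ck_on k U (\<lambda>x. frechet_derivative f (at x within U) v))"

definition smooth_on :: "'a set \<Rightarrow> ('a::real_normed_vector \<Rightarrow> 'b::real_normed_vector) \<Rightarrow> bool" where
  "smooth_on U f \<longleftrightarrow> (\<forall>k. Ck_on k U f)"


section \<open>Smooth manifolds\<close>

datatype ('a, 'e) chart = Chart (chart_dom: "'a set") (chart_map: "'a \<Rightarrow> 'e")

definition chart_inv :: "('a, 'e) chart \<Rightarrow> 'e \<Rightarrow> 'a" where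
  "chart_inv \<phi> = inv_into (chart_dom \<phi>) (chart_map \<phi>)"

definition transition :: "('a, 'e) chart \<Rightarrow> ('a, 'e) chart \<Rightarrow> 'e \<Rightarrow> 'e" where
  "transition \<phi> \<psi> = chart_map \<psi> \<circ> chart_inv \<phi>"

definition atlas_carrier :: "('a, 'e) chart set \<Rightarrow> 'a set" where
  "atlas_carrier A = \<Union> (chart_dom ` A)"

definition smooth_atlas :: "('a, 'e::euclidean_space) chart set \<Rightarrow> bool" where
  "smooth_atlas A \<longleftrightarrow>
     (\<forall>\<phi>\<in>A. inj_on (chart_map \<phi>) (chart_dom \<phi>) \<and> open (chart_map \<phi> ` chart_dom \<phi>)) \<and>
     (\<forall>\<phi>\<in>A. \<forall>\<psi>\<in>A.
        open (chart_map \<phi> ` (chart_dom \<phi> \<inter> chart_dom \<psi>)) \<and>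
        smooth_on (chart_map \<phi> ` (chart_dom \<phi> \<inter> chart_dom \<psi>)) (transition \<phi> \<psi>))"

text \<open>The topology for which the charts are homeomorphisms onto open sets.\<close>

definition atlas_topology :: "('a, 'e::euclidean_space) chart set \<Rightarrow> 'a topology" where
  "atlas_topology A = topology (\<lambda>U. U \<subseteq> atlas_carrier A \<and>
     (\<forall>\<phi>\<in>A. open (chart_map \<phi> ` (U \<inter> chart_dom \<phi>))))"

lemma openin_atlas_topology:
  assumes "smooth_atlas A"
  shows "openin (atlas_topology A) U \<longleftrightarrow>
    U \<subseteq> atlas_carrier A \<and> (\<forall>\<phi>\<in>A. open (chart_map \<phi> ` (U \<inter> chart_dom \<phi>)))"
proof -
  let ?P = "\<lambda>U. U \<subseteq> atlas_carrier A \<and> (\<forall>\<phi>\<in>A. open (chart_map \<phi> ` (U \<inter> chart_dom \<phi>)))"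
  have "?P (U \<inter> V)" if U: "?P U" and V: "?P V" for U V
  proof (intro conjI ballI)
    fix \<phi> assume "\<phi> \<in> A"
    then have "inj_on (chart_map \<phi>) (chart_dom \<phi>)"
      using assms by (simp add: smooth_atlas_def)
    then have "chart_map \<phi> ` (U \<inter> V \<inter> chart_dom \<phi>) =
        chart_map \<phi> ` (U \<inter> chart_dom \<phi>) \<inter> chart_map \<phi> ` (V \<inter> chart_dom \<phi>)"
      unfolding inj_on_def by blast
    then show "open (chart_map \<phi> ` (U \<inter> V \<inter> chart_dom \<phi>))"
      using U V \<open>\<phi> \<in> A\<close> by (simp add: open_Int)
  qed (use U in blast)
  moreover have "?P (\<Union>K)" if K: "\<forall>U\<in>K. ?P U" for K
  proof (intro conjI ballI)
    fix \<phi> assume "\<phi> \<in> A"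
    have "chart_map \<phi> ` (\<Union>K \<inter> chart_dom \<phi>) = (\<Union>U\<in>K. chart_map \<phi> ` (U \<inter> chart_dom \<phi>))"
      by blast
    then show "open (chart_map \<phi> ` (\<Union>K \<inter> chart_dom \<phi>))"
      using K \<open>\<phi> \<in> A\<close> by auto
  qed (use K in blast)
  ultimately have "istopology ?P"
    unfolding istopology_def by blast
  then show ?thesis
    by (simp add: atlas_topology_def)
qed

text \<open>A manifold is given by an atlas, not assumed maximal; all notions below are invariant under
  enlarging it by compatible charts. The dimension is that of the model space \<open>'e\<close>.\<close>

definition smooth_manifold :: "('a, 'e::euclidean_space) chart set \<Rightarrow> bool" where
  "smooth_manifold A \<longleftrightarrow> smooth_atlas A \<and>
     Hausdorff_space (atlas_topology A) \<and> second_countable (atlas_topology A)"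

definition smooth_map ::
    "('a, 'e::euclidean_space) chart set \<Rightarrow> ('b, 'f::euclidean_space) chart set \<Rightarrow> ('a \<Rightarrow> 'b) \<Rightarrow> bool" where
  "smooth_map A B F \<longleftrightarrow> F ` atlas_carrier A \<subseteq> atlas_carrier B \<and>
     (\<forall>\<phi>\<in>A. \<forall>\<psi>\<in>B.
        open (chart_map \<phi> ` {p \<in> chart_dom \<phi>. F p \<in> chart_dom \<psi>}) \<and>
        smooth_on (chart_map \<phi> ` {p \<in> chart_dom \<phi>. F p \<in> chart_dom \<psi>})
          (chart_map \<psi> \<circ> F \<circ> chart_inv \<phi>))"

definition diffeomorphism ::
    "('a, 'e::euclidean_space) chart set \<Rightarrow> ('b, 'f::euclidean_space) chart set \<Rightarrow> ('a \<Rightarrow> 'b) \<Rightarrow> bool" where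
  "diffeomorphism A B F \<longleftrightarrow> bij_betw F (atlas_carrier A) (atlas_carrier B) \<and>
     smooth_map A B F \<and> smooth_map B A (inv_into (atlas_carrier A) F)"

definition restrict_chart :: "'a set \<Rightarrow> ('a, 'e) chart \<Rightarrow> ('a, 'e) chart" where
  "restrict_chart U \<phi> = Chart (chart_dom \<phi> \<inter> U) (chart_map \<phi>)"

text \<open>The open submanifold \<open>U\<close>, and an open subset of a Euclidean space as a manifold.\<close>

definition restrict_atlas :: "('a, 'e) chart set \<Rightarrow> 'a set \<Rightarrow> ('a, 'e) chart set" where
  "restrict_atlas A U = restrict_chart U ` A"

definition open_atlas :: "'e set \<Rightarrow> ('e, 'e) chart set" where
  "open_atlas W = {Chart W id}"


section \<open>Tangent bundle and vector fields\<close>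

text \<open>A tangent vector at \<open>p\<close> is the family \<open>v\<close> of its components \<open>v \<phi>\<close> in the charts \<open>\<phi>\<close> around
  \<open>p\<close>, subject to the transformation law; at all other \<open>\<phi>\<close> the family is set to \<open>0\<close>, which makes
  it unique. An element of the tangent bundle is a pair \<open>(p, v)\<close>.\<close>

type_synonym ('a, 'e) tvec = "('a, 'e) chart \<Rightarrow> 'e"

definition tangent_space :: "('a, 'e::euclidean_space) chart set \<Rightarrow> 'a \<Rightarrow> ('a, 'e) tvec set" where
  "tangent_space A p = {v.
     (\<forall>\<phi>\<in>A. \<forall>\<psi>\<in>A. p \<in> chart_dom \<phi> \<longrightarrow> p \<in> chart_dom \<psi> \<longrightarrow>
        v \<psi> = frechet_derivative (transition \<phi> \<psi>) (at (chart_map \<phi> p)) (v \<phi>)) \<and>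
     (\<forall>\<phi>. \<not> (\<phi> \<in> A \<and> p \<in> chart_dom \<phi>) \<longrightarrow> v \<phi> = 0)}"

definition tangent_bundle :: "('a, 'e::euclidean_space) chart set \<Rightarrow> ('a \<times> ('a, 'e) tvec) set" where
  "tangent_bundle A = Sigma (atlas_carrier A) (tangent_space A)"

definition on_charts :: "('a, 'e) chart set \<Rightarrow> 'a \<Rightarrow> (('a, 'e) chart \<Rightarrow> 'e::zero) \<Rightarrow> ('a, 'e) tvec" where
  "on_charts A p f = (\<lambda>\<phi>. if \<phi> \<in> A \<and> p \<in> chart_dom \<phi> then f \<phi> else 0)"

text \<open>The tangent vector at \<open>p\<close> whose components in the chart \<open>\<phi>\<close> are \<open>y\<close>.\<close>

definition coord_vector ::
    "('a, 'e::euclidean_space) chart set \<Rightarrow> ('a, 'e) chart \<Rightarrow> 'a \<Rightarrow> 'e \<Rightarrow> ('a, 'e) tvec" where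
  "coord_vector A \<phi> p y =
     on_charts A p (\<lambda>\<psi>. frechet_derivative (transition \<phi> \<psi>) (at (chart_map \<phi> p)) y)"

text \<open>Induced coordinates \<open>(x, y)\<close> on the tangent bundle.\<close>

definition tangent_chart ::
    "('a, 'e::euclidean_space) chart set \<Rightarrow> ('a, 'e) chart \<Rightarrow> ('a \<times> ('a, 'e) tvec, 'e \<times> 'e) chart" where
  "tangent_chart A \<phi> =
     Chart {u \<in> tangent_bundle A. fst u \<in> chart_dom \<phi>} (\<lambda>u. (chart_map \<phi> (fst u), snd u \<phi>))"

definition tangent_atlas ::
    "('a, 'e::euclidean_space) chart set \<Rightarrow> ('a \<times> ('a, 'e) tvec, 'e \<times> 'e) chart set" where
  "tangent_atlas A = tangent_chart A ` A"

definition tangent_map :: "('a, 'e::euclidean_space) chart set \<Rightarrow> ('b, 'f::euclidean_space) chart set \<Rightarrow>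
    ('a \<Rightarrow> 'b) \<Rightarrow> 'a \<times> ('a, 'e) tvec \<Rightarrow> 'b \<times> ('b, 'f) tvec" where
  "tangent_map A B F u =
     (let \<phi> = (SOME \<phi>. \<phi> \<in> A \<and> fst u \<in> chart_dom \<phi>)
      in (F (fst u), on_charts B (F (fst u)) (\<lambda>\<psi>.
            frechet_derivative (chart_map \<psi> \<circ> F \<circ> chart_inv \<phi>) (at (chart_map \<phi> (fst u))) (snd u \<phi>))))"

definition vector_field ::
    "('a, 'e::euclidean_space) chart set \<Rightarrow> ('a \<Rightarrow> 'a \<times> ('a, 'e) tvec) \<Rightarrow> bool" where
  "vector_field A X \<longleftrightarrow> smooth_map A (tangent_atlas A) X \<and> (\<forall>p\<in>atlas_carrier A. fst (X p) = p)"

definition vf_components :: "('a, 'e) chart \<Rightarrow> ('a \<Rightarrow> 'a \<times> ('a, 'e) tvec) \<Rightarrow> 'e \<Rightarrow> 'e" where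
  "vf_components \<phi> X z = snd (X (chart_inv \<phi> z)) \<phi>"

text \<open>In coordinates, \<open>[X, Y]\<^sup>i = X\<^sup>j \<partial>\<^sub>j Y\<^sup>i - Y\<^sup>j \<partial>\<^sub>j X\<^sup>i\<close>.\<close>

definition lie_bracket :: "('a, 'e::euclidean_space) chart set \<Rightarrow> ('a \<Rightarrow> 'a \<times> ('a, 'e) tvec) \<Rightarrow>
    ('a \<Rightarrow> 'a \<times> ('a, 'e) tvec) \<Rightarrow> 'a \<Rightarrow> 'a \<times> ('a, 'e) tvec" where
  "lie_bracket A X Y p = (p, on_charts A p (\<lambda>\<phi>.
     frechet_derivative (vf_components \<phi> Y) (at (chart_map \<phi> p)) (snd (X p) \<phi>) -
     frechet_derivative (vf_components \<phi> X) (at (chart_map \<phi> p)) (snd (Y p) \<phi>)))"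

text \<open>Velocity of a curve. At the end points of an interval \<open>I\<close> it is one-sided.\<close>

definition velocity :: "('a, 'e::euclidean_space) chart set \<Rightarrow> real set \<Rightarrow> (real \<Rightarrow> 'a) \<Rightarrow>
    real \<Rightarrow> 'a \<times> ('a, 'e) tvec" where
  "velocity A I c t =
     (c t, on_charts A (c t) (\<lambda>\<phi>. vector_derivative (chart_map \<phi> \<circ> c) (at t within I)))"


section \<open>Sprays and geodesics\<close>

definition slit_bundle :: "('a, 'e::euclidean_space) chart set \<Rightarrow> ('a \<times> ('a, 'e) tvec) set" where
  "slit_bundle A = {u \<in> tangent_bundle A. snd u \<noteq> 0}"

definition slit_chart ::
    "('a, 'e::euclidean_space) chart set \<Rightarrow> ('a, 'e) chart \<Rightarrow> ('a \<times> ('a, 'e) tvec, 'e \<times> 'e) chart" where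
  "slit_chart A \<phi> = restrict_chart (slit_bundle A) (tangent_chart A \<phi>)"

definition slit_atlas ::
    "('a, 'e::euclidean_space) chart set \<Rightarrow> ('a \<times> ('a, 'e) tvec, 'e \<times> 'e) chart set" where
  "slit_atlas A = restrict_atlas (tangent_atlas A) (slit_bundle A)"

text \<open>Vector fields on the slit tangent bundle take values in its tangent bundle.\<close>

type_synonym ('a, 'e) slit_field = "'a \<times> ('a, 'e) tvec \<Rightarrow>
  ('a \<times> ('a, 'e) tvec) \<times> ('a \<times> ('a, 'e) tvec, 'e \<times> 'e) tvec"

definition semispray ::
    "('a, 'e::euclidean_space) chart set \<Rightarrow> ('a, 'e) slit_field \<Rightarrow> bool" where
  "semispray A S \<longleftrightarrow> vector_field (slit_atlas A) S \<and>
     (\<forall>u\<in>slit_bundle A. tangent_map (slit_atlas A) A fst (S u) = u)"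

definition liouville ::
    "('a, 'e::euclidean_space) chart set \<Rightarrow> ('a, 'e) slit_field" where
  "liouville A u = (u, on_charts (slit_atlas A) u (\<lambda>\<kappa>. (0, snd (chart_map \<kappa> u))))"

definition spray ::
    "('a, 'e::euclidean_space) chart set \<Rightarrow> ('a, 'e) slit_field \<Rightarrow> bool" where
  "spray A S \<longleftrightarrow> semispray A S \<and>
     (\<forall>u\<in>slit_bundle A. lie_bracket (slit_atlas A) (liouville A) S u = S u)"

text \<open>\<open>I\<close> is an open interval in \<open>geodesic_on\<close> and a closed one in \<open>geodesic_on_closed\<close>.\<close>

definition geodesic_on :: "('a, 'e::euclidean_space) chart set \<Rightarrow> ('a, 'e) slit_field \<Rightarrow>
    real set \<Rightarrow> (real \<Rightarrow> 'a) \<Rightarrow> bool" where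
  "geodesic_on A S I c \<longleftrightarrow> open I \<and> is_interval I \<and> smooth_map (open_atlas I) A c \<and>
     (\<forall>t\<in>I. snd (velocity A I c t) \<noteq> 0 \<and>
        velocity (slit_atlas A) I (velocity A I c) t = S (velocity A I c t))"

definition geodesic_on_closed :: "('a, 'e::euclidean_space) chart set \<Rightarrow> ('a, 'e) slit_field \<Rightarrow>
    real set \<Rightarrow> (real \<Rightarrow> 'a) \<Rightarrow> bool" where
  "geodesic_on_closed A S I c \<longleftrightarrow> (\<exists>I' c'. I \<subseteq> I' \<and> geodesic_on A S I' c' \<and> (\<forall>t\<in>I. c' t = c t))"


section \<open>The dynamical covariant derivative\<close>

text \<open>In the chart \<open>\<phi>\<close> and at \<open>z = (x, y)\<close>: the coefficients \<open>G\<^sup>i\<close>, from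
  \<open>S = y\<^sup>i \<partial>/\<partial>x\<^sup>i - 2 G\<^sup>i \<partial>/\<partial>y\<^sup>i\<close>, and the linear maps \<open>w \<mapsto> N\<^sup>i\<^sub>j w\<^sup>j\<close> and \<open>w \<mapsto> \<Phi>\<^sup>i\<^sub>j w\<^sup>j\<close>.\<close>

definition spray_coeff :: "('a, 'e::euclidean_space) chart set \<Rightarrow> ('a, 'e) slit_field \<Rightarrow>
    ('a, 'e) chart \<Rightarrow> 'e \<times> 'e \<Rightarrow> 'e" where
  "spray_coeff A S \<phi> z = - (1/2) *\<^sub>R snd (vf_components (slit_chart A \<phi>) S z)"

definition conn_coeff :: "('a, 'e::euclidean_space) chart set \<Rightarrow> ('a, 'e) slit_field \<Rightarrow>
    ('a, 'e) chart \<Rightarrow> 'e \<times> 'e \<Rightarrow> 'e \<Rightarrow> 'e" where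
  "conn_coeff A S \<phi> z w =
     frechet_derivative (\<lambda>y. spray_coeff A S \<phi> (fst z, y)) (at (snd z)) w"

definition jacobi_coeff :: "('a, 'e::euclidean_space) chart set \<Rightarrow> ('a, 'e) slit_field \<Rightarrow>
    ('a, 'e) chart \<Rightarrow> 'e \<times> 'e \<Rightarrow> 'e \<Rightarrow> 'e" where
  "jacobi_coeff A S \<phi> z w =
     2 *\<^sub>R frechet_derivative (\<lambda>x. spray_coeff A S \<phi> (x, snd z)) (at (fst z)) w
     - frechet_derivative (\<lambda>z'. conn_coeff A S \<phi> z' w) (at z) (vf_components (slit_chart A \<phi>) S z)
     - conn_coeff A S \<phi> z (conn_coeff A S \<phi> z w)"

text \<open>Vector fields and (1,1)-tensors along \<open>c\<close>. Values of \<open>J t\<close> outside the tangent space at \<open>c t\<close>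
  play no role.\<close>

definition vector_field_along :: "('a, 'e::euclidean_space) chart set \<Rightarrow> real set \<Rightarrow> (real \<Rightarrow> 'a) \<Rightarrow>
    (real \<Rightarrow> ('a, 'e) tvec) \<Rightarrow> bool" where
  "vector_field_along A I c X \<longleftrightarrow>
     (\<forall>t\<in>I. X t \<in> tangent_space A (c t)) \<and>
     (\<forall>\<phi>\<in>A. smooth_on {t \<in> I. c t \<in> chart_dom \<phi>} (\<lambda>t. X t \<phi>))"

definition endo_tensor_along :: "('a, 'e::euclidean_space) chart set \<Rightarrow> real set \<Rightarrow> (real \<Rightarrow> 'a) \<Rightarrow>
    (real \<Rightarrow> ('a, 'e) tvec \<Rightarrow> ('a, 'e) tvec) \<Rightarrow> bool" where
  "endo_tensor_along A I c J \<longleftrightarrow>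
     (\<forall>t\<in>I. J t ` tangent_space A (c t) \<subseteq> tangent_space A (c t) \<and>
        (\<forall>u\<in>tangent_space A (c t). \<forall>v\<in>tangent_space A (c t). \<forall>r q.
           J t (r *\<^sub>R u + q *\<^sub>R v) = r *\<^sub>R J t u + q *\<^sub>R J t v)) \<and>
     (\<forall>\<phi>\<in>A. \<forall>w. smooth_on {t \<in> I. c t \<in> chart_dom \<phi>} (\<lambda>t. J t (coord_vector A \<phi> (c t) w) \<phi>))"

definition conn_along :: "('a, 'e::euclidean_space) chart set \<Rightarrow> ('a, 'e) slit_field \<Rightarrow>
    real set \<Rightarrow> (real \<Rightarrow> 'a) \<Rightarrow> real \<Rightarrow> ('a, 'e) chart \<Rightarrow> 'e \<Rightarrow> 'e" where
  "conn_along A S I c t \<phi> = conn_coeff A S \<phi> (chart_map (tangent_chart A \<phi>) (velocity A I c t))"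

definition nabla_vector :: "('a, 'e::euclidean_space) chart set \<Rightarrow> ('a, 'e) slit_field \<Rightarrow>
    real set \<Rightarrow> (real \<Rightarrow> 'a) \<Rightarrow> (real \<Rightarrow> ('a, 'e) tvec) \<Rightarrow> real \<Rightarrow> ('a, 'e) tvec" where
  "nabla_vector A S I c X t = on_charts A (c t) (\<lambda>\<phi>.
     vector_derivative (\<lambda>s. X s \<phi>) (at t within I) + conn_along A S I c t \<phi> (X t \<phi>))"

text \<open>By the Leibniz rule, with \<open>\<nabla>\<partial>\<^sub>j = N\<^sup>i\<^sub>j \<partial>\<^sub>i\<close> and \<open>\<nabla>dx\<^sup>i = - N\<^sup>i\<^sub>j dx\<^sup>j\<close>, the derivative of
  \<open>J = J\<^sup>i\<^sub>j \<partial>\<^sub>i \<otimes> dx\<^sup>j\<close> has the components \<open>(\<nabla>J)\<^sup>i\<^sub>j = dJ\<^sup>i\<^sub>j/dt + N\<^sup>i\<^sub>k J\<^sup>k\<^sub>j - J\<^sup>i\<^sub>k N\<^sup>k\<^sub>j\<close>.\<close>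

definition nabla_endo :: "('a, 'e::euclidean_space) chart set \<Rightarrow> ('a, 'e) slit_field \<Rightarrow>
    real set \<Rightarrow> (real \<Rightarrow> 'a) \<Rightarrow> (real \<Rightarrow> ('a, 'e) tvec \<Rightarrow> ('a, 'e) tvec) \<Rightarrow>
    real \<Rightarrow> ('a, 'e) tvec \<Rightarrow> ('a, 'e) tvec" where
  "nabla_endo A S I c J t v = on_charts A (c t) (\<lambda>\<phi>.
     vector_derivative (\<lambda>s. J s (coord_vector A \<phi> (c s) (v \<phi>)) \<phi>) (at t within I)
     + conn_along A S I c t \<phi> (J t v \<phi>)
     - J t (coord_vector A \<phi> (c t) (conn_along A S I c t \<phi> (v \<phi>))) \<phi>)"

definition jacobi_endo :: "('a, 'e::euclidean_space) chart set \<Rightarrow> ('a, 'e) slit_field \<Rightarrow>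
    real set \<Rightarrow> (real \<Rightarrow> 'a) \<Rightarrow> real \<Rightarrow> ('a, 'e) tvec \<Rightarrow> ('a, 'e) tvec" where
  "jacobi_endo A S I c t v = on_charts A (c t) (\<lambda>\<phi>.
     jacobi_coeff A S \<phi> (chart_map (tangent_chart A \<phi>) (velocity A I c t)) (v \<phi>))"

definition jacobi_tensor :: "('a, 'e::euclidean_space) chart set \<Rightarrow> ('a, 'e) slit_field \<Rightarrow>
    real set \<Rightarrow> (real \<Rightarrow> 'a) \<Rightarrow> (real \<Rightarrow> ('a, 'e) tvec \<Rightarrow> ('a, 'e) tvec) \<Rightarrow> bool" where
  "jacobi_tensor A S I c J \<longleftrightarrow> endo_tensor_along A I c J \<and>
     (\<forall>t\<in>I. \<forall>v\<in>tangent_space A (c t).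
        nabla_endo A S I c (nabla_endo A S I c J) t v + jacobi_endo A S I c t (J t v) = 0)"

definition parallel_vector :: "('a, 'e::euclidean_space) chart set \<Rightarrow> ('a, 'e) slit_field \<Rightarrow>
    real set \<Rightarrow> (real \<Rightarrow> 'a) \<Rightarrow> (real \<Rightarrow> ('a, 'e) tvec) \<Rightarrow> bool" where
  "parallel_vector A S I c X \<longleftrightarrow>
     vector_field_along A I c X \<and> (\<forall>t\<in>I. nabla_vector A S I c X t = 0)"

text \<open>\<open>e 0, \<dots>, e (n - 2)\<close> are the parallel extensions of a basis of the hyperplane \<open>W\<close> of the
  tangent space at \<open>c 0\<close>, and \<open>frame_span e t\<close> is \<open>W\<^sub>t\<close>.\<close>

definition parallel_basis_extension :: "('a, 'e::euclidean_space) chart set \<Rightarrow> ('a, 'e) slit_field \<Rightarrow>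
    real set \<Rightarrow> (real \<Rightarrow> 'a) \<Rightarrow> ('a, 'e) tvec set \<Rightarrow> (nat \<Rightarrow> real \<Rightarrow> ('a, 'e) tvec) \<Rightarrow> bool" where
  "parallel_basis_extension A S I c W e \<longleftrightarrow>
     (\<forall>i<DIM('e) - 1. parallel_vector A S I c (e i)) \<and>
     inj_on (\<lambda>i. e i 0) {..<DIM('e) - 1} \<and>
     independent ((\<lambda>i. e i 0) ` {..<DIM('e) - 1}) \<and>
     span ((\<lambda>i. e i 0) ` {..<DIM('e) - 1}) = W"

definition frame_span :: "(nat \<Rightarrow> real \<Rightarrow> ('a, 'e::euclidean_space) tvec) \<Rightarrow> real \<Rightarrow> ('a, 'e) tvec set" where
  "frame_span e t = span ((\<lambda>i. e i t) ` {..<DIM('e) - 1})"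

definition transversal :: "('a, 'e::euclidean_space) chart set \<Rightarrow> real set \<Rightarrow> (real \<Rightarrow> 'a) \<Rightarrow>
    (real \<Rightarrow> ('a, 'e) tvec \<Rightarrow> ('a, 'e) tvec) \<Rightarrow> (real \<Rightarrow> ('a, 'e) tvec set) \<Rightarrow> bool" where
  "transversal A I c J Wt \<longleftrightarrow>
     (\<forall>t\<in>I. J t (snd (velocity A I c t)) = 0 \<and> J t ` tangent_space A (c t) \<subseteq> Wt t)"

definition invertible_tensor :: "('a, 'e::euclidean_space) chart set \<Rightarrow> ('a, 'e) slit_field \<Rightarrow>
    real set \<Rightarrow> (real \<Rightarrow> 'a) \<Rightarrow> (real \<Rightarrow> ('a, 'e) tvec \<Rightarrow> ('a, 'e) tvec) \<Rightarrow> bool" where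
  "invertible_tensor A S I c J \<longleftrightarrow>
     (\<exists>W e. subspace W \<and> dim W = DIM('e) - 1 \<and> W \<subseteq> tangent_space A (c 0) \<and>
        snd (velocity A I c 0) \<notin> W \<and> parallel_basis_extension A S I c W e \<and>
        transversal A I c J (frame_span e) \<and>
        (\<forall>t\<in>I. bij_betw (J t) (frame_span e t) (frame_span e t)))"

end

theory Submission
  imports Defs
begin

text \<open>Let \<open>e\<^sub>i\<close> be the parallel frame of \<open>W\<^sub>t\<close>. The fields \<open>J e\<^sub>i\<close> satisfy the linearized geodesic
  equation, because \<open>\<nabla>\<^sup>2J + \<Phi>J = 0\<close> is that equation rewritten with the Berwald connection. Vary the
  initial values of \<open>c\<close> at \<open>t = 0\<close> linearly by the initial values of the \<open>J e\<^sub>i\<close>, flow along geodesics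
  and continue the family over the compact interval. Then \<open>\<partial>V/\<partial>s\<^sup>i\<close> at \<open>s = 0\<close> solves the same linear
  initial value problem as \<open>J e\<^sub>i\<close>, so both agree on the whole interval. Since \<open>J\<close> is invertible on
  \<open>W\<^sub>t\<close> and the velocity, being parallel, never lies in \<open>W\<^sub>t\<close>, \<open>V\<close> is a local diffeomorphism at every
  \<open>(t, 0)\<close>. It is injective on the compact set \<open>{a..b} \<times> {0}\<close>, hence a diffeomorphism near it.\<close>

subsection \<open>Maps of class \<open>C\<^sup>k\<close>\<close>

text \<open>The objects to be compared have different domains: \<open>J\<close> and the parallel
  frame live on \<open>{a..b}\<close> with one-sided derivatives at the ends, the family
  \<open>V\<close> on an open interval. The comparison therefore uses derivatives within
  \<open>{a..b}\<close> and the first order system \<open>X' = W\<close>,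
  \<open>W' = DH (X, W)\<close> in each chart, where the geodesic equation reads
  \<open>x'' = H (x, x')\<close>. The field of a variation satisfies this system by differentiating
  the geodesic equation in the parameter, without a connection; the connection enters only when the
  Jacobi equation is brought into the same form. Homogeneity of the spray enters through Euler's
  relation \<open>DH (0, y) = 2 H\<close>, which makes the velocity parallel and so keeps it outside
  \<open>W_t\<close>. Linear initial values suffice because only the first derivative at
  \<open>s = 0\<close> is compared. The Hausdorff property enters twice: it makes agreement of two
  geodesics a closed condition, and it separates the images of distinct points of the curve.\<close>

lemma Ck_on_Suc_imp: "Ck_on (Suc k) U f \<Longrightarrow> Ck_on k U f"
proof (induction k arbitrary: f)
  case 0
  then show ?case by (simp add: differentiable_imp_continuous_on)
next
  case (Suc k)
  then show ?case by simp
qed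

lemma Ck_on_le: "Ck_on k U f \<Longrightarrow> j \<le> k \<Longrightarrow> Ck_on j U f"
  by (induction k) (auto simp: le_Suc_eq simp del: Ck_on.simps intro: Ck_on_Suc_imp)

lemma Ck_on_imp_continuous_on: "Ck_on k U f \<Longrightarrow> continuous_on U f"
  using Ck_on_le[of k U f 0] by simp

lemma has_derivative_cong_within:
  "x \<in> U \<Longrightarrow> (\<And>y. y \<in> U \<Longrightarrow> f y = g y) \<Longrightarrow>
    (f has_derivative f') (at x within U) \<longleftrightarrow> (g has_derivative f') (at x within U)"
  using has_derivative_transform[of x U f g f'] has_derivative_transform[of x U g f f'] by auto

lemma frechet_derivative_cong_within:
  assumes "x \<in> U" "\<And>y. y \<in> U \<Longrightarrow> f y = g y"
  shows "frechet_derivative f (at x within U) = frechet_derivative g (at x within U)"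
  unfolding frechet_derivative_def using has_derivative_cong_within[OF assms] by simp

lemma Ck_on_cong:
  assumes "\<And>x. x \<in> U \<Longrightarrow> f x = g x"
  shows "Ck_on k U f \<longleftrightarrow> Ck_on k U g"
  using assms
proof (induction k arbitrary: f g)
  case 0
  then show ?case by (simp cong: continuous_on_cong)
next
  case (Suc k)
  have "f differentiable_on U \<longleftrightarrow> g differentiable_on U"
    unfolding differentiable_on_def differentiable_def
    using has_derivative_cong_within[of _ U f g] Suc.prems by blast
  moreover have "Ck_on k U (\<lambda>x. frechet_derivative f (at x within U) v) \<longleftrightarrow>
      Ck_on k U (\<lambda>x. frechet_derivative g (at x within U) v)" for v
    by (rule Suc.IH) (metis frechet_derivative_cong_within Suc.prems)
  ultimately show ?case by simp
qed

lemma Ck_on_Suc_open: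
  assumes "open U"
  shows "Ck_on (Suc k) U f \<longleftrightarrow>
    (\<forall>x\<in>U. f differentiable at x) \<and> (\<forall>v. Ck_on k U (\<lambda>x. frechet_derivative f (at x) v))"
proof -
  have "Ck_on k U (\<lambda>x. frechet_derivative f (at x within U) v) \<longleftrightarrow>
      Ck_on k U (\<lambda>x. frechet_derivative f (at x) v)" for v
    by (rule Ck_on_cong) (simp add: at_within_open[OF _ assms])
  then show ?thesis
    by (simp add: differentiable_on_eq_differentiable_at[OF assms])
qed

declare Ck_on.simps(2) [simp del]

text \<open>On an open set an explicitly known derivative may stand for the chosen
  \<open>frechet_derivative\<close>; a C^k claim about a construction thus follows by induction from
  the formula for its derivative.\<close>

lemma Ck_on_SucI:
  assumes "open U" "\<And>x. x \<in> U \<Longrightarrow> (f has_derivative f' x) (at x)"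
    "\<And>v. Ck_on k U (\<lambda>x. f' x v)"
  shows "Ck_on (Suc k) U f"
proof -
  have "Ck_on k U (\<lambda>x. frechet_derivative f (at x) v) \<longleftrightarrow> Ck_on k U (\<lambda>x. f' x v)" for v
    by (rule Ck_on_cong) (metis assms(2) frechet_derivative_at)
  then show ?thesis
    using assms by (auto simp: Ck_on_Suc_open differentiable_def)
qed

lemma Ck_on_SucD:
  assumes "open U" "Ck_on (Suc k) U f"
  shows "x \<in> U \<Longrightarrow> (f has_derivative frechet_derivative f (at x)) (at x)"
    "Ck_on k U (\<lambda>x. frechet_derivative f (at x) v)"
  using assms by (auto simp: Ck_on_Suc_open frechet_derivative_works)

lemma Ck_on_const: "open U \<Longrightarrow> Ck_on k U (\<lambda>x. c)"
proof (induction k arbitrary: c)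
  case (Suc k)
  then show ?case
    by (intro Ck_on_SucI[where f' = "\<lambda>_ _. 0"]) (auto intro: has_derivative_const)
qed auto

lemma Ck_on_subset:
  assumes "Ck_on k U f" "open U" "open V" "V \<subseteq> U"
  shows "Ck_on k V f"
  using assms(1)
proof (induction k arbitrary: f)
  case 0
  then show ?case using assms(4) by (auto intro: continuous_on_subset)
next
  case (Suc k)
  then show ?case using assms by (auto simp: Ck_on_Suc_open)
qed

text \<open>On open sets the derivative at a point does not depend on the surrounding set, so the
  derivatives on the various neighbourhoods are restrictions of one function, to which the induction
  on \<open>k\<close> applies.\<close>

lemma Ck_on_local:
  assumes "open U" "\<And>x. x \<in> U \<Longrightarrow> \<exists>N. open N \<and> x \<in> N \<and> N \<subseteq> U \<and> Ck_on k N f"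
  shows "Ck_on k U f"
  using assms(2)
proof (induction k arbitrary: f)
  case 0
  have "continuous (at x) f" if x: "x \<in> U" for x
  proof -
    obtain N where "open N" "x \<in> N" "continuous_on N f"
      using 0[OF x] by auto
    then show ?thesis
      by (simp add: continuous_on_eq_continuous_at)
  qed
  then show ?case
    by (simp add: continuous_on_eq_continuous_at assms(1))
next
  case (Suc k)
  have *: "\<exists>N. open N \<and> x \<in> N \<and> N \<subseteq> U \<and> (\<forall>x\<in>N. f differentiable at x) \<and>
      (\<forall>v. Ck_on k N (\<lambda>x. frechet_derivative f (at x) v))" if x: "x \<in> U" for x
  proof -
    obtain N where N: "open N" "x \<in> N" "N \<subseteq> U" "Ck_on (Suc k) N f"
      using Suc.prems[OF x] by auto
    from N(4) show ?thesis
      unfolding Ck_on_Suc_open[OF N(1)] using N(1-3) by auto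
  qed
  show ?case unfolding Ck_on_Suc_open[OF assms(1)]
  proof (intro conjI allI ballI)
    fix x assume "x \<in> U" from *[OF this] show "f differentiable at x"
      by auto
  next
    fix v
    show "Ck_on k U (\<lambda>x. frechet_derivative f (at x) v)"
    proof (rule Suc.IH)
      fix x assume "x \<in> U" from *[OF this]
      show "\<exists>N. open N \<and> x \<in> N \<and> N \<subseteq> U \<and> Ck_on k N (\<lambda>x. frechet_derivative f (at x) v)"
        by auto
    qed
  qed
qed

lemma Ck_on_bounded_linear:
  assumes "bounded_linear L" "open U" "Ck_on k U f"
  shows "Ck_on k U (\<lambda>x. L (f x))"
  using assms(3)
proof (induction k arbitrary: f)
  case 0
  then show ?case by (simp add: assms(1) bounded_linear.continuous_on)
next
  case (Suc k)
  note d = Ck_on_SucD[OF assms(2) Suc.prems]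
  show ?case
    by (rule Ck_on_SucI[OF assms(2)])
      (auto intro!: bounded_linear.has_derivative[OF assms(1)] d Suc.IH)
qed

lemma Ck_on_ident:
  assumes "open U" shows "Ck_on k U (\<lambda>x. x)"
proof (cases k)
  case (Suc k)
  then show ?thesis using assms
    by (auto intro!: Ck_on_SucI[where f' = "\<lambda>_ v. v"] Ck_on_const)
qed auto

lemma Ck_on_linear: "bounded_linear L \<Longrightarrow> open U \<Longrightarrow> Ck_on k U L"
  by (rule Ck_on_bounded_linear[OF _ _ Ck_on_ident])

lemma Ck_on_add:
  assumes "open U" "Ck_on k U f" "Ck_on k U g"
  shows "Ck_on k U (\<lambda>x. f x + g x)"
  using assms(2,3)
proof (induction k arbitrary: f g)
  case 0
  then show ?case by (auto intro: continuous_intros)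
next
  case (Suc k)
  note d = Ck_on_SucD[OF assms(1) Suc.prems(1)] Ck_on_SucD[OF assms(1) Suc.prems(2)]
  show ?case
    by (rule Ck_on_SucI[OF assms(1)]) (auto intro!: has_derivative_add d Suc.IH)
qed

lemma Ck_on_minus: "open U \<Longrightarrow> Ck_on k U f \<Longrightarrow> Ck_on k U (\<lambda>x. - f x)"
  by (rule Ck_on_bounded_linear[OF bounded_linear_minus[OF bounded_linear_ident]])

lemma Ck_on_diff:
  assumes "open U" "Ck_on k U f" "Ck_on k U g"
  shows "Ck_on k U (\<lambda>x. f x - g x)"
  using Ck_on_add[OF assms(1,2) Ck_on_minus[OF assms(1,3)]] by simp

lemma Ck_on_sum:
  assumes "open U" "\<And>i. i \<in> I \<Longrightarrow> Ck_on k U (f i)"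
  shows "Ck_on k U (\<lambda>x. \<Sum>i\<in>I. f i x)"
  using assms(2)
  by (induction I rule: infinite_finite_induct) (auto intro!: Ck_on_const[OF assms(1)] Ck_on_add[OF assms(1)])

lemma (in bounded_bilinear) Ck_on_bilinear:
  assumes "open U" "Ck_on k U f" "Ck_on k U g"
  shows "Ck_on k U (\<lambda>x. prod (f x) (g x))"
  using assms(2,3)
proof (induction k arbitrary: f g)
  case 0
  then show ?case by (auto intro: continuous_on)
next
  case (Suc k)
  note d = Ck_on_SucD[OF assms(1) Suc.prems(1)] Ck_on_SucD[OF assms(1) Suc.prems(2)]
  show ?case
    by (rule Ck_on_SucI[OF assms(1)])
      (auto intro!: FDERIV d Ck_on_add[OF assms(1)] Suc.IH Suc.prems[THEN Ck_on_Suc_imp])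
qed

lemmas Ck_on_scaleR = bounded_bilinear.Ck_on_bilinear[OF bounded_bilinear_scaleR]
lemmas Ck_on_inner = bounded_bilinear.Ck_on_bilinear[OF bounded_bilinear_inner]

lemma Ck_on_Pair:
  assumes "open U" "Ck_on k U f" "Ck_on k U g"
  shows "Ck_on k U (\<lambda>x. (f x, g x))"
proof -
  have "Ck_on k U (\<lambda>x. (f x, 0))" "Ck_on k U (\<lambda>x. (0, g x))"
    using Ck_on_bounded_linear[OF bounded_linear_Pair[OF bounded_linear_ident bounded_linear_zero] assms(1,2)]
      Ck_on_bounded_linear[OF bounded_linear_Pair[OF bounded_linear_zero bounded_linear_ident] assms(1,3)]
    by auto
  from Ck_on_add[OF assms(1) this] show ?thesis
    by simp
qed


section \<open>Families of linear maps and the chain rule\<close>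

lemma linear_sum_Basis:
  fixes x :: "'a::euclidean_space"
  assumes "linear L"
  shows "L x = (\<Sum>b\<in>Basis. (x \<bullet> b) *\<^sub>R L b)"
proof -
  have "L x = L (\<Sum>b\<in>Basis. (x \<bullet> b) *\<^sub>R b)"
    by (simp add: euclidean_representation)
  also have "\<dots> = (\<Sum>b\<in>Basis. (x \<bullet> b) *\<^sub>R L b)"
    by (simp only: linear_sum[OF assms] linear_scale[OF assms])
  finally show ?thesis .
qed

text \<open>In finite dimension a linear map is the sum of its values on a basis, so regularity for
  each fixed vector suffices even if the vector varies with the point. \<open>Ck_on\<close> speaks
  of directional derivatives only; this lemma is the bridge to derivatives applied to moving
  vectors.\<close>

lemma Ck_on_linear_family:
  fixes u :: "'x::real_normed_vector \<Rightarrow> 'a::euclidean_space" and L :: "'x \<Rightarrow> 'a \<Rightarrow> 'b::real_normed_vector"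
  assumes "open U" "\<And>x. x \<in> U \<Longrightarrow> linear (L x)" "\<And>b. Ck_on k U (\<lambda>x. L x b)" "Ck_on k U u"
  shows "Ck_on k U (\<lambda>x. L x (u x))"
proof -
  have "Ck_on k U (\<lambda>x. \<Sum>b\<in>Basis. (u x \<bullet> b) *\<^sub>R L x b)"
    by (intro Ck_on_sum Ck_on_scaleR Ck_on_inner Ck_on_const assms)
  then show ?thesis
    by (subst Ck_on_cong[where g = "\<lambda>x. \<Sum>b\<in>Basis. (u x \<bullet> b) *\<^sub>R L x b"])
      (auto intro: linear_sum_Basis assms)
qed

text \<open>The chain rule presents the derivative of the composite as a linear family applied to a
  moving vector. The induction generalises over \<open>g\<close> because it is applied to the
  derivative of \<open>g\<close> in each fixed direction.\<close>

lemma Ck_on_compose: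
  fixes f :: "'a::real_normed_vector \<Rightarrow> 'b::euclidean_space" and g :: "'b \<Rightarrow> 'c::real_normed_vector"
  assumes "open U" "open V" "f ` U \<subseteq> V" "Ck_on k U f" "Ck_on k V g"
  shows "Ck_on k U (\<lambda>x. g (f x))"
  using assms(4,5)
proof (induction k arbitrary: g)
  case 0
  then show ?case using continuous_on_compose2[of V g U f] assms(3) by simp
next
  case (Suc k)
  note d = Ck_on_SucD[OF assms(1) Suc.prems(1)] Ck_on_SucD[OF assms(2) Suc.prems(2)]
  show ?case
  proof (rule Ck_on_SucI[OF assms(1)])
    fix x assume "x \<in> U"
    then show "((\<lambda>x. g (f x)) has_derivative (\<lambda>v. frechet_derivative g (at (f x)) (frechet_derivative f (at x) v))) (at x)"
      using has_derivative_compose[OF d(1) d(3)] assms(3) by blast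
  next
    fix v
    show "Ck_on k U (\<lambda>x. frechet_derivative g (at (f x)) (frechet_derivative f (at x) v))"
    proof (rule Ck_on_linear_family[OF assms(1)])
      show "linear (frechet_derivative g (at (f x)))" if "x \<in> U" for x
        using has_derivative_linear[OF d(3)] that assms(3) by blast
      show "Ck_on k U (\<lambda>x. frechet_derivative g (at (f x)) b)" for b
        by (rule Suc.IH[OF Ck_on_Suc_imp[OF Suc.prems(1)] d(4)])
      show "Ck_on k U (\<lambda>x. frechet_derivative f (at x) v)" by (rule d)
    qed
  qed
qed

section \<open>Smooth maps\<close>

lemma smooth_on_imp_Ck_on: "smooth_on U f \<Longrightarrow> Ck_on k U f"
  by (simp add: smooth_on_def)

lemma smooth_on_cong: "(\<And>x. x \<in> U \<Longrightarrow> f x = g x) \<Longrightarrow> smooth_on U f \<longleftrightarrow> smooth_on U g"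
  unfolding smooth_on_def using Ck_on_cong by blast

lemma smooth_on_subset: "smooth_on U f \<Longrightarrow> open U \<Longrightarrow> open V \<Longrightarrow> V \<subseteq> U \<Longrightarrow> smooth_on V f"
  unfolding smooth_on_def using Ck_on_subset by blast

lemma smooth_on_local:
  assumes "open U" "\<And>x. x \<in> U \<Longrightarrow> \<exists>N. open N \<and> x \<in> N \<and> N \<subseteq> U \<and> smooth_on N f"
  shows "smooth_on U f"
  unfolding smooth_on_def
proof (intro allI Ck_on_local[OF assms(1)])
  fix k x assume "x \<in> U" from assms(2)[OF this]
  show "\<exists>N. open N \<and> x \<in> N \<and> N \<subseteq> U \<and> Ck_on k N f"
    by (auto simp: smooth_on_def)
qed

lemma smooth_on_const: "open U \<Longrightarrow> smooth_on U (\<lambda>x. c)"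
  unfolding smooth_on_def by (intro allI Ck_on_const)

lemma smooth_on_ident: "open U \<Longrightarrow> smooth_on U (\<lambda>x. x)"
  unfolding smooth_on_def by (intro allI Ck_on_ident)

lemma smooth_on_bounded_linear:
  assumes "bounded_linear L" "open U" "smooth_on U f"
  shows "smooth_on U (\<lambda>x. L (f x))"
  unfolding smooth_on_def
  by (intro allI Ck_on_bounded_linear[OF assms(1,2)]) (use assms in \<open>simp add: smooth_on_def\<close>)

lemma smooth_on_linear: "bounded_linear L \<Longrightarrow> open U \<Longrightarrow> smooth_on U L"
  by (rule smooth_on_bounded_linear[OF _ _ smooth_on_ident])

lemma smooth_on_add:
  assumes "open U" "smooth_on U f" "smooth_on U g"
  shows "smooth_on U (\<lambda>x. f x + g x)"
  unfolding smooth_on_def by (intro allI Ck_on_add[OF assms(1)]) (use assms in \<open>simp_all add: smooth_on_def\<close>)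

lemma smooth_on_diff:
  assumes "open U" "smooth_on U f" "smooth_on U g"
  shows "smooth_on U (\<lambda>x. f x - g x)"
  unfolding smooth_on_def by (intro allI Ck_on_diff[OF assms(1)]) (use assms in \<open>simp_all add: smooth_on_def\<close>)

lemma smooth_on_scaleR:
  assumes "open U" "smooth_on U f" "smooth_on U g"
  shows "smooth_on U (\<lambda>x. f x *\<^sub>R g x)"
  unfolding smooth_on_def by (intro allI Ck_on_scaleR[OF assms(1)]) (use assms in \<open>simp_all add: smooth_on_def\<close>)

lemma smooth_on_Pair:
  assumes "open U" "smooth_on U f" "smooth_on U g"
  shows "smooth_on U (\<lambda>x. (f x, g x))"
  unfolding smooth_on_def by (intro allI Ck_on_Pair[OF assms(1)]) (use assms in \<open>simp_all add: smooth_on_def\<close>)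

lemmas smooth_on_fst = smooth_on_bounded_linear[OF bounded_linear_fst]
lemmas smooth_on_snd = smooth_on_bounded_linear[OF bounded_linear_snd]

lemma smooth_on_linear_family:
  fixes u :: "'x::real_normed_vector \<Rightarrow> 'a::euclidean_space" and L :: "'x \<Rightarrow> 'a \<Rightarrow> 'b::real_normed_vector"
  assumes "open U" "\<And>x. x \<in> U \<Longrightarrow> linear (L x)" "\<And>b. smooth_on U (\<lambda>x. L x b)" "smooth_on U u"
  shows "smooth_on U (\<lambda>x. L x (u x))"
  unfolding smooth_on_def
proof
  fix k
  show "Ck_on k U (\<lambda>x. L x (u x))"
    by (rule Ck_on_linear_family[OF assms(1,2) smooth_on_imp_Ck_on[OF assms(3)] smooth_on_imp_Ck_on[OF assms(4)]])
qed

lemma smooth_on_compose: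
  fixes f :: "'a::real_normed_vector \<Rightarrow> 'b::euclidean_space" and g :: "'b \<Rightarrow> 'c::real_normed_vector"
  assumes "open U" "open V" "f ` U \<subseteq> V" "smooth_on U f" "smooth_on V g"
  shows "smooth_on U (\<lambda>x. g (f x))"
  unfolding smooth_on_def
proof
  fix k
  show "Ck_on k U (\<lambda>x. g (f x))"
    by (rule Ck_on_compose[OF assms(1,2,3) smooth_on_imp_Ck_on[OF assms(4)] smooth_on_imp_Ck_on[OF assms(5)]])
qed

lemma smooth_on_imp_continuous_on: "smooth_on U f \<Longrightarrow> continuous_on U f"
  by (rule Ck_on_imp_continuous_on[OF smooth_on_imp_Ck_on])

lemma smooth_on_has_derivative:
  assumes "smooth_on U f" "open U" "x \<in> U"
  shows "(f has_derivative frechet_derivative f (at x)) (at x)"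
  by (rule Ck_on_SucD(1)[OF assms(2) smooth_on_imp_Ck_on[OF assms(1)] assms(3)])

lemma smooth_on_derivative:
  assumes "smooth_on U f" "open U"
  shows "smooth_on U (\<lambda>x. frechet_derivative f (at x) v)"
  unfolding smooth_on_def
  by (intro allI Ck_on_SucD(2)[OF assms(2) smooth_on_imp_Ck_on[OF assms(1)]])

text \<open>Smoothness of the tangent map of \<open>f\<close>: base point and direction may both
  move.\<close>

lemma smooth_on_derivative2:
  fixes f :: "'a::euclidean_space \<Rightarrow> 'b::real_normed_vector"
  assumes "smooth_on U f" "open U" "open W" "smooth_on W g" "smooth_on W h" "g ` W \<subseteq> U"
  shows "smooth_on W (\<lambda>x. frechet_derivative f (at (g x)) (h x))"
proof (rule smooth_on_linear_family[OF assms(3)])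
  show "linear (frechet_derivative f (at (g x)))" if "x \<in> W" for x
    using has_derivative_linear[OF smooth_on_has_derivative[OF assms(1,2)]] that assms(6) by blast
  show "smooth_on W (\<lambda>x. frechet_derivative f (at (g x)) b)" for b
    by (rule smooth_on_compose[OF assms(3,2,6,4) smooth_on_derivative[OF assms(1,2)]])
qed fact

subsection \<open>Linearization, second derivatives and smooth inverses\<close>

lemma blinfun_apply_frechet_derivative:
  fixes f :: "'a::real_normed_vector \<Rightarrow> 'b::real_normed_vector"
  assumes "f differentiable at x"
  shows "blinfun_apply (Blinfun (frechet_derivative f (at x))) = frechet_derivative f (at x)"
  using assms by (meson bounded_linear_Blinfun_apply frechet_derivative_works has_derivative_bounded_linear)

text \<open>The domain is finite dimensional, so continuity of each directional derivative gives
  continuity in the operator norm. The uniform estimates on compact sets below need that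
  norm.\<close>

lemma continuous_on_Blinfun_derivative:
  fixes f :: "'a::euclidean_space \<Rightarrow> 'b::real_normed_vector"
  assumes "open U" "Ck_on (Suc k) U f"
  shows "continuous_on U (\<lambda>x. Blinfun (frechet_derivative f (at x)))"
proof (rule continuous_on_blinfun_componentwise)
  fix i :: 'a
  have "continuous_on U (\<lambda>x. frechet_derivative f (at x) i)"
    using Ck_on_imp_continuous_on[OF Ck_on_SucD(2)[OF assms]] .
  moreover have "f differentiable at x" if "x \<in> U" for x
    using Ck_on_SucD(1)[OF assms that] by (auto simp: differentiable_def)
  ultimately show "continuous_on U (\<lambda>x. blinfun_apply (Blinfun (frechet_derivative f (at x))) i)"
    by (simp add: blinfun_apply_frechet_derivative cong: continuous_on_cong)
qed

text \<open>The closed neighbourhood is the sum of \<open>K\<close> and a closed ball around 0, and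
  a sum of compact sets is compact.\<close>

lemma compact_neighbourhood:
  fixes K :: "'a::euclidean_space set"
  assumes "compact K" "open U" "K \<subseteq> U"
  obtains e where "e > 0" "\<And>x y. x \<in> K \<Longrightarrow> dist x y \<le> e \<Longrightarrow> y \<in> U" "compact (\<Union>x\<in>K. cball x e)"
proof -
  obtain e where e: "e > 0" "(\<Union>x\<in>K. cball x e) \<subseteq> U"
    using compact_subset_open_imp_cball_epsilon_subset[OF assms] by blast
  have "(\<Union>x\<in>K. cball x e) = {x + y |x y. x \<in> K \<and> y \<in> cball 0 e}"
    by (simp add: set_eq_iff dist_norm) (metis add_diff_cancel_left' diff_add_cancel add.commute norm_minus_commute)
  note eq = this
  have "compact {x + y |x y. x \<in> K \<and> y \<in> cball 0 e}"
    by (rule compact_sums[OF assms(1) compact_cball])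
  then have "compact (\<Union>x\<in>K. cball x e)"
    unfolding eq .
  moreover have "y \<in> U" if "x \<in> K" "dist x y \<le> e" for x y
    using e(2) that by (meson UN_I mem_cball subsetD)
  ultimately show thesis
    using that e(1) by blast
qed

text \<open>On a compact neighbourhood of \<open>K\<close> the derivative is uniformly continuous;
  hence on a ball whose radius does not depend on \<open>x\<close> in \<open>K\<close>, the
  difference of \<open>f\<close> and its derivative at \<open>x\<close> is Lipschitz with constant
  \<epsilon>. Applied to the graph of a solution, this gives an error bound uniform in time.\<close>

lemma C1_linearization_compact:
  fixes f :: "'a::euclidean_space \<Rightarrow> 'b::real_normed_vector"
  assumes U: "open U" and f: "Ck_on (Suc 0) U f" and K: "compact K" "K \<subseteq> U" and "\<epsilon> > 0"
  obtains \<eta> where "\<eta> > 0"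
    "\<And>x y. x \<in> K \<Longrightarrow> dist x y < \<eta> \<Longrightarrow> y \<in> U"
    "\<And>x y z. x \<in> K \<Longrightarrow> dist x y < \<eta> \<Longrightarrow> dist x z < \<eta> \<Longrightarrow>
        norm (f z - f y - frechet_derivative f (at x) (z - y)) \<le> \<epsilon> * norm (z - y)"
proof -
  let ?D = "\<lambda>x. Blinfun (frechet_derivative f (at x))"
  obtain e where e: "e > 0" "\<And>x y. x \<in> K \<Longrightarrow> dist x y \<le> e \<Longrightarrow> y \<in> U" "compact (\<Union>x\<in>K. cball x e)"
    using compact_neighbourhood[OF K(1) U K(2)] by blast
  have df: "(f has_derivative ?D x) (at x)" if "x \<in> U" for x
    using Ck_on_SucD(1)[OF U f that]
    by (metis blinfun_apply_frechet_derivative differentiable_def)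
  have "uniformly_continuous_on (\<Union>x\<in>K. cball x e) ?D"
    by (intro compact_uniformly_continuous e continuous_on_subset[OF continuous_on_Blinfun_derivative[OF U f]])
      (use e(2) in auto)
  then obtain d where d: "d > 0"
    "\<And>x y. x \<in> (\<Union>x\<in>K. cball x e) \<Longrightarrow> y \<in> (\<Union>x\<in>K. cball x e) \<Longrightarrow> dist y x < d \<Longrightarrow> dist (?D y) (?D x) < \<epsilon>"
    using \<open>\<epsilon> > 0\<close> unfolding uniformly_continuous_on_def by metis
  show thesis
  proof (rule that[of "min d e"])
    show "min d e > 0" using d e by simp
    show "y \<in> U" if "x \<in> K" "dist x y < min d e" for x y
      using e(2) that by auto
    fix x y z assume x: "x \<in> K" and yz: "dist x y < min d e" "dist x z < min d e"
    have xU: "x \<in> U" using x K(2) by blast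
    have sub: "ball x (min d e) \<subseteq> U" using e(2)[OF x] by auto
    have "norm (f z - f y - blinfun_apply (?D x) (z - y)) \<le> norm (z - y) * \<epsilon>"
    proof (rule differentiable_bound_linearization[where S = "ball x (min d e)" and f' = "\<lambda>x. blinfun_apply (?D x)"])
      show "y + t *\<^sub>R (z - y) \<in> ball x (min d e)" if "t \<in> {0..1}" for t
      proof -
        have "(1 - t) *\<^sub>R y + t *\<^sub>R z \<in> ball x (min d e)"
          using convexD_alt[OF convex_ball, of y x "min d e" z t] yz that by (simp only: mem_ball atLeastAtMost_iff)
        moreover have "y + t *\<^sub>R (z - y) = (1 - t) *\<^sub>R y + t *\<^sub>R z"
          by (simp add: algebra_simps)
        ultimately show ?thesis by simp
      qed
      show "(f has_derivative ?D w) (at w within ball x (min d e))" if "w \<in> ball x (min d e)" for w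
        by (rule has_derivative_at_withinI[OF df]) (rule subsetD[OF sub that])
      show "onorm (blinfun_apply (?D w) - blinfun_apply (?D x)) \<le> \<epsilon>" if w: "w \<in> ball x (min d e)" for w
      proof -
        have "dist (?D w) (?D x) < \<epsilon>"
        proof (rule d(2))
          show "x \<in> (\<Union>x\<in>K. cball x e)" "w \<in> (\<Union>x\<in>K. cball x e)"
            using x e(1) w by (auto intro!: bexI[of _ x])
          show "dist w x < d"
            using w by (simp add: dist_commute)
        qed
        moreover have "blinfun_apply (?D w) - blinfun_apply (?D x) = blinfun_apply (?D w - ?D x)"
          by (simp add: fun_eq_iff blinfun.diff_left)
        ultimately show ?thesis
          by (simp add: dist_norm norm_blinfun.rep_eq)
      qed
      show "x \<in> ball x (min d e)" using d e by simp
    qed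
    then show "norm (f z - f y - frechet_derivative f (at x) (z - y)) \<le> \<epsilon> * norm (z - y)"
      using frechet_derivative_at[OF df[OF xU]] by (metis mult.commute)
  qed
qed

text \<open>The mean value inequality is applied along \<open>v\<close> to the difference of
  \<open>f\<close> at points a distance \<open>h *\<^sub>R w\<close> apart. This leaves the first
  difference of the map that sends \<open>y\<close> to the derivative of \<open>f\<close> at
  \<open>y\<close> in direction \<open>v\<close>, which is linearized at \<open>x\<close>.\<close>

lemma second_difference_estimate:
  fixes f :: "'a::euclidean_space \<Rightarrow> 'b::real_normed_vector"
  assumes U: "open U" and f: "smooth_on U f" and x: "x \<in> U" and "\<epsilon> > 0"
  obtains \<eta> where "\<eta> > 0"
    "\<And>h. 0 < h \<Longrightarrow> h < \<eta> \<Longrightarrow> norm (f (x + h *\<^sub>R v + h *\<^sub>R w) - f (x + h *\<^sub>R v) - (f (x + h *\<^sub>R w) - f x)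
        - (h * h) *\<^sub>R frechet_derivative (\<lambda>y. frechet_derivative f (at y) v) (at x) w) \<le> \<epsilon> * (h * h) * norm w"
proof -
  let ?g = "\<lambda>y. frechet_derivative f (at y) v"
  have g: "Ck_on (Suc 0) U ?g"
    by (rule smooth_on_imp_Ck_on[OF smooth_on_derivative[OF f U]])
  obtain r where r: "r > 0" "\<And>y. dist x y < r \<Longrightarrow> y \<in> U"
    "\<And>y z. dist x y < r \<Longrightarrow> dist x z < r \<Longrightarrow>
        norm (?g z - ?g y - frechet_derivative ?g (at x) (z - y)) \<le> \<epsilon> * norm (z - y)"
    using C1_linearization_compact[OF U g compact_sing, of x \<epsilon>] x \<open>\<epsilon> > 0\<close>
    by (metis empty_subsetI insert_subset singletonI)
  have lin: "linear (frechet_derivative ?g (at x))"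
    using Ck_on_SucD(1)[OF U g x] has_derivative_linear by blast
  \<comment> \<open>For \<open>h < \<eta>\<close> the whole parallelogram spanned by
    \<open>h *\<^sub>R v\<close> and \<open>h *\<^sub>R w\<close> stays within distance
    \<open>r\<close> of \<open>x\<close>; the summand 1 covers \<open>v = w = 0\<close>.\<close>
  define \<eta> where "\<eta> = r / (1 + norm v + norm w)"
  have n: "0 < 1 + norm v + norm w" by (smt (verit) norm_ge_zero)
  show thesis
  proof (rule that[of \<eta>])
    show "\<eta> > 0" using r n by (simp add: \<eta>_def)
    fix h :: real assume h: "0 < h" "h < \<eta>"
    have small: "dist x (x + s *\<^sub>R v + q *\<^sub>R w) < r" if "0 \<le> s" "s \<le> h" "0 \<le> q" "q \<le> h" for s q
    proof -
      have "dist x (x + s *\<^sub>R v + q *\<^sub>R w) = norm (s *\<^sub>R v + q *\<^sub>R w)"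
        by (simp add: dist_norm algebra_simps norm_minus_commute)
      also have "\<dots> \<le> s * norm v + q * norm w"
        using that norm_triangle_ineq[of "s *\<^sub>R v" "q *\<^sub>R w"] by simp
      also have "\<dots> \<le> h * norm v + h * norm w"
        by (intro add_mono mult_right_mono) (use that in auto)
      also have "\<dots> < h * (1 + norm v + norm w)"
        using h by (simp add: algebra_simps)
      also have "\<dots> \<le> r"
        using h n by (simp add: \<eta>_def field_simps)
      finally show ?thesis .
    qed
    \<comment> \<open>The expected bilinear term is subtracted in advance: \<open>p h - p 0\<close>
      is the quantity to be estimated, and the derivative of \<open>p\<close> is only a
      linearization error.\<close>
    define p where "p = (\<lambda>s. f (x + s *\<^sub>R v + h *\<^sub>R w) - f (x + s *\<^sub>R v) - (s * h) *\<^sub>R frechet_derivative ?g (at x) w)"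
    have "norm (p h - p 0) \<le> (\<epsilon> * h * norm w) * norm (h - 0)"
    proof (rule differentiable_bound[of "{0..h}" p "\<lambda>s \<tau>. \<tau> *\<^sub>R (?g (x + s *\<^sub>R v + h *\<^sub>R w) - ?g (x + s *\<^sub>R v) - h *\<^sub>R frechet_derivative ?g (at x) w)"])
      fix s assume s: "s \<in> {0..h}"
      let ?y1 = "x + s *\<^sub>R v + h *\<^sub>R w" and ?y0 = "x + s *\<^sub>R v"
      have y1: "?y1 \<in> U" "?y0 \<in> U"
        using r(2) small[of s h] small[of s 0] s by auto
      have d: "((\<lambda>s. f (x + s *\<^sub>R v + q *\<^sub>R w)) has_derivative (\<lambda>\<tau>. frechet_derivative f (at (x + s *\<^sub>R v + q *\<^sub>R w)) (\<tau> *\<^sub>R v))) (at s)"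
        if "x + s *\<^sub>R v + q *\<^sub>R w \<in> U" for q
      proof -
        have "((\<lambda>s. x + s *\<^sub>R v + q *\<^sub>R w) has_derivative (\<lambda>\<tau>. \<tau> *\<^sub>R v)) (at s)"
          by (auto intro!: derivative_eq_intros)
        from has_derivative_compose[OF this smooth_on_has_derivative[OF f U that]] show ?thesis .
      qed
      have lf: "linear (frechet_derivative f (at y))" if "y \<in> U" for y
        using smooth_on_has_derivative[OF f U that] has_derivative_linear by blast
      have 1: "(p has_derivative (\<lambda>\<tau>. frechet_derivative f (at ?y1) (\<tau> *\<^sub>R v) - frechet_derivative f (at ?y0) (\<tau> *\<^sub>R v) - (\<tau> * h) *\<^sub>R frechet_derivative ?g (at x) w)) (at s)"
        unfolding p_def using d[of h] d[of 0] y1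
        by (intro has_derivative_diff) (auto intro!: derivative_eq_intros)
      have 2: "(\<lambda>\<tau>. frechet_derivative f (at ?y1) (\<tau> *\<^sub>R v) - frechet_derivative f (at ?y0) (\<tau> *\<^sub>R v) - (\<tau> * h) *\<^sub>R frechet_derivative ?g (at x) w)
        = (\<lambda>\<tau>. \<tau> *\<^sub>R (?g ?y1 - ?g ?y0 - h *\<^sub>R frechet_derivative ?g (at x) w))"
        by (rule ext, simp only: linear_scale[OF lf[OF y1(1)]] linear_scale[OF lf[OF y1(2)]])
          (simp add: algebra_simps)
      show "(p has_derivative (\<lambda>\<tau>. \<tau> *\<^sub>R (?g ?y1 - ?g ?y0 - h *\<^sub>R frechet_derivative ?g (at x) w))) (at s within {0..h})"
        by (rule has_derivative_at_withinI[OF 1[unfolded 2]])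
      have "norm (?g ?y1 - ?g ?y0 - frechet_derivative ?g (at x) (?y1 - ?y0)) \<le> \<epsilon> * norm (?y1 - ?y0)"
        by (rule r(3)) (use small[of s h] small[of s 0] s in auto)
      then have "norm (?g ?y1 - ?g ?y0 - h *\<^sub>R frechet_derivative ?g (at x) w) \<le> \<epsilon> * h * norm w"
        using h by (simp add: linear_scale[OF lin])
      then show "onorm (\<lambda>\<tau>. \<tau> *\<^sub>R (?g ?y1 - ?g ?y0 - h *\<^sub>R frechet_derivative ?g (at x) w)) \<le> \<epsilon> * h * norm w"
        by (intro onorm_le) (auto simp: mult.commute mult_left_mono)
    qed (use h in auto)
    then show "norm (f (x + h *\<^sub>R v + h *\<^sub>R w) - f (x + h *\<^sub>R v) - (f (x + h *\<^sub>R w) - f x)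
        - (h * h) *\<^sub>R frechet_derivative ?g (at x) w) \<le> \<epsilon> * (h * h) * norm w"
      using h by (simp add: p_def algebra_simps)
  qed
qed

text \<open>The second difference does not change when \<open>v\<close> and \<open>w\<close> are
  exchanged, so after division by \<open>h * h\<close> it is close to both iterated
  derivatives.\<close>

lemma second_derivative_symmetric:
  fixes f :: "'a::euclidean_space \<Rightarrow> 'b::real_normed_vector"
  assumes U: "open U" and f: "smooth_on U f" and x: "x \<in> U"
  shows "frechet_derivative (\<lambda>y. frechet_derivative f (at y) v) (at x) w =
    frechet_derivative (\<lambda>y. frechet_derivative f (at y) w) (at x) v" (is "?A = ?B")
proof -
  have "norm (?A - ?B) \<le> \<epsilon> * (norm v + norm w)" if e: "\<epsilon> > 0" for \<epsilon>
  proof -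
    obtain \<eta>1 where 1: "\<eta>1 > 0" "\<And>h. 0 < h \<Longrightarrow> h < \<eta>1 \<Longrightarrow> norm (f (x + h *\<^sub>R v + h *\<^sub>R w) - f (x + h *\<^sub>R v) - (f (x + h *\<^sub>R w) - f x)
        - (h * h) *\<^sub>R ?A) \<le> \<epsilon> * (h * h) * norm w"
      using second_difference_estimate[OF assms e, of v w] by blast
    obtain \<eta>2 where 2: "\<eta>2 > 0" "\<And>h. 0 < h \<Longrightarrow> h < \<eta>2 \<Longrightarrow> norm (f (x + h *\<^sub>R w + h *\<^sub>R v) - f (x + h *\<^sub>R w) - (f (x + h *\<^sub>R v) - f x)
        - (h * h) *\<^sub>R ?B) \<le> \<epsilon> * (h * h) * norm v"
      using second_difference_estimate[OF assms e, of w v] by blast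
    define h where "h = min \<eta>1 \<eta>2 / 2"
    have h: "0 < h" "h < \<eta>1" "h < \<eta>2" using 1(1) 2(1) by (auto simp: h_def min_def)
    let ?Q = "f (x + h *\<^sub>R v + h *\<^sub>R w) - f (x + h *\<^sub>R v) - (f (x + h *\<^sub>R w) - f x)"
    have Q: "f (x + h *\<^sub>R w + h *\<^sub>R v) - f (x + h *\<^sub>R w) - (f (x + h *\<^sub>R v) - f x) = ?Q"
      by (simp add: algebra_simps)
    have "(h * h) * norm (?A - ?B) = norm ((?Q - (h * h) *\<^sub>R ?B) - (?Q - (h * h) *\<^sub>R ?A))"
      using h by (simp add: algebra_simps flip: scaleR_diff_right)
    also have "\<dots> \<le> \<epsilon> * (h * h) * norm v + \<epsilon> * (h * h) * norm w"
      using norm_triangle_ineq4 1(2)[OF h(1,2)] 2(2)[OF h(1,3)] Q by (smt (verit))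
    also have "\<dots> = (h * h) * (\<epsilon> * (norm v + norm w))"
      by (simp add: algebra_simps)
    finally show ?thesis using h by simp
  qed
  then have small: "norm (?A - ?B) \<le> \<epsilon> * (norm v + norm w)" if "\<epsilon> > 0" for \<epsilon>
    using that by blast
  have "norm (?A - ?B) \<le> 0"
  proof (rule field_le_epsilon)
    fix e :: real assume "e > 0"
    have n: "0 < 1 + norm v + norm w" by (smt (verit) norm_ge_zero)
    have "norm (?A - ?B) \<le> (e / (1 + norm v + norm w)) * (norm v + norm w)"
      using \<open>e > 0\<close> n by (intro small) simp
    also have "\<dots> \<le> e"
      using \<open>e > 0\<close> n by (simp add: field_simps)
    finally show "norm (?A - ?B) \<le> 0 + e" by simp
  qed
  then show ?thesis by simp
qed

text \<open>Gronwall's argument in both time directions: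
  \<open>(d s \<bullet> d s) * exp (- 2 * L * s)\<close> does not increase, which settles times
  after \<open>t0\<close>, and \<open>(d s \<bullet> d s) * exp (2 * L * s)\<close> does not
  decrease, which settles times before. Derivatives within \<open>K\<close> suffice, so end points
  are allowed.\<close>

lemma linear_bound_imp_zero:
  fixes d :: "real \<Rightarrow> 'b::real_inner"
  assumes K: "is_interval K"
    and der: "\<And>t. t \<in> K \<Longrightarrow> (d has_vector_derivative d' t) (at t within K)"
    and bnd: "\<And>t. t \<in> K \<Longrightarrow> norm (d' t) \<le> L * norm (d t)"
    and t0: "t0 \<in> K" "d t0 = 0" and t: "t \<in> K"
  shows "d t = 0"
proof -
  have Kc: "s \<in> K" if "p \<in> K" "q \<in> K" "p \<le> s" "s \<le> q" for p q s
    using K that unfolding is_interval_1 by blast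
  have ip: "\<bar>d s \<bullet> d' s\<bar> \<le> L * (d s \<bullet> d s)" if "s \<in> K" for s
  proof -
    have "\<bar>d s \<bullet> d' s\<bar> \<le> norm (d s) * norm (d' s)" by (rule Cauchy_Schwarz_ineq2)
    also have "\<dots> \<le> norm (d s) * (L * norm (d s))" by (intro mult_left_mono bnd that) simp
    finally show ?thesis by (simp add: power2_norm_eq_inner[symmetric] power2_eq_square algebra_simps)
  qed
  define g where "g = (\<lambda>c s. (d s \<bullet> d s) * exp (c * s))"
  have dg: "(g c has_derivative (\<lambda>\<tau>. \<tau> * ((2 * (d s \<bullet> d' s) + c * (d s \<bullet> d s)) * exp (c * s)))) (at s within {p..q})"
    if "p \<in> K" "q \<in> K" "p \<le> s" "s \<le> q" for c s p q
  proof -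
    have sub: "{p..q} \<subseteq> K" using Kc that(1,2) by (meson atLeastAtMost_iff subsetI)
    have "s \<in> K" using sub that(3,4) by (meson atLeastAtMost_iff subsetD)
    have "(d has_derivative (\<lambda>\<tau>. \<tau> *\<^sub>R d' s)) (at s within {p..q})"
      by (rule has_derivative_subset[OF der[OF \<open>s \<in> K\<close>, unfolded has_vector_derivative_def] sub])
    from has_derivative_inner[OF this this]
    have "((\<lambda>s. d s \<bullet> d s) has_derivative (\<lambda>\<tau>. d s \<bullet> (\<tau> *\<^sub>R d' s) + (\<tau> *\<^sub>R d' s) \<bullet> d s)) (at s within {p..q})" .
    moreover have "((\<lambda>s. exp (c * s)) has_derivative (\<lambda>\<tau>. exp (c * s) * (c * \<tau>))) (at s within {p..q})"
      by (rule has_derivative_eq_rhs[OF has_derivative_exp[OF has_derivative_mult_right[OF has_derivative_ident]]])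
        (simp add: mult.commute)
    ultimately have "(g c has_derivative (\<lambda>\<tau>. (d s \<bullet> d s) * (exp (c * s) * (c * \<tau>)) + (d s \<bullet> (\<tau> *\<^sub>R d' s) + (\<tau> *\<^sub>R d' s) \<bullet> d s) * exp (c * s))) (at s within {p..q})"
      unfolding g_def by (rule has_derivative_mult)
    then show ?thesis
      by (rule has_derivative_eq_rhs) (simp add: fun_eq_iff algebra_simps inner_commute)
  qed
  have nn: "d t \<bullet> d t \<le> 0"
  proof (cases "t0 \<le> t")
    case True
    from mvt_very_simple[of t0 t "g (- (2 * L))", OF True dg[OF t0(1) t]]
    obtain s where s: "s \<in> {t0..t}"
      "g (- (2 * L)) t - g (- (2 * L)) t0 = (t - t0) * ((2 * (d s \<bullet> d' s) + - (2 * L) * (d s \<bullet> d s)) * exp (- (2 * L) * s))"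
      by blast
    have "s \<in> K" using Kc s(1) t t0(1) by (meson atLeastAtMost_iff)
    then have "2 * (d s \<bullet> d' s) + - (2 * L) * (d s \<bullet> d s) \<le> 0" using ip[of s] by (simp add: abs_le_iff)
    then have "g (- (2 * L)) t - g (- (2 * L)) t0 \<le> 0"
      unfolding s(2) using True by (intro mult_nonneg_nonpos mult_nonpos_nonneg) auto
    then show ?thesis using t0(2) by (simp add: g_def mult_le_0_iff)
  next
    case False
    then have le: "t \<le> t0" by simp
    from mvt_very_simple[of t t0 "g (2 * L)", OF le dg[OF t t0(1)]]
    obtain s where s: "s \<in> {t..t0}"
      "g (2 * L) t0 - g (2 * L) t = (t0 - t) * ((2 * (d s \<bullet> d' s) + (2 * L) * (d s \<bullet> d s)) * exp ((2 * L) * s))"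
      by blast
    have "s \<in> K" using Kc s(1) t t0(1) by (meson atLeastAtMost_iff)
    then have "2 * (d s \<bullet> d' s) + (2 * L) * (d s \<bullet> d s) \<ge> 0" using ip[of s] by (simp add: abs_le_iff)
    then have "g (2 * L) t0 - g (2 * L) t \<ge> 0"
      unfolding s(2) using le by (intro mult_nonneg_nonneg) auto
    then show ?thesis using t0(2) by (simp add: g_def mult_le_0_iff)
  qed
  then show ?thesis
    using inner_ge_zero[of "d t"] by (metis inner_eq_zero_iff order_antisym)
qed


section \<open>Inverses of families of linear maps\<close>

lemma linear_bij_lower_bound:
  fixes L :: "'a::euclidean_space \<Rightarrow> 'a"
  assumes "linear L" "bij L"
  obtains m where "m > 0" "\<And>x. m * norm x \<le> norm (L x)"
  using linear_inj_bounded_below_pos[OF assms(1) bij_is_inj[OF assms(2)]] by metis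

text \<open>Finitely many basis vectors control the operator norm; each one contributes the error
  \<open>e / DIM('a)\<close>.\<close>

lemma linear_family_norm_tendsto:
  fixes L :: "'x::real_normed_vector \<Rightarrow> 'a::euclidean_space \<Rightarrow> 'b::real_normed_vector"
  assumes "open V" "y0 \<in> V" "\<And>y. y \<in> V \<Longrightarrow> linear (L y)" "\<And>b. continuous (at y0) (\<lambda>y. L y b)" "e > 0"
  obtains d where "d > 0" "\<And>y w. norm (y - y0) < d \<Longrightarrow> y \<in> V \<and> norm (L y w - L y0 w) \<le> e * norm w"
proof -
  define e' where "e' = e / DIM('a)"
  have e': "e' > 0" using assms(5) by (simp add: e'_def)
  have "eventually (\<lambda>y. \<forall>b\<in>Basis. dist (L y b) (L y0 b) < e') (nhds y0)"
  proof (rule eventually_ball_finite)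
    show "\<forall>b\<in>Basis. eventually (\<lambda>y. dist (L y b) (L y0 b) < e') (nhds y0)"
      using tendstoD[OF assms(4)[unfolded continuous_at] e'] e' by (simp add: eventually_nhds_conv_at)
  qed simp
  moreover have "eventually (\<lambda>y. y \<in> V) (nhds y0)"
    using assms(1,2) by (rule eventually_nhds_in_open)
  ultimately have "eventually (\<lambda>y. y \<in> V \<and> (\<forall>b\<in>Basis. dist (L y b) (L y0 b) < e')) (nhds y0)"
    by eventually_elim simp
  then obtain d where d: "d > 0" "\<And>y. dist y y0 < d \<Longrightarrow> y \<in> V \<and> (\<forall>b\<in>Basis. dist (L y b) (L y0 b) < e')"
    unfolding eventually_nhds_metric by blast
  show thesis
  proof (rule that[OF d(1)])
    fix y w assume y: "norm (y - y0) < d"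
    have yV: "y \<in> V" "\<And>b. b \<in> Basis \<Longrightarrow> norm (L y b - L y0 b) \<le> e'"
      using d(2)[of y] y by (auto simp: dist_norm intro: less_imp_le)
    have "L y w - L y0 w = (\<Sum>b\<in>Basis. (w \<bullet> b) *\<^sub>R (L y b - L y0 b))"
      using linear_sum_Basis[OF assms(3)[OF yV(1)], of w] linear_sum_Basis[OF assms(3)[OF assms(2)], of w]
      by (simp add: sum_subtractf scaleR_diff_right)
    also have "norm \<dots> \<le> (\<Sum>b\<in>(Basis::'a set). norm w * e')"
    proof (rule sum_norm_le)
      fix b :: 'a assume b: "b \<in> Basis"
      show "norm ((w \<bullet> b) *\<^sub>R (L y b - L y0 b)) \<le> norm w * e'"
        using Basis_le_norm[OF b, of w] yV(2)[OF b] by (simp add: mult_mono)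
    qed
    also have "\<dots> = e * norm w" by (simp add: e'_def)
    finally show "y \<in> V \<and> norm (L y w - L y0 w) \<le> e * norm w"
      using yV(1) by simp
  qed
qed

text \<open>The lower bound \<open>m\<close> of \<open>L y0\<close> loses at most
  \<open>m / 2\<close> for nearby \<open>y\<close>. Applied to the difference of the two inverse
  images of \<open>v\<close>, it bounds this difference by the residual of the fixed vector
  \<open>inv (L y0) v\<close>, whose behaviour in \<open>y\<close> is known.\<close>

lemma inverse_family_bound:
  fixes L :: "'x::real_normed_vector \<Rightarrow> 'a::euclidean_space \<Rightarrow> 'a"
  assumes V: "open V" and y0: "y0 \<in> V" and lin: "\<And>y. y \<in> V \<Longrightarrow> linear (L y)"
    and bij: "\<And>y. y \<in> V \<Longrightarrow> bij (L y)" and cont: "\<And>b. continuous (at y0) (\<lambda>y. L y b)"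
  obtains C d where "C > 0" "d > 0"
    "\<And>y. norm (y - y0) < d \<Longrightarrow> y \<in> V \<and> norm (inv (L y) v - inv (L y0) v) \<le> C * norm (L y (inv (L y0) v) - v)"
proof -
  obtain m where m: "m > 0" "\<And>x. m * norm x \<le> norm (L y0 x)"
    using linear_bij_lower_bound[OF lin bij] y0 by metis
  obtain d where d: "d > 0" "\<And>y w. norm (y - y0) < d \<Longrightarrow> y \<in> V \<and> norm (L y w - L y0 w) \<le> m / 2 * norm w"
    using linear_family_norm_tendsto[OF V y0 lin cont, of "m / 2"] m(1) by (metis half_gt_zero)
  show thesis
  proof (rule that[of "2 / m" d])
    fix y assume y: "norm (y - y0) < d"
    then have yV: "y \<in> V" using d(2) by blast
    let ?w = "inv (L y) v - inv (L y0) v"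
    have "m * norm ?w \<le> norm (L y0 ?w)" by (rule m)
    also have "\<dots> \<le> norm (L y ?w) + norm (L y ?w - L y0 ?w)"
      by (metis norm_minus_commute norm_triangle_sub)
    also have "\<dots> \<le> norm (L y ?w) + m / 2 * norm ?w"
      using d(2)[OF y] by simp
    also have "L y ?w = v - L y (inv (L y0) v)"
      using linear_diff[OF lin[OF yV]] surj_f_inv_f[OF bij_is_surj[OF bij[OF yV]]] by simp
    finally have "norm ?w \<le> 2 / m * norm (v - L y (inv (L y0) v))"
      using m(1) by (simp add: field_simps)
    then show "y \<in> V \<and> norm ?w \<le> 2 / m * norm (L y (inv (L y0) v) - v)"
      using yV by (simp add: norm_minus_commute)
  qed (use m d in auto)
qed

lemma linear_inv:
  assumes "linear L" "bij L"
  shows "linear (inv L)"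
proof (rule linearI)
  have s: "L (inv L x) = x" for x
    using assms(2) by (simp add: bij_is_surj surj_f_inv_f)
  have i: "inv L (L x) = x" for x
    using assms(2) by (simp add: bij_is_inj)
  show "inv L (x + y) = inv L x + inv L y" for x y
    using i[of "inv L x + inv L y"] by (simp only: linear_add[OF assms(1)] s)
  show "inv L (r *\<^sub>R x) = r *\<^sub>R inv L x" for r x
    using i[of "r *\<^sub>R inv L x"] by (simp only: linear_scale[OF assms(1)] s)
qed

lemma continuous_inverse_family:
  fixes L :: "'x::real_normed_vector \<Rightarrow> 'a::euclidean_space \<Rightarrow> 'a"
  assumes V: "open V" and y0: "y0 \<in> V" and lin: "\<And>y. y \<in> V \<Longrightarrow> linear (L y)"
    and bij: "\<And>y. y \<in> V \<Longrightarrow> bij (L y)" and cont: "\<And>b. continuous (at y0) (\<lambda>y. L y b)"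
  shows "continuous (at y0) (\<lambda>y. inv (L y) v)"
proof -
  obtain C d where C: "C > 0" "d > 0"
    "\<And>y. norm (y - y0) < d \<Longrightarrow> y \<in> V \<and> norm (inv (L y) v - inv (L y0) v) \<le> C * norm (L y (inv (L y0) v) - v)"
    using inverse_family_bound[OF assms] by metis
  have v: "L y0 (inv (L y0) v) = v" using surj_f_inv_f[OF bij_is_surj[OF bij[OF y0]]] .
  have "((\<lambda>y. L y (inv (L y0) v)) \<longlongrightarrow> v) (at y0)"
    using cont[of "inv (L y0) v"] v by (simp add: continuous_at)
  then have "((\<lambda>y. C * norm (L y (inv (L y0) v) - v)) \<longlongrightarrow> C * norm (v - v)) (at y0)"
    by (intro tendsto_mult tendsto_const tendsto_norm tendsto_diff)
  then have lim: "((\<lambda>y. C * norm (L y (inv (L y0) v) - v)) \<longlongrightarrow> 0) (at y0)" by simp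
  have "((\<lambda>y. inv (L y) v - inv (L y0) v) \<longlongrightarrow> 0) (at y0)"
  proof (rule Lim_null_comparison[OF _ lim])
    show "\<forall>\<^sub>F y in at y0. norm (inv (L y) v - inv (L y0) v) \<le> C * norm (L y (inv (L y0) v) - v)"
      unfolding eventually_at using C(2,3) by (auto simp: dist_norm)
  qed
  then show ?thesis by (simp add: continuous_at Lim_null[symmetric])
qed

text \<open>The formula arises from differentiating \<open>L y (inv (L y) v) = v\<close>.
  Differentiability is assumed for each fixed vector \<open>b\<close> only, so the remainder is
  estimated by hand.\<close>

lemma has_derivative_inverse_family:
  fixes L :: "'x::real_normed_vector \<Rightarrow> 'a::euclidean_space \<Rightarrow> 'a"
  assumes V: "open V" and y0: "y0 \<in> V" and lin: "\<And>y. y \<in> V \<Longrightarrow> linear (L y)"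
    and bij: "\<And>y. y \<in> V \<Longrightarrow> bij (L y)"
    and der: "\<And>b. ((\<lambda>y. L y b) has_derivative D b) (at y0)"
  shows "((\<lambda>y. inv (L y) v) has_derivative (\<lambda>h. - inv (L y0) (D (inv (L y0) v) h))) (at y0)"
proof -
  have cont: "continuous (at y0) (\<lambda>y. L y b)" for b
    using has_derivative_continuous[OF der] .
  define u0 where "u0 = inv (L y0) v"
  have u0: "L y0 u0 = v" unfolding u0_def using surj_f_inv_f[OF bij_is_surj[OF bij[OF y0]]] .
  have bl: "bounded_linear (inv (L y0))"
    using linear_inv[OF lin bij] y0 by (simp add: linear_conv_bounded_linear)
  obtain K where K: "K > 0" "\<And>w. norm (inv (L y0) w) \<le> norm w * K"
    using bounded_linear.pos_bounded[OF bl] by blast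
  obtain B where B: "B > 0" "\<And>h. norm (D u0 h) \<le> norm h * B"
    using bounded_linear.pos_bounded[OF has_derivative_bounded_linear[OF der]] by blast
  obtain C d where C: "C > 0" "d > 0"
    "\<And>y. norm (y - y0) < d \<Longrightarrow> y \<in> V \<and> norm (inv (L y) v - u0) \<le> C * norm (L y u0 - v)"
    using inverse_family_bound[OF V y0 lin bij cont, where v = v] unfolding u0_def by metis
  \<comment> \<open>The remainder of the inverse is the image, under \<open>inv (L y0)\<close>, of
    two small terms: the remainder of \<open>L y u0\<close>, and \<open>L y - L y0\<close> applied
    to the difference of the inverses, a product of two small factors.\<close>
  have ident: "inv (L y) v - u0 + inv (L y0) (D u0 (y - y0)) =
      - inv (L y0) ((L y u0 - L y0 u0 - D u0 (y - y0)) + (L y (inv (L y) v - u0) - L y0 (inv (L y) v - u0)))"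
    if y: "y \<in> V" for y
  proof -
    have s: "L y (inv (L y) v) = v" using surj_f_inv_f[OF bij_is_surj[OF bij[OF y]]] .
    have i: "inv (L y0) (L y0 w) = w" for w using inv_f_f[OF bij_is_inj[OF bij[OF y0]]] .
    have "(L y u0 - L y0 u0 - D u0 (y - y0)) + (L y (inv (L y) v - u0) - L y0 (inv (L y) v - u0))
        = - (L y0 (inv (L y) v - u0) + D u0 (y - y0))"
      by (simp add: linear_diff[OF lin[OF y]] linear_diff[OF lin[OF y0]] s u0)
    then show ?thesis
      by (simp only: linear_neg[OF bounded_linear.linear[OF bl]] linear_add[OF bounded_linear.linear[OF bl]] i minus_minus)
  qed
  show ?thesis
    unfolding has_derivative_at_alt u0_def[symmetric]
  proof (intro conjI allI impI)
    show "bounded_linear (\<lambda>h. - inv (L y0) (D u0 h))"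
      by (intro bounded_linear_minus bounded_linear_compose[OF bl] has_derivative_bounded_linear[OF der])
    fix e :: real assume e: "e > 0"
    \<comment> \<open>After multiplication by \<open>K\<close> each of the two terms may use half of
      \<open>e\<close>; \<open>e2\<close> moreover absorbs the Lipschitz factor
      \<open>C * (B + e1)\<close> of the inverse.\<close>
    define e1 where "e1 = e / (2 * K)"
    define e2 where "e2 = e / (2 * K * (C * (B + e1)))"
    have e1: "e1 > 0" using e K by (simp add: e1_def)
    have e2: "e2 > 0" using e K C B e1 by (simp add: e2_def)
    obtain d1 where d1: "d1 > 0" "\<And>y. norm (y - y0) < d1 \<Longrightarrow> norm (L y u0 - L y0 u0 - D u0 (y - y0)) \<le> e1 * norm (y - y0)"
      using der[of u0] e1 unfolding has_derivative_at_alt by blast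
    obtain d2 where d2: "d2 > 0" "\<And>y w. norm (y - y0) < d2 \<Longrightarrow> y \<in> V \<and> norm (L y w - L y0 w) \<le> e2 * norm w"
      using linear_family_norm_tendsto[OF V y0 lin cont e2] by metis
    show "\<exists>d>0. \<forall>y. norm (y - y0) < d \<longrightarrow>
        norm (inv (L y) v - u0 - - inv (L y0) (D u0 (y - y0))) \<le> e * norm (y - y0)"
    proof (intro exI[of _ "min d (min d1 d2)"] conjI allI impI)
      show "0 < min d (min d1 d2)" using C d1 d2 by simp
      fix y assume y: "norm (y - y0) < min d (min d1 d2)"
      then have yV: "y \<in> V" using C(3) by simp
      let ?A = "L y u0 - L y0 u0 - D u0 (y - y0)" and ?w = "inv (L y) v - u0"
      have A: "norm ?A \<le> e1 * norm (y - y0)" using d1(2) y by simp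
      have "norm ?w \<le> C * norm (L y u0 - v)" using C(3) y by simp
      also have "norm (L y u0 - v) \<le> norm (D u0 (y - y0)) + norm ?A"
        using norm_triangle_ineq[of "D u0 (y - y0)" ?A] by (simp add: u0)
      also have "\<dots> \<le> (B + e1) * norm (y - y0)"
        using A B(2)[of "y - y0"] by (simp add: algebra_simps)
      finally have w: "norm ?w \<le> C * (B + e1) * norm (y - y0)" using C(1) by (simp add: mult.assoc)
      have "norm (L y ?w - L y0 ?w) \<le> e2 * norm ?w" using d2(2) y by simp
      also have "\<dots> \<le> e2 * (C * (B + e1) * norm (y - y0))" using w e2 by (intro mult_left_mono) auto
      also have "\<dots> = e / (2 * K) * norm (y - y0)"
      proof -
        have "e2 * (C * (B + e1)) = e / (2 * K)"
          using C(1) B(1) e1 K(1) by (simp add: e2_def)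
        then show ?thesis by (metis mult.assoc)
      qed
      finally have w2: "norm (L y ?w - L y0 ?w) \<le> e / (2 * K) * norm (y - y0)" .
      have "norm (?w - - inv (L y0) (D u0 (y - y0))) = norm (inv (L y0) (?A + (L y ?w - L y0 ?w)))"
        using ident[OF yV] by (simp only: diff_minus_eq_add norm_minus_cancel)
      also have "\<dots> \<le> norm (?A + (L y ?w - L y0 ?w)) * K" by (rule K)
      also have "\<dots> \<le> (e1 * norm (y - y0) + e / (2 * K) * norm (y - y0)) * K"
        using K(1) A w2 norm_triangle_ineq[of ?A "L y ?w - L y0 ?w"] by (intro mult_right_mono) linarith+
      also have "\<dots> = e * norm (y - y0)" using K(1) by (simp add: e1_def field_simps)
      finally show "norm (?w - - inv (L y0) (D u0 (y - y0))) \<le> e * norm (y - y0)" .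
    qed
  qed
qed

text \<open>The derivative of the inverse is built from the inverse itself and the derivative of
  \<open>L\<close>; so the class C^k of the inverse gives the same class for its derivative, one
  order more for the inverse.\<close>

lemma Ck_on_inverse_family:
  fixes L :: "'x::real_normed_vector \<Rightarrow> 'a::euclidean_space \<Rightarrow> 'a"
  assumes V: "open V" and lin: "\<And>y. y \<in> V \<Longrightarrow> linear (L y)"
    and bij: "\<And>y. y \<in> V \<Longrightarrow> bij (L y)" and Ck: "\<And>b. Ck_on k V (\<lambda>y. L y b)"
  shows "Ck_on k V (\<lambda>y. inv (L y) v)"
  using Ck
proof (induction k arbitrary: v)
  case 0
  have "continuous (at y) (\<lambda>y. inv (L y) v)" if "y \<in> V" for y
  proof (rule continuous_inverse_family[OF V that lin bij])
    show "continuous (at y) (\<lambda>y. L y b)" for b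
      using 0[of b] that V by (simp add: continuous_on_eq_continuous_at)
  qed
  then show ?case using V by (simp add: continuous_on_eq_continuous_at)
next
  case (Suc k)
  note d = Ck_on_SucD[OF V Suc.prems]
  have IH: "Ck_on k V (\<lambda>y. inv (L y) w)" for w
    by (rule Suc.IH) (rule Ck_on_Suc_imp[OF Suc.prems])
  let ?D = "\<lambda>y b. frechet_derivative (\<lambda>y. L y b) (at y)"
  \<comment> \<open>For a fixed direction \<open>h\<close> the derivative depends linearly on
    \<open>b\<close>. This allows the moving vector \<open>inv (L y) v\<close> to be inserted for
    \<open>b\<close>.\<close>
  have linD: "linear (\<lambda>b. ?D y b h)" if y: "y \<in> V" for y h
  proof (rule linearI)
    fix b c r
    have "((\<lambda>y. L y (b + c)) has_derivative (\<lambda>h. ?D y b h + ?D y c h)) (at y)"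
      by (rule has_derivative_transform_within_open[OF has_derivative_add[OF d(1)[OF y] d(1)[OF y]] V y])
        (simp add: linear_add[OF lin])
    from fun_cong[OF frechet_derivative_at[OF this], of h]
    show "?D y (b + c) h = ?D y b h + ?D y c h" by simp
    have "((\<lambda>y. L y (r *\<^sub>R b)) has_derivative (\<lambda>h. r *\<^sub>R ?D y b h)) (at y)"
      by (rule has_derivative_transform_within_open[OF has_derivative_scaleR_right[OF d(1)[OF y]] V y])
        (simp add: linear_scale[OF lin])
    from fun_cong[OF frechet_derivative_at[OF this], of h]
    show "?D y (r *\<^sub>R b) h = r *\<^sub>R ?D y b h" by simp
  qed
  show ?case
  proof (rule Ck_on_SucI[OF V])
    show "((\<lambda>y. inv (L y) v) has_derivative (\<lambda>h. - inv (L y) (?D y (inv (L y) v) h))) (at y)" if "y \<in> V" for y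
      by (rule has_derivative_inverse_family[OF V that lin bij d(1)[OF that]])
    show "Ck_on k V (\<lambda>y. - inv (L y) (?D y (inv (L y) v) h))" for h
    proof (rule Ck_on_minus[OF V])
      have "Ck_on k V (\<lambda>y. ?D y (inv (L y) v) h)"
        by (rule Ck_on_linear_family[of V "\<lambda>y b. ?D y b h", OF V linD d(2) IH])
      then show "Ck_on k V (\<lambda>y. inv (L y) (?D y (inv (L y) v) h))"
        by (rule Ck_on_linear_family[of V "\<lambda>y. inv (L y)" k, OF V linear_inv[OF lin bij] IH, rotated -1])
    qed
  qed
qed

text \<open>Bootstrapping: if \<open>g\<close> is of class C^k, then so is its derivative, the
  inverse of the derivative of \<open>f\<close> at \<open>g y\<close>; hence \<open>g\<close> is of
  class C^(k+1).\<close>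

lemma smooth_inverse:
  fixes f :: "'a::euclidean_space \<Rightarrow> 'a"
  assumes U: "open U" and f: "smooth_on U f" and V: "open V"
    and g: "continuous_on V g" "g ` V \<subseteq> U"
    and der: "\<And>y. y \<in> V \<Longrightarrow> (g has_derivative inv (frechet_derivative f (at (g y)))) (at y)"
    and bij: "\<And>y. y \<in> V \<Longrightarrow> bij (frechet_derivative f (at (g y)))"
  shows "smooth_on V g"
  unfolding smooth_on_def
proof
  fix k show "Ck_on k V g"
  proof (induction k)
    case 0
    then show ?case using g by simp
  next
    case (Suc k)
    show ?case
    proof (rule Ck_on_SucI[OF V der])
      show "Ck_on k V (\<lambda>y. inv (frechet_derivative f (at (g y))) v)" for v
      proof (rule Ck_on_inverse_family[OF V _ bij])
        show "linear (frechet_derivative f (at (g y)))" if "y \<in> V" for y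
          using has_derivative_linear[OF smooth_on_has_derivative[OF f U]] g(2) that by blast
        show "Ck_on k V (\<lambda>y. frechet_derivative f (at (g y)) b)" for b
          by (rule Ck_on_compose[OF V U g(2) Suc smooth_on_imp_Ck_on[OF smooth_on_derivative[OF f U]]])
      qed
    qed
  qed
qed

text \<open>Source and target have different types of equal dimension. Composition with the inverse
  \<open>M\<close> of the derivative at \<open>x0\<close> yields a self-map \<open>F\<close> whose
  derivative there is the identity; the local inverse of \<open>f\<close> is that of
  \<open>F\<close> after \<open>M\<close>.\<close>

theorem smooth_inverse_function_theorem:
  fixes f :: "'a::euclidean_space \<Rightarrow> 'b::euclidean_space"
  assumes U: "open U" and f: "smooth_on U f" and x0: "x0 \<in> U"
    and inj: "inj (frechet_derivative f (at x0))" and dim: "DIM('a) = DIM('b)"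
  obtains U' V g where "open U'" "x0 \<in> U'" "U' \<subseteq> U" "open V" "homeomorphism U' V f g" "smooth_on V g"
proof -
  define L where "L = frechet_derivative f (at x0)"
  have L: "linear L" unfolding L_def using has_derivative_linear[OF smooth_on_has_derivative[OF f U x0]] .
  obtain M where M: "linear M" "\<And>x. M (L x) = x" "\<And>y. L (M y) = y"
  proof -
    obtain M where M: "linear M" "M \<circ> L = id" using linear_injective_left_inverse[OF L] inj L_def by blast
    have "surj L" using L inj dim unfolding L_def
      by (metis dim_UNIV dim_image_eq dim_eq_full dim_substandard span_UNIV linear_injective_imp_surjective[of L] L_def)
    then have "L (M y) = y" for y using M(2) by (metis comp_apply id_apply surjD)
    then show thesis using that M by (metis comp_apply id_apply)
  qed
  have bM: "bounded_linear M" and bL: "bounded_linear L"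
    using M L linear_conv_bounded_linear by blast+
  define F where "F = (\<lambda>x. M (f x))"
  have F: "smooth_on U F" unfolding F_def by (rule smooth_on_bounded_linear[OF bM U f])
  let ?F' = "\<lambda>x. Blinfun (frechet_derivative F (at x))"
  have dF: "(F has_derivative frechet_derivative F (at x)) (at x)" if "x \<in> U" for x
    using smooth_on_has_derivative[OF F U that] .
  have ap: "blinfun_apply (?F' x) = frechet_derivative F (at x)" if "x \<in> U" for x
    using dF[OF that] by (metis bounded_linear_Blinfun_apply has_derivative_bounded_linear)
  have "(F has_derivative (\<lambda>v. M (L v))) (at x0)"
    unfolding F_def L_def
    by (rule bounded_linear.has_derivative[OF bM smooth_on_has_derivative[OF f U x0]])
  from frechet_derivative_at[OF this] have "frechet_derivative F (at x0) = (\<lambda>v. v)"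
    using M(2) by simp
  with ap[OF x0] have "blinfun_apply (?F' x0) v = v" for v
    by (simp only:)
  then have id: "id_blinfun o\<^sub>L ?F' x0 = id_blinfun"
    by (intro blinfun_eqI) (simp only: blinfun_apply_blinfun_compose blinfun_apply_id_blinfun)
  have cont: "continuous_on U ?F'"
    by (rule continuous_on_Blinfun_derivative[OF U smooth_on_imp_Ck_on[OF F]])
  have dF': "(F has_derivative blinfun_apply (?F' x)) (at x)" if "x \<in> U" for x
    using dF[OF that] ap[OF that] by simp
  obtain U' V g g' where 1: "open U'" "U' \<subseteq> U" "x0 \<in> U'" "open V" "F x0 \<in> V" "homeomorphism U' V F g"
    "\<And>y. y \<in> V \<Longrightarrow> (g has_derivative (g' y)) (at y)"
    "\<And>y. y \<in> V \<Longrightarrow> g' y = inv (blinfun_apply (?F' (g y)))"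
    "\<And>y. y \<in> V \<Longrightarrow> bij (blinfun_apply (?F' (g y)))"
    using inverse_function_theorem[OF U dF' cont x0 id] by metis
  have gV: "g ` V = U'" "\<And>y. y \<in> V \<Longrightarrow> g y \<in> U"
    using 1(2,6) by (auto simp: homeomorphism_def)
  have g: "smooth_on V g"
  proof (rule smooth_inverse[OF U F 1(4)])
    show "continuous_on V g" using 1(6) by (simp add: homeomorphism_def)
    show "g ` V \<subseteq> U" using gV by blast
    show "(g has_derivative inv (frechet_derivative F (at (g y)))) (at y)" if "y \<in> V" for y
      using 1(7)[OF that] unfolding 1(8)[OF that] ap[OF gV(2)[OF that]] .
    show "bij (frechet_derivative F (at (g y)))" if "y \<in> V" for y
      using 1(9)[OF that] unfolding ap[OF gV(2)[OF that]] .
  qed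
  define W where "W = M -` V"
  have W: "open W" unfolding W_def using 1(4) bM
    by (intro open_vimage) (auto simp: linear_continuous_on)
  have "homeomorphism U' W f (\<lambda>y. g (M y))"
    unfolding homeomorphism_def
  proof (intro conjI ballI)
    show "continuous_on U' f"
      using continuous_on_subset[OF smooth_on_imp_continuous_on[OF f] 1(2)] .
    show "continuous_on W (\<lambda>y. g (M y))"
      by (rule continuous_on_compose2[OF smooth_on_imp_continuous_on[OF g] linear_continuous_on[OF bM]])
        (auto simp: W_def)
    show gf: "g (M (f x)) = x" if "x \<in> U'" for x
      using 1(6) that by (auto simp: homeomorphism_def F_def)
    show fg: "f (g (M y)) = y" if "y \<in> W" for y
    proof -
      have "M (f (g (M y))) = M y" using 1(6) that by (auto simp: homeomorphism_def F_def W_def)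
      then show ?thesis using M(3) by metis
    qed
    show "f ` U' = W"
    proof
      show "f ` U' \<subseteq> W" using 1(6) by (auto simp: homeomorphism_def F_def W_def)
      show "W \<subseteq> f ` U'"
      proof
        fix y assume "y \<in> W"
        then have "g (M y) \<in> U'" "f (g (M y)) = y" using fg gV(1) by (auto simp: W_def)
        then show "y \<in> f ` U'" by (metis imageI)
      qed
    qed
    show "(\<lambda>y. g (M y)) ` W = U'"
    proof
      show "(\<lambda>y. g (M y)) ` W \<subseteq> U'" using gV(1) by (auto simp: W_def)
      show "U' \<subseteq> (\<lambda>y. g (M y)) ` W"
      proof
        fix x assume x: "x \<in> U'"
        have "M (f x) \<in> V" using 1(6) x by (auto simp: homeomorphism_def F_def)
        then show "x \<in> (\<lambda>y. g (M y)) ` W"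
          using gf[OF x] by (intro image_eqI[of _ _ "f x"]) (auto simp: W_def)
      qed
    qed
  qed
  moreover have "smooth_on W (\<lambda>y. g (M y))"
    by (rule smooth_on_compose[OF W 1(4) _ smooth_on_linear[OF bM W] g]) (auto simp: W_def)
  ultimately show thesis using that 1(1-3) W by blast
qed

subsection \<open>Smooth dependence of solutions of differential equations\<close>

text \<open>The substitution of \<open>\<tau> * t\<close> turns the integral from 0 to
  \<open>t\<close> into one over a fixed interval, valid for both signs of \<open>t\<close>; only
  continuity in a parameter remains.\<close>

lemma continuous_on_parametric_integral:
  fixes h :: "real \<Rightarrow> 'p::topological_space \<Rightarrow> 'y::banach"
  assumes "continuous_on UNIV (\<lambda>(t, p). h t p)"
  shows "continuous_on UNIV (\<lambda>(t, p). integral {0..1} (\<lambda>\<tau>. t *\<^sub>R h (\<tau> * t) p))"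
proof -
  have 1: "continuous_on (UNIV \<times> cbox 0 1) (\<lambda>x. h (snd x * fst (fst x)) (snd (fst x)))"
    by (rule continuous_on_compose2[OF assms, of _ "\<lambda>x. (snd x * fst (fst x), snd (fst x))", simplified])
      (intro continuous_intros)
  have "continuous_on (UNIV \<times> cbox 0 1) (\<lambda>(tp, \<tau>). fst tp *\<^sub>R h (\<tau> * fst tp) (snd tp))"
    using continuous_on_scaleR[OF continuous_on_fst[OF continuous_on_fst[OF continuous_on_id]] 1]
    by (simp add: case_prod_beta)
  from integral_continuous_on_param[OF this] show ?thesis
    by (simp add: case_prod_beta)
qed

text \<open>Undoing the substitution, the integral is \<open>g t - g 0\<close> for an antiderivative
  \<open>g\<close> of \<open>f\<close>.\<close>

lemma has_vector_derivative_scaled_integral: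
  fixes f :: "real \<Rightarrow> 'y::banach"
  assumes "continuous_on {-\<delta>..\<delta>} f" "\<bar>t\<bar> < \<delta>"
  shows "((\<lambda>t. integral {0..1} (\<lambda>\<tau>. t *\<^sub>R f (\<tau> * t))) has_vector_derivative f t) (at t)"
proof -
  obtain g where g: "\<And>x. x \<in> {-\<delta>..\<delta>} \<Longrightarrow> (g has_vector_derivative f x) (at x within {-\<delta>..\<delta>})"
    using antiderivative_continuous[OF assms(1)] by blast
  have eq: "integral {0..1} (\<lambda>\<tau>. s *\<^sub>R f (\<tau> * s)) = g s - g 0" if s: "\<bar>s\<bar> < \<delta>" for s
  proof -
    have "((\<lambda>\<tau>. s *\<^sub>R f (\<tau> * s)) has_integral g (1 * s) - g (0 * s)) {0..1}"
    proof (rule fundamental_theorem_of_calculus)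
      fix \<tau> :: real assume \<tau>: "\<tau> \<in> {0..1}"
      have "\<bar>\<tau> * s\<bar> < \<delta>"
      proof -
        have "\<bar>\<tau> * s\<bar> \<le> 1 * \<bar>s\<bar>"
          unfolding abs_mult using \<tau> by (intro mult_right_mono) auto
        then show ?thesis using s by simp
      qed
      then have "(g has_vector_derivative f (\<tau> * s)) (at (\<tau> * s))"
        using g[of "\<tau> * s"] at_within_interior[of "\<tau> * s" "{-\<delta>..\<delta>}"] by (simp add: abs_less_iff)
      then have "(g has_derivative (\<lambda>x. x *\<^sub>R f (\<tau> * s))) (at (\<tau> * s))"
        by (simp add: has_vector_derivative_def)
      moreover have "((\<lambda>\<tau>. \<tau> * s) has_derivative (\<lambda>x. x * s)) (at \<tau>)"
        by (rule has_derivative_mult_left[OF has_derivative_ident])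
      ultimately have "((\<lambda>\<tau>. g (\<tau> * s)) has_derivative (\<lambda>x. (x * s) *\<^sub>R f (\<tau> * s))) (at \<tau>)"
        using has_derivative_compose[where f = "\<lambda>\<tau>. \<tau> * s" and g = g] by blast
      then show "((\<lambda>\<tau>. g (\<tau> * s)) has_vector_derivative s *\<^sub>R f (\<tau> * s)) (at \<tau> within {0..1})"
        unfolding has_vector_derivative_def by (simp add: has_derivative_at_withinI)
    qed simp
    from integral_unique[OF this] show ?thesis by (simp only: mult_1 mult_zero_left)
  qed
  have "(g has_vector_derivative f t) (at t)"
    using g[of t] at_within_interior[of t "{-\<delta>..\<delta>}"] assms(2) by (simp add: abs_less_iff)
  then have "((\<lambda>s. g s - g 0) has_vector_derivative f t) (at t)"
    using has_vector_derivative_diff[OF _ has_vector_derivative_const] by fastforce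
  then show ?thesis
  proof (rule has_vector_derivative_transform_within_open)
    show "open {-\<delta><..<\<delta>}" "t \<in> {-\<delta><..<\<delta>}" using assms(2) by (auto simp: abs_less_iff)
    show "g s - g 0 = integral {0..1} (\<lambda>\<tau>. s *\<^sub>R f (\<tau> * s))" if "s \<in> {-\<delta><..<\<delta>}" for s
      using eq[of s] that by (simp add: abs_less_iff)
  qed
qed

text \<open>Outside \<open>[-\<delta>, \<delta>]\<close> time is clamped, so that the contraction acts on bounded functions defined
  everywhere and the solution is jointly continuous by construction.\<close>

lemma parametric_picard:
  fixes h :: "real \<Rightarrow> 'p::metric_space \<Rightarrow> 'y::banach \<Rightarrow> 'y"
  assumes \<delta>: "\<delta> > 0" and L: "0 \<le> L" "\<delta> * L < 1"
    and cont: "continuous_on UNIV (\<lambda>(t, p, y). h t p y)"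
    and bnd: "\<And>t p. norm (h t p 0) \<le> B"
    and lip: "\<And>t p y y'. norm (h t p y - h t p y') \<le> L * norm (y - y')"
  obtains u where "continuous_on UNIV (\<lambda>(t, p). u t p)"
    "\<And>t p. \<bar>t\<bar> < \<delta> \<Longrightarrow> ((\<lambda>t. u t p) has_vector_derivative h t p (u t p)) (at t)"
    "\<And>p. u 0 p = 0"
proof -
  define cl where "cl = (\<lambda>t. max (-\<delta>) (min \<delta> t))"
  have cl: "\<bar>cl t\<bar> \<le> \<delta>" "\<bar>t\<bar> < \<delta> \<Longrightarrow> cl t = t" for t
    using \<delta> by (auto simp: cl_def)
  have clc: "continuous_on X cl" for X unfolding cl_def by (intro continuous_intros)
  \<comment> \<open>For times in \<open>{-\<delta>..\<delta>}\<close> this is the integral of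
    \<open>h s p (w (s, p))\<close> over \<open>s\<close> from 0 to \<open>t\<close>, so a fixed
    point solves the equation with initial value 0.\<close>
  define I where "I = (\<lambda>w. \<lambda>(t, p). integral {0..1} (\<lambda>\<tau>. cl t *\<^sub>R h (\<tau> * cl t) p (w (\<tau> * cl t, p))))"
  have hc: "continuous_on UNIV (\<lambda>(t, p). h t p (w (t, p)))" if "continuous_on UNIV w" for w
    using continuous_on_compose2[OF cont, of UNIV "\<lambda>x. (fst x, snd x, w x)"] that
    by (simp add: case_prod_beta continuous_intros)
  have Ic: "continuous_on UNIV (I w)" if "continuous_on UNIV w" for w
  proof -
    have "continuous_on UNIV (\<lambda>x. (\<lambda>(t, p). integral {0..1} (\<lambda>\<tau>. t *\<^sub>R h (\<tau> * t) p (w (\<tau> * t, p)))) (cl (fst x), snd x))"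
      by (rule continuous_on_compose2[OF continuous_on_parametric_integral[OF hc[OF that]]])
        (auto intro!: continuous_on_Pair continuous_on_compose2[OF clc continuous_on_fst[OF continuous_on_id]]
          continuous_on_snd continuous_on_id)
    then show ?thesis by (simp add: I_def case_prod_beta)
  qed
  have hs: "continuous_on {0..1} (\<lambda>\<tau>. s *\<^sub>R h (\<tau> * s) p (w (\<tau> * s, p)))" if "continuous_on UNIV w" for w s p
  proof -
    have "continuous_on {0..1} (\<lambda>\<tau>. (\<lambda>(t, p). h t p (w (t, p))) (\<tau> * s, p))"
      by (rule continuous_on_compose2[OF hc[OF that]]) (auto intro!: continuous_intros)
    then show ?thesis by (intro continuous_on_scaleR continuous_on_const) simp
  qed
  \<comment> \<open>The operator preserves boundedness: \<open>h\<close> is bounded at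
    \<open>y = 0\<close>, and the Lipschitz condition controls its growth from there.\<close>
  have Ib: "norm (I w x) \<le> \<delta> * (B + L * C)" if "continuous_on UNIV w" "\<And>x. norm (w x) \<le> C" for w x C
  proof -
    have hb: "norm (h t p (w (t, p))) \<le> B + L * C" for t p
    proof -
      have "norm (h t p (w (t, p))) \<le> norm (h t p 0) + norm (h t p (w (t, p)) - h t p 0)"
        by (metis norm_triangle_sub)
      also have "\<dots> \<le> B + L * C"
        using bnd[of t p] lip[of t p "w (t, p)" 0] mult_left_mono[OF that(2)[of "(t, p)"] L(1)] by simp
      finally show ?thesis .
    qed
    obtain t p where x: "x = (t, p)" by (cases x)
    have "norm (integral {0..1} (\<lambda>\<tau>. cl t *\<^sub>R h (\<tau> * cl t) p (w (\<tau> * cl t, p)))) \<le> (\<delta> * (B + L * C)) * (1 - 0)"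
    proof (rule integral_bound)
      fix \<tau> :: real assume "\<tau> \<in> {0..1}"
      show "norm (cl t *\<^sub>R h (\<tau> * cl t) p (w (\<tau> * cl t, p))) \<le> \<delta> * (B + L * C)"
        using cl(1)[of t] hb[of "\<tau> * cl t" p] by (simp add: mult_mono)
    qed (use hs[OF that(1)] in auto)
    then show ?thesis by (simp add: I_def x)
  qed
  have Il: "norm (I w x - I w' x) \<le> \<delta> * L * C" if w: "continuous_on UNIV w" "continuous_on UNIV w'" "\<And>x. norm (w x - w' x) \<le> C" for w w' x C
  proof -
    obtain t p where x: "x = (t, p)" by (cases x)
    have "I w x - I w' x = integral {0..1} (\<lambda>\<tau>. cl t *\<^sub>R h (\<tau> * cl t) p (w (\<tau> * cl t, p)) - cl t *\<^sub>R h (\<tau> * cl t) p (w' (\<tau> * cl t, p)))"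
      unfolding I_def x using integral_diff[OF integrable_continuous_real[OF hs[OF w(1)]] integrable_continuous_real[OF hs[OF w(2)]]]
      by simp
    also have "norm \<dots> \<le> (\<delta> * L * C) * (1 - 0)"
    proof (rule integral_bound)
      fix \<tau> :: real assume "\<tau> \<in> {0..1}"
      have "norm (h (\<tau> * cl t) p (w (\<tau> * cl t, p)) - h (\<tau> * cl t) p (w' (\<tau> * cl t, p))) \<le> L * C"
        using lip[of "\<tau> * cl t" p "w (\<tau> * cl t, p)" "w' (\<tau> * cl t, p)"] mult_left_mono[OF w(3)[of "(\<tau> * cl t, p)"] L(1)] by linarith
      then have "\<bar>cl t\<bar> * norm (h (\<tau> * cl t) p (w (\<tau> * cl t, p)) - h (\<tau> * cl t) p (w' (\<tau> * cl t, p))) \<le> \<delta> * (L * C)"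
        using cl(1)[of t] by (intro mult_mono) auto
      then show "norm (cl t *\<^sub>R h (\<tau> * cl t) p (w (\<tau> * cl t, p)) - cl t *\<^sub>R h (\<tau> * cl t) p (w' (\<tau> * cl t, p))) \<le> \<delta> * L * C"
        by (simp add: scaleR_diff_right[symmetric] mult.assoc)
    qed (use hs[OF w(1)] hs[OF w(2)] in \<open>auto intro!: continuous_on_diff\<close>)
    finally show ?thesis by simp
  qed
  define \<T> where "\<T> = (\<lambda>w :: (real \<times> 'p) \<Rightarrow>\<^sub>C 'y. Bcontfun (I (apply_bcontfun w)))"
  have \<T>: "apply_bcontfun (\<T> w) = I (apply_bcontfun w)" for w
  proof -
    have "I (apply_bcontfun w) \<in> bcontfun"
      by (rule bcontfun_normI[OF Ic Ib]) (auto intro: norm_bounded)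
    then show ?thesis by (simp add: \<T>_def Bcontfun_inverse)
  qed
  have "\<exists>!w. \<T> w = w"
  proof (rule banach_fix_type)
    show "0 \<le> \<delta> * L" "\<delta> * L < 1" using \<delta> L by auto
    show "\<forall>w w'. dist (\<T> w) (\<T> w') \<le> \<delta> * L * dist w w'"
    proof (intro allI dist_bound)
      fix w w' :: "(real \<times> 'p) \<Rightarrow>\<^sub>C 'y" and x
      show "dist (apply_bcontfun (\<T> w) x) (apply_bcontfun (\<T> w') x) \<le> \<delta> * L * dist w w'"
        unfolding \<T> dist_norm[of "I _ _"]
        by (rule Il) (auto simp: dist_norm[symmetric] intro: dist_bounded)
    qed
  qed
  then obtain w where "\<T> w = w" by blast
  then have fp: "apply_bcontfun w x = I (apply_bcontfun w) x" for x using \<T> by metis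
  define u where "u = (\<lambda>t p. apply_bcontfun w (t, p))"
  show thesis
  proof (rule that[of u])
    show "continuous_on UNIV (\<lambda>(t, p). u t p)" by (simp add: u_def case_prod_beta)
    show "u 0 p = 0" for p
      using fp[of "(0, p)"] cl(2)[of 0] \<delta> by (simp add: u_def I_def)
    fix t p assume t: "\<bar>t\<bar> < \<delta>"
    have "continuous_on {-\<delta>..\<delta>} (\<lambda>t. (\<lambda>(t, p). h t p (apply_bcontfun w (t, p))) (t, p))"
      by (rule continuous_on_compose2[OF hc]) (auto intro!: continuous_intros)
    then have "continuous_on {-\<delta>..\<delta>} (\<lambda>t. h t p (apply_bcontfun w (t, p)))" by simp
    from has_vector_derivative_scaled_integral[OF this t]
    show "((\<lambda>t. u t p) has_vector_derivative h t p (u t p)) (at t)"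
      unfolding u_def
    proof (rule has_vector_derivative_transform_within_open)
      show "open {-\<delta><..<\<delta>}" "t \<in> {-\<delta><..<\<delta>}" using t by (auto simp: abs_less_iff)
      show "integral {0..1} (\<lambda>\<tau>. s *\<^sub>R h (\<tau> * s) p (apply_bcontfun w (\<tau> * s, p))) = apply_bcontfun w (s, p)"
        if "s \<in> {-\<delta><..<\<delta>}" for s
        using fp[of "(s, p)"] cl(2)[of s] that by (simp add: I_def abs_less_iff)
    qed
  qed
qed


text \<open>Let \<open>R\<close> be the maximum of the remainder \<open>r\<close> over the time
  interval. By linearization of \<open>h\<close> along the solution, the derivative of
  \<open>r\<close> is at most \<open>(\<epsilon> + L) * R\<close> plus a small multiple of
  \<open>norm k\<close>. Integrating over a time shorter than \<delta> gives at most
  \<open>R / 2\<close> plus a small multiple of \<open>norm k\<close>, because \<epsilon> \<delta>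
  and \<delta> L are at most 1/4. The term \<open>R / 2\<close> is absorbed on the left.\<close>

lemma has_derivative_of_variational_equation:
  fixes h :: "(real \<times> 'p::euclidean_space) \<times> 'y::euclidean_space \<Rightarrow> 'y" and u :: "real \<times> 'p \<Rightarrow> 'y"
    and v :: "real \<Rightarrow> 'p \<Rightarrow>\<^sub>L 'y"
  assumes L: "0 \<le> L" "\<delta> * L \<le> 1 / 4" and Om: "open Om" "Ck_on (Suc 0) Om h" and P: "open P"
    and u: "continuous_on ({-\<delta><..<\<delta>} \<times> P) u" "\<And>t p. \<bar>t\<bar> < \<delta> \<Longrightarrow> p \<in> P \<Longrightarrow> ((t, p), u (t, p)) \<in> Om"
    and ode: "\<And>t p. \<bar>t\<bar> < \<delta> \<Longrightarrow> p \<in> P \<Longrightarrow> ((\<lambda>t. u (t, p)) has_vector_derivative h ((t, p), u (t, p))) (at t)"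
    and bnd: "\<And>t p w. \<bar>t\<bar> < \<delta> \<Longrightarrow> p \<in> P \<Longrightarrow>
        norm (frechet_derivative h (at ((t, p), u (t, p))) (0, w)) \<le> L * norm w"
    and T: "\<bar>T\<bar> < \<delta>" and p: "p \<in> P"
    and v0: "((\<lambda>p. u (0, p)) has_derivative v 0) (at p)"
    and v: "\<And>t q. \<bar>t\<bar> \<le> \<bar>T\<bar> \<Longrightarrow> ((\<lambda>t. v t q) has_vector_derivative
        frechet_derivative h (at ((t, p), u (t, p))) ((0, q), v t q)) (at t)"
    and vc: "continuous_on {-\<bar>T\<bar>..\<bar>T\<bar>} v"
  shows "((\<lambda>p. u (T, p)) has_derivative v T) (at p)"
proof -
  define I where "I = {-\<bar>T\<bar>..\<bar>T\<bar>}"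
  have I: "compact I" "0 \<in> I" "T \<in> I" "\<And>t. t \<in> I \<longleftrightarrow> \<bar>t\<bar> \<le> \<bar>T\<bar>" by (auto simp: I_def)
  have Id: "\<bar>t\<bar> < \<delta>" "\<bar>t\<bar> \<le> \<delta>" "-\<delta> < t" "t < \<delta>" if "t \<in> I" for t using that T I(4)[of t] by auto
  have \<delta>: "\<delta> > 0" using T by linarith
  define D where "D = (\<lambda>t. frechet_derivative h (at ((t, p), u (t, p))))"
  have Dl: "linear (D t)" if "t \<in> I" for t
    unfolding D_def using has_derivative_linear[OF Ck_on_SucD(1)[OF Om u(2)[OF Id(1)[OF that] p]]] .
  obtain C where C: "C > 0" "\<And>t. t \<in> I \<Longrightarrow> norm (v t) \<le> C"
  proof -
    have "bounded (v ` I)" using compact_imp_bounded[OF compact_continuous_image[OF vc[folded I_def] I(1)]] .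
    then show thesis using that unfolding bounded_pos by blast
  qed
  obtain \<rho> where \<rho>: "\<rho> > 0" "cball p \<rho> \<subseteq> P" using P p open_contains_cball by blast
  have uc: "uniformly_continuous_on (I \<times> cball p \<rho>) u"
    by (rule compact_uniformly_continuous[OF continuous_on_subset[OF u(1)] compact_Times[OF I(1) compact_cball]])
      (use \<rho>(2) Id(3,4) in auto)
  show ?thesis
    unfolding has_derivative_at_alt
  proof (intro conjI allI impI)
    show "bounded_linear (v T)" by (rule blinfun.bounded_linear_right)
    fix e :: real assume e: "e > 0"
    \<comment> \<open>The first entry provides the quarter needed to absorb \<open>R / 2\<close>;
      the second is \<open>e\<close> divided by the factor that the absorbed inequality puts in
      front of \<open>norm k\<close>.\<close>
    define \<epsilon> where "\<epsilon> = min (1 / (4 * \<delta>)) (e / (2 * (1 + \<delta> * (1 + C))))"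
    have n: "0 < 2 * (1 + \<delta> * (1 + C))" using \<delta> C(1) by (simp add: add_pos_pos)
    have \<epsilon>: "\<epsilon> > 0" unfolding \<epsilon>_def using e \<delta> n by simp
    have \<epsilon>1: "\<epsilon> * \<delta> \<le> 1 / 4"
    proof -
      have "\<epsilon> * \<delta> \<le> 1 / (4 * \<delta>) * \<delta>" using \<delta> by (intro mult_right_mono) (auto simp: \<epsilon>_def)
      then show ?thesis using \<delta> by simp
    qed
    have \<epsilon>2: "\<epsilon> * (2 * (1 + \<delta> * (1 + C))) \<le> e"
    proof -
      have "\<epsilon> * (2 * (1 + \<delta> * (1 + C))) \<le> e / (2 * (1 + \<delta> * (1 + C))) * (2 * (1 + \<delta> * (1 + C)))"
        using n by (intro mult_right_mono) (auto simp: \<epsilon>_def)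
      then show ?thesis using n by simp
    qed
    \<comment> \<open>The graph over the compact time interval: linearization along it has one
      radius \<eta> for all times.\<close>
    define K where "K = (\<lambda>t. ((t, p), u (t, p))) ` I"
    have K: "compact K" "K \<subseteq> Om"
    proof -
      have "continuous_on I (\<lambda>t. u (t, p))"
        by (rule continuous_on_compose2[OF u(1)]) (use Id(3,4) p in \<open>auto intro!: continuous_intros\<close>)
      then have "continuous_on I (\<lambda>t. ((t, p), u (t, p)))"
        by (intro continuous_on_Pair continuous_on_id continuous_on_const)
      then show "compact K" unfolding K_def by (rule compact_continuous_image[OF _ I(1)])
      show "K \<subseteq> Om" unfolding K_def using u(2)[OF Id(1) p] by blast
    qed
    obtain \<eta> where \<eta>: "\<eta> > 0"
      "\<And>x y z. x \<in> K \<Longrightarrow> dist x y < \<eta> \<Longrightarrow> dist x z < \<eta> \<Longrightarrow>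
        norm (h z - h y - frechet_derivative h (at x) (z - y)) \<le> \<epsilon> * norm (z - y)"
      using C1_linearization_compact[OF Om K \<epsilon>] by metis
    obtain d1 where d1: "d1 > 0" "\<And>x y. x \<in> I \<times> cball p \<rho> \<Longrightarrow> y \<in> I \<times> cball p \<rho> \<Longrightarrow> dist y x < d1 \<Longrightarrow> dist (u y) (u x) < \<eta> / 2"
      using uc \<eta>(1) unfolding uniformly_continuous_on_def by (metis half_gt_zero)
    obtain d2 where d2: "d2 > 0" "\<And>p'. norm (p' - p) < d2 \<Longrightarrow> norm (u (0, p') - u (0, p) - v 0 (p' - p)) \<le> \<epsilon> * norm (p' - p)"
      using v0 \<epsilon> unfolding has_derivative_at_alt by blast
    define d where "d = min (min d1 d2) (min \<rho> (\<eta> / 2))"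
    have d: "d > 0" using d1 d2 \<rho> \<eta>(1) by (simp add: d_def)
    show "\<exists>d>0. \<forall>y. norm (y - p) < d \<longrightarrow> norm (u (T, y) - u (T, p) - v T (y - p)) \<le> e * norm (y - p)"
    proof (intro exI[of _ d] conjI allI impI d)
      fix p' assume p': "norm (p' - p) < d"
      define k where "k = p' - p"
      have k: "norm k < d1" "norm k < d2" "norm k < \<rho>" "norm k < \<eta> / 2" using p' by (auto simp: d_def k_def)
      have p'P: "p' \<in> P" "p' \<in> cball p \<rho>" using k(3) \<rho>(2) by (auto simp: k_def dist_norm norm_minus_commute)
      define r where "r = (\<lambda>t. u (t, p') - u (t, p) - v t k)"
      define r' where "r' = (\<lambda>t. h ((t, p'), u (t, p')) - h ((t, p), u (t, p)) - D t ((0, k), v t k))"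
      have rd: "(r has_vector_derivative r' t) (at t)" if "t \<in> I" for t
        unfolding r_def r'_def D_def
        using ode[OF Id(1)[OF that] p'P(1)] ode[OF Id(1)[OF that] p] v[of t k] that I(4)
        by (intro has_vector_derivative_diff) auto
      have "continuous_on I r"
        using rd by (intro continuous_at_imp_continuous_on ballI has_vector_derivative_continuous)
      then have "continuous_on I (\<lambda>t. norm (r t))" by (rule continuous_on_norm)
      \<comment> \<open>Estimating at a maximum point makes the unknown \<open>R\<close> appear on
        both sides, which is what permits the absorption.\<close>
      then obtain m where m: "m \<in> I" "\<And>t. t \<in> I \<Longrightarrow> norm (r t) \<le> norm (r m)"
        using continuous_attains_sup[OF I(1)] I(2) by (metis empty_iff)
      define R where "R = norm (r m)"
      have r'b: "norm (r' t) \<le> (\<epsilon> + L) * R + \<epsilon> * (1 + C) * norm k" if t: "t \<in> I" for t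
      proof -
        define \<Delta> where "\<Delta> = u (t, p') - u (t, p)"
        have \<Delta>: "\<Delta> = r t + v t k" by (simp add: \<Delta>_def r_def)
        have vk: "norm (v t k) \<le> C * norm k"
          using norm_blinfun[of "v t" k] C(2)[OF t] by (meson mult_right_mono norm_ge_zero order_trans)
        have rt: "norm (r t) \<le> R" using m(2)[OF t] by (simp add: R_def)
        have "dist (u (t, p')) (u (t, p)) < \<eta> / 2"
          by (rule d1(2)) (use t p'P(2) \<rho>(1) k(1) in \<open>auto simp: dist_Pair_Pair dist_norm k_def\<close>)
        then have \<Delta>s: "norm \<Delta> < \<eta> / 2" by (simp add: \<Delta>_def dist_norm)
        have zz: "((t, p'), u (t, p')) - ((t, p), u (t, p)) = ((0, k), \<Delta>)"
          by (simp add: k_def \<Delta>_def)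
        have nz: "norm ((0::real, k), \<Delta>) \<le> norm k + norm \<Delta>"
          using norm_Pair_le[of "(0::real, k)" \<Delta>] by (simp add: norm_Pair1)
        have "norm (h ((t, p'), u (t, p')) - h ((t, p), u (t, p)) - D t ((0, k), \<Delta>)) \<le> \<epsilon> * norm ((0::real, k), \<Delta>)"
        proof -
          have "dist ((t, p), u (t, p)) ((t, p'), u (t, p')) < \<eta>"
            unfolding dist_commute[of "((t, p), u (t, p))"] dist_norm[of "((t, p'), u (t, p'))"] zz
            using nz \<Delta>s k(4) by linarith
          moreover have "((t, p), u (t, p)) \<in> K" using t by (auto simp: K_def)
          moreover have "dist ((t, p), u (t, p)) ((t, p), u (t, p)) < \<eta>" using \<eta>(1) by simp
          ultimately show ?thesis
            unfolding D_def zz[symmetric] by (intro \<eta>(2))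
        qed
        also have "\<dots> \<le> \<epsilon> * (norm k + norm \<Delta>)" using nz \<epsilon> by simp
        also have "\<dots> \<le> \<epsilon> * (norm k + (R + C * norm k))"
        proof -
          have "norm \<Delta> \<le> R + C * norm k"
            unfolding \<Delta> using rt vk norm_triangle_ineq[of "r t" "v t k"] by linarith
          then show ?thesis using \<epsilon> by simp
        qed
        finally have 1: "norm (h ((t, p'), u (t, p')) - h ((t, p), u (t, p)) - D t ((0, k), \<Delta>)) \<le> \<epsilon> * (norm k + (R + C * norm k))" .
        have "norm (D t (0, r t)) \<le> L * norm (r t)" unfolding D_def by (rule bnd[OF Id(1)[OF t] p])
        also have "\<dots> \<le> L * R" using rt L(1) by (rule mult_left_mono)
        finally have 2: "norm (D t (0, r t)) \<le> L * R" .
        have "((0::real, k), \<Delta>) = ((0, k), v t k) + (0, r t)" unfolding \<Delta> by (simp add: add.commute)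
        then have "D t ((0, k), \<Delta>) = D t ((0, k), v t k) + D t (0, r t)"
          using linear_add[OF Dl[OF t]] by metis
        then have "r' t = (h ((t, p'), u (t, p')) - h ((t, p), u (t, p)) - D t ((0, k), \<Delta>)) + D t (0, r t)"
          by (simp add: r'_def)
        then have "norm (r' t) \<le> \<epsilon> * (norm k + (R + C * norm k)) + L * R"
          using norm_triangle_le[OF add_mono[OF 1 2]] by simp
        then show ?thesis by (simp add: algebra_simps)
      qed
      have "norm (r m - r 0) \<le> ((\<epsilon> + L) * R + \<epsilon> * (1 + C) * norm k) * norm (m - 0)"
      proof (rule differentiable_bound[of I r "\<lambda>t x. x *\<^sub>R r' t"])
        show "convex I" by (simp add: I_def)
        show "(r has_derivative (\<lambda>x. x *\<^sub>R r' t)) (at t within I)" if "t \<in> I" for t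
          using has_derivative_at_withinI[OF rd[OF that, unfolded has_vector_derivative_def]] .
        show "onorm (\<lambda>x. x *\<^sub>R r' t) \<le> (\<epsilon> + L) * R + \<epsilon> * (1 + C) * norm k" if "t \<in> I" for t
          using mult_right_mono[OF r'b[OF that] abs_ge_zero] by (intro onorm_le) (simp add: mult.commute)
      qed (use m I in auto)
      also have "\<dots> \<le> ((\<epsilon> + L) * R + \<epsilon> * (1 + C) * norm k) * \<delta>"
        using Id(2)[OF m(1)] \<epsilon> L C(1) by (intro mult_left_mono) (auto simp: R_def)
      also have "\<dots> = (\<epsilon> * \<delta> + \<delta> * L) * R + \<epsilon> * (\<delta> * (1 + C)) * norm k"
        by (simp add: algebra_simps)
      also have "\<dots> \<le> (1 / 2) * R + \<epsilon> * (\<delta> * (1 + C)) * norm k"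
        using \<epsilon>1 L(2) by (intro add_right_mono mult_right_mono) (auto simp: R_def)
      finally have "norm (r m - r 0) \<le> R / 2 + \<epsilon> * (\<delta> * (1 + C)) * norm k" by simp
      moreover have "norm (r 0) \<le> \<epsilon> * norm k" using d2(2)[of p'] k(2) by (simp add: r_def k_def)
      ultimately have "R \<le> R / 2 + \<epsilon> * (\<delta> * (1 + C)) * norm k + \<epsilon> * norm k"
        using norm_triangle_sub[of "r m" "r 0"] by (simp add: R_def)
      then have "R \<le> \<epsilon> * (2 * (1 + \<delta> * (1 + C))) * norm k" by (simp add: algebra_simps)
      also have "\<dots> \<le> e * norm k" using \<epsilon>2 by (rule mult_right_mono) simp
      finally have "norm (r T) \<le> e * norm k" using m(2)[OF I(3)] by (simp add: R_def)
      then show "norm (u (T, p') - u (T, p) - v T (p' - p)) \<le> e * norm (p' - p)"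
        by (simp add: r_def k_def)
    qed
  qed
qed

text \<open>The variational equation is linear in an unknown with values in the operators from
  parameters to states, so one application of \<open>parametric_picard\<close> solves it for all
  directions at once, continuously in time and parameter.\<close>

lemma variational_equation_solution:
  fixes h :: "(real \<times> 'p::euclidean_space) \<times> 'y::euclidean_space \<Rightarrow> 'y" and u :: "real \<times> 'p \<Rightarrow> 'y"
  assumes L: "0 \<le> L" "\<delta> * L \<le> 1 / 4" and Om: "open Om" "Ck_on (Suc 0) Om h" and P: "open P"
    and u: "continuous_on ({-\<delta><..<\<delta>} \<times> P) u" "\<And>t p. \<bar>t\<bar> < \<delta> \<Longrightarrow> p \<in> P \<Longrightarrow> ((t, p), u (t, p)) \<in> Om"
    and init: "Ck_on (Suc 0) P (\<lambda>p. u (0, p))"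
    and bnd: "\<And>t p w. \<bar>t\<bar> < \<delta> \<Longrightarrow> p \<in> P \<Longrightarrow>
        norm (frechet_derivative h (at ((t, p), u (t, p))) (0, w)) \<le> L * norm w"
    and d: "0 < d" "d < \<delta>" and \<rho>: "\<rho> > 0" "cball p0 \<rho> \<subseteq> P"
  obtains v :: "real \<Rightarrow> 'p \<Rightarrow> 'p \<Rightarrow>\<^sub>L 'y" where "continuous_on UNIV (\<lambda>(t, p). v t p)"
    "\<And>p. p \<in> cball p0 \<rho> \<Longrightarrow> ((\<lambda>p. u (0, p)) has_derivative v 0 p) (at p)"
    "\<And>t p q. \<bar>t\<bar> < d \<Longrightarrow> p \<in> cball p0 \<rho> \<Longrightarrow> ((\<lambda>t. v t p q) has_vector_derivative
        frechet_derivative h (at ((t, p), u (t, p))) ((0, q), v t p q)) (at t)"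
proof -
  \<comment> \<open>Time and parameter are retracted to the compact set
    \<open>{-d..d} \<times> cball p0 \<rho>\<close>. The coefficients thereby become continuous and
    bounded everywhere and are unchanged on this set.\<close>
  define ct where "ct = (\<lambda>t. max (-d) (min d t))"
  define cp where "cp = closest_point (cball p0 \<rho>)"
  have ct: "\<bar>ct t\<bar> \<le> d" "\<bar>ct t\<bar> < \<delta>" "\<bar>t\<bar> \<le> d \<Longrightarrow> ct t = t" for t using d by (auto simp: ct_def)
  have cp: "cp p \<in> cball p0 \<rho>" "p \<in> cball p0 \<rho> \<Longrightarrow> cp p = p" for p
    unfolding cp_def using \<rho>(1) closest_point_in_set[OF closed_cball, of p0 \<rho> p]
    by (simp_all add: closest_point_self)
  have cpP: "cp p \<in> P" for p using cp(1) \<rho>(2) by blast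
  have ctc: "continuous_on X ct" for X unfolding ct_def by (intro continuous_intros)
  have cpc: "continuous_on X cp" for X unfolding cp_def
    using \<rho>(1) by (intro continuous_on_closest_point) auto
  define c where "c = (\<lambda>(t, p). (ct t, cp p))"
  have cc: "continuous_on UNIV c"
    unfolding c_def case_prod_beta
    by (intro continuous_on_Pair continuous_on_compose2[OF ctc[of UNIV]] continuous_on_compose2[OF cpc[of UNIV]]
        continuous_on_fst continuous_on_snd continuous_on_id) auto
  have cr: "c x \<in> {-d..d} \<times> cball p0 \<rho>" "c x \<in> {-\<delta><..<\<delta>} \<times> P" "c (c x) = c x" for x
  proof -
    obtain t p where x: "x = (t, p)" by (cases x)
    show "c x \<in> {-d..d} \<times> cball p0 \<rho>" using ct(1)[of t] cp(1)[of p] by (auto simp: c_def x abs_le_iff)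
    show "c x \<in> {-\<delta><..<\<delta>} \<times> P" using ct(2)[of t] cpP by (auto simp: c_def x abs_less_iff)
    show "c (c x) = c x" using ct(3)[OF ct(1)[of t]] cp(2)[OF cp(1)[of p]] by (simp add: c_def x)
  qed
  let ?Dh = "\<lambda>z. Blinfun (frechet_derivative h (at z))"
  define E where "E = (\<lambda>x. ?Dh (c x, u (c x)))"
  have Om': "(c x, u (c x)) \<in> Om" for x
    using u(2)[of "fst (c x)" "snd (c x)"] cr(2)[of x] by (auto simp: abs_less_iff)
  have uc: "continuous_on UNIV (\<lambda>x. u (c x))"
    by (rule continuous_on_compose2[OF u(1) cc]) (use cr(2) in blast)
  have Ec: "continuous_on UNIV E"
    unfolding E_def
    by (rule continuous_on_compose2[OF continuous_on_Blinfun_derivative[OF Om] continuous_on_Pair[OF cc uc]])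
      (use Om' in blast)
  have Ea: "blinfun_apply (E x) = frechet_derivative h (at (c x, u (c x)))" for x
    unfolding E_def using Ck_on_SucD(1)[OF Om Om'[of x]] by (metis bounded_linear_Blinfun_apply has_derivative_bounded_linear)
  \<comment> \<open>Composition with \<open>inP\<close> and \<open>inY\<close> extracts from the
    derivative of \<open>h\<close> its parts in the parameter and in the state.\<close>
  define inP :: "'p \<Rightarrow>\<^sub>L ((real \<times> 'p) \<times> 'y)" where "inP = Blinfun (\<lambda>q. ((0, q), 0))"
  define inY :: "'y \<Rightarrow>\<^sub>L ((real \<times> 'p) \<times> 'y)" where "inY = Blinfun (\<lambda>w. (0, w))"
  have inP: "blinfun_apply inP q = ((0, q), 0)" for q unfolding inP_def
    by (subst bounded_linear_Blinfun_apply)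
      (rule bounded_linear_Pair[OF bounded_linear_Pair[OF bounded_linear_zero bounded_linear_ident] bounded_linear_zero], rule refl)
  have inY: "blinfun_apply inY w = (0, w)" for w unfolding inY_def
    by (subst bounded_linear_Blinfun_apply)
      (rule bounded_linear_Pair[OF bounded_linear_zero bounded_linear_ident], rule refl)
  define W0 where "W0 = (\<lambda>p. Blinfun (frechet_derivative (\<lambda>p. u (0, p)) (at (cp p))))"
  have W0c: "continuous_on X W0" for X unfolding W0_def
    by (rule continuous_on_compose2[OF continuous_on_Blinfun_derivative[OF P init] cpc]) (use cpP in blast)
  \<comment> \<open>Solutions from \<open>parametric_picard\<close> start at 0; hence the unknown is
    the deviation from the initial derivative \<open>W0 p\<close>, which is added back at the
    end.\<close>
  define k where "k = (\<lambda>t p W. (E (t, p) o\<^sub>L inP) + ((E (t, p) o\<^sub>L inY) o\<^sub>L (W + W0 p)))"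
  note comp_cont = bounded_bilinear.continuous_on[OF bounded_bilinear_blinfun_compose]
  have kc: "continuous_on UNIV (\<lambda>(t, p, W). k t p W)"
  proof -
    have e: "continuous_on UNIV (\<lambda>x :: real \<times> 'p \<times> ('p \<Rightarrow>\<^sub>L 'y). E (fst x, fst (snd x)))"
      by (rule continuous_on_compose2[OF Ec]) (intro continuous_intros, blast)
    have w: "continuous_on UNIV (\<lambda>x :: real \<times> 'p \<times> ('p \<Rightarrow>\<^sub>L 'y). W0 (fst (snd x)))"
      by (rule continuous_on_compose2[OF W0c[of UNIV]]) (intro continuous_intros, blast)
    show ?thesis unfolding k_def case_prod_beta
      by (intro continuous_on_add comp_cont continuous_on_const e w continuous_on_snd continuous_on_id)
  qed
  have nY: "norm (E x o\<^sub>L inY) \<le> L" for x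
  proof (rule norm_blinfun_bound[OF L(1)])
    fix w
    show "norm (blinfun_apply (E x o\<^sub>L inY) w) \<le> L * norm w"
      using bnd[of "fst (c x)" "snd (c x)" w] cr(2)[of x]
      by (auto simp: Ea inY abs_less_iff)
  qed
  obtain B where B: "\<And>t p. norm (k t p 0) \<le> B"
  proof -
    let ?g = "\<lambda>x. k (fst x) (snd x) 0"
    have g: "continuous_on UNIV ?g"
      using continuous_on_compose2[OF kc, of UNIV "\<lambda>x. (fst x, snd x, 0)"] by (simp add: continuous_intros)
    have "bounded (?g ` ({-d..d} \<times> cball p0 \<rho>))"
      by (intro compact_imp_bounded compact_continuous_image continuous_on_subset[OF g] compact_Times compact_Icc compact_cball) auto
    then obtain B where B: "\<And>x. x \<in> {-d..d} \<times> cball p0 \<rho> \<Longrightarrow> norm (?g x) \<le> B"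
      unfolding bounded_iff by blast
    have "norm (k t p 0) \<le> B" for t p
    proof -
      have "W0 (snd (c (t, p))) = W0 p" using cp(2)[OF cp(1)[of p]] by (simp add: W0_def c_def)
      moreover have "E (c (t, p)) = E (t, p)" by (simp add: E_def cr(3))
      ultimately have "k t p 0 = ?g (c (t, p))" by (simp add: k_def)
      then show ?thesis using B[OF cr(1)] by metis
    qed
    then show thesis using that by blast
  qed
  have lip: "norm (k t p W - k t p W') \<le> L * norm (W - W')" for t p W W'
  proof -
    have "k t p W - k t p W' = (E (t, p) o\<^sub>L inY) o\<^sub>L (W - W')"
      by (simp add: k_def blinfun_eqI blinfun.diff_left blinfun.add_left blinfun.diff_right blinfun.add_right)
    also have "norm \<dots> \<le> norm (E (t, p) o\<^sub>L inY) * norm (W - W')" by (rule norm_blinfun_compose)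
    also have "\<dots> \<le> L * norm (W - W')" by (rule mult_right_mono[OF nY norm_ge_zero])
    finally show ?thesis .
  qed
  have dL: "d * L < 1"
  proof -
    have "d * L \<le> \<delta> * L" using d L(1) by (intro mult_right_mono) auto
    then show ?thesis using L(2) by simp
  qed
  obtain w where w: "continuous_on UNIV (\<lambda>(t, p). w t p)"
    "\<And>t p. \<bar>t\<bar> < d \<Longrightarrow> ((\<lambda>t. w t p) has_vector_derivative k t p (w t p)) (at t)" "\<And>p. w 0 p = 0"
    using parametric_picard[OF d(1) L(1) dL kc B lip] by blast
  show thesis
  proof (rule that[of "\<lambda>t p. w t p + W0 p"])
    show "continuous_on UNIV (\<lambda>(t, p). w t p + W0 p)"
      using w(1) unfolding case_prod_beta
      by (intro continuous_on_add continuous_on_compose2[OF W0c[of UNIV] continuous_on_snd[OF continuous_on_id]]) auto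
    show "((\<lambda>p. u (0, p)) has_derivative blinfun_apply (w 0 p + W0 p)) (at p)" if p: "p \<in> cball p0 \<rho>" for p
    proof -
      have "p \<in> P" using p \<rho>(2) by blast
      from Ck_on_SucD(1)[OF P init this] have *: "((\<lambda>p. u (0, p)) has_derivative frechet_derivative (\<lambda>p. u (0, p)) (at p)) (at p)" .
      then have "blinfun_apply (W0 p) = frechet_derivative (\<lambda>p. u (0, p)) (at p)"
        unfolding W0_def cp(2)[OF p] by (metis bounded_linear_Blinfun_apply has_derivative_bounded_linear)
      then show ?thesis using * by (simp add: w(3))
    qed
    fix t p q assume t: "\<bar>t\<bar> < d" and p: "p \<in> cball p0 \<rho>"
    have c: "c (t, p) = (t, p)" using ct(3)[of t] cp(2)[OF p] t by (simp add: c_def)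
    have lin: "linear (frechet_derivative h (at ((t, p), u (t, p))))"
      using Ea[of "(t, p)"] c by (metis blinfun.bounded_linear_right bounded_linear.linear)
    have "((\<lambda>t. w t p + W0 p) has_vector_derivative k t p (w t p) + 0) (at t)"
      by (rule has_vector_derivative_add[OF w(2)[OF t] has_vector_derivative_const])
    from bounded_linear.has_vector_derivative[OF blinfun.bounded_linear_left[of q] this]
    have "((\<lambda>t. blinfun_apply (w t p + W0 p) q) has_vector_derivative blinfun_apply (k t p (w t p) + 0) q) (at t)" .
    moreover have "blinfun_apply (k t p (w t p) + 0) q =
        frechet_derivative h (at ((t, p), u (t, p))) ((0, q), 0) + frechet_derivative h (at ((t, p), u (t, p))) (0, blinfun_apply (w t p + W0 p) q)"
      by (simp add: k_def blinfun.add_left Ea c inP inY)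
    moreover have "\<dots> = frechet_derivative h (at ((t, p), u (t, p))) ((0, q), blinfun_apply (w t p + W0 p) q)"
      by (simp add: linear_add[OF lin, symmetric] zero_prod_def)
    ultimately show "((\<lambda>t. blinfun_apply (w t p + W0 p) q) has_vector_derivative
        frechet_derivative h (at ((t, p), u (t, p))) ((0, q), blinfun_apply (w t p + W0 p) q)) (at t)"
      by simp
  qed
qed


text \<open>The partial derivative in time is the equation, the one in the parameter solves the
  variational equation. The latter is jointly continuous as constructed, so the partial derivatives
  combine to a total derivative.\<close>

lemma ode_derivative:
  fixes h :: "(real \<times> 'p::euclidean_space) \<times> 'y::euclidean_space \<Rightarrow> 'y" and u :: "real \<times> 'p \<Rightarrow> 'y"
  defines "V \<equiv> \<lambda>x. frechet_derivative (\<lambda>p. u (fst x, p)) (at (snd x))"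
  assumes L: "0 \<le> L" "\<delta> * L \<le> 1 / 4" and Om: "open Om" "Ck_on (Suc 0) Om h" and P: "open P"
    and u: "continuous_on ({-\<delta><..<\<delta>} \<times> P) u" "\<And>t p. \<bar>t\<bar> < \<delta> \<Longrightarrow> p \<in> P \<Longrightarrow> ((t, p), u (t, p)) \<in> Om"
    and ode: "\<And>t p. \<bar>t\<bar> < \<delta> \<Longrightarrow> p \<in> P \<Longrightarrow> ((\<lambda>t. u (t, p)) has_vector_derivative h ((t, p), u (t, p))) (at t)"
    and init: "Ck_on (Suc 0) P (\<lambda>p. u (0, p))"
    and bnd: "\<And>t p w. \<bar>t\<bar> < \<delta> \<Longrightarrow> p \<in> P \<Longrightarrow>
        norm (frechet_derivative h (at ((t, p), u (t, p))) (0, w)) \<le> L * norm w"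
    and t0: "\<bar>t0\<bar> < \<delta>" and p0: "p0 \<in> P"
  shows "(u has_derivative (\<lambda>\<xi>. fst \<xi> *\<^sub>R h ((t0, p0), u (t0, p0)) + V (t0, p0) (snd \<xi>))) (at (t0, p0))"
    and "continuous (at (t0, p0)) (\<lambda>x. V x q)"
    and "((\<lambda>t. V (t, p0) q) has_vector_derivative
        frechet_derivative h (at ((t0, p0), u (t0, p0))) ((0, q), V (t0, p0) q)) (at t0)"
proof -
  \<comment> \<open>The midpoint: \<open>t0\<close> is interior to the time interval of length
    \<open>2 * d\<close>, whose closure still lies in the domain.\<close>
  define d where "d = (\<bar>t0\<bar> + \<delta>) / 2"
  have d: "0 < d" "d < \<delta>" "\<bar>t0\<bar> < d" using t0 by (auto simp: d_def)
  obtain \<rho> where \<rho>: "\<rho> > 0" "cball p0 \<rho> \<subseteq> P" using P p0 open_contains_cball by blast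
  obtain v :: "real \<Rightarrow> 'p \<Rightarrow> 'p \<Rightarrow>\<^sub>L 'y" where v: "continuous_on UNIV (\<lambda>(t, p). v t p)"
    "\<And>p. p \<in> cball p0 \<rho> \<Longrightarrow> ((\<lambda>p. u (0, p)) has_derivative v 0 p) (at p)"
    "\<And>t p q. \<bar>t\<bar> < d \<Longrightarrow> p \<in> cball p0 \<rho> \<Longrightarrow> ((\<lambda>t. v t p q) has_vector_derivative
        frechet_derivative h (at ((t, p), u (t, p))) ((0, q), v t p q)) (at t)"
    using variational_equation_solution[OF L Om P u init bnd d(1,2) \<rho>] by blast
  have vt: "continuous_on X (\<lambda>t. v t p)" for X p
    using continuous_on_compose2[OF v(1), of X "\<lambda>t. (t, p)"] by (simp add: continuous_intros)
  have dv: "((\<lambda>p. u (t, p)) has_derivative v t p) (at p)" if t: "\<bar>t\<bar> < d" and p: "p \<in> cball p0 \<rho>" for t p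
  proof -
    have "\<bar>t\<bar> < \<delta>" "p \<in> P" using t d p \<rho>(2) by auto
    show ?thesis
    proof (rule has_derivative_of_variational_equation[where v = "\<lambda>t. v t p", OF L Om P u ode bnd \<open>\<bar>t\<bar> < \<delta>\<close> \<open>p \<in> P\<close> _ _ vt])
      show "((\<lambda>p. u (0, p)) has_derivative v 0 p) (at p)" by (rule v(2)[OF p])
      show "((\<lambda>t. v t p q) has_vector_derivative frechet_derivative h (at ((s, p), u (s, p))) ((0, q), v s p q)) (at s)"
        if "\<bar>s\<bar> \<le> \<bar>t\<bar>" for s q
        using that t by (intro v(3)[OF _ p]) simp
    qed
  qed
  have V: "V (t, p) = blinfun_apply (v t p)" if "\<bar>t\<bar> < d" "p \<in> cball p0 \<rho>" for t p
    unfolding V_def using frechet_derivative_at[OF dv[OF that]] by simp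
  define N where "N = {-d<..<d} \<times> ball p0 \<rho>"
  have N: "open N" "(t0, p0) \<in> N" using d(3) \<rho>(1) by (auto simp: N_def abs_less_iff open_Times)
  have "continuous_on N (\<lambda>x. (\<lambda>(t, p). v t p) x q)"
    by (rule continuous_on_subset[OF bounded_linear.continuous_on[OF blinfun.bounded_linear_left v(1)] subset_UNIV])
  moreover have "V x q = (\<lambda>(t, p). v t p) x q" if "x \<in> N" for x
    using V[of "fst x" "snd x"] that by (auto simp: N_def abs_less_iff case_prod_beta)
  ultimately have "continuous_on N (\<lambda>x. V x q)" by (simp cong: continuous_on_cong)
  then show "continuous (at (t0, p0)) (\<lambda>x. V x q)" using N by (simp add: continuous_on_eq_continuous_at)
  have "((\<lambda>t. V (t, p0) q) has_vector_derivative
        frechet_derivative h (at ((t0, p0), u (t0, p0))) ((0, q), v t0 p0 q)) (at t0)"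
  proof (rule has_vector_derivative_transform_within_open[OF v(3)[OF d(3)]])
    show "open {-d<..<d}" "t0 \<in> {-d<..<d}" using d(3) by (auto simp: abs_less_iff)
    show "blinfun_apply (v t p0) q = V (t, p0) q" if "t \<in> {-d<..<d}" for t
      using V[of t p0] that \<rho>(1) by (simp add: abs_less_iff)
  qed (use \<rho>(1) in simp)
  then show "((\<lambda>t. V (t, p0) q) has_vector_derivative
        frechet_derivative h (at ((t0, p0), u (t0, p0))) ((0, q), V (t0, p0) q)) (at t0)"
    using V[OF d(3), of p0] \<rho>(1) by simp
  have "((\<lambda>(t, p). u (t, p)) has_derivative (\<lambda>(\<tau>, q). \<tau> *\<^sub>R h ((t0, p0), u (t0, p0)) + v t0 p0 q)) (at (t0, p0) within {-d<..<d} \<times> ball p0 \<rho>)"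
  proof (rule has_derivative_partialsI)
    show "((\<lambda>t. u (t, p0)) has_derivative (\<lambda>\<tau>. \<tau> *\<^sub>R h ((t0, p0), u (t0, p0)))) (at t0 within {-d<..<d})"
      by (rule has_derivative_at_withinI[OF ode[OF t0 p0, unfolded has_vector_derivative_def]])
    show "((\<lambda>p. u (t, p)) has_derivative blinfun_apply (v t p)) (at p within ball p0 \<rho>)"
      if "t \<in> {-d<..<d}" "p \<in> ball p0 \<rho>" for t p
      by (rule has_derivative_at_withinI[OF dv]) (use that in \<open>auto simp: abs_less_iff\<close>)
    show "continuous (at (t0, p0) within {-d<..<d} \<times> ball p0 \<rho>) (\<lambda>(t, p). v t p)"
      using v(1) by (simp add: continuous_on_eq_continuous_at continuous_at_imp_continuous_at_within)
  qed (use \<rho>(1) in auto)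
  then have "(u has_derivative (\<lambda>(\<tau>, q). \<tau> *\<^sub>R h ((t0, p0), u (t0, p0)) + v t0 p0 q)) (at (t0, p0))"
    using at_within_open[OF N(2,1)] by (simp add: N_def)
  then show "(u has_derivative (\<lambda>\<xi>. fst \<xi> *\<^sub>R h ((t0, p0), u (t0, p0)) + V (t0, p0) (snd \<xi>))) (at (t0, p0))"
    by (rule has_derivative_eq_rhs) (use V[OF d(3), of p0] \<rho>(1) in \<open>simp add: fun_eq_iff\<close>)
qed

section \<open>Higher derivatives in time and parameter\<close>

lemma partial_frechet_derivative:
  assumes "h differentiable at (x, y)"
  shows "frechet_derivative (\<lambda>w. h (x, w)) (at y) w = frechet_derivative h (at (x, y)) (0, w)"
proof -
  have "((\<lambda>w. (x, w)) has_derivative (\<lambda>w. (0, w))) (at y)"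
    by (rule has_derivative_Pair[OF has_derivative_const has_derivative_ident])
  from has_derivative_compose[OF this] assms
  have "((\<lambda>w. h (x, w)) has_derivative (\<lambda>w. frechet_derivative h (at (x, y)) (0, w))) (at y)"
    by (simp add: frechet_derivative_works)
  from frechet_derivative_at[OF this] show ?thesis by metis
qed

text \<open>The class of equations is chosen such that the equation of a directional derivative of \<open>u\<close>
  belongs to it again, with the same types and the same bound \<open>L\<close>; this permits the induction on \<open>k\<close>
  without shrinking the domain.\<close>

lemma Ck_on_ode_solution:
  fixes h :: "(real \<times> 'p::euclidean_space) \<times> 'y::euclidean_space \<Rightarrow> 'y" and u :: "real \<times> 'p \<Rightarrow> 'y"
  assumes L: "0 \<le> L" "\<delta> * L \<le> 1 / 4" and P: "open P"
    and Om: "open Om" "Ck_on k Om h"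
    and u: "continuous_on ({-\<delta><..<\<delta>} \<times> P) u" "\<And>t p. \<bar>t\<bar> < \<delta> \<Longrightarrow> p \<in> P \<Longrightarrow> ((t, p), u (t, p)) \<in> Om"
    and ode: "\<And>t p. \<bar>t\<bar> < \<delta> \<Longrightarrow> p \<in> P \<Longrightarrow> ((\<lambda>t. u (t, p)) has_vector_derivative h ((t, p), u (t, p))) (at t)"
    and init: "Ck_on k P (\<lambda>p. u (0, p))"
    and bnd: "\<And>t p w. \<bar>t\<bar> < \<delta> \<Longrightarrow> p \<in> P \<Longrightarrow>
        norm (frechet_derivative (\<lambda>w. h ((t, p), w)) (at (u (t, p))) w) \<le> L * norm w"
  shows "Ck_on k ({-\<delta><..<\<delta>} \<times> P) u"
  using Om u ode init bnd
proof (induction k arbitrary: h u Om)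
  case 0
  then show ?case by simp
next
  case (Suc k)
  note Om = Suc.prems(1,2) and u = Suc.prems(3,4) and ode = Suc.prems(5) and init = Suc.prems(6) and bnd = Suc.prems(7)
  let ?D = "{-\<delta><..<\<delta>} \<times> P"
  have D: "open ?D" using P by (simp add: open_Times)
  \<comment> \<open>A first use of the induction hypothesis, for the equation itself: the
    coefficients of the variational equation contain \<open>u\<close>, so its class must be known
    before they can be of class C^k.\<close>
  have uk: "Ck_on k ?D u"
    using Suc.IH[OF Om(1) Ck_on_Suc_imp[OF Om(2)] u ode Ck_on_Suc_imp[OF init] bnd] by blast
  have Om1: "Ck_on (Suc 0) Om h" by (rule Ck_on_le[OF Om(2)]) simp
  have init1: "Ck_on (Suc 0) P (\<lambda>p. u (0, p))" by (rule Ck_on_le[OF init]) simp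
  have dh: "(h has_derivative frechet_derivative h (at z)) (at z)" if "z \<in> Om" for z
    using Ck_on_SucD(1)[OF Om that] .
  have bnd1: "norm (frechet_derivative h (at ((t, p), u (t, p))) (0, w)) \<le> L * norm w"
    if "\<bar>t\<bar> < \<delta>" "p \<in> P" for t p w
  proof -
    have "h differentiable at ((t, p), u (t, p))"
      by (rule differentiableI[OF dh[OF u(2)[OF that]]])
    from partial_frechet_derivative[OF this] show ?thesis
      using bnd[OF that, of w] by simp
  qed
  define V where "V = (\<lambda>x. frechet_derivative (\<lambda>p. u (fst x, p)) (at (snd x)))"
  note der = ode_derivative[OF L Om(1) Om1 P u ode init1 bnd1]
  have gr: "(x, u x) \<in> Om" if "x \<in> ?D" for x
    using u(2)[of "fst x" "snd x"] that by (auto simp: abs_less_iff)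
  have gk: "Ck_on k ?D (\<lambda>x. (x, u x))"
    by (rule Ck_on_Pair[OF D Ck_on_ident[OF D] uk])
  show ?case
  proof (rule Ck_on_SucI[OF D])
    show "(u has_derivative (\<lambda>\<xi>. fst \<xi> *\<^sub>R h (x, u x) + V x (snd \<xi>))) (at x)" if "x \<in> ?D" for x
      using der(1)[of "fst x" "snd x"] that by (auto simp: abs_less_iff case_prod_beta V_def)
    fix \<xi> :: "real \<times> 'p"
    define q where "q = snd \<xi>"
    have "Ck_on k ?D (\<lambda>x. h (x, u x))"
      by (rule Ck_on_compose[OF D Om(1) _ gk Ck_on_Suc_imp[OF Om(2)]]) (use gr in blast)
    moreover have "Ck_on k ?D (\<lambda>x. V x q)"
    proof (rule Suc.IH)
      let ?E = "?D \<times> (UNIV :: 'y set)"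
      \<comment> \<open>The right-hand side of the equation for \<open>V x q\<close>. The known
        solution \<open>u\<close> is inserted into the coefficients, and the state
        \<open>snd z\<close> enters affinely, hence may range over the whole space.\<close>
      let ?h = "\<lambda>z. frechet_derivative h (at (fst z, u (fst z))) ((0, q), snd z)"
      show E: "open ?E" using D by (simp add: open_Times)
      have sE: "z \<in> ?E \<Longrightarrow> fst z \<in> ?D" for z by auto
      have fk: "Ck_on k ?E (\<lambda>z. fst z)" and sk: "Ck_on k ?E (\<lambda>z. snd z)"
        by (rule Ck_on_linear[OF bounded_linear_fst E], rule Ck_on_linear[OF bounded_linear_snd E])
      have gE: "Ck_on k ?E (\<lambda>z. (fst z, u (fst z)))"
        by (rule Ck_on_compose[OF E D _ fk gk]) auto
      show "Ck_on k ?E ?h"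
      proof (rule Ck_on_linear_family[of ?E "\<lambda>z. frechet_derivative h (at (fst z, u (fst z)))", OF E])
        show "linear (frechet_derivative h (at (fst z, u (fst z))))" if "z \<in> ?E" for z
          using has_derivative_linear[OF dh[OF gr[OF sE[OF that]]]] .
        show "Ck_on k ?E (\<lambda>z. frechet_derivative h (at (fst z, u (fst z))) b)" for b
          by (rule Ck_on_compose[OF E Om(1) _ gE Ck_on_SucD(2)[OF Om]]) (use gr sE in blast)
        show "Ck_on k ?E (\<lambda>z. ((0, q), snd z))"
          by (rule Ck_on_Pair[OF E Ck_on_const[OF E] sk])
      qed
      show "continuous_on ?D (\<lambda>x. V x q)"
      proof (intro continuous_at_imp_continuous_on ballI)
        fix x assume "x \<in> ?D"
        then show "continuous (at x) (\<lambda>x. V x q)"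
          using der(2)[of "fst x" "snd x"] by (auto simp: abs_less_iff V_def)
      qed
      show "((t, p), V (t, p) q) \<in> ?E" if "\<bar>t\<bar> < \<delta>" "p \<in> P" for t p
        using that by (auto simp: abs_less_iff)
      show "((\<lambda>t. V (t, p) q) has_vector_derivative ?h ((t, p), V (t, p) q)) (at t)" if "\<bar>t\<bar> < \<delta>" "p \<in> P" for t p
        using der(3)[of t p q] that by (simp add: V_def)
      show "Ck_on k P (\<lambda>p. V (0, p) q)"
        unfolding V_def using Ck_on_SucD(2)[OF P init, of q] by simp
      fix t p w assume tp: "\<bar>t\<bar> < \<delta>" "p \<in> P"
      let ?A = "frechet_derivative h (at ((t, p), u (t, p)))"
      have bl: "bounded_linear ?A" using has_derivative_bounded_linear[OF dh[OF u(2)[OF tp]]] .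
      have "((\<lambda>w. ((0, q), w)) has_derivative (\<lambda>w. (0, w))) (at (V (t, p) q))"
        by (rule has_derivative_Pair[OF has_derivative_const has_derivative_ident])
      from bounded_linear.has_derivative[OF bl this]
      have "((\<lambda>w. ?A ((0, q), w)) has_derivative (\<lambda>w. ?A (0, w))) (at (V (t, p) q))" .
      from frechet_derivative_at[OF this]
      show "norm (frechet_derivative (\<lambda>w. ?h ((t, p), w)) (at (V (t, p) q)) w) \<le> L * norm w"
        using bnd1[OF tp, of w] by (simp add: fun_eq_iff)
    qed
    ultimately show "Ck_on k ?D (\<lambda>x. fst \<xi> *\<^sub>R h (x, u x) + V x (snd \<xi>))"
      unfolding q_def by (intro Ck_on_add[OF D] Ck_on_scaleR[OF D] Ck_on_const[OF D])
  qed
qed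

text \<open>The field is composed with the projection \<open>cp\<close> onto a closed ball, which
  makes it bounded and Lipschitz everywhere; the unknown \<open>w\<close> is the displacement from
  the starting point, so its initial value is 0 for every starting point. For short times and
  starting points near \<open>z0\<close> the solution stays in the ball, where the projection is the
  identity.\<close>

theorem smooth_local_flow:
  fixes F :: "'x::euclidean_space \<Rightarrow> 'x"
  assumes U: "open U" and F: "smooth_on U F" and z0: "z0 \<in> U"
  obtains \<delta> N \<Psi> where "\<delta> > 0" "open N" "z0 \<in> N" "N \<subseteq> U" "smooth_on ({-\<delta><..<\<delta>} \<times> N) \<Psi>"
    "\<And>t z. \<bar>t\<bar> < \<delta> \<Longrightarrow> z \<in> N \<Longrightarrow> \<Psi> (t, z) \<in> U"
    "\<And>z. z \<in> N \<Longrightarrow> \<Psi> (0, z) = z"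
    "\<And>t z. \<bar>t\<bar> < \<delta> \<Longrightarrow> z \<in> N \<Longrightarrow> ((\<lambda>t. \<Psi> (t, z)) has_vector_derivative F (\<Psi> (t, z))) (at t)"
proof -
  obtain r where r: "r > 0" "cball z0 r \<subseteq> U" using U z0 open_contains_cball by blast
  let ?D = "\<lambda>x. Blinfun (frechet_derivative F (at x))"
  have dF: "(F has_derivative frechet_derivative F (at x)) (at x)" if "x \<in> U" for x
    using smooth_on_has_derivative[OF F U that] .
  have Da: "blinfun_apply (?D x) = frechet_derivative F (at x)" if "x \<in> U" for x
    using dF[OF that] by (metis bounded_linear_Blinfun_apply has_derivative_bounded_linear)
  have "bounded (?D ` cball z0 r)"
    by (intro compact_imp_bounded compact_continuous_image compact_cball
        continuous_on_subset[OF continuous_on_Blinfun_derivative[OF U smooth_on_imp_Ck_on[OF F]] r(2)])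
  then obtain L where L: "L > 0" "\<And>x. x \<in> cball z0 r \<Longrightarrow> norm (?D x) \<le> L"
    unfolding bounded_pos by blast
  have Fc: "continuous_on U F" using smooth_on_imp_continuous_on[OF F] .
  have "bounded (F ` cball z0 r)"
    by (intro compact_imp_bounded compact_continuous_image compact_cball continuous_on_subset[OF Fc r(2)])
  then obtain B where B: "B > 0" "\<And>x. x \<in> cball z0 r \<Longrightarrow> norm (F x) \<le> B"
    unfolding bounded_pos by blast
  define cp where "cp = closest_point (cball z0 r)"
  have cp: "cp p \<in> cball z0 r" "p \<in> cball z0 r \<Longrightarrow> cp p = p" for p
    unfolding cp_def using r(1) closest_point_in_set[OF closed_cball, of z0 r p]
    by (simp_all add: closest_point_self)
  have cpl: "norm (cp x - cp y) \<le> norm (x - y)" for x y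
    unfolding cp_def dist_norm[symmetric] using r(1) by (intro closest_point_lipschitz) auto
  have cpc: "continuous_on X cp" for X unfolding cp_def
    using r(1) by (intro continuous_on_closest_point) auto
  have Fl: "norm (F x - F y) \<le> L * norm (x - y)" if "x \<in> cball z0 r" "y \<in> cball z0 r" for x y
  proof (rule differentiable_bound[OF convex_cball _ _ that(1) that(2)])
    show "(F has_derivative blinfun_apply (?D x)) (at x within cball z0 r)" if "x \<in> cball z0 r" for x
    proof -
      have "x \<in> U" using that r(2) by blast
      then show ?thesis using has_derivative_at_withinI[OF dF] Da by metis
    qed
    show "onorm (blinfun_apply (?D x)) \<le> L" if "x \<in> cball z0 r" for x
      using L(2)[OF that] by (simp add: norm_blinfun.rep_eq)
  qed
  \<comment> \<open>The first bound gives the contraction and the quarter required by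
    \<open>Ck_on_ode_solution\<close>; the second keeps the displacement below \<open>r / 2\<close>,
    so that points starting in the ball of radius \<open>r / 2\<close> do not leave the ball of
    radius \<open>r\<close>.\<close>
  define \<delta> where "\<delta> = min (1 / (4 * L)) (r / (4 * B))"
  have \<delta>: "\<delta> > 0" using L(1) B(1) r(1) by (simp add: \<delta>_def)
  have \<delta>L: "\<delta> * L \<le> 1 / 4"
  proof -
    have "\<delta> * L \<le> 1 / (4 * L) * L" using L(1) by (intro mult_right_mono) (auto simp: \<delta>_def)
    then show ?thesis using L(1) by simp
  qed
  have \<delta>B: "B * \<delta> < r / 2"
  proof -
    have "B * \<delta> \<le> B * (r / (4 * B))" using B(1) by (intro mult_left_mono) (auto simp: \<delta>_def)
    also have "\<dots> = r / 4" using B(1) by simp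
    finally show ?thesis using r(1) by simp
  qed
  define h where "h = (\<lambda>(t::real) p y. F (cp (p + y)))"
  have hc: "continuous_on UNIV (\<lambda>(t, p, y). h t p y)"
    unfolding h_def case_prod_beta
    by (rule continuous_on_compose2[OF Fc continuous_on_compose2[OF cpc[of UNIV]]])
      (use cp(1) r(2) in \<open>auto intro!: continuous_intros\<close>)
  have hb: "norm (h t p y) \<le> B" for t p y unfolding h_def by (rule B(2)[OF cp(1)])
  have hl: "norm (h t p y - h t p y') \<le> L * norm (y - y')" for t p y y'
  proof -
    have "norm (h t p y - h t p y') \<le> L * norm (cp (p + y) - cp (p + y'))"
      unfolding h_def by (rule Fl[OF cp(1) cp(1)])
    also have "\<dots> \<le> L * norm ((p + y) - (p + y'))" using L(1) by (intro mult_left_mono[OF cpl]) simp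
    finally show ?thesis by simp
  qed
  have "\<delta> * L < 1" "0 \<le> L" using \<delta>L L(1) by auto
  then obtain w where w: "continuous_on UNIV (\<lambda>(t, p). w t p)"
    "\<And>t p. \<bar>t\<bar> < \<delta> \<Longrightarrow> ((\<lambda>t. w t p) has_vector_derivative h t p (w t p)) (at t)" "\<And>p. w 0 p = 0"
    using parametric_picard[OF \<delta> _ _ hc hb hl] by blast
  have wb: "norm (w t p) < r / 2" if t: "\<bar>t\<bar> < \<delta>" for t p
  proof -
    have "norm (w t p - w 0 p) \<le> B * norm (t - 0)"
    proof (rule differentiable_bound[of "{-\<delta><..<\<delta>}" "\<lambda>t. w t p" "\<lambda>t x. x *\<^sub>R h t p (w t p)"])
      show "((\<lambda>t. w t p) has_derivative (\<lambda>x. x *\<^sub>R h t p (w t p))) (at t within {-\<delta><..<\<delta>})" if "t \<in> {-\<delta><..<\<delta>}" for t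
        using that by (intro has_derivative_at_withinI[OF w(2)[unfolded has_vector_derivative_def]]) (auto simp: abs_less_iff)
      show "onorm (\<lambda>x. x *\<^sub>R h t p (w t p)) \<le> B" for t
        using mult_right_mono[OF hb abs_ge_zero] by (intro onorm_le) (simp add: mult.commute)
    qed (use t \<delta> in \<open>auto simp: abs_less_iff\<close>)
    also have "\<dots> \<le> B * \<delta>" using t B(1) by (intro mult_left_mono) auto
    finally show ?thesis using \<delta>B by (simp add: w(3))
  qed
  define \<Psi> where "\<Psi> = (\<lambda>(t, z). z + w t z)"
  define N where "N = ball z0 (r / 2)"
  have N: "open N" "z0 \<in> N" "N \<subseteq> U" using r by (auto simp: N_def)
  have inb: "\<Psi> (t, z) \<in> ball z0 r" if "\<bar>t\<bar> < \<delta>" "z \<in> N" for t z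
  proof -
    have "norm (\<Psi> (t, z) - z0) \<le> norm (z - z0) + norm (w t z)"
      using norm_triangle_ineq[of "z - z0" "w t z"] by (simp add: \<Psi>_def algebra_simps)
    then show ?thesis using wb[OF that(1), of z] that(2) by (simp add: N_def dist_norm norm_minus_commute)
  qed
  have ode: "((\<lambda>t. \<Psi> (t, z)) has_vector_derivative F (\<Psi> (t, z))) (at t)" if "\<bar>t\<bar> < \<delta>" "z \<in> N" for t z
  proof -
    have "((\<lambda>t. z + w t z) has_vector_derivative 0 + h t z (w t z)) (at t)"
      by (rule has_vector_derivative_add[OF has_vector_derivative_const w(2)[OF that(1)]])
    moreover have "h t z (w t z) = F (\<Psi> (t, z))"
      using cp(2)[of "\<Psi> (t, z)"] inb[OF that] by (simp add: h_def \<Psi>_def)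
    ultimately show ?thesis by (simp add: \<Psi>_def)
  qed
  have \<Psi>c: "continuous_on X \<Psi>" for X
    unfolding \<Psi>_def case_prod_beta using continuous_on_subset[OF w(1)[unfolded case_prod_beta] subset_UNIV]
    by (intro continuous_on_add continuous_on_snd continuous_on_id) auto
  have \<Psi>0: "\<Psi> (0, z) = z" for z by (simp add: \<Psi>_def w(3))
  \<comment> \<open>Regularity is derived from the unprojected field on the open ball, which
    contains the solution; the projected field is in general only Lipschitz.\<close>
  have "Ck_on k ({-\<delta><..<\<delta>} \<times> N) \<Psi>" for k
  proof (rule Ck_on_ode_solution[OF _ \<delta>L N(1), of "UNIV \<times> ball z0 r" _ "\<lambda>z. F (snd z)"])
    show "0 \<le> L" using L(1) by simp
    show op: "open (UNIV \<times> ball z0 r)" by (simp add: open_Times)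
    show "Ck_on k (UNIV \<times> ball z0 r) (\<lambda>z. F (snd z))"
      by (rule Ck_on_compose[OF op U _ Ck_on_linear[OF bounded_linear_snd op] smooth_on_imp_Ck_on[OF F]])
        (use r(2) in auto)
    show "continuous_on ({-\<delta><..<\<delta>} \<times> N) \<Psi>" by (rule \<Psi>c)
    show "((t, p), \<Psi> (t, p)) \<in> UNIV \<times> ball z0 r" if "\<bar>t\<bar> < \<delta>" "p \<in> N" for t p
      using inb[OF that] by simp
    show "((\<lambda>t. \<Psi> (t, p)) has_vector_derivative F (snd ((t, p), \<Psi> (t, p)))) (at t)" if "\<bar>t\<bar> < \<delta>" "p \<in> N" for t p
      using ode[OF that] by simp
    show "Ck_on k N (\<lambda>p. \<Psi> (0, p))" unfolding \<Psi>0 by (rule Ck_on_ident[OF N(1)])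
    show "norm (frechet_derivative (\<lambda>w. F (snd ((t, p), w))) (at (\<Psi> (t, p))) w) \<le> L * norm w"
      if "\<bar>t\<bar> < \<delta>" "p \<in> N" for t p w
    proof -
      have b: "\<Psi> (t, p) \<in> cball z0 r" using inb[OF that] by simp
      then have "\<Psi> (t, p) \<in> U" using r(2) by blast
      then show ?thesis
        using norm_blinfun[of "?D (\<Psi> (t, p))" w] L(2)[OF b] Da mult_right_mono[OF L(2)[OF b], of "norm w"] by simp
    qed
  qed
  then have "smooth_on ({-\<delta><..<\<delta>} \<times> N) \<Psi>" by (simp add: smooth_on_def)
  moreover have "\<Psi> (t, z) \<in> U" if "\<bar>t\<bar> < \<delta>" "z \<in> N" for t z
    using inb[OF that] r(2) by auto
  ultimately show thesis using that[OF \<delta> N] \<Psi>0 ode by blast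
qed

subsection \<open>Charts\<close>

text \<open>The change of induced coordinates on the full tangent bundle. It is an explicit formula
  including zero vectors, whereas the transition of slit charts passes through chart inverses; the
  two agree for nonzero vectors.\<close>

definition tangent_transition :: "('a, 'e::real_normed_vector) chart \<Rightarrow> ('a, 'e) chart \<Rightarrow> 'e \<times> 'e \<Rightarrow> 'e \<times> 'e" where
  "tangent_transition \<phi> \<psi> z = (transition \<phi> \<psi> (fst z), frechet_derivative (transition \<phi> \<psi>) (at (fst z)) (snd z))"

lemma smooth_map_open_atlas:
  fixes A :: "('a, 'e::euclidean_space) chart set"
  shows "smooth_map (open_atlas W) A F \<longleftrightarrow> F ` W \<subseteq> atlas_carrier A \<and>
    (\<forall>\<psi>\<in>A. open {p \<in> W. F p \<in> chart_dom \<psi>} \<and> smooth_on {p \<in> W. F p \<in> chart_dom \<psi>} (\<lambda>p. chart_map \<psi> (F p)))"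
proof -
  have "chart_inv (Chart W id) x = x" if "x \<in> W" for x
    unfolding chart_inv_def using inv_into_f_f[of id W x] that by simp
  then have "smooth_on {p \<in> W. F p \<in> chart_dom \<psi>} (chart_map \<psi> \<circ> F \<circ> chart_inv (Chart W id)) \<longleftrightarrow>
      smooth_on {p \<in> W. F p \<in> chart_dom \<psi>} (\<lambda>p. chart_map \<psi> (F p))" for \<psi> :: "('a, 'e) chart"
    by (intro smooth_on_cong) auto
  then show ?thesis
    by (simp add: smooth_map_def open_atlas_def atlas_carrier_def)
qed

context
  fixes A :: "('a, 'e::euclidean_space) chart set"
  assumes A: "smooth_atlas A"
begin

lemma chart_inj: "\<phi> \<in> A \<Longrightarrow> inj_on (chart_map \<phi>) (chart_dom \<phi>)"
  and chart_open: "\<phi> \<in> A \<Longrightarrow> open (chart_map \<phi> ` chart_dom \<phi>)"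
  and chart_inter_open: "\<phi> \<in> A \<Longrightarrow> \<psi> \<in> A \<Longrightarrow> open (chart_map \<phi> ` (chart_dom \<phi> \<inter> chart_dom \<psi>))"
  and transition_smooth: "\<phi> \<in> A \<Longrightarrow> \<psi> \<in> A \<Longrightarrow>
    smooth_on (chart_map \<phi> ` (chart_dom \<phi> \<inter> chart_dom \<psi>)) (transition \<phi> \<psi>)"
  using A by (auto simp: smooth_atlas_def)

lemma chart_inv_map: "\<phi> \<in> A \<Longrightarrow> p \<in> chart_dom \<phi> \<Longrightarrow> chart_inv \<phi> (chart_map \<phi> p) = p"
  unfolding chart_inv_def by (rule inv_into_f_f[OF chart_inj])

lemma chart_inv_in: "x \<in> chart_map \<phi> ` chart_dom \<phi> \<Longrightarrow> chart_inv \<phi> x \<in> chart_dom \<phi>"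
  and chart_map_inv: "x \<in> chart_map \<phi> ` chart_dom \<phi> \<Longrightarrow> chart_map \<phi> (chart_inv \<phi> x) = x"
  unfolding chart_inv_def by (rule inv_into_into, assumption) (rule f_inv_into_f)

lemma transition_map: "\<phi> \<in> A \<Longrightarrow> p \<in> chart_dom \<phi> \<Longrightarrow> transition \<phi> \<psi> (chart_map \<phi> p) = chart_map \<psi> p"
  by (simp add: transition_def chart_inv_map)

lemma transition_has_derivative:
  assumes "\<phi> \<in> A" "\<psi> \<in> A" "p \<in> chart_dom \<phi>" "p \<in> chart_dom \<psi>"
  shows "(transition \<phi> \<psi> has_derivative frechet_derivative (transition \<phi> \<psi>) (at (chart_map \<phi> p))) (at (chart_map \<phi> p))"
  by (rule smooth_on_has_derivative[OF transition_smooth[OF assms(1,2)] chart_inter_open[OF assms(1,2)]])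
    (use assms in blast)

lemma transition_derivative_linear:
  assumes "\<phi> \<in> A" "\<psi> \<in> A" "p \<in> chart_dom \<phi>" "p \<in> chart_dom \<psi>"
  shows "linear (frechet_derivative (transition \<phi> \<psi>) (at (chart_map \<phi> p)))"
  using has_derivative_linear[OF transition_has_derivative[OF assms]] .

lemma transition_derivative_id:
  assumes "\<phi> \<in> A" "p \<in> chart_dom \<phi>"
  shows "frechet_derivative (transition \<phi> \<phi>) (at (chart_map \<phi> p)) y = y"
proof -
  have "(transition \<phi> \<phi> has_derivative (\<lambda>y. y)) (at (chart_map \<phi> p))"
  proof (rule has_derivative_transform_within_open[OF has_derivative_ident chart_open[OF assms(1)]])
    show "chart_map \<phi> p \<in> chart_map \<phi> ` chart_dom \<phi>" using assms by blast
    show "x = transition \<phi> \<phi> x" if "x \<in> chart_map \<phi> ` chart_dom \<phi>" for x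
      using chart_map_inv[OF that] by (simp add: transition_def)
  qed
  from fun_cong[OF frechet_derivative_at[OF this], of y] show ?thesis by simp
qed

lemma transition_derivative_cocycle:
  assumes "\<phi> \<in> A" "\<psi> \<in> A" "\<theta> \<in> A" "p \<in> chart_dom \<phi>" "p \<in> chart_dom \<psi>" "p \<in> chart_dom \<theta>"
  shows "frechet_derivative (transition \<psi> \<theta>) (at (chart_map \<psi> p)) (frechet_derivative (transition \<phi> \<psi>) (at (chart_map \<phi> p)) y)
    = frechet_derivative (transition \<phi> \<theta>) (at (chart_map \<phi> p)) y"
proof -
  have "((\<lambda>x. transition \<psi> \<theta> (transition \<phi> \<psi> x)) has_derivative
      (\<lambda>y. frechet_derivative (transition \<psi> \<theta>) (at (chart_map \<psi> p)) (frechet_derivative (transition \<phi> \<psi>) (at (chart_map \<phi> p)) y)))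
      (at (chart_map \<phi> p))"
    using has_derivative_compose[OF transition_has_derivative[OF assms(1,2,4,5)], of "transition \<psi> \<theta>"]
      transition_has_derivative[OF assms(2,3,5,6)] by (simp add: transition_map assms)
  then have "(transition \<phi> \<theta> has_derivative
      (\<lambda>y. frechet_derivative (transition \<psi> \<theta>) (at (chart_map \<psi> p)) (frechet_derivative (transition \<phi> \<psi>) (at (chart_map \<phi> p)) y)))
      (at (chart_map \<phi> p))"
  proof (rule has_derivative_transform_within_open[OF _ chart_inter_open[OF assms(1,2)]])
    show "chart_map \<phi> p \<in> chart_map \<phi> ` (chart_dom \<phi> \<inter> chart_dom \<psi>)" using assms by blast
    show "transition \<psi> \<theta> (transition \<phi> \<psi> x) = transition \<phi> \<theta> x" if "x \<in> chart_map \<phi> ` (chart_dom \<phi> \<inter> chart_dom \<psi>)" for x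
      using that by (auto simp: transition_map assms)
  qed
  from fun_cong[OF frechet_derivative_at[OF this], of y] show ?thesis .
qed

section \<open>Tangent vectors and their components\<close>

lemma coord_vector_apply:
  assumes "\<psi> \<in> A" "p \<in> chart_dom \<psi>"
  shows "coord_vector A \<phi> p y \<psi> = frechet_derivative (transition \<phi> \<psi>) (at (chart_map \<phi> p)) y"
  using assms by (simp add: coord_vector_def on_charts_def)

lemma coord_vector_same: "\<phi> \<in> A \<Longrightarrow> p \<in> chart_dom \<phi> \<Longrightarrow> coord_vector A \<phi> p y \<phi> = y"
  by (simp add: coord_vector_apply transition_derivative_id)

lemma coord_vector_tangent: "\<phi> \<in> A \<Longrightarrow> p \<in> chart_dom \<phi> \<Longrightarrow> coord_vector A \<phi> p y \<in> tangent_space A p"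
  unfolding tangent_space_def
  by (auto simp: coord_vector_apply transition_derivative_cocycle) (auto simp: coord_vector_def on_charts_def)

lemma tangent_space_transform:
  "v \<in> tangent_space A p \<Longrightarrow> \<phi> \<in> A \<Longrightarrow> \<psi> \<in> A \<Longrightarrow> p \<in> chart_dom \<phi> \<Longrightarrow> p \<in> chart_dom \<psi> \<Longrightarrow>
    v \<psi> = frechet_derivative (transition \<phi> \<psi>) (at (chart_map \<phi> p)) (v \<phi>)"
  unfolding tangent_space_def by blast

lemma tangent_space_outside: "v \<in> tangent_space A p \<Longrightarrow> \<not> (\<phi> \<in> A \<and> p \<in> chart_dom \<phi>) \<Longrightarrow> v \<phi> = 0"
  unfolding tangent_space_def by blast

text \<open>One component determines the others by the transformation law, and all components
  outside the charts at \<open>p\<close> are 0 by convention.\<close>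

lemma tangent_space_eqI:
  assumes "v \<in> tangent_space A p" "w \<in> tangent_space A p" "\<phi> \<in> A" "p \<in> chart_dom \<phi>" "v \<phi> = w \<phi>"
  shows "v = w"
proof
  fix \<psi> show "v \<psi> = w \<psi>"
    using tangent_space_transform[OF assms(1,3), of \<psi>] tangent_space_transform[OF assms(2,3), of \<psi>]
      tangent_space_outside[OF assms(1), of \<psi>] tangent_space_outside[OF assms(2), of \<psi>] assms(4,5) by metis
qed

lemma tangent_space_coord:
  assumes "v \<in> tangent_space A p" "\<phi> \<in> A" "p \<in> chart_dom \<phi>"
  shows "coord_vector A \<phi> p (v \<phi>) = v"
  by (rule tangent_space_eqI[OF coord_vector_tangent[OF assms(2,3)] assms coord_vector_same[OF assms(2,3)]])

lemma tangent_space_subspace: "subspace (tangent_space A p)"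
  unfolding subspace_def
proof (intro conjI ballI allI)
  show "0 \<in> tangent_space A p"
    unfolding tangent_space_def using transition_derivative_linear by (auto simp: linear_0)
  show "v + w \<in> tangent_space A p" if "v \<in> tangent_space A p" "w \<in> tangent_space A p" for v w
    unfolding tangent_space_def
  proof (intro CollectI conjI ballI allI impI)
    fix \<phi> \<psi> assume *: "\<phi> \<in> A" "\<psi> \<in> A" "p \<in> chart_dom \<phi>" "p \<in> chart_dom \<psi>"
    show "(v + w) \<psi> = frechet_derivative (transition \<phi> \<psi>) (at (chart_map \<phi> p)) ((v + w) \<phi>)"
      using tangent_space_transform[OF that(1) *] tangent_space_transform[OF that(2) *]
      by (simp only: plus_fun_apply linear_add[OF transition_derivative_linear[OF *]])
  next
    fix \<phi> assume "\<not> (\<phi> \<in> A \<and> p \<in> chart_dom \<phi>)"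
    then show "(v + w) \<phi> = 0"
      using tangent_space_outside[OF that(1)] tangent_space_outside[OF that(2)] by simp
  qed
  show "r *\<^sub>R v \<in> tangent_space A p" if "v \<in> tangent_space A p" for r v
    unfolding tangent_space_def
  proof (intro CollectI conjI ballI allI impI)
    fix \<phi> \<psi> assume *: "\<phi> \<in> A" "\<psi> \<in> A" "p \<in> chart_dom \<phi>" "p \<in> chart_dom \<psi>"
    show "(r *\<^sub>R v) \<psi> = frechet_derivative (transition \<phi> \<psi>) (at (chart_map \<phi> p)) ((r *\<^sub>R v) \<phi>)"
      using tangent_space_transform[OF that(1) *]
      by (simp only: scaleR_fun_def linear_scale[OF transition_derivative_linear[OF *]])
  next
    fix \<phi> assume "\<not> (\<phi> \<in> A \<and> p \<in> chart_dom \<phi>)"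
    then show "(r *\<^sub>R v) \<phi> = 0"
      using tangent_space_outside[OF that(1)] by (simp add: scaleR_fun_def)
  qed
qed

subsection \<open>Smooth maps from open sets\<close>

text \<open>The definition of a smooth map asks for every chart of the atlas. One chart near each
  point is enough, since every other expression arises from it by a smooth transition.\<close>

lemma smooth_map_open_atlasI:
  fixes F :: "'x::euclidean_space \<Rightarrow> 'a"
  assumes W: "open W"
    and loc: "\<And>p. p \<in> W \<Longrightarrow> \<exists>N \<phi>. open N \<and> p \<in> N \<and> N \<subseteq> W \<and> \<phi> \<in> A \<and> F ` N \<subseteq> chart_dom \<phi> \<and>
      smooth_on N (\<lambda>p. chart_map \<phi> (F p))"
  shows "smooth_map (open_atlas W) A F"
  unfolding smooth_map_open_atlas
proof (intro conjI ballI)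
  show "F ` W \<subseteq> atlas_carrier A"
    using loc unfolding atlas_carrier_def by blast
  fix \<psi> assume \<psi>: "\<psi> \<in> A"
  let ?D = "{p \<in> W. F p \<in> chart_dom \<psi>}"
  have *: "\<exists>N. open N \<and> p \<in> N \<and> N \<subseteq> ?D \<and> smooth_on N (\<lambda>p. chart_map \<psi> (F p))" if p: "p \<in> ?D" for p
  proof -
    obtain N \<phi> where N: "open N" "p \<in> N" "N \<subseteq> W" "\<phi> \<in> A" "F ` N \<subseteq> chart_dom \<phi>"
      "smooth_on N (\<lambda>p. chart_map \<phi> (F p))"
      using loc[of p] p by blast
    let ?V = "chart_map \<phi> ` (chart_dom \<phi> \<inter> chart_dom \<psi>)"
    define N' where "N' = N \<inter> (\<lambda>p. chart_map \<phi> (F p)) -` ?V"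
    have N': "open N'" unfolding N'_def
      using smooth_on_imp_continuous_on[OF N(6)] N(1) chart_inter_open[OF N(4) \<psi>]
      by (simp add: continuous_open_preimage)
    have mem: "q \<in> N' \<longleftrightarrow> q \<in> N \<and> F q \<in> chart_dom \<psi>" for q
    proof -
      have "F q \<in> chart_dom \<psi>" if q: "q \<in> N" "chart_map \<phi> (F q) \<in> ?V"
      proof -
        obtain q' where q': "chart_map \<phi> (F q) = chart_map \<phi> q'" "q' \<in> chart_dom \<phi>" "q' \<in> chart_dom \<psi>"
          using q(2) by blast
        have "F q = q'" using inj_onD[OF chart_inj[OF N(4)] q'(1)] q'(2) q(1) N(5) by blast
        then show ?thesis using q' by simp
      qed
      then show ?thesis using N(5) by (auto simp: N'_def)
    qed
    have "smooth_on N' (\<lambda>q. transition \<phi> \<psi> (chart_map \<phi> (F q)))"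
      by (rule smooth_on_compose[OF N' chart_inter_open[OF N(4) \<psi>] _ smooth_on_subset[OF N(6,1) N'] transition_smooth[OF N(4) \<psi>]])
        (auto simp: N'_def)
    moreover have "transition \<phi> \<psi> (chart_map \<phi> (F q)) = chart_map \<psi> (F q)" if "q \<in> N'" for q
      using that N(5) by (intro transition_map[OF N(4)]) (auto simp: mem)
    ultimately have "smooth_on N' (\<lambda>q. chart_map \<psi> (F q))"
      using smooth_on_cong by (metis (no_types, lifting))
    moreover have "p \<in> N'" "N' \<subseteq> ?D" using p N(2,3) by (auto simp: mem)
    ultimately show ?thesis using N' by blast
  qed
  show D: "open ?D"
    by (subst open_subopen) (use * in blast)
  show "smooth_on ?D (\<lambda>p. chart_map \<psi> (F p))"
    by (rule smooth_on_local[OF D *])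
qed

lemma smooth_map_open_atlas_restrict:
  fixes F :: "'x::euclidean_space \<Rightarrow> 'a"
  assumes "smooth_map (open_atlas W) A F" "open W'" "W' \<subseteq> W"
  shows "smooth_map (open_atlas W') A F"
proof (rule smooth_map_open_atlasI[OF assms(2)])
  fix p assume p: "p \<in> W'"
  then obtain \<phi> where \<phi>: "\<phi> \<in> A" "F p \<in> chart_dom \<phi>"
    using assms(1,3) unfolding smooth_map_open_atlas atlas_carrier_def by blast
  have o: "open {p \<in> W. F p \<in> chart_dom \<phi>}" "smooth_on {p \<in> W. F p \<in> chart_dom \<phi>} (\<lambda>p. chart_map \<phi> (F p))"
    using assms(1) \<phi>(1) by (auto simp: smooth_map_open_atlas)
  let ?N = "{p \<in> W. F p \<in> chart_dom \<phi>} \<inter> W'"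
  have "smooth_on ?N (\<lambda>p. chart_map \<phi> (F p))"
    by (rule smooth_on_subset[OF o(2,1)]) (use o(1) assms(2) in auto)
  then show "\<exists>N \<phi>. open N \<and> p \<in> N \<and> N \<subseteq> W' \<and> \<phi> \<in> A \<and> F ` N \<subseteq> chart_dom \<phi> \<and> smooth_on N (\<lambda>p. chart_map \<phi> (F p))"
    using o(1) assms(2,3) p \<phi> by (intro exI[of _ ?N] exI[of _ \<phi>]) (auto intro: open_Int)
qed

lemma smooth_map_open_atlas_compose:
  fixes F :: "'x::euclidean_space \<Rightarrow> 'a" and g :: "'z::euclidean_space \<Rightarrow> 'x"
  assumes F: "smooth_map (open_atlas W) A F" and Z: "open Z" and g: "smooth_on Z g" "g ` Z \<subseteq> W"
  shows "smooth_map (open_atlas Z) A (\<lambda>z. F (g z))"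
proof (rule smooth_map_open_atlasI[OF Z])
  fix z assume z: "z \<in> Z"
  then obtain \<phi> where \<phi>: "\<phi> \<in> A" "F (g z) \<in> chart_dom \<phi>"
    using F g(2) unfolding smooth_map_open_atlas atlas_carrier_def by blast
  let ?D = "{p \<in> W. F p \<in> chart_dom \<phi>}"
  have o: "open ?D" "smooth_on ?D (\<lambda>p. chart_map \<phi> (F p))"
    using F \<phi>(1) by (auto simp: smooth_map_open_atlas)
  define N where "N = Z \<inter> g -` ?D"
  have N: "open N" unfolding N_def
    by (rule continuous_open_preimage[OF smooth_on_imp_continuous_on[OF g(1)] Z o(1)])
  have "smooth_on N (\<lambda>z. chart_map \<phi> (F (g z)))"
    by (rule smooth_on_compose[OF N o(1) _ smooth_on_subset[OF g(1) Z N] o(2)]) (auto simp: N_def)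
  moreover have "z \<in> N" "N \<subseteq> Z" "(\<lambda>z. F (g z)) ` N \<subseteq> chart_dom \<phi>"
    using z \<phi>(2) g(2) by (auto simp: N_def)
  ultimately show "\<exists>N \<phi>. open N \<and> z \<in> N \<and> N \<subseteq> Z \<and> \<phi> \<in> A \<and> (\<lambda>z. F (g z)) ` N \<subseteq> chart_dom \<phi> \<and>
      smooth_on N (\<lambda>z. chart_map \<phi> (F (g z)))"
    using N \<phi>(1) by blast
qed

subsection \<open>The slit tangent bundle\<close>

lemma slit_chart_dom: "chart_dom (slit_chart A \<phi>) = {u \<in> slit_bundle A. fst u \<in> chart_dom \<phi>}"
  by (auto simp: slit_chart_def restrict_chart_def tangent_chart_def slit_bundle_def)

lemma slit_chart_map: "chart_map (slit_chart A \<phi>) u = (chart_map \<phi> (fst u), snd u \<phi>)"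
  by (simp add: slit_chart_def restrict_chart_def tangent_chart_def)

lemma slit_atlas_eq: "slit_atlas A = slit_chart A ` A"
  by (auto simp: slit_atlas_def restrict_atlas_def tangent_atlas_def slit_chart_def)

lemma slit_bundleD:
  assumes "u \<in> slit_bundle A"
  shows "snd u \<in> tangent_space A (fst u)" "snd u \<noteq> 0" "fst u \<in> atlas_carrier A"
  using assms by (auto simp: slit_bundle_def tangent_bundle_def)

lemma slit_bundleI:
  assumes "v \<in> tangent_space A p" "\<phi> \<in> A" "p \<in> chart_dom \<phi>" "v \<phi> \<noteq> 0"
  shows "(p, v) \<in> slit_bundle A"
  using assms by (auto simp: slit_bundle_def tangent_bundle_def atlas_carrier_def)

lemma slit_component_nonzero:
  assumes "u \<in> slit_bundle A" "\<phi> \<in> A" "fst u \<in> chart_dom \<phi>"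
  shows "snd u \<phi> \<noteq> 0"
proof
  assume "snd u \<phi> = 0"
  then have "snd u = 0"
    using tangent_space_eqI[OF slit_bundleD(1)[OF assms(1)] subspace_0[OF tangent_space_subspace] assms(2,3)] by simp
  then show False using slit_bundleD(2)[OF assms(1)] by simp
qed

lemma slit_carrier: "atlas_carrier (slit_atlas A) = slit_bundle A"
  by (auto simp: atlas_carrier_def slit_atlas_eq slit_chart_dom slit_bundle_def tangent_bundle_def)

lemma coord_vector_slit:
  assumes "\<phi> \<in> A" "p \<in> chart_dom \<phi>" "y \<noteq> 0"
  shows "(p, coord_vector A \<phi> p y) \<in> chart_dom (slit_chart A \<phi>)"
    "chart_map (slit_chart A \<phi>) (p, coord_vector A \<phi> p y) = (chart_map \<phi> p, y)"
  using slit_bundleI[OF coord_vector_tangent[OF assms(1,2)] assms(1,2)] coord_vector_same[OF assms(1,2)] assms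
  by (auto simp: slit_chart_dom slit_chart_map)

lemma slit_chart_image:
  assumes "\<phi> \<in> A"
  shows "chart_map (slit_chart A \<phi>) ` chart_dom (slit_chart A \<phi>) = chart_map \<phi> ` chart_dom \<phi> \<times> (UNIV - {0 :: 'e})"
proof
  show "chart_map (slit_chart A \<phi>) ` chart_dom (slit_chart A \<phi>) \<subseteq> chart_map \<phi> ` chart_dom \<phi> \<times> (UNIV - {0 :: 'e})"
    using slit_component_nonzero[OF _ assms] by (auto simp: slit_chart_dom slit_chart_map)
  show "chart_map \<phi> ` chart_dom \<phi> \<times> (UNIV - {0 :: 'e}) \<subseteq> chart_map (slit_chart A \<phi>) ` chart_dom (slit_chart A \<phi>)"
  proof
    fix z assume "z \<in> chart_map \<phi> ` chart_dom \<phi> \<times> (UNIV - {0 :: 'e})"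
    then obtain p y where "p \<in> chart_dom \<phi>" "y \<noteq> 0" "z = (chart_map \<phi> p, y)" by auto
    then show "z \<in> chart_map (slit_chart A \<phi>) ` chart_dom (slit_chart A \<phi>)"
      using coord_vector_slit[OF assms] by (metis image_eqI)
  qed
qed

lemma slit_chart_inj:
  assumes "\<phi> \<in> A"
  shows "inj_on (chart_map (slit_chart A \<phi>)) (chart_dom (slit_chart A \<phi>))"
proof (rule inj_onI)
  fix u w assume u: "u \<in> chart_dom (slit_chart A \<phi>)" and w: "w \<in> chart_dom (slit_chart A \<phi>)"
    and eq: "chart_map (slit_chart A \<phi>) u = chart_map (slit_chart A \<phi>) w"
  have "fst u = fst w"
    using eq u w chart_inj[OF assms] by (auto simp: slit_chart_map slit_chart_dom inj_on_def)
  moreover have "snd u = snd w"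
  proof (rule tangent_space_eqI[OF _ _ assms])
    show "snd u \<in> tangent_space A (fst w)" "snd w \<in> tangent_space A (fst w)"
      using slit_bundleD(1)[of u] slit_bundleD(1)[of w] u w \<open>fst u = fst w\<close> by (auto simp: slit_chart_dom)
  qed (use eq w in \<open>auto simp: slit_chart_map slit_chart_dom\<close>)
  ultimately show "u = w" by (simp add: prod_eq_iff)
qed

lemma slit_chart_inv:
  assumes "\<phi> \<in> A" "p \<in> chart_dom \<phi>" "y \<noteq> 0"
  shows "chart_inv (slit_chart A \<phi>) (chart_map \<phi> p, y) = (p, coord_vector A \<phi> p y)"
  using inv_into_f_f[OF slit_chart_inj[OF assms(1)] coord_vector_slit(1)[OF assms]]
  by (simp add: chart_inv_def coord_vector_slit(2)[OF assms])

lemma slit_chart_inv_map: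
  assumes "\<phi> \<in> A" "u \<in> slit_bundle A" "fst u \<in> chart_dom \<phi>"
  shows "chart_inv (slit_chart A \<phi>) (chart_map \<phi> (fst u), snd u \<phi>) = u"
  using slit_chart_inv[OF assms(1,3) slit_component_nonzero[OF assms(2,1,3)]]
    tangent_space_coord[OF slit_bundleD(1)[OF assms(2)] assms(1,3)] by simp

lemma slit_image_open: "\<phi> \<in> A \<Longrightarrow> open (chart_map \<phi> ` chart_dom \<phi> \<times> (UNIV - {0 :: 'e}))"
  by (intro open_Times chart_open open_Diff) auto

lemma tangent_transition_smooth:
  assumes "\<phi> \<in> A" "\<psi> \<in> A"
  shows "smooth_on (chart_map \<phi> ` (chart_dom \<phi> \<inter> chart_dom \<psi>) \<times> UNIV) (tangent_transition \<phi> \<psi>)"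
proof -
  let ?V = "chart_map \<phi> ` (chart_dom \<phi> \<inter> chart_dom \<psi>)"
  have V: "open ?V" by (rule chart_inter_open[OF assms])
  have W: "open (?V \<times> (UNIV :: 'e set))" using V by (simp add: open_Times)
  have f: "smooth_on (?V \<times> (UNIV :: 'e set)) (\<lambda>z. fst z)" and s: "smooth_on (?V \<times> (UNIV :: 'e set)) (\<lambda>z. snd z)"
    by (rule smooth_on_linear[OF bounded_linear_fst W], rule smooth_on_linear[OF bounded_linear_snd W])
  show ?thesis
    unfolding tangent_transition_def
    by (rule smooth_on_Pair[OF W smooth_on_compose[OF W V _ f transition_smooth[OF assms]]
        smooth_on_derivative2[OF transition_smooth[OF assms] V W f s]]) auto
qed

lemma slit_transition:
  assumes "\<phi> \<in> A" "\<psi> \<in> A" "x \<in> chart_map \<phi> ` (chart_dom \<phi> \<inter> chart_dom \<psi>)" "y \<noteq> 0"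
  shows "transition (slit_chart A \<phi>) (slit_chart A \<psi>) (x, y) = tangent_transition \<phi> \<psi> (x, y)"
proof -
  obtain p where p: "x = chart_map \<phi> p" "p \<in> chart_dom \<phi>" "p \<in> chart_dom \<psi>" using assms(3) by blast
  show ?thesis
    using assms p by (simp add: transition_def[of "slit_chart _ _"] slit_chart_inv slit_chart_map tangent_transition_def
        transition_map coord_vector_apply)
qed

lemma slit_transition_derivative:
  assumes "\<phi> \<in> A" "\<psi> \<in> A" "p \<in> chart_dom \<phi>" "p \<in> chart_dom \<psi>" "y \<noteq> 0"
  shows "(tangent_transition \<phi> \<psi> has_derivative
      frechet_derivative (transition (slit_chart A \<phi>) (slit_chart A \<psi>)) (at (chart_map \<phi> p, y))) (at (chart_map \<phi> p, y))"
proof -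
  let ?V = "chart_map \<phi> ` (chart_dom \<phi> \<inter> chart_dom \<psi>)"
  have W: "open (?V \<times> (UNIV :: 'e set))" using chart_inter_open[OF assms(1,2)] by (simp add: open_Times)
  have W': "open (?V \<times> (UNIV - {0 :: 'e}))" using chart_inter_open[OF assms(1,2)] by (intro open_Times open_Diff) auto
  have "(tangent_transition \<phi> \<psi> has_derivative frechet_derivative (tangent_transition \<phi> \<psi>) (at (chart_map \<phi> p, y))) (at (chart_map \<phi> p, y))"
    by (rule smooth_on_has_derivative[OF tangent_transition_smooth[OF assms(1,2)] W]) (use assms in auto)
  moreover from this have "(transition (slit_chart A \<phi>) (slit_chart A \<psi>) has_derivative
      frechet_derivative (tangent_transition \<phi> \<psi>) (at (chart_map \<phi> p, y))) (at (chart_map \<phi> p, y))"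
  proof (rule has_derivative_transform_within_open[OF _ W'])
    show "(chart_map \<phi> p, y) \<in> ?V \<times> (UNIV - {0})" using assms by auto
    show "tangent_transition \<phi> \<psi> z = transition (slit_chart A \<phi>) (slit_chart A \<psi>) z" if "z \<in> ?V \<times> (UNIV - {0})" for z
      using slit_transition[OF assms(1,2), of "fst z" "snd z"] that by (simp add: mem_Times_iff)
  qed
  ultimately show ?thesis using frechet_derivative_at by metis
qed

end


subsection \<open>Curves\<close>

lemma smooth_on_real_has_vector_derivative:
  fixes x :: "real \<Rightarrow> 'b::real_normed_vector"
  assumes "smooth_on D x" "open D" "t \<in> D"
  shows "(x has_vector_derivative vector_derivative x (at t)) (at t)"
  using smooth_on_has_derivative[OF assms] differentiableI vector_derivative_works by blast

lemma vector_derivative_eq_frechet: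
  fixes x :: "real \<Rightarrow> 'b::real_normed_vector"
  assumes "(x has_derivative D) (at t)"
  shows "vector_derivative x (at t) = D 1"
proof -
  have "D \<tau> = \<tau> *\<^sub>R D 1" for \<tau>
    using linear_scale[OF has_derivative_linear[OF assms], of \<tau> 1] by (metis mult.right_neutral real_scaleR_def)
  then have "(x has_vector_derivative D 1) (at t)"
    unfolding has_vector_derivative_def by (intro has_derivative_eq_rhs[OF assms] ext)
  then show ?thesis by (rule vector_derivative_at)
qed

lemma smooth_on_vector_derivative:
  fixes x :: "real \<Rightarrow> 'b::real_normed_vector"
  assumes "smooth_on D x" "open D"
  shows "smooth_on D (\<lambda>t. vector_derivative x (at t))"
proof -
  have "vector_derivative x (at t) = frechet_derivative x (at t) 1" if "t \<in> D" for t
    by (rule vector_derivative_eq_frechet[OF smooth_on_has_derivative[OF assms that]])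
  then show ?thesis
    using smooth_on_derivative[OF assms, of 1] smooth_on_cong[of D "\<lambda>t. vector_derivative x (at t)"] by metis
qed

context
  fixes A :: "('a, 'e::euclidean_space) chart set" and I :: "real set" and c :: "real \<Rightarrow> 'a"
  assumes A: "smooth_atlas A" and I: "open I" and c: "smooth_map (open_atlas I) A c"
begin

lemma curve_chart:
  assumes "\<phi> \<in> A"
  shows "open {t \<in> I. c t \<in> chart_dom \<phi>}" "smooth_on {t \<in> I. c t \<in> chart_dom \<phi>} (\<lambda>t. chart_map \<phi> (c t))"
  using c assms by (auto simp: smooth_map_open_atlas)

lemma curve_chart_exists:
  assumes "t \<in> I"
  obtains \<phi> where "\<phi> \<in> A" "c t \<in> chart_dom \<phi>"
  using c assms unfolding smooth_map_open_atlas atlas_carrier_def by blast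

lemma velocity_component:
  assumes "\<phi> \<in> A" "t \<in> I" "c t \<in> chart_dom \<phi>"
  shows "snd (velocity A I c t) \<phi> = vector_derivative (\<lambda>s. chart_map \<phi> (c s)) (at t)"
  using assms at_within_open[OF assms(2) I] by (simp add: velocity_def on_charts_def comp_def)

lemma fst_velocity: "fst (velocity A I c t) = c t"
  by (simp add: velocity_def)

lemma velocity_tangent:
  assumes t: "t \<in> I"
  shows "snd (velocity A I c t) \<in> tangent_space A (c t)"
  unfolding tangent_space_def
proof (intro CollectI conjI ballI allI impI)
  fix \<phi> \<psi> assume *: "\<phi> \<in> A" "\<psi> \<in> A" "c t \<in> chart_dom \<phi>" "c t \<in> chart_dom \<psi>"
  let ?x = "\<lambda>s. chart_map \<phi> (c s)"
  have o: "open ({s \<in> I. c s \<in> chart_dom \<phi>} \<inter> {s \<in> I. c s \<in> chart_dom \<psi>})"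
    using curve_chart(1) * by (intro open_Int) auto
  have x: "(?x has_derivative frechet_derivative ?x (at t)) (at t)"
    by (rule smooth_on_has_derivative[OF curve_chart(2,1)[OF *(1)]]) (use t * in simp)
  have "((\<lambda>s. transition \<phi> \<psi> (?x s)) has_derivative
      (\<lambda>\<tau>. frechet_derivative (transition \<phi> \<psi>) (at (?x t)) (frechet_derivative ?x (at t) \<tau>))) (at t)"
    by (rule has_derivative_compose[OF x transition_has_derivative[OF A *]])
  then have "((\<lambda>s. chart_map \<psi> (c s)) has_derivative
      (\<lambda>\<tau>. frechet_derivative (transition \<phi> \<psi>) (at (?x t)) (frechet_derivative ?x (at t) \<tau>))) (at t)"
    by (rule has_derivative_transform_within_open[OF _ o]) (use t * transition_map[OF A *(1)] in auto)
  from vector_derivative_eq_frechet[OF this] vector_derivative_eq_frechet[OF x]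
  show "snd (velocity A I c t) \<psi> = frechet_derivative (transition \<phi> \<psi>) (at (?x t)) (snd (velocity A I c t) \<phi>)"
    using * t by (simp add: velocity_component)
qed (auto simp: velocity_def on_charts_def)

end

subsection \<open>Sprays in coordinates\<close>

text \<open>Equal to \<open>- 2 *\<^sub>R G\<close> for the spray coefficients \<open>G\<close>;
  with it the geodesic equation takes the form \<open>x'' = H (x, x')\<close>.\<close>

definition spray_acceleration ::
    "('a, 'e::euclidean_space) chart set \<Rightarrow> ('a, 'e) slit_field \<Rightarrow> ('a, 'e) chart \<Rightarrow> 'e \<times> 'e \<Rightarrow> 'e" where
  "spray_acceleration A S \<phi> z = snd (vf_components (slit_chart A \<phi>) S z)"

lemma spray_coeff_acceleration: "spray_coeff A S \<phi> z = - (1/2) *\<^sub>R spray_acceleration A S \<phi> z"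
  by (simp add: spray_coeff_def spray_acceleration_def)

locale spray_manifold =
  fixes A :: "('a, 'e::euclidean_space) chart set" and S :: "('a, 'e) slit_field"
  assumes smooth_manifold: "smooth_manifold A" and is_spray: "spray A S"
begin

lemma atlas: "smooth_atlas A" and hausdorff: "Hausdorff_space (atlas_topology A)"
  using smooth_manifold by (auto simp: smooth_manifold_def)

abbreviation "H \<equiv> spray_acceleration A S"

definition phase_domain :: "('a, 'e) chart \<Rightarrow> ('e \<times> 'e) set" where
  "phase_domain \<phi> = chart_map \<phi> ` chart_dom \<phi> \<times> (UNIV - {0})"

lemma open_phase_domain: "\<phi> \<in> A \<Longrightarrow> open (phase_domain \<phi>)"
  unfolding phase_domain_def by (rule slit_image_open[OF atlas])

lemma spray_value:
  assumes "u \<in> slit_bundle A"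
  shows "fst (S u) = u" "snd (S u) \<in> tangent_space (slit_atlas A) u" "S u \<in> tangent_bundle (slit_atlas A)"
proof -
  have vf: "vector_field (slit_atlas A) S"
    using is_spray by (simp add: spray_def semispray_def)
  have u: "u \<in> atlas_carrier (slit_atlas A)" using assms slit_carrier[OF atlas] by simp
  then show 1: "fst (S u) = u" using vf by (simp add: vector_field_def)
  have "S u \<in> atlas_carrier (tangent_atlas (slit_atlas A))"
    using vf u unfolding vector_field_def smooth_map_def by blast
  then show "S u \<in> tangent_bundle (slit_atlas A)"
    by (auto simp: atlas_carrier_def tangent_atlas_def tangent_chart_def)
  then show "snd (S u) \<in> tangent_space (slit_atlas A) u"
    using 1 by (auto simp: tangent_bundle_def)
qed

lemma spray_components_smooth:
  assumes \<phi>: "\<phi> \<in> A"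
  shows "smooth_on (phase_domain \<phi>) (vf_components (slit_chart A \<phi>) S)"
proof -
  let ?\<kappa> = "slit_chart A \<phi>" and ?\<kappa>' = "tangent_chart (slit_atlas A) (slit_chart A \<phi>)"
  have \<kappa>: "?\<kappa> \<in> slit_atlas A" using \<phi> slit_atlas_eq[OF atlas] by blast
  then have "?\<kappa>' \<in> tangent_atlas (slit_atlas A)" by (simp add: tangent_atlas_def)
  moreover have "smooth_map (slit_atlas A) (tangent_atlas (slit_atlas A)) S"
    using is_spray by (simp add: spray_def semispray_def vector_field_def)
  ultimately have sm: "smooth_on (chart_map ?\<kappa> ` {p \<in> chart_dom ?\<kappa>. S p \<in> chart_dom ?\<kappa>'}) (chart_map ?\<kappa>' \<circ> S \<circ> chart_inv ?\<kappa>)"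
    using \<kappa> unfolding smooth_map_def by blast
  have "{p \<in> chart_dom ?\<kappa>. S p \<in> chart_dom ?\<kappa>'} = chart_dom ?\<kappa>"
    using spray_value(1,3) by (auto simp: tangent_chart_def slit_chart_dom[OF atlas])
  with sm have "smooth_on (phase_domain \<phi>) (chart_map ?\<kappa>' \<circ> S \<circ> chart_inv ?\<kappa>)"
    by (simp add: slit_chart_image[OF atlas \<phi>] phase_domain_def)
  from smooth_on_snd[OF open_phase_domain[OF \<phi>] this] show ?thesis
    by (simp add: tangent_chart_def vf_components_def[abs_def])
qed

lemma spray_components_at:
  assumes "\<phi> \<in> A" "u \<in> slit_bundle A" "fst u \<in> chart_dom \<phi>"
  shows "vf_components (slit_chart A \<phi>) S (chart_map \<phi> (fst u), snd u \<phi>) = snd (S u) (slit_chart A \<phi>)"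
  by (simp add: vf_components_def slit_chart_inv_map[OF atlas assms])

lemma spray_transform:
  assumes "\<phi> \<in> A" "\<psi> \<in> A" "u \<in> slit_bundle A" "fst u \<in> chart_dom \<phi>" "fst u \<in> chart_dom \<psi>"
  obtains D where "(tangent_transition \<phi> \<psi> has_derivative D) (at (chart_map \<phi> (fst u), snd u \<phi>))"
    "snd (S u) (slit_chart A \<psi>) = D (snd (S u) (slit_chart A \<phi>))"
proof -
  have "slit_chart A \<phi> \<in> slit_atlas A" "slit_chart A \<psi> \<in> slit_atlas A"
    using assms slit_atlas_eq[OF atlas] by auto
  moreover have "u \<in> chart_dom (slit_chart A \<phi>)" "u \<in> chart_dom (slit_chart A \<psi>)"
    using assms by (auto simp: slit_chart_dom[OF atlas])
  ultimately have "snd (S u) (slit_chart A \<psi>) = frechet_derivative (transition (slit_chart A \<phi>) (slit_chart A \<psi>))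
      (at (chart_map (slit_chart A \<phi>) u)) (snd (S u) (slit_chart A \<phi>))"
    using spray_value(2)[OF assms(3)] unfolding tangent_space_def by blast
  then show thesis
    using slit_transition_derivative[OF atlas assms(1,2,4,5) slit_component_nonzero[OF atlas assms(3,1,4)]]
    by (intro that) (auto simp: slit_chart_map[OF atlas])
qed

text \<open>\<open>tangent_map\<close> evaluates in a chart picked by \<open>SOME\<close>, so the
  semispray condition yields the claim first in that chart. The first block of the derivative of
  \<open>tangent_transition\<close> is the derivative of the base transition, by which
  \<open>snd u\<close> transforms as well; this moves the claim to \<phi>.\<close>

lemma spray_first_component_at:
  assumes "\<phi> \<in> A" "u \<in> slit_bundle A" "fst u \<in> chart_dom \<phi>"
  shows "fst (snd (S u) (slit_chart A \<phi>)) = snd u \<phi>"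
proof -
  define \<kappa> where "\<kappa> = (SOME \<kappa>. \<kappa> \<in> slit_atlas A \<and> fst (S u) \<in> chart_dom \<kappa>)"
  have "slit_chart A \<phi> \<in> slit_atlas A \<and> fst (S u) \<in> chart_dom (slit_chart A \<phi>)"
    using assms spray_value(1)[OF assms(2)] by (auto simp: slit_atlas_eq[OF atlas] slit_chart_dom[OF atlas])
  then have \<kappa>: "\<kappa> \<in> slit_atlas A \<and> fst (S u) \<in> chart_dom \<kappa>"
    unfolding \<kappa>_def by (rule someI)
  then obtain \<psi> where \<psi>: "\<psi> \<in> A" "\<kappa> = slit_chart A \<psi>" by (auto simp: slit_atlas_eq[OF atlas])
  then have u\<psi>: "fst u \<in> chart_dom \<psi>" using \<kappa> spray_value(1)[OF assms(2)] by (simp add: slit_chart_dom[OF atlas])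
  let ?z = "(chart_map \<psi> (fst u), snd u \<psi>)"
  have "tangent_map (slit_atlas A) A fst (S u) = u"
    using is_spray assms(2) by (simp add: spray_def semispray_def)
  from this[unfolded tangent_map_def Let_def, folded \<kappa>_def] have "on_charts A (fst u) (\<lambda>\<theta>. frechet_derivative (chart_map \<theta> \<circ> fst \<circ> chart_inv \<kappa>) (at (chart_map \<kappa> u)) (snd (S u) \<kappa>)) = snd u"
    by (simp add: spray_value(1)[OF assms(2)] prod_eq_iff)
  from fun_cong[OF this, of \<psi>] have 1: "frechet_derivative (chart_map \<psi> \<circ> fst \<circ> chart_inv \<kappa>) (at ?z) (snd (S u) \<kappa>) = snd u \<psi>"
    using \<psi> u\<psi> by (simp add: on_charts_def slit_chart_map[OF atlas])
  have zin: "?z \<in> phase_domain \<psi>"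
    using u\<psi> slit_component_nonzero[OF atlas assms(2) \<psi>(1) u\<psi>] by (auto simp: phase_domain_def)
  have "(chart_map \<psi> \<circ> fst \<circ> chart_inv \<kappa> has_derivative fst) (at ?z)"
  proof (rule has_derivative_transform_within_open[OF _ open_phase_domain[OF \<psi>(1)] zin])
    show "(fst has_derivative fst) (at ?z)" by (rule bounded_linear_imp_has_derivative[OF bounded_linear_fst])
    show "fst z = (chart_map \<psi> \<circ> fst \<circ> chart_inv \<kappa>) z" if z: "z \<in> phase_domain \<psi>" for z
    proof -
      obtain p y where "z = (chart_map \<psi> p, y)" "p \<in> chart_dom \<psi>" "y \<noteq> 0"
        using z by (auto simp: phase_domain_def)
      then show ?thesis using slit_chart_inv[OF atlas \<psi>(1), of p y] by (simp add: \<psi>(2))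
    qed
  qed
  from frechet_derivative_at[OF this] 1 have f: "fst (snd (S u) \<kappa>) = snd u \<psi>" by simp
  obtain D where D: "(tangent_transition \<psi> \<phi> has_derivative D) (at ?z)"
    "snd (S u) (slit_chart A \<phi>) = D (snd (S u) (slit_chart A \<psi>))"
    using spray_transform[OF \<psi>(1) assms(1,2) u\<psi> assms(3)] by blast
  let ?T = "frechet_derivative (transition \<psi> \<phi>) (at (chart_map \<psi> (fst u)))"
  have "((\<lambda>z. transition \<psi> \<phi> (fst z)) has_derivative (\<lambda>w. ?T (fst w))) (at ?z)"
    using has_derivative_compose[OF bounded_linear_imp_has_derivative[OF bounded_linear_fst], of "transition \<psi> \<phi>" ?T ?z UNIV]
      transition_has_derivative[OF atlas \<psi>(1) assms(1) u\<psi> assms(3)] by simp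
  moreover have "((\<lambda>z. transition \<psi> \<phi> (fst z)) has_derivative (\<lambda>w. fst (D w))) (at ?z)"
    using has_derivative_fst[OF D(1)] by (simp add: tangent_transition_def)
  ultimately have "(\<lambda>w. fst (D w)) = (\<lambda>w. ?T (fst w))"
    by (rule has_derivative_unique[rotated])
  from fun_cong[OF this, of "snd (S u) (slit_chart A \<psi>)"] f
  have "fst (snd (S u) (slit_chart A \<phi>)) = ?T (snd u \<psi>)" by (simp add: D(2) \<psi>(2))
  then show ?thesis
    using tangent_space_transform[OF atlas slit_bundleD(1)[OF atlas assms(2)] \<psi>(1) assms(1) u\<psi> assms(3)] by simp
qed

lemma slit_point:
  assumes "\<phi> \<in> A" "z \<in> phase_domain \<phi>"
  obtains u where "u \<in> slit_bundle A" "fst u \<in> chart_dom \<phi>" "z = (chart_map \<phi> (fst u), snd u \<phi>)"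
proof -
  have "z \<in> chart_map (slit_chart A \<phi>) ` chart_dom (slit_chart A \<phi>)"
    unfolding slit_chart_image[OF atlas assms(1)] using assms(2) by (simp only: phase_domain_def)
  then obtain u where u: "u \<in> chart_dom (slit_chart A \<phi>)" "z = chart_map (slit_chart A \<phi>) u"
    by blast
  then show thesis
    using that[of u] by (simp add: slit_chart_map[OF atlas] slit_chart_dom[OF atlas])
qed

lemma spray_components:
  assumes "\<phi> \<in> A" "z \<in> phase_domain \<phi>"
  shows "vf_components (slit_chart A \<phi>) S z = (snd z, H \<phi> z)"
proof -
  obtain u where u: "u \<in> slit_bundle A" "fst u \<in> chart_dom \<phi>" "z = (chart_map \<phi> (fst u), snd u \<phi>)"
    using slit_point[OF assms] by blast
  show ?thesis
    unfolding u(3) using spray_components_at[OF assms(1) u(1,2)] spray_first_component_at[OF assms(1) u(1,2)]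
    by (simp add: prod_eq_iff spray_acceleration_def)
qed

lemma acceleration_smooth: "\<phi> \<in> A \<Longrightarrow> smooth_on (phase_domain \<phi>) (H \<phi>)"
  unfolding spray_acceleration_def[abs_def]
  by (rule smooth_on_snd[OF open_phase_domain spray_components_smooth])

lemma acceleration_has_derivative:
  "\<phi> \<in> A \<Longrightarrow> z \<in> phase_domain \<phi> \<Longrightarrow> (H \<phi> has_derivative frechet_derivative (H \<phi>) (at z)) (at z)"
  by (rule smooth_on_has_derivative[OF acceleration_smooth open_phase_domain])

text \<open>Euler's relation for degree 2. The second component of \<open>[C, S] = S\<close> reads
  \<open>DH (0, y) - H = H\<close>, because the Liouville field has coordinates
  \<open>(0, y)\<close> and its derivative sends \<open>(y, H)\<close> to
  \<open>(0, H)\<close>.\<close>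

lemma acceleration_homogeneous:
  assumes "\<phi> \<in> A" "z \<in> phase_domain \<phi>"
  shows "frechet_derivative (H \<phi>) (at z) (0, snd z) = 2 *\<^sub>R H \<phi> z"
proof -
  obtain u where u: "u \<in> slit_bundle A" "fst u \<in> chart_dom \<phi>" "z = (chart_map \<phi> (fst u), snd u \<phi>)"
    using slit_point[OF assms] by blast
  let ?\<kappa> = "slit_chart A \<phi>"
  have \<kappa>: "?\<kappa> \<in> slit_atlas A" "u \<in> chart_dom ?\<kappa>" "chart_map ?\<kappa> u = z"
    using assms u by (auto simp: slit_atlas_eq[OF atlas] slit_chart_dom[OF atlas] slit_chart_map[OF atlas])
  have "lie_bracket (slit_atlas A) (liouville A) S u = S u"
    using is_spray u(1) by (simp add: spray_def)
  from arg_cong[OF this, of "\<lambda>w. snd w ?\<kappa>"]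
  have 1: "frechet_derivative (vf_components ?\<kappa> S) (at z) (0, snd z) -
      frechet_derivative (vf_components ?\<kappa> (liouville A)) (at z) (snd (S u) ?\<kappa>) = snd (S u) ?\<kappa>"
    using \<kappa> by (simp add: lie_bracket_def on_charts_def liouville_def)
  have Su: "snd (S u) ?\<kappa> = (snd z, H \<phi> z)"
    using spray_components_at[OF assms(1) u(1,2)] spray_components[OF assms] u(3) by simp
  have "(vf_components ?\<kappa> (liouville A) has_derivative (\<lambda>w. (0, snd w))) (at z)"
  proof (rule has_derivative_transform_within_open[OF _ open_phase_domain[OF assms(1)] assms(2)])
    show "((\<lambda>z. (0, snd z)) has_derivative (\<lambda>w. (0, snd w))) (at z)"
      by (intro has_derivative_Pair has_derivative_const bounded_linear_imp_has_derivative[OF bounded_linear_snd])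
    fix z' assume z': "z' \<in> phase_domain \<phi>"
    obtain w where w: "w \<in> slit_bundle A" "fst w \<in> chart_dom \<phi>" "z' = (chart_map \<phi> (fst w), snd w \<phi>)"
      using slit_point[OF assms(1) z'] by blast
    show "(0, snd z') = vf_components ?\<kappa> (liouville A) z'"
      using w slit_chart_inv_map[OF atlas assms(1) w(1,2)] \<kappa>(1)
      by (simp add: vf_components_def liouville_def on_charts_def slit_chart_map[OF atlas] slit_chart_dom[OF atlas])
  qed
  from frechet_derivative_at[OF this]
  have 2: "frechet_derivative (vf_components ?\<kappa> (liouville A)) (at z) = (\<lambda>w. (0, snd w))" by simp
  have "(vf_components ?\<kappa> S has_derivative frechet_derivative (vf_components ?\<kappa> S) (at z)) (at z)"
    by (rule smooth_on_has_derivative[OF spray_components_smooth open_phase_domain]) (use assms in auto)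
  from frechet_derivative_at[OF has_derivative_snd[OF this]]
  have "frechet_derivative (H \<phi>) (at z) = (\<lambda>w. snd (frechet_derivative (vf_components ?\<kappa> S) (at z) w))"
    by (simp add: spray_acceleration_def[abs_def])
  moreover have "snd (frechet_derivative (vf_components ?\<kappa> S) (at z) (0, snd z)) = H \<phi> z + H \<phi> z"
    using arg_cong[OF 1, of snd] by (simp add: 2 Su algebra_simps)
  ultimately show ?thesis by (simp add: scaleR_2)
qed

text \<open>Only the second component of the equation between velocity and spray carries
  information; the first one states that the velocity is the derivative of the curve.\<close>

lemma geodesic_coordinates:
  assumes g: "geodesic_on A S I c" and \<phi>: "\<phi> \<in> A" and t: "t \<in> I" "c t \<in> chart_dom \<phi>"
  defines "x \<equiv> \<lambda>s. chart_map \<phi> (c s)"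
  shows "(x has_vector_derivative vector_derivative x (at t)) (at t)"
    "((\<lambda>s. vector_derivative x (at s)) has_vector_derivative H \<phi> (x t, vector_derivative x (at t))) (at t)"
    "(x t, vector_derivative x (at t)) \<in> phase_domain \<phi>"
proof -
  have I: "open I" "smooth_map (open_atlas I) A c" using g by (auto simp: geodesic_on_def)
  let ?D = "{s \<in> I. c s \<in> chart_dom \<phi>}"
  have D: "open ?D" "smooth_on ?D x" "t \<in> ?D"
    using curve_chart[OF atlas I \<phi>] t by (auto simp: x_def)
  show xd: "(x has_vector_derivative vector_derivative x (at t)) (at t)"
    by (rule smooth_on_real_has_vector_derivative[OF D(2,1,3)])
  let ?y = "\<lambda>s. vector_derivative x (at s)"
  have yd: "(?y has_vector_derivative vector_derivative ?y (at t)) (at t)"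
    by (rule smooth_on_real_has_vector_derivative[OF smooth_on_vector_derivative[OF D(2,1)] D(1,3)])
  let ?v = "velocity A I c"
  have vc: "snd (?v s) \<phi> = ?y s" if "s \<in> ?D" for s
    using velocity_component[OF atlas I \<phi>, of s] that by (simp add: x_def)
  have vs: "?v t \<in> slit_bundle A"
    using g t velocity_tangent[OF atlas I t(1)] \<phi>
    by (auto simp: slit_bundle_def tangent_bundle_def geodesic_on_def atlas_carrier_def velocity_def)
  have fv: "fst (?v t) = c t" by (rule fst_velocity[OF atlas I])
  show ph: "(x t, ?y t) \<in> phase_domain \<phi>"
    using slit_component_nonzero[OF atlas vs \<phi>] t vc[OF D(3)] by (auto simp: phase_domain_def fv x_def)
  have "velocity (slit_atlas A) I ?v t = S (?v t)" using g t by (simp add: geodesic_on_def)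
  from arg_cong[OF this, of "\<lambda>w. snd w (slit_chart A \<phi>)"]
  have "vector_derivative (chart_map (slit_chart A \<phi>) \<circ> ?v) (at t) = snd (S (?v t)) (slit_chart A \<phi>)"
  proof -
    have "slit_chart A \<phi> \<in> slit_atlas A" "?v t \<in> chart_dom (slit_chart A \<phi>)"
      using \<phi> vs t fv by (auto simp: slit_atlas_eq[OF atlas] slit_chart_dom[OF atlas])
    then show "snd (velocity (slit_atlas A) I ?v t) (slit_chart A \<phi>) = snd (S (?v t)) (slit_chart A \<phi>) \<Longrightarrow> ?thesis"
      using at_within_open[OF t(1) I(1)] by (simp add: velocity_def[of "slit_atlas A"] on_charts_def)
  qed
  also have "\<dots> = (?y t, H \<phi> (x t, ?y t))"
    using spray_components_at[OF \<phi> vs] spray_components[OF \<phi> ph] fv t vc[OF D(3)] by (simp add: x_def)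
  finally have e: "vector_derivative (chart_map (slit_chart A \<phi>) \<circ> ?v) (at t) = (?y t, H \<phi> (x t, ?y t))" .
  have "((\<lambda>s. (x s, ?y s)) has_vector_derivative (?y t, vector_derivative ?y (at t))) (at t)"
    by (rule has_vector_derivative_Pair[OF xd yd])
  then have "(chart_map (slit_chart A \<phi>) \<circ> ?v has_vector_derivative (?y t, vector_derivative ?y (at t))) (at t)"
    by (rule has_vector_derivative_transform_within_open[OF _ D(1,3)])
      (use vc in \<open>auto simp: slit_chart_map[OF atlas] fst_velocity[OF atlas I] x_def\<close>)
  from vector_derivative_at[OF this] e have "vector_derivative ?y (at t) = H \<phi> (x t, ?y t)" by simp
  then show "(?y has_vector_derivative H \<phi> (x t, ?y t)) (at t)" using yd by simp
qed

text \<open>A single chart suffices at each time: the velocity of the phase curve and the value of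
  the spray both transform by the derivative of \<open>tangent_transition\<close>, so equality
  carries over to every other slit chart.\<close>

lemma geodesic_onI:
  assumes I: "open I" "is_interval I" and c: "smooth_map (open_atlas I) A c"
    and eq: "\<And>t. t \<in> I \<Longrightarrow> \<exists>\<phi>\<in>A. c t \<in> chart_dom \<phi> \<and> vector_derivative (\<lambda>s. chart_map \<phi> (c s)) (at t) \<noteq> 0 \<and>
      ((\<lambda>s. vector_derivative (\<lambda>s. chart_map \<phi> (c s)) (at s)) has_vector_derivative
        H \<phi> (chart_map \<phi> (c t), vector_derivative (\<lambda>s. chart_map \<phi> (c s)) (at t))) (at t)"
  shows "geodesic_on A S I c"
  unfolding geodesic_on_def
proof (intro conjI ballI I c)
  fix t assume t: "t \<in> I"
  obtain \<phi> where \<phi>: "\<phi> \<in> A" "c t \<in> chart_dom \<phi>" "vector_derivative (\<lambda>s. chart_map \<phi> (c s)) (at t) \<noteq> 0"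
     "((\<lambda>s. vector_derivative (\<lambda>s. chart_map \<phi> (c s)) (at s)) has_vector_derivative
        H \<phi> (chart_map \<phi> (c t), vector_derivative (\<lambda>s. chart_map \<phi> (c s)) (at t))) (at t)"
    using eq[OF t] by blast
  let ?v = "velocity A I c"
  have fv: "fst (?v s) = c s" for s by (rule fst_velocity[OF atlas I(1) c])
  have vt: "snd (?v t) \<phi> = vector_derivative (\<lambda>s. chart_map \<phi> (c s)) (at t)"
    by (rule velocity_component[OF atlas I(1) c \<phi>(1) t \<phi>(2)])
  show nz: "snd (?v t) \<noteq> 0" using vt \<phi>(3) by auto
  have vs: "?v t \<in> slit_bundle A"
    using slit_bundleI[OF atlas velocity_tangent[OF atlas I(1) c t] \<phi>(1,2)] vt \<phi>(3) by (metis fv prod.collapse)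
  let ?X = "\<lambda>\<psi> s. (chart_map \<psi> (c s), vector_derivative (\<lambda>s. chart_map \<psi> (c s)) (at s))"
  have X: "chart_map (slit_chart A \<psi>) (?v s) = ?X \<psi> s" if "\<psi> \<in> A" "s \<in> I" "c s \<in> chart_dom \<psi>" for \<psi> s
    using velocity_component[OF atlas I(1) c that] by (simp add: slit_chart_map[OF atlas] fv)
  have ph: "?X \<phi> t \<in> phase_domain \<phi>" using \<phi>(2,3) by (auto simp: phase_domain_def)
  have o: "open {s \<in> I. c s \<in> chart_dom \<psi>}" if "\<psi> \<in> A" for \<psi>
    by (rule curve_chart(1)[OF atlas I(1) c that])
  have x: "((\<lambda>s. chart_map \<phi> (c s)) has_vector_derivative snd (?X \<phi> t)) (at t)"
    using smooth_on_real_has_vector_derivative[OF curve_chart(2,1)[OF atlas I(1) c \<phi>(1)], of t] t \<phi>(2) by simp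
  have X\<phi>: "(?X \<phi> has_vector_derivative (snd (?X \<phi> t), H \<phi> (?X \<phi> t))) (at t)"
    using has_vector_derivative_Pair[OF x \<phi>(4)] by simp
  have Su\<phi>: "snd (S (?v t)) (slit_chart A \<phi>) = (snd (?X \<phi> t), H \<phi> (?X \<phi> t))"
    using spray_components_at[OF \<phi>(1) vs] spray_components[OF \<phi>(1) ph] \<phi>(2) vt by (simp add: fv)
  have main: "vector_derivative (chart_map (slit_chart A \<psi>) \<circ> ?v) (at t) = snd (S (?v t)) (slit_chart A \<psi>)"
    if \<psi>: "\<psi> \<in> A" "c t \<in> chart_dom \<psi>" for \<psi>
  proof -
    obtain D where D: "(tangent_transition \<phi> \<psi> has_derivative D) (at (?X \<phi> t))"
      "snd (S (?v t)) (slit_chart A \<psi>) = D (snd (S (?v t)) (slit_chart A \<phi>))"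
      using spray_transform[OF \<phi>(1) \<psi>(1) vs] \<phi>(2) \<psi>(2) vt by (auto simp: fv)
    have "((\<lambda>s. tangent_transition \<phi> \<psi> (?X \<phi> s)) has_derivative (\<lambda>\<tau>. D (\<tau> *\<^sub>R (snd (?X \<phi> t), H \<phi> (?X \<phi> t))))) (at t)"
      by (rule has_derivative_compose[OF X\<phi>[unfolded has_vector_derivative_def] D(1)])
    then have "(chart_map (slit_chart A \<psi>) \<circ> ?v has_derivative (\<lambda>\<tau>. D (\<tau> *\<^sub>R (snd (?X \<phi> t), H \<phi> (?X \<phi> t))))) (at t)"
    proof (rule has_derivative_transform_within_open[OF _ open_Int[OF o[OF \<phi>(1)] o[OF \<psi>(1)]]])
      show "t \<in> {s \<in> I. c s \<in> chart_dom \<phi>} \<inter> {s \<in> I. c s \<in> chart_dom \<psi>}" using t \<phi>(2) \<psi>(2) by simp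
      fix s assume s: "s \<in> {s \<in> I. c s \<in> chart_dom \<phi>} \<inter> {s \<in> I. c s \<in> chart_dom \<psi>}"
      have "tangent_transition \<phi> \<psi> (?X \<phi> s) = ?X \<psi> s"
        using tangent_space_transform[OF atlas velocity_tangent[OF atlas I(1) c, of s] \<phi>(1) \<psi>(1)] s
          velocity_component[OF atlas I(1) c] transition_map[OF atlas \<phi>(1)] \<phi>(1) \<psi>(1)
        by (simp add: tangent_transition_def)
      then show "tangent_transition \<phi> \<psi> (?X \<phi> s) = (chart_map (slit_chart A \<psi>) \<circ> ?v) s"
        using X[OF \<psi>(1), of s] s by simp
    qed
    from vector_derivative_eq_frechet[OF this] show ?thesis using D(2) Su\<phi> by simp
  qed
  show "velocity (slit_atlas A) I ?v t = S (?v t)"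
  proof (rule prod_eqI)
    show "fst (velocity (slit_atlas A) I ?v t) = fst (S (?v t))"
      by (simp add: velocity_def[of "slit_atlas A"] spray_value(1)[OF vs])
    show "snd (velocity (slit_atlas A) I ?v t) = snd (S (?v t))"
    proof
      fix \<kappa>
      show "snd (velocity (slit_atlas A) I ?v t) \<kappa> = snd (S (?v t)) \<kappa>"
      proof (cases "\<kappa> \<in> slit_atlas A \<and> ?v t \<in> chart_dom \<kappa>")
        case True
        then obtain \<psi> where \<psi>: "\<psi> \<in> A" "\<kappa> = slit_chart A \<psi>" "c t \<in> chart_dom \<psi>"
          by (auto simp: slit_atlas_eq[OF atlas] slit_chart_dom[OF atlas] fv)
        show ?thesis
          using main[OF \<psi>(1,3)] True at_within_open[OF t I(1)] \<psi>(2)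
          by (simp add: velocity_def[of "slit_atlas A"] on_charts_def)
      next
        case False
        then have "snd (S (?v t)) \<kappa> = 0"
          using spray_value(2)[OF vs] unfolding tangent_space_def by blast
        then show ?thesis using False by (auto simp: velocity_def[of "slit_atlas A"] on_charts_def)
      qed
    qed
  qed
qed

end

subsection \<open>Gluing\<close>

lemma smooth_map_open_preimage:
  fixes F :: "'x::euclidean_space \<Rightarrow> 'a"
  assumes A: "smooth_atlas A" and W: "open W" and F: "smooth_map (open_atlas W) A F" and U: "openin (atlas_topology A) U"
  shows "open {p \<in> W. F p \<in> U}"
proof (subst open_subopen, intro ballI)
  fix p assume p: "p \<in> {p \<in> W. F p \<in> U}"
  obtain \<phi> where \<phi>: "\<phi> \<in> A" "F p \<in> chart_dom \<phi>"
    using F p unfolding smooth_map_open_atlas atlas_carrier_def by blast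
  let ?D = "{p \<in> W. F p \<in> chart_dom \<phi>}" and ?V = "chart_map \<phi> ` (U \<inter> chart_dom \<phi>)"
  have D: "open ?D" "smooth_on ?D (\<lambda>p. chart_map \<phi> (F p))"
    using F \<phi>(1) by (auto simp: smooth_map_open_atlas)
  have "open ?V" using U \<phi>(1) by (simp add: openin_atlas_topology[OF A])
  then have "open (?D \<inter> (\<lambda>p. chart_map \<phi> (F p)) -` ?V)"
    by (rule continuous_open_preimage[OF smooth_on_imp_continuous_on[OF D(2)] D(1)])
  moreover have "?D \<inter> (\<lambda>p. chart_map \<phi> (F p)) -` ?V \<subseteq> {p \<in> W. F p \<in> U}"
    using inj_onD[OF chart_inj[OF A \<phi>(1)]] by blast
  moreover have "p \<in> ?D \<inter> (\<lambda>p. chart_map \<phi> (F p)) -` ?V" using p \<phi> by blast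
  ultimately show "\<exists>T. open T \<and> p \<in> T \<and> T \<subseteq> {p \<in> W. F p \<in> U}" by blast
qed

lemma openin_atlas_carrier:
  assumes "smooth_atlas A"
  shows "openin (atlas_topology A) (atlas_carrier A)"
proof -
  have "atlas_carrier A \<inter> chart_dom \<phi> = chart_dom \<phi>" if "\<phi> \<in> A" for \<phi>
    using that by (auto simp: atlas_carrier_def)
  then show ?thesis
    by (simp add: openin_atlas_topology[OF assms] chart_open[OF assms])
qed

lemma smooth_map_local:
  fixes F :: "'x::euclidean_space \<Rightarrow> 'a"
  assumes A: "smooth_atlas A" and W: "open W"
    and loc: "\<And>p. p \<in> W \<Longrightarrow> \<exists>W' F'. open W' \<and> p \<in> W' \<and> W' \<subseteq> W \<and> smooth_map (open_atlas W') A F' \<and> (\<forall>q\<in>W'. F q = F' q)"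
  shows "smooth_map (open_atlas W) A F"
proof (rule smooth_map_open_atlasI[OF A W])
  fix p assume p: "p \<in> W"
  obtain W' F' where W': "open W'" "p \<in> W'" "W' \<subseteq> W" "smooth_map (open_atlas W') A F'" "\<forall>q\<in>W'. F q = F' q"
    using loc[OF p] by (elim exE conjE)
  obtain \<phi> where \<phi>: "\<phi> \<in> A" "F' p \<in> chart_dom \<phi>"
    using W'(2,4) unfolding smooth_map_open_atlas atlas_carrier_def by blast
  let ?D = "{p \<in> W'. F' p \<in> chart_dom \<phi>}"
  have D: "open ?D" "smooth_on ?D (\<lambda>p. chart_map \<phi> (F' p))"
    using W'(4) \<phi>(1) by (auto simp: smooth_map_open_atlas)
  have "smooth_on ?D (\<lambda>p. chart_map \<phi> (F p))"
    using D(2) W'(5) smooth_on_cong[of ?D "\<lambda>p. chart_map \<phi> (F p)" "\<lambda>p. chart_map \<phi> (F' p)"] by simp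
  then show "\<exists>N \<phi>. open N \<and> p \<in> N \<and> N \<subseteq> W \<and> \<phi> \<in> A \<and> F ` N \<subseteq> chart_dom \<phi> \<and> smooth_on N (\<lambda>p. chart_map \<phi> (F p))"
    using D(1) \<phi> W'(2,3,5) by (intro exI[of _ ?D] exI[of _ \<phi>]) auto
qed

context spray_manifold
begin

lemma geodesic_onD:
  assumes "geodesic_on A S I c"
  shows "open I" "is_interval I" "smooth_map (open_atlas I) A c"
  using assms by (auto simp: geodesic_on_def)

text \<open>Velocity and acceleration at \<open>t\<close> depend only on the curve near
  \<open>t\<close>. The neighbourhood \<open>J\<close> is merely open, while a geodesic is defined
  on an interval; hence the comparison geodesic may live on a larger \<open>J'\<close>.\<close>

lemma geodesic_on_local:
  assumes I: "open I" "is_interval I"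
    and loc: "\<And>t. t \<in> I \<Longrightarrow> \<exists>J c'. t \<in> J \<and> open J \<and> J \<subseteq> I \<and> (\<exists>J'. J \<subseteq> J' \<and> geodesic_on A S J' c') \<and> (\<forall>s\<in>J. c s = c' s)"
  shows "geodesic_on A S I c"
proof (rule geodesic_onI[OF I])
  show "smooth_map (open_atlas I) A c"
  proof (rule smooth_map_local[OF atlas I(1)])
    fix t assume t: "t \<in> I"
    obtain J c' J' where J: "t \<in> J" "open J" "J \<subseteq> I" "J \<subseteq> J'" "geodesic_on A S J' c'" "\<forall>s\<in>J. c s = c' s"
      using loc[OF t] by blast
    have "smooth_map (open_atlas J) A c'"
      by (rule smooth_map_open_atlas_restrict[OF atlas geodesic_onD(3)[OF J(5)] J(2,4)])
    then show "\<exists>W' F'. open W' \<and> t \<in> W' \<and> W' \<subseteq> I \<and> smooth_map (open_atlas W') A F' \<and> (\<forall>q\<in>W'. c q = F' q)"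
      using J by (intro exI[of _ J] exI[of _ c']) simp
  qed
  fix t assume t: "t \<in> I"
  obtain J c' J' where J: "t \<in> J" "open J" "J \<subseteq> I" "J \<subseteq> J'" "geodesic_on A S J' c'" "\<forall>s\<in>J. c s = c' s"
    using loc[OF t] by blast
  have tJ': "t \<in> J'" using J by blast
  obtain \<phi> where \<phi>: "\<phi> \<in> A" "c' t \<in> chart_dom \<phi>"
    using curve_chart_exists[OF atlas geodesic_onD(1)[OF J(5)] geodesic_onD(3)[OF J(5)] tJ'] by blast
  let ?x = "\<lambda>s. chart_map \<phi> (c s)" and ?x' = "\<lambda>s. chart_map \<phi> (c' s)"
  note g = geodesic_coordinates[OF J(5) \<phi>(1)]
  have cond: "open {s \<in> J'. c' s \<in> chart_dom \<phi>}"
    by (rule curve_chart(1)[OF atlas geodesic_onD(1)[OF J(5)] geodesic_onD(3)[OF J(5)] \<phi>(1)])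
  let ?D = "J \<inter> {s \<in> J'. c' s \<in> chart_dom \<phi>}"
  have D: "open ?D" "t \<in> ?D" using J cond tJ' \<phi> by auto
  have vd: "vector_derivative ?x (at s) = vector_derivative ?x' (at s)" if s: "s \<in> ?D" for s
  proof (rule vector_derivative_at)
    have "(?x' has_vector_derivative vector_derivative ?x' (at s)) (at s)" using g(1)[of s] s by simp
    then show "(?x has_vector_derivative vector_derivative ?x' (at s)) (at s)"
      by (rule has_vector_derivative_transform_within_open[OF _ D(1) s]) (use J(6) in simp)
  qed
  have "((\<lambda>s. vector_derivative ?x' (at s)) has_vector_derivative H \<phi> (?x' t, vector_derivative ?x' (at t))) (at t)"
    using g(2)[of t] \<phi> tJ' by simp
  then have "((\<lambda>s. vector_derivative ?x (at s)) has_vector_derivative H \<phi> (?x' t, vector_derivative ?x' (at t))) (at t)"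
    by (rule has_vector_derivative_transform_within_open[OF _ D]) (use vd in simp)
  moreover have "vector_derivative ?x (at t) \<noteq> 0"
    using g(3)[of t] \<phi> tJ' vd[OF D(2)] by (simp add: phase_domain_def)
  ultimately show "\<exists>\<phi>\<in>A. c t \<in> chart_dom \<phi> \<and> vector_derivative (\<lambda>s. chart_map \<phi> (c s)) (at t) \<noteq> 0 \<and>
      ((\<lambda>s. vector_derivative (\<lambda>s. chart_map \<phi> (c s)) (at s)) has_vector_derivative
        H \<phi> (chart_map \<phi> (c t), vector_derivative (\<lambda>s. chart_map \<phi> (c s)) (at t))) (at t)"
    using \<phi> J(1,6) vd[OF D(2)] by (intro bexI[of _ \<phi>]) auto
qed

subsection \<open>Uniqueness of geodesics\<close>

lemma velocity_component_geodesic: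
  assumes "geodesic_on A S I c" "\<phi> \<in> A" "t \<in> I" "c t \<in> chart_dom \<phi>"
  shows "snd (velocity A I c t) \<phi> = vector_derivative (\<lambda>s. chart_map \<phi> (c s)) (at t)"
  by (rule velocity_component[OF atlas geodesic_onD(1)[OF assms(1)] geodesic_onD(3)[OF assms(1)] assms(2-4)])

lemma velocity_tangent_geodesic:
  "geodesic_on A S I c \<Longrightarrow> t \<in> I \<Longrightarrow> snd (velocity A I c t) \<in> tangent_space A (c t)"
  by (rule velocity_tangent[OF atlas geodesic_onD(1) geodesic_onD(3)])

lemma fst_velocity_geodesic: "fst (velocity A I c t) = c t"
  by (simp add: velocity_def)

lemma velocity_eqI:
  assumes g: "geodesic_on A S I1 c1" "geodesic_on A S I2 c2" and t: "t \<in> I1" "t \<in> I2" "c1 t = c2 t"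
    and \<phi>: "\<phi> \<in> A" "c2 t \<in> chart_dom \<phi>"
    and eq: "vector_derivative (\<lambda>s. chart_map \<phi> (c1 s)) (at t) = vector_derivative (\<lambda>s. chart_map \<phi> (c2 s)) (at t)"
  shows "velocity A I1 c1 t = velocity A I2 c2 t"
proof (rule prod_eqI)
  show "fst (velocity A I1 c1 t) = fst (velocity A I2 c2 t)" using t(3) by (simp add: fst_velocity_geodesic)
  show "snd (velocity A I1 c1 t) = snd (velocity A I2 c2 t)"
    using tangent_space_eqI[OF atlas velocity_tangent_geodesic[OF g(1) t(1), unfolded t(3)] velocity_tangent_geodesic[OF g(2) t(2)] \<phi>]
      velocity_component_geodesic[OF g(1) \<phi>(1) t(1)] velocity_component_geodesic[OF g(2) \<phi>(1) t(2)] \<phi>(2) eq t(3) by simp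
qed

text \<open>In one chart the two phase curves solve the same first order system with right-hand side
  \<open>F\<close>, which is Lipschitz near the common value; Gronwall's argument applies to their
  difference.\<close>

lemma geodesic_unique_near:
  assumes g: "geodesic_on A S I1 c1" "geodesic_on A S I2 c2" and t: "t \<in> I1" "t \<in> I2"
    and eq: "velocity A I1 c1 t = velocity A I2 c2 t"
  obtains r where "r > 0" "\<And>s. s \<in> ball t r \<Longrightarrow> s \<in> I1 \<and> s \<in> I2 \<and> velocity A I1 c1 s = velocity A I2 c2 s"
proof -
  have ct: "c1 t = c2 t" using arg_cong[OF eq, of fst] by (simp add: fst_velocity_geodesic)
  obtain \<phi> where \<phi>: "\<phi> \<in> A" "c1 t \<in> chart_dom \<phi>"
    using curve_chart_exists[OF atlas geodesic_onD(1)[OF g(1)] geodesic_onD(3)[OF g(1)] t(1)] by blast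
  define z where "z = (\<lambda>c s. (chart_map \<phi> (c s), vector_derivative (\<lambda>s. chart_map \<phi> (c s)) (at s)))"
  define F where "F = (\<lambda>z. (snd z, H \<phi> z))"
  let ?P = "phase_domain \<phi>"
  have P: "open ?P" by (rule open_phase_domain[OF \<phi>(1)])
  have F: "smooth_on ?P F" unfolding F_def
    by (rule smooth_on_Pair[OF P smooth_on_linear[OF bounded_linear_snd P] acceleration_smooth[OF \<phi>(1)]])
  define D where "D = (\<lambda>I (c :: real \<Rightarrow> 'a). {s \<in> I. c s \<in> chart_dom \<phi>})"
  have zd: "(z c has_vector_derivative F (z c s)) (at s)" "z c s \<in> ?P" and Do: "open (D I c)"
    if "geodesic_on A S I c" "s \<in> D I c" for I c s
  proof -
    have s: "s \<in> I" "c s \<in> chart_dom \<phi>" using that by (auto simp: D_def)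
    note gc = geodesic_coordinates[OF that(1) \<phi>(1) s]
    show "(z c has_vector_derivative F (z c s)) (at s)"
      using has_vector_derivative_Pair[OF gc(1,2)] by (simp add: z_def F_def)
    show "z c s \<in> ?P" using gc(3) by (simp add: z_def)
    show "open (D I c)" unfolding D_def
      by (rule curve_chart(1)[OF atlas geodesic_onD(1)[OF that(1)] geodesic_onD(3)[OF that(1)] \<phi>(1)])
  qed
  have tD: "t \<in> D I1 c1" "t \<in> D I2 c2" using t \<phi> ct by (auto simp: D_def)
  have z12: "z c1 t = z c2 t"
    using velocity_component_geodesic[OF g(1) \<phi>(1) t(1) \<phi>(2)] velocity_component_geodesic[OF g(2) \<phi>(1) t(2)] \<phi>(2) ct eq
    by (simp add: z_def)
  have F1: "Ck_on (Suc 0) ?P F" by (rule smooth_on_imp_Ck_on[OF F])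
  \<comment> \<open>Linearization with error factor 1 gives \<open>F\<close> the Lipschitz constant
    \<open>1 + B\<close> near \<open>z c1 t\<close>, where \<open>B\<close> bounds the derivative
    there.\<close>
  obtain \<eta> where \<eta>: "\<eta> > 0"
    "\<And>x y w. x \<in> {z c1 t} \<Longrightarrow> dist x y < \<eta> \<Longrightarrow> dist x w < \<eta> \<Longrightarrow>
        norm (F w - F y - frechet_derivative F (at x) (w - y)) \<le> 1 * norm (w - y)"
    using C1_linearization_compact[OF P F1 compact_sing, of "z c1 t" 1] zd(2)[OF g(1) tD(1)]
    by (metis empty_subsetI insert_subset zero_less_one)
  obtain B where B: "B > 0" "\<And>w. norm (frechet_derivative F (at (z c1 t)) w) \<le> norm w * B"
    using bounded_linear.pos_bounded[OF has_derivative_bounded_linear[OF smooth_on_has_derivative[OF F P zd(2)[OF g(1) tD(1)]]]] by blast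
  define N where "N = (\<lambda>I c. D I c \<inter> z c -` ball (z c1 t) \<eta>)"
  have N: "open (N I c)" if "geodesic_on A S I c" "t \<in> D I c" for I c
    unfolding N_def
    by (rule continuous_open_preimage[OF _ Do[OF that] open_ball])
      (intro continuous_at_imp_continuous_on ballI has_vector_derivative_continuous[OF zd(1)[OF that(1)]])
  have "open (N I1 c1 \<inter> N I2 c2)" "t \<in> N I1 c1 \<inter> N I2 c2"
    using N[OF g(1) tD(1)] N[OF g(2) tD(2)] tD \<eta>(1) z12 by (auto simp: N_def)
  then obtain r where r: "r > 0" "ball t r \<subseteq> N I1 c1 \<inter> N I2 c2" using open_contains_ball by blast
  have d0: "z c1 s - z c2 s = 0" if s: "s \<in> ball t r" for s
  proof (rule linear_bound_imp_zero[where d = "\<lambda>s. z c1 s - z c2 s" and K = "ball t r" and d' = "\<lambda>s. F (z c1 s) - F (z c2 s)" and L = "1 + B" and ?t0.0 = t])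
    show "is_interval (ball t r)" by (simp add: is_interval_ball_real)
    fix s assume "s \<in> ball t r"
    then have s: "s \<in> D I1 c1" "s \<in> D I2 c2" "dist (z c1 t) (z c1 s) < \<eta>" "dist (z c1 t) (z c2 s) < \<eta>"
      using r(2) by (auto simp: N_def)
    show "((\<lambda>s. z c1 s - z c2 s) has_vector_derivative F (z c1 s) - F (z c2 s)) (at s within ball t r)"
      by (rule has_vector_derivative_at_within[OF has_vector_derivative_diff[OF zd(1)[OF g(1) s(1)] zd(1)[OF g(2) s(2)]]])
    let ?d = "z c1 s - z c2 s"
    have "norm (F (z c1 s) - F (z c2 s)) \<le> norm (frechet_derivative F (at (z c1 t)) ?d)
        + norm (F (z c1 s) - F (z c2 s) - frechet_derivative F (at (z c1 t)) ?d)"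
      by (rule norm_triangle_sub)
    then show "norm (F (z c1 s) - F (z c2 s)) \<le> (1 + B) * norm ?d"
      using B(2)[of ?d] \<eta>(2)[OF singletonI s(4) s(3)] by (simp add: algebra_simps)
  qed (use r(1) s z12 in auto)
  have "velocity A I1 c1 s = velocity A I2 c2 s" if s: "s \<in> ball t r" for s
  proof -
    have sD: "s \<in> D I1 c1" "s \<in> D I2 c2" using s r(2) by (auto simp: N_def)
    have "z c1 s = z c2 s" using d0[OF s] by simp
    then have e: "chart_map \<phi> (c1 s) = chart_map \<phi> (c2 s)"
      "vector_derivative (\<lambda>s. chart_map \<phi> (c1 s)) (at s) = vector_derivative (\<lambda>s. chart_map \<phi> (c2 s)) (at s)"
      by (auto simp: z_def)
    have "c1 s = c2 s" using inj_onD[OF chart_inj[OF atlas \<phi>(1)] e(1)] sD by (simp add: D_def)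
    then show ?thesis using velocity_eqI[OF g _ _ _ \<phi>(1) _ e(2)] sD by (simp add: D_def)
  qed
  moreover have "s \<in> I1 \<and> s \<in> I2" if "s \<in> ball t r" for s
    using that r(2) by (auto simp: N_def D_def)
  ultimately show thesis using that r(1) by blast
qed

text \<open>Equality of the velocities propagates over the connected set \<open>K\<close>. It is an
  open condition by the local uniqueness. So is its failure: distinct base points are separated by
  the Hausdorff property, and distinct velocities at one base point by continuity of the components
  in a chart.\<close>

lemma geodesic_unique:
  assumes g: "geodesic_on A S I1 c1" "geodesic_on A S I2 c2"
    and K: "open K" "connected K" "K \<subseteq> I1" "K \<subseteq> I2" and t0: "t0 \<in> K" and t: "t \<in> K"
    and eq: "velocity A I1 c1 t0 = velocity A I2 c2 t0"
  shows "velocity A I1 c1 t = velocity A I2 c2 t"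
proof (rule connected_induction_simple[OF K(2) t0 t, where P = "\<lambda>t. velocity A I1 c1 t = velocity A I2 c2 t", OF eq])
  let ?P = "\<lambda>t. velocity A I1 c1 t = velocity A I2 c2 t"
  fix a assume a: "a \<in> K"
  have "\<exists>T. open T \<and> T \<subseteq> K \<and> a \<in> T \<and> (\<forall>x\<in>T. \<forall>y\<in>T. ?P x \<longrightarrow> ?P y)"
  proof (cases "?P a")
    case True
    obtain r where r: "r > 0" "\<And>s. s \<in> ball a r \<Longrightarrow> s \<in> I1 \<and> s \<in> I2 \<and> ?P s"
      using geodesic_unique_near[OF g _ _ True] a K by blast
    then show ?thesis using a K(1) by (intro exI[of _ "K \<inter> ball a r"]) (auto intro: open_Int)
  next
    case False
    have "\<exists>T. open T \<and> T \<subseteq> K \<and> a \<in> T \<and> (\<forall>x\<in>T. \<not> ?P x)"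
    proof (cases "c1 a = c2 a")
      case eq: False
      have aI: "a \<in> I1" "a \<in> I2" using a K by auto
      have tops: "c1 a \<in> topspace (atlas_topology A)" "c2 a \<in> topspace (atlas_topology A)"
      proof -
        have "atlas_carrier A \<subseteq> topspace (atlas_topology A)"
          by (rule openin_subset[OF openin_atlas_carrier[OF atlas]])
        moreover have "c1 a \<in> atlas_carrier A" "c2 a \<in> atlas_carrier A"
          using geodesic_onD(3)[OF g(1)] geodesic_onD(3)[OF g(2)] aI unfolding smooth_map_open_atlas by auto
        ultimately show "c1 a \<in> topspace (atlas_topology A)" "c2 a \<in> topspace (atlas_topology A)" by auto
      qed
      obtain U1 U2 where U: "openin (atlas_topology A) U1" "openin (atlas_topology A) U2" "c1 a \<in> U1" "c2 a \<in> U2" "disjnt U1 U2"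
        using hausdorff tops eq unfolding Hausdorff_space_def by blast
      have o: "open {s \<in> I1. c1 s \<in> U1}" "open {s \<in> I2. c2 s \<in> U2}"
        by (rule smooth_map_open_preimage[OF atlas geodesic_onD(1)[OF g(1)] geodesic_onD(3)[OF g(1)] U(1)],
            rule smooth_map_open_preimage[OF atlas geodesic_onD(1)[OF g(2)] geodesic_onD(3)[OF g(2)] U(2)])
      have "\<not> ?P s" if "c1 s \<in> U1" "c2 s \<in> U2" for s
      proof
        assume "?P s"
        from arg_cong[OF this, of fst] have "c1 s = c2 s" by (simp add: fst_velocity_geodesic)
        then show False using that U(5) by (auto simp: disjnt_def)
      qed
      then show ?thesis using a aI U o K(1)
        by (intro exI[of _ "K \<inter> ({s \<in> I1. c1 s \<in> U1} \<inter> {s \<in> I2. c2 s \<in> U2})"]) (auto intro: open_Int)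
    next
      case eq: True
      have aI: "a \<in> I1" "a \<in> I2" using a K by auto
      obtain \<phi> where \<phi>: "\<phi> \<in> A" "c1 a \<in> chart_dom \<phi>"
        using curve_chart_exists[OF atlas geodesic_onD(1)[OF g(1)] geodesic_onD(3)[OF g(1)] aI(1)] by blast
      define y where "y = (\<lambda>c s. vector_derivative (\<lambda>s. chart_map \<phi> (c s)) (at s))"
      have ya: "y c1 a \<noteq> y c2 a"
        using velocity_eqI[OF g aI eq \<phi>(1)] False \<phi>(2) eq by (auto simp: y_def)
      let ?D = "K \<inter> ({s \<in> I1. c1 s \<in> chart_dom \<phi>} \<inter> {s \<in> I2. c2 s \<in> chart_dom \<phi>})"
      have D: "open ?D"
        using K(1) curve_chart(1)[OF atlas geodesic_onD(1)[OF g(1)] geodesic_onD(3)[OF g(1)] \<phi>(1)]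
          curve_chart(1)[OF atlas geodesic_onD(1)[OF g(2)] geodesic_onD(3)[OF g(2)] \<phi>(1)] by (intro open_Int)
      have yc: "continuous_on ?D (\<lambda>s. y c1 s - y c2 s)"
      proof (intro continuous_at_imp_continuous_on ballI)
        fix s assume s: "s \<in> ?D"
        then show "continuous (at s) (\<lambda>s. y c1 s - y c2 s)" unfolding y_def
          by (intro continuous_diff has_vector_derivative_continuous[OF geodesic_coordinates(2)[OF g(1) \<phi>(1)]]
              has_vector_derivative_continuous[OF geodesic_coordinates(2)[OF g(2) \<phi>(1)]]) auto
      qed
      have oT: "open (?D \<inter> (\<lambda>s. y c1 s - y c2 s) -` (- {0}))"
        by (rule continuous_open_preimage[OF yc D]) auto
      have "\<not> ?P s" if s: "s \<in> ?D" "y c1 s - y c2 s \<noteq> 0" for s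
      proof
        assume *: "?P s"
        have "y c1 s = y c2 s"
          using velocity_component_geodesic[OF g(1) \<phi>(1), of s] velocity_component_geodesic[OF g(2) \<phi>(1), of s] s(1) *
          by (simp add: y_def)
        then show False using s(2) by simp
      qed
      then show ?thesis using oT a aI \<phi> eq ya
        by (intro exI[of _ "?D \<inter> (\<lambda>s. y c1 s - y c2 s) -` (- {0})"]) auto
    qed
    then show ?thesis by blast
  qed
  then show "\<exists>T. openin (top_of_set K) T \<and> a \<in> T \<and> (\<forall>x\<in>T. \<forall>y\<in>T. ?P x \<longrightarrow> ?P y)"
    using openin_open_eq[OF K(1)] by blast
qed

subsection \<open>Families of geodesics\<close>

text \<open>The duration \<delta> and the set \<open>N\<close> of initial data depend on
  \<open>z0\<close> only, while the initial time \<open>t1\<close> and the family \<open>Z\<close>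
  of initial data are free. The equation is autonomous, so \<open>t1\<close> is a mere shift of
  time. This uniformity is what the continuation of families rests on.\<close>

lemma local_geodesic_flow:
  assumes \<phi>: "\<phi> \<in> A" and z0: "z0 \<in> phase_domain \<phi>"
  obtains \<delta> N where "\<delta> > 0" "open N" "z0 \<in> N" "N \<subseteq> phase_domain \<phi>"
    "\<And>(B :: 's::euclidean_space set) Z t1. open B \<Longrightarrow> smooth_on B Z \<Longrightarrow> Z ` B \<subseteq> N \<Longrightarrow>
      \<exists>W. smooth_map (open_atlas ({t1-\<delta><..<t1+\<delta>} \<times> B)) A W \<and>
        (\<forall>s\<in>B. geodesic_on A S {t1-\<delta><..<t1+\<delta>} (\<lambda>t. W (t, s)) \<and>
          W (t1, s) \<in> chart_dom \<phi> \<and> chart_map \<phi> (W (t1, s)) = fst (Z s) \<and>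
          vector_derivative (\<lambda>t. chart_map \<phi> (W (t, s))) (at t1) = snd (Z s))"
proof -
  define F where "F = (\<lambda>z. (snd z, H \<phi> z))"
  let ?P = "phase_domain \<phi>"
  have P: "open ?P" by (rule open_phase_domain[OF \<phi>])
  have F: "smooth_on ?P F" unfolding F_def
    by (rule smooth_on_Pair[OF P smooth_on_linear[OF bounded_linear_snd P] acceleration_smooth[OF \<phi>]])
  obtain \<delta> N \<Psi> where fl: "\<delta> > 0" "open N" "z0 \<in> N" "N \<subseteq> ?P" "smooth_on ({-\<delta><..<\<delta>} \<times> N) \<Psi>"
    "\<And>t z. \<bar>t\<bar> < \<delta> \<Longrightarrow> z \<in> N \<Longrightarrow> \<Psi> (t, z) \<in> ?P"
    "\<And>z. z \<in> N \<Longrightarrow> \<Psi> (0, z) = z"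
    "\<And>t z. \<bar>t\<bar> < \<delta> \<Longrightarrow> z \<in> N \<Longrightarrow> ((\<lambda>t. \<Psi> (t, z)) has_vector_derivative F (\<Psi> (t, z))) (at t)"
    using smooth_local_flow[OF P F z0] by blast
  show thesis
  proof (rule that[OF fl(1-4)])
    fix B :: "'s set" and Z and t1 :: real
    assume B: "open B" and Z: "smooth_on B Z" "Z ` B \<subseteq> N"
    let ?I = "{t1-\<delta><..<t1+\<delta>}"
    let ?D = "?I \<times> B"
    have D: "open ?D" using B by (simp add: open_Times)
    define Q where "Q = (\<lambda>(t, s). \<Psi> (t - t1, Z s))"
    have QI: "\<bar>t - t1\<bar> < \<delta>" if "t \<in> ?I" for t using that by auto
    have ZN: "Z s \<in> N" if "s \<in> B" for s using that Z by blast
    have Qs: "smooth_on ?D Q"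
    proof -
      have f: "smooth_on ?D (\<lambda>p. fst p - t1)"
        by (rule smooth_on_diff[OF D smooth_on_linear[OF bounded_linear_fst D] smooth_on_const[OF D]])
      have s: "smooth_on ?D (\<lambda>p. Z (snd p))"
        by (rule smooth_on_compose[OF D B _ smooth_on_linear[OF bounded_linear_snd D] Z(1)]) auto
      have o: "open ({-\<delta><..<\<delta>} \<times> N)" using fl(2) by (simp add: open_Times)
      show ?thesis unfolding Q_def case_prod_beta
        by (rule smooth_on_compose[OF D o _ smooth_on_Pair[OF D f s] fl(5)]) (use ZN in auto)
    qed
    have QP: "Q (t, s) \<in> ?P" if "t \<in> ?I" "s \<in> B" for t s
      using fl(6)[OF QI[OF that(1)] ZN[OF that(2)]] by (simp add: Q_def)
    have Qd: "((\<lambda>t. Q (t, s)) has_vector_derivative (snd (Q (t, s)), H \<phi> (Q (t, s)))) (at t)" if "t \<in> ?I" "s \<in> B" for t s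
    proof -
      have "((\<lambda>t. t - t1) has_vector_derivative 1 - 0) (at t)"
        by (rule has_vector_derivative_diff[OF has_vector_derivative_id has_vector_derivative_const])
      from vector_diff_chain_at[OF this fl(8)[OF QI[OF that(1)] ZN[OF that(2)]]]
      show ?thesis by (simp add: Q_def comp_def F_def)
    qed
    define W where "W = (\<lambda>p. chart_inv \<phi> (fst (Q p)))"
    have Wd: "W p \<in> chart_dom \<phi>" and Wm: "chart_map \<phi> (W p) = fst (Q p)" if "p \<in> ?D" for p
    proof -
      have "fst (Q p) \<in> chart_map \<phi> ` chart_dom \<phi>"
        using QP[of "fst p" "snd p"] that by (auto simp: phase_domain_def)
      then show "W p \<in> chart_dom \<phi>" "chart_map \<phi> (W p) = fst (Q p)"
        using chart_inv_in[OF atlas] chart_map_inv[OF atlas] by (simp_all add: W_def)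
    qed
    have "smooth_on ?D (\<lambda>p. chart_map \<phi> (W p))"
      using smooth_on_fst[OF D Qs] smooth_on_cong[of ?D "\<lambda>p. chart_map \<phi> (W p)" "\<lambda>p. fst (Q p)"] Wm by simp
    then have Wsm: "smooth_map (open_atlas ?D) A W"
      using D \<phi> Wd by (intro smooth_map_open_atlasI[OF atlas D] exI[of _ ?D] exI[of _ \<phi>]) auto
    have vd: "vector_derivative (\<lambda>t. chart_map \<phi> (W (t, s))) (at t) = snd (Q (t, s))" if "t \<in> ?I" "s \<in> B" for t s
    proof (rule vector_derivative_at)
      have "((\<lambda>t. fst (Q (t, s))) has_vector_derivative snd (Q (t, s))) (at t)"
        using bounded_linear.has_vector_derivative[OF bounded_linear_fst Qd[OF that]] by simp
      then show "((\<lambda>t. chart_map \<phi> (W (t, s))) has_vector_derivative snd (Q (t, s))) (at t)"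
        by (rule has_vector_derivative_transform_within_open[OF _ open_greaterThanLessThan that(1)])
          (use Wm that(2) in auto)
    qed
    have "geodesic_on A S ?I (\<lambda>t. W (t, s))" if s: "s \<in> B" for s
    proof (rule geodesic_onI)
      show "open ?I" by simp
      show "is_interval ?I" by (simp add: is_interval_oo)
      have "smooth_on ?I (\<lambda>t. (t, s))"
        by (rule smooth_on_Pair[OF _ smooth_on_ident smooth_on_const]) auto
      from smooth_map_open_atlas_compose[OF atlas Wsm open_greaterThanLessThan this]
      show "smooth_map (open_atlas ?I) A (\<lambda>t. W (t, s))"
        using s by auto
      fix t assume t: "t \<in> ?I"
      have "((\<lambda>t. snd (Q (t, s))) has_vector_derivative H \<phi> (Q (t, s))) (at t)"
        using bounded_linear.has_vector_derivative[OF bounded_linear_snd Qd[OF t s]] by simp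
      then have "((\<lambda>t. vector_derivative (\<lambda>t. chart_map \<phi> (W (t, s))) (at t)) has_vector_derivative H \<phi> (Q (t, s))) (at t)"
        by (rule has_vector_derivative_transform_within_open[OF _ open_greaterThanLessThan t]) (use vd s in auto)
      note d = this
      have q: "Q (t, s) = (chart_map \<phi> (W (t, s)), vector_derivative (\<lambda>t. chart_map \<phi> (W (t, s))) (at t))"
        using vd[OF t s] Wm[of "(t, s)"] t s by (simp add: prod_eq_iff)
      have nz: "snd (Q (t, s)) \<noteq> 0" using QP[OF t s] by (auto simp: phase_domain_def)
      show "\<exists>\<phi>\<in>A. W (t, s) \<in> chart_dom \<phi> \<and> vector_derivative (\<lambda>t. chart_map \<phi> (W (t, s))) (at t) \<noteq> 0 \<and>
          ((\<lambda>t. vector_derivative (\<lambda>t. chart_map \<phi> (W (t, s))) (at t)) has_vector_derivative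
            H \<phi> (chart_map \<phi> (W (t, s)), vector_derivative (\<lambda>t. chart_map \<phi> (W (t, s))) (at t))) (at t)"
      proof (intro bexI[OF _ \<phi>] conjI)
        show "W (t, s) \<in> chart_dom \<phi>" using Wd[of "(t, s)"] t s by simp
        show "vector_derivative (\<lambda>t. chart_map \<phi> (W (t, s))) (at t) \<noteq> 0" using nz vd[OF t s] by simp
      qed (simp only: q[symmetric] d)
    qed
    moreover have "Q (t1, s) = Z s" if "s \<in> B" for s using fl(7)[OF ZN[OF that]] by (simp add: Q_def)
    ultimately show "\<exists>W. smooth_map (open_atlas ?D) A W \<and>
        (\<forall>s\<in>B. geodesic_on A S ?I (\<lambda>t. W (t, s)) \<and> W (t1, s) \<in> chart_dom \<phi> \<and> chart_map \<phi> (W (t1, s)) = fst (Z s) \<and>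
          vector_derivative (\<lambda>t. chart_map \<phi> (W (t, s))) (at t1) = snd (Z s))"
      using Wsm Wd Wm vd fl(1) by (intro exI[of _ W]) auto
  qed
qed

definition geodesic_family :: "real set \<Rightarrow> 's::euclidean_space set \<Rightarrow> (real \<times> 's \<Rightarrow> 'a) \<Rightarrow> bool" where
  "geodesic_family I B V \<longleftrightarrow> open I \<and> is_interval I \<and> open B \<and> smooth_map (open_atlas (I \<times> B)) A V \<and>
    (\<forall>s\<in>B. geodesic_on A S I (\<lambda>t. V (t, s)))"

text \<open>Positions and velocities of the family at \<open>t1\<close> serve as initial data for
  the flow near \<open>T\<close>. They are close to those of \<open>c\<close> only for small
  parameters, which is why the parameter set shrinks; on the overlap, old and new curves agree by
  uniqueness.\<close>

lemma geodesic_family_extend_local: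
  assumes c: "geodesic_on A S I0 c" and T: "T \<in> I0"
  obtains \<delta> where "\<delta> > 0" "{T-\<delta><..<T+\<delta>} \<subseteq> I0"
    "\<And>I (B :: 's::euclidean_space set) V t1. geodesic_family I B V \<Longrightarrow> 0 \<in> B \<Longrightarrow> I \<subseteq> I0 \<Longrightarrow>
      (\<And>t. t \<in> I \<Longrightarrow> V (t, 0) = c t) \<Longrightarrow> t1 \<in> I \<Longrightarrow> t1 \<in> {T-\<delta><..<T+\<delta>} \<Longrightarrow>
      \<exists>B' V'. 0 \<in> B' \<and> B' \<subseteq> B \<and> geodesic_family (I \<union> {T-\<delta><..<T+\<delta>}) B' V' \<and>
        (\<forall>t\<in>I. \<forall>s\<in>B'. V' (t, s) = V (t, s)) \<and> (\<forall>t \<in> I \<union> {T-\<delta><..<T+\<delta>}. V' (t, 0) = c t)"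
proof -
  note cI = geodesic_onD(1)[OF c] and cs = geodesic_onD(3)[OF c]
  obtain \<phi> where \<phi>: "\<phi> \<in> A" "c T \<in> chart_dom \<phi>" using curve_chart_exists[OF atlas cI cs T] by blast
  define z where "z = (\<lambda>t. (chart_map \<phi> (c t), vector_derivative (\<lambda>s. chart_map \<phi> (c s)) (at t)))"
  let ?D = "{t \<in> I0. c t \<in> chart_dom \<phi>}"
  have D: "open ?D" by (rule curve_chart(1)[OF atlas cI cs \<phi>(1)])
  note gc = geodesic_coordinates[OF c \<phi>(1)]
  have "z T \<in> phase_domain \<phi>" using gc(3)[OF T \<phi>(2)] by (simp add: z_def)
  from local_geodesic_flow[where 's = 's, OF \<phi>(1) this]
  obtain \<delta>1 N where fl: "\<delta>1 > 0" "open N" "z T \<in> N" "N \<subseteq> phase_domain \<phi>"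
    "\<And>(B :: 's set) Z t1. open B \<Longrightarrow> smooth_on B Z \<Longrightarrow> Z ` B \<subseteq> N \<Longrightarrow>
      \<exists>W. smooth_map (open_atlas ({t1-\<delta>1<..<t1+\<delta>1} \<times> B)) A W \<and>
        (\<forall>s\<in>B. geodesic_on A S {t1-\<delta>1<..<t1+\<delta>1} (\<lambda>t. W (t, s)) \<and>
          W (t1, s) \<in> chart_dom \<phi> \<and> chart_map \<phi> (W (t1, s)) = fst (Z s) \<and>
          vector_derivative (\<lambda>t. chart_map \<phi> (W (t, s))) (at t1) = snd (Z s))"
    by blast
  have zc: "continuous_on ?D z" unfolding z_def
    by (intro continuous_on_Pair continuous_at_imp_continuous_on ballI)
      (use has_vector_derivative_continuous[OF gc(1)] has_vector_derivative_continuous[OF gc(2)] in auto)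
  have "open (?D \<inter> z -` N)" by (rule continuous_open_preimage[OF zc D fl(2)])
  moreover have "T \<in> ?D \<inter> z -` N" using T \<phi> fl(3) by simp
  ultimately obtain r where r: "r > 0" "ball T r \<subseteq> ?D \<inter> z -` N" using open_contains_ball by blast
  \<comment> \<open>With half the flow duration, the interval around \<open>T\<close> lies in the
    interval of radius \<open>\<delta>1\<close> around any of its points, so every \<open>t1\<close>
    in it can serve as starting time.\<close>
  define \<delta> where "\<delta> = min r (\<delta>1 / 2)"
  let ?J = "{T-\<delta><..<T+\<delta>}"
  have \<delta>: "\<delta> > 0" "\<delta> \<le> \<delta>1 / 2" using r(1) fl(1) by (auto simp: \<delta>_def)
  have J: "t \<in> ?D" "z t \<in> N" if "t \<in> ?J" for t
  proof -
    have "t \<in> ball T r" using that by (auto simp: \<delta>_def dist_real_def)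
    then show "t \<in> ?D" "z t \<in> N" using r(2) by auto
  qed
  show thesis
  proof (rule that[OF \<delta>(1)])
    show "?J \<subseteq> I0" using J by auto
    fix I and B :: "'s set" and V t1
    assume V: "geodesic_family I B V" and B: "0 \<in> B" and I: "I \<subseteq> I0" and Vc: "\<And>t. t \<in> I \<Longrightarrow> V (t, 0) = c t"
      and t1: "t1 \<in> I" "t1 \<in> ?J"
    have Vo: "open I" "is_interval I" "open B" "smooth_map (open_atlas (I \<times> B)) A V"
      and Vg: "\<And>s. s \<in> B \<Longrightarrow> geodesic_on A S I (\<lambda>t. V (t, s))"
      using V by (auto simp: geodesic_family_def)
    let ?E = "{p \<in> I \<times> B. V p \<in> chart_dom \<phi>}"
    let ?f = "\<lambda>p. chart_map \<phi> (V p)"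
    have E: "open ?E" "smooth_on ?E ?f"
      using Vo(4) \<phi>(1) by (auto simp: smooth_map_open_atlas)
    define B1 where "B1 = B \<inter> (\<lambda>s. (t1, s)) -` ?E"
    have B1: "open B1" unfolding B1_def
      by (rule continuous_open_preimage[OF _ Vo(3) E(1)]) (intro continuous_intros)
    have B1E: "(t1, s) \<in> ?E" if "s \<in> B1" for s using that by (simp add: B1_def)
    have ism: "smooth_on B1 (\<lambda>s. (t1, s))"
      by (rule smooth_on_Pair[OF B1 smooth_on_const[OF B1] smooth_on_ident[OF B1]])
    \<comment> \<open>The velocity is written as the total derivative in direction
      \<open>(1, 0)\<close>, not as the derivative of a slice, because its smooth dependence on
      \<open>s\<close> is then immediate.\<close>
    define Z where "Z = (\<lambda>s. (?f (t1, s), frechet_derivative ?f (at (t1, s)) (1, 0)))"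
    have Z: "smooth_on B1 Z" unfolding Z_def
      by (rule smooth_on_Pair[OF B1 smooth_on_compose[OF B1 E(1) _ ism E(2)]
            smooth_on_derivative2[OF E(2,1) B1 ism smooth_on_const[OF B1]]]) (use B1E in auto)
    have vdZ: "vector_derivative (\<lambda>t. chart_map \<phi> (V (t, s))) (at t1) = snd (Z s)" if "s \<in> B1" for s
    proof -
      have "((\<lambda>t. (t, s)) has_derivative (\<lambda>\<tau>. (\<tau>, 0))) (at t1)"
        by (rule has_derivative_Pair[OF has_derivative_ident has_derivative_const])
      from has_derivative_compose[OF this smooth_on_has_derivative[OF E(2,1) B1E[OF that]]]
      have "((\<lambda>t. ?f (t, s)) has_derivative (\<lambda>\<tau>. frechet_derivative ?f (at (t1, s)) (\<tau>, 0))) (at t1)" .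
      from vector_derivative_eq_frechet[OF this] show ?thesis by (simp add: Z_def)
    qed
    have Vc1: "V (t1, 0) = c t1" by (rule Vc[OF t1(1)])
    have 0: "0 \<in> B1" using J(1)[OF t1(2)] t1(1) B Vc1 by (simp add: B1_def)
    have vel0: "vector_derivative (\<lambda>t. chart_map \<phi> (V (t, 0))) (at t1) = vector_derivative (\<lambda>t. chart_map \<phi> (c t)) (at t1)"
    proof (rule vector_derivative_at)
      show "((\<lambda>t. chart_map \<phi> (V (t, 0))) has_vector_derivative vector_derivative (\<lambda>t. chart_map \<phi> (c t)) (at t1)) (at t1)"
        by (rule has_vector_derivative_transform_within_open[OF gc(1) Vo(1) t1(1)])
          (use J(1)[OF t1(2)] Vc in auto)
    qed
    have Z0: "Z 0 \<in> N"
    proof -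
      have "Z 0 = z t1" using vdZ[OF 0] vel0 Vc1 by (simp add: prod_eq_iff z_def) (simp add: Z_def Vc1)
      then show ?thesis using J(2)[OF t1(2)] by simp
    qed
    \<comment> \<open>Parameters whose initial data lie in \<open>N\<close>. The parameter 0 is one
      of them, since there the data are those of \<open>c\<close>.\<close>
    define B' where "B' = B1 \<inter> Z -` N"
    have B': "open B'" unfolding B'_def
      by (rule continuous_open_preimage[OF smooth_on_imp_continuous_on[OF Z] B1 fl(2)])
    have B'B: "B' \<subseteq> B1" "B' \<subseteq> B" "0 \<in> B'" "Z ` B' \<subseteq> N" using 0 Z0 by (auto simp: B'_def B1_def)
    let ?I1 = "{t1-\<delta>1<..<t1+\<delta>1}"
    obtain W where W: "smooth_map (open_atlas (?I1 \<times> B')) A W"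
      "\<And>s. s \<in> B' \<Longrightarrow> geodesic_on A S ?I1 (\<lambda>t. W (t, s))"
      "\<And>s. s \<in> B' \<Longrightarrow> W (t1, s) \<in> chart_dom \<phi>"
      "\<And>s. s \<in> B' \<Longrightarrow> chart_map \<phi> (W (t1, s)) = fst (Z s)"
      "\<And>s. s \<in> B' \<Longrightarrow> vector_derivative (\<lambda>t. chart_map \<phi> (W (t, s))) (at t1) = snd (Z s)"
      using fl(5)[OF B' smooth_on_subset[OF Z B1 B' B'B(1)] B'B(4)] by blast
    have JI1: "?J \<subseteq> ?I1"
    proof
      fix t assume "t \<in> ?J"
      then show "t \<in> ?I1" using t1(2) \<delta>(2) unfolding greaterThanLessThan_iff by linarith
    qed
    have t1I1: "t1 \<in> ?I1" using fl(1) by simp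
    have velW: "velocity A I (\<lambda>t. V (t, s)) t1 = velocity A ?I1 (\<lambda>t. W (t, s)) t1" if s: "s \<in> B'" for s
    proof (rule velocity_eqI[OF Vg W(2)[OF s] t1(1) t1I1 _ \<phi>(1) W(3)[OF s]])
      show "s \<in> B" using s B'B by blast
      have sB1: "s \<in> B1" using s B'B by blast
      have "chart_map \<phi> (V (t1, s)) = chart_map \<phi> (W (t1, s))" using W(4)[OF s] by (simp add: Z_def)
      then show "V (t1, s) = W (t1, s)"
        using inj_onD[OF chart_inj[OF atlas \<phi>(1)]] B1E[OF sB1] W(3)[OF s] by blast
      show "vector_derivative (\<lambda>t. chart_map \<phi> (V (t, s))) (at t1) = vector_derivative (\<lambda>t. chart_map \<phi> (W (t, s))) (at t1)"
        using vdZ[OF sB1] W(5)[OF s] by simp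
    qed
    \<comment> \<open>The overlap of two intervals is connected and contains \<open>t1\<close>,
      where the velocities agree; so the gluing is well defined on all of it.\<close>
    have VW: "V (t, s) = W (t, s)" if "t \<in> I" "t \<in> ?I1" "s \<in> B'" for t s
    proof -
      have "is_interval (I \<inter> ?I1)" by (rule is_interval_Int[OF Vo(2) is_interval_oo])
      then have con: "connected (I \<inter> ?I1)" by (simp add: is_interval_connected_1)
      have "s \<in> B" using that B'B by blast
      from geodesic_unique[OF Vg[OF this] W(2)[OF that(3)] open_Int[OF Vo(1) open_greaterThanLessThan] con Int_lower1 Int_lower2, of t1 t]
      have "velocity A I (\<lambda>t. V (t, s)) t = velocity A ?I1 (\<lambda>t. W (t, s)) t"
        using that t1 t1I1 velW by blast
      from arg_cong[OF this, of fst] show ?thesis by (simp add: fst_velocity_geodesic)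
    qed
    have Wc: "W (t, 0) = c t" if t: "t \<in> ?J" for t
    proof -
      have con: "connected ?J" by (simp add: is_interval_oo is_interval_connected_1[symmetric])
      have "velocity A ?I1 (\<lambda>t. W (t, 0)) t1 = velocity A I0 c t1"
      proof (rule velocity_eqI[OF W(2)[OF B'B(3)] c t1I1 _ _ \<phi>(1)])
        show "t1 \<in> I0" "c t1 \<in> chart_dom \<phi>" using J(1)[OF t1(2)] by auto
        show "W (t1, 0) = c t1" using VW[OF t1(1) t1I1 B'B(3)] Vc1 by simp
        show "vector_derivative (\<lambda>t. chart_map \<phi> (W (t, 0))) (at t1) = vector_derivative (\<lambda>t. chart_map \<phi> (c t)) (at t1)"
          using W(5)[OF B'B(3)] vdZ[OF 0] vel0 by simp
      qed
      from geodesic_unique[OF W(2)[OF B'B(3)] c open_greaterThanLessThan con JI1 _ t1(2) t this]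
      have "velocity A ?I1 (\<lambda>t. W (t, 0)) t = velocity A I0 c t" using J(1) by blast
      from arg_cong[OF this, of fst] show ?thesis by (simp add: fst_velocity_geodesic)
    qed
    define V' where "V' = (\<lambda>p. if fst p \<in> I then V p else W p)"
    have V'V: "V' (t, s) = V (t, s)" if "t \<in> I" for t s using that by (simp add: V'_def)
    have V'W: "V' (t, s) = W (t, s)" if "t \<in> ?J" "s \<in> B'" for t s
      using VW[of t s] that JI1 by (auto simp: V'_def)
    have oIJ: "open (I \<union> ?J)" using Vo(1) by (intro open_Un) auto
    have "connected (I \<union> ?J)"
      using Vo(2) t1 by (intro connected_Un) (auto simp: is_interval_connected_1[symmetric] is_interval_oo)
    then have iIJ: "is_interval (I \<union> ?J)" by (simp add: is_interval_connected_1)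
    have "smooth_map (open_atlas ((I \<union> ?J) \<times> B')) A V'"
    proof (rule smooth_map_local[OF atlas])
      show "open ((I \<union> ?J) \<times> B')" using oIJ B' by (rule open_Times)
      fix p assume p: "p \<in> (I \<union> ?J) \<times> B'"
      show "\<exists>W' F'. open W' \<and> p \<in> W' \<and> W' \<subseteq> (I \<union> ?J) \<times> B' \<and> smooth_map (open_atlas W') A F' \<and> (\<forall>q\<in>W'. V' q = F' q)"
      proof (cases "fst p \<in> I")
        case True
        have o: "open (I \<times> B')" using Vo(1) B' by (rule open_Times)
        have "smooth_map (open_atlas (I \<times> B')) A V"
          by (rule smooth_map_open_atlas_restrict[OF atlas Vo(4) o]) (use B'B in auto)
        then show ?thesis using p True o V'V by (intro exI[of _ "I \<times> B'"] exI[of _ V]) auto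
      next
        case False
        have o: "open (?J \<times> B')" using open_greaterThanLessThan B' by (rule open_Times)
        have "smooth_map (open_atlas (?J \<times> B')) A W"
          by (rule smooth_map_open_atlas_restrict[OF atlas W(1) o]) (use JI1 in auto)
        then show ?thesis using p False o V'W by (intro exI[of _ "?J \<times> B'"] exI[of _ W]) auto
      qed
    qed
    moreover have "geodesic_on A S (I \<union> ?J) (\<lambda>t. V' (t, s))" if s: "s \<in> B'" for s
    proof (rule geodesic_on_local[OF oIJ iIJ])
      fix t assume t: "t \<in> I \<union> ?J"
      show "\<exists>K c'. t \<in> K \<and> open K \<and> K \<subseteq> I \<union> ?J \<and> (\<exists>J'. K \<subseteq> J' \<and> geodesic_on A S J' c') \<and> (\<forall>q\<in>K. V' (q, s) = c' q)"
      proof (cases "t \<in> I")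
        case True
        have "s \<in> B" using s B'B by blast
        then show ?thesis
          using True Vo(1) Vg V'V by (intro exI[of _ I] exI[of _ "\<lambda>t. V (t, s)"]) auto
      next
        case False
        then show ?thesis
          using t W(2)[OF s] JI1 V'W s open_greaterThanLessThan[of "T-\<delta>" "T+\<delta>"] by (intro exI[of _ ?J] exI[of _ "\<lambda>t. W (t, s)"]) blast
      qed
    qed
    ultimately have "geodesic_family (I \<union> ?J) B' V'"
      using oIJ iIJ B' by (simp add: geodesic_family_def)
    moreover have "V' (t, 0) = c t" if "t \<in> I \<union> ?J" for t
      using that V'V Vc V'W[OF _ B'B(3)] Wc by (cases "t \<in> I") auto
    ultimately show "\<exists>B' V'. 0 \<in> B' \<and> B' \<subseteq> B \<and> geodesic_family (I \<union> ?J) B' V' \<and>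
        (\<forall>t\<in>I. \<forall>s\<in>B'. V' (t, s) = V (t, s)) \<and> (\<forall>t \<in> I \<union> ?J. V' (t, 0) = c t)"
      using B'B V'V by (intro exI[of _ B'] exI[of _ V']) auto
  qed
qed

text \<open>That some extension reaches \<open>T\<close> is a locally constant property of
  \<open>T\<close> by the local continuation, and the interval \<open>I0\<close> is connected. The
  parameter set shrinks with each continuation but keeps 0.\<close>

lemma geodesic_family_extend:
  fixes B :: "'s::euclidean_space set"
  assumes c: "geodesic_on A S I0 c" and V: "geodesic_family I B V" and B: "0 \<in> B" and I: "I \<subseteq> I0"
    and Vc: "\<And>t. t \<in> I \<Longrightarrow> V (t, 0) = c t" and t0: "t0 \<in> I" and T: "T \<in> I0"
  obtains I' B' V' where "I \<subseteq> I'" "I' \<subseteq> I0" "T \<in> I'" "0 \<in> B'" "B' \<subseteq> B" "geodesic_family I' B' V'"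
    "\<And>t s. t \<in> I \<Longrightarrow> s \<in> B' \<Longrightarrow> V' (t, s) = V (t, s)" "\<And>t. t \<in> I' \<Longrightarrow> V' (t, 0) = c t"
proof -
  define P where "P = (\<lambda>T. \<exists>I' B' V'. I \<subseteq> I' \<and> I' \<subseteq> I0 \<and> T \<in> I' \<and> 0 \<in> B' \<and> B' \<subseteq> B \<and> geodesic_family I' B' V' \<and>
    (\<forall>t\<in>I. \<forall>s\<in>B'. V' (t, s) = V (t, s)) \<and> (\<forall>t\<in>I'. V' (t, 0) = c t))"
  have "connected I0" using geodesic_onD(2)[OF c] by (simp add: is_interval_connected_1)
  then have "P T"
  proof (rule connected_induction_simple)
    show "t0 \<in> I0" "T \<in> I0" using t0 I T by auto
    show "P t0" unfolding P_def using I t0 B V Vc by (intro exI[of _ I] exI[of _ B] exI[of _ V]) auto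
    fix a assume a: "a \<in> I0"
    obtain \<delta> where \<delta>: "\<delta> > 0" "{a-\<delta><..<a+\<delta>} \<subseteq> I0"
      "\<And>I (B :: 's set) V t1. geodesic_family I B V \<Longrightarrow> 0 \<in> B \<Longrightarrow> I \<subseteq> I0 \<Longrightarrow>
      (\<And>t. t \<in> I \<Longrightarrow> V (t, 0) = c t) \<Longrightarrow> t1 \<in> I \<Longrightarrow> t1 \<in> {a-\<delta><..<a+\<delta>} \<Longrightarrow>
      \<exists>B' V'. 0 \<in> B' \<and> B' \<subseteq> B \<and> geodesic_family (I \<union> {a-\<delta><..<a+\<delta>}) B' V' \<and>
        (\<forall>t\<in>I. \<forall>s\<in>B'. V' (t, s) = V (t, s)) \<and> (\<forall>t \<in> I \<union> {a-\<delta><..<a+\<delta>}. V' (t, 0) = c t)"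
      using geodesic_family_extend_local[where 's = 's, OF c a] by blast
    let ?J = "{a-\<delta><..<a+\<delta>}"
    have "P y" if x: "x \<in> ?J" "P x" and y: "y \<in> ?J" for x y
    proof -
      obtain I' B' V' where 1: "I \<subseteq> I'" "I' \<subseteq> I0" "x \<in> I'" "0 \<in> B'" "B' \<subseteq> B" "geodesic_family I' B' V'"
        "\<And>t s. t \<in> I \<Longrightarrow> s \<in> B' \<Longrightarrow> V' (t, s) = V (t, s)" "\<And>t. t \<in> I' \<Longrightarrow> V' (t, 0) = c t"
        using x(2) unfolding P_def by blast
      obtain B2 V2 where 2: "0 \<in> B2" "B2 \<subseteq> B'" "geodesic_family (I' \<union> ?J) B2 V2"
        "\<And>t s. t \<in> I' \<Longrightarrow> s \<in> B2 \<Longrightarrow> V2 (t, s) = V' (t, s)" "\<And>t. t \<in> I' \<union> ?J \<Longrightarrow> V2 (t, 0) = c t"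
        using \<delta>(3)[OF 1(6,4,2,8,3) x(1)] by blast
      have V2: "V2 (t, s) = V (t, s)" if "t \<in> I" "s \<in> B2" for t s
      proof -
        have "t \<in> I'" "s \<in> B'" using that 1(1) 2(2) by blast+
        then show ?thesis using 2(4)[of t s] 1(7)[of t s] that by simp
      qed
      show ?thesis unfolding P_def
      proof (intro exI[of _ "I' \<union> ?J"] exI[of _ B2] exI[of _ V2] conjI ballI)
        show "I' \<union> ?J \<subseteq> I0" using 1(2) \<delta>(2) by blast
        show "B2 \<subseteq> B" using 2(2) 1(5) by blast
        show "geodesic_family (I' \<union> ?J) B2 V2" by (rule 2(3))
        show "I \<subseteq> I' \<union> ?J" "y \<in> I' \<union> ?J" using 1(1) y by blast+
        show "0 \<in> B2" by (rule 2(1))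
        show "V2 (t, s) = V (t, s)" if "t \<in> I" "s \<in> B2" for t s by (rule V2[OF that])
        show "V2 (t, 0) = c t" if "t \<in> I' \<union> ?J" for t by (rule 2(5)[OF that])
      qed
    qed
    then show "\<exists>T. openin (top_of_set I0) T \<and> a \<in> T \<and> (\<forall>x\<in>T. \<forall>y\<in>T. P x \<longrightarrow> P y)"
    proof (intro exI[of _ ?J] conjI ballI impI)
      show "openin (top_of_set I0) ?J" using \<delta>(2) by (simp add: openin_open_eq[OF geodesic_onD(1)[OF c]])
      show "a \<in> ?J" using \<delta>(1) by simp
    qed
  qed
  then show thesis using that unfolding P_def by blast
qed

end

subsection \<open>Diffeomorphisms near a compact set\<close>

lemma local_inverse_in_charts:
  fixes V :: "'x::euclidean_space \<Rightarrow> 'a" and A :: "('a, 'e::euclidean_space) chart set"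
  assumes A: "smooth_atlas A" and dim: "DIM('x) = DIM('e)" and V: "smooth_map (open_atlas W) A V" and p: "p \<in> W"
    and \<phi>: "\<phi> \<in> A" "V p \<in> chart_dom \<phi>" and inj: "inj (frechet_derivative (\<lambda>p. chart_map \<phi> (V p)) (at p))"
  obtains U O' g where "open U" "p \<in> U" "U \<subseteq> W" "V ` U \<subseteq> chart_dom \<phi>" "open O'"
    "homeomorphism U O' (\<lambda>p. chart_map \<phi> (V p)) g" "smooth_on O' g"
proof -
  let ?E = "{p \<in> W. V p \<in> chart_dom \<phi>}"
  have E: "open ?E" "smooth_on ?E (\<lambda>p. chart_map \<phi> (V p))" "p \<in> ?E"
    using V \<phi> p by (auto simp: smooth_map_open_atlas)
  obtain U O' g where "open U" "p \<in> U" "U \<subseteq> ?E" "open O'" "homeomorphism U O' (\<lambda>p. chart_map \<phi> (V p)) g" "smooth_on O' g"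
    using smooth_inverse_function_theorem[OF E inj dim] by blast
  then show thesis by (intro that[of U O' g]) auto
qed

lemma homeomorphism_image_open:
  assumes h: "homeomorphism U O' f g" and U': "open U'" "U' \<subseteq> U" and O': "open O'"
  shows "open (f ` U')"
proof -
  have "f ` U' = O' \<inter> g -` U'"
  proof
    show "f ` U' \<subseteq> O' \<inter> g -` U'" using h U'(2) by (auto simp: homeomorphism_def)
    show "O' \<inter> g -` U' \<subseteq> f ` U'"
    proof
      fix y assume "y \<in> O' \<inter> g -` U'"
      then have "y = f (g y)" "g y \<in> U'" using h by (auto simp: homeomorphism_def)
      then show "y \<in> f ` U'" by blast
    qed
  qed
  moreover have "open (O' \<inter> g -` U')"
    using continuous_open_preimage[OF _ O' U'(1)] h by (simp add: homeomorphism_def)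
  ultimately show ?thesis by simp
qed

lemma chart_image_open_change:
  assumes A: "smooth_atlas A" and \<phi>: "\<phi> \<in> A" and \<psi>: "\<psi> \<in> A" and M: "M \<subseteq> chart_dom \<phi> \<inter> chart_dom \<psi>" and o: "open (chart_map \<phi> ` M)"
  shows "open (chart_map \<psi> ` M)"
proof -
  let ?V = "chart_map \<psi> ` (chart_dom \<psi> \<inter> chart_dom \<phi>)"
  have "chart_map \<psi> ` M = ?V \<inter> transition \<psi> \<phi> -` (chart_map \<phi> ` M)"
  proof
    show "chart_map \<psi> ` M \<subseteq> ?V \<inter> transition \<psi> \<phi> -` (chart_map \<phi> ` M)"
      using M transition_map[OF A \<psi>] by auto
    show "?V \<inter> transition \<psi> \<phi> -` (chart_map \<phi> ` M) \<subseteq> chart_map \<psi> ` M"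
    proof
      fix x assume "x \<in> ?V \<inter> transition \<psi> \<phi> -` (chart_map \<phi> ` M)"
      then obtain q m where q: "x = chart_map \<psi> q" "q \<in> chart_dom \<psi>" "q \<in> chart_dom \<phi>" "m \<in> M" "transition \<psi> \<phi> x = chart_map \<phi> m"
        by blast
      have "chart_map \<phi> q = chart_map \<phi> m" using q transition_map[OF A \<psi> q(2)] by simp
      then have "q = m" using inj_onD[OF chart_inj[OF A \<phi>]] q M by blast
      then show "x \<in> chart_map \<psi> ` M" using q by blast
    qed
  qed
  moreover have "open (?V \<inter> transition \<psi> \<phi> -` (chart_map \<phi> ` M))"
    by (rule continuous_open_preimage[OF smooth_on_imp_continuous_on[OF transition_smooth[OF A \<psi> \<phi>]] chart_inter_open[OF A \<psi> \<phi>] o])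
  ultimately show ?thesis by simp
qed

text \<open>Injectivity near \<open>K\<close> is a property of pairs: it holds near each diagonal
  pair by the local inverse and near each other pair of points of \<open>K\<close> by the Hausdorff
  property, so compactness of \<open>K \<times> K\<close> yields a uniform tube. The local inverses
  then make the image open and the inverse smooth. The conclusion covers all open \<open>D\<close>
  in the tube, so that a product box can be chosen afterwards.\<close>

theorem diffeomorphism_near_compact:
  fixes V :: "'x::euclidean_space \<Rightarrow> 'a" and A :: "('a, 'e::euclidean_space) chart set"
  assumes manifold: "smooth_manifold A" and dim: "DIM('x) = DIM('e)"
    and W: "open W" and V: "smooth_map (open_atlas W) A V" and K: "compact K" "K \<subseteq> W" and injK: "inj_on V K"
    and imm: "\<And>p. p \<in> K \<Longrightarrow> \<exists>\<phi>\<in>A. V p \<in> chart_dom \<phi> \<and> inj (frechet_derivative (\<lambda>p. chart_map \<phi> (V p)) (at p))"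
  obtains e where "e > 0" "\<And>D. open D \<Longrightarrow> D \<subseteq> (\<Union>x\<in>K. ball x e) \<Longrightarrow>
    D \<subseteq> W \<and> openin (atlas_topology A) (V ` D) \<and> diffeomorphism (open_atlas D) (restrict_atlas A (V ` D)) V"
proof -
  have A: "smooth_atlas A" and haus: "Hausdorff_space (atlas_topology A)"
    using manifold by (auto simp: smooth_manifold_def)
  \<comment> \<open>The local inverse \<open>g\<close> and its chart are kept as data: they provide
    openness of images and smoothness of the global inverse, besides local injectivity.\<close>
  define locc where "locc = (\<lambda>U \<phi> O' g. \<phi> \<in> A \<and> open U \<and> U \<subseteq> W \<and> V ` U \<subseteq> chart_dom \<phi> \<and> open O' \<and>
    homeomorphism U O' (\<lambda>p. chart_map \<phi> (V p)) g \<and> smooth_on O' g)"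
  define loc where "loc = (\<lambda>U. \<exists>\<phi> O' g. locc U \<phi> O' g)"
  have locK: "\<exists>U. loc U \<and> p \<in> U" if p: "p \<in> K" for p
  proof -
    obtain \<phi> where \<phi>: "\<phi> \<in> A" "V p \<in> chart_dom \<phi>" "inj (frechet_derivative (\<lambda>p. chart_map \<phi> (V p)) (at p))"
      using imm[OF p] by blast
    have "p \<in> W" using p K(2) by blast
    from local_inverse_in_charts[OF A dim V this \<phi>]
    obtain U O' g where U: "open U" "p \<in> U" "U \<subseteq> W" "V ` U \<subseteq> chart_dom \<phi>" "open O'"
      "homeomorphism U O' (\<lambda>p. chart_map \<phi> (V p)) g" "smooth_on O' g" by blast
    have "locc U \<phi> O' g" unfolding locc_def by (intro conjI \<phi>(1) U)
    then have "loc U" unfolding loc_def by blast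
    then show ?thesis using U(2) by (intro exI[of _ U] conjI)
  qed
  have loc_inj: "inj_on V U" if U: "loc U" for U
  proof (rule inj_onI)
    fix p q assume pq: "p \<in> U" "q \<in> U" "V p = V q"
    obtain \<phi> O' g where l: "locc U \<phi> O' g" using U unfolding loc_def by blast
    have h: "homeomorphism U O' (\<lambda>p. chart_map \<phi> (V p)) g" using l by (simp add: locc_def)
    have "g (chart_map \<phi> (V p)) = p" "g (chart_map \<phi> (V q)) = q" using h pq(1,2) by (simp_all add: homeomorphism_def)
    then show "p = q" using pq(3) by metis
  qed
  define G where "G = \<Union> (Collect loc)"
  have loc_open: "open U" and loc_sub: "U \<subseteq> W" if lU: "loc U" for U
  proof -
    obtain \<phi> O' g where "locc U \<phi> O' g" using lU unfolding loc_def by blast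
    then show "open U" "U \<subseteq> W" by (simp_all add: locc_def)
  qed
  have G: "open G" "K \<subseteq> G" "G \<subseteq> W"
  proof -
    show "open G" unfolding G_def using loc_open by (intro open_Union) simp
    show "K \<subseteq> G"
    proof
      fix p assume p: "p \<in> K"
      obtain U where "loc U" "p \<in> U" using locK[OF p] by blast
      then show "p \<in> G" unfolding G_def by blast
    qed
    show "G \<subseteq> W" unfolding G_def using loc_sub by (intro Union_least) simp
  qed
  \<comment> \<open>The pairs of points that do not violate injectivity. Membership in
    \<open>G\<close> is included so that points of the tube also have a local inverse.\<close>
  define R where "R = {x \<in> G \<times> G. V (fst x) = V (snd x) \<longrightarrow> fst x = snd x}"
  have "K \<times> K \<subseteq> interior R"
  proof
    fix x assume "x \<in> K \<times> K"
    then obtain p q where x: "x = (p, q)" "p \<in> K" "q \<in> K" by auto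
    obtain U U' where U: "loc U" "p \<in> U" "loc U'" "q \<in> U'" using locK x by blast
    show "x \<in> interior R"
    proof (cases "p = q")
      case True
      have "U \<times> U \<subseteq> R" using U(1) loc_inj[OF U(1)] by (auto simp: R_def G_def inj_on_def)
      moreover have "open (U \<times> U)" using loc_open[OF U(1)] by (simp add: open_Times)
      moreover have "x \<in> U \<times> U" using x U True by simp
      ultimately show ?thesis by (rule interiorI[rotated 2])
    next
      case False
      then have ne: "V p \<noteq> V q" using inj_onD[OF injK] x by blast
      have "V p \<in> atlas_carrier A" "V q \<in> atlas_carrier A"
        using V K(2) x unfolding smooth_map_open_atlas by auto
      then have "V p \<in> topspace (atlas_topology A)" "V q \<in> topspace (atlas_topology A)"
        using openin_subset[OF openin_atlas_carrier[OF A]] by auto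
      then obtain U1 U2 where T: "openin (atlas_topology A) U1" "openin (atlas_topology A) U2" "V p \<in> U1" "V q \<in> U2" "disjnt U1 U2"
        using haus[unfolded Hausdorff_space_def, rule_format, of "V p" "V q"] ne by blast
      let ?T1 = "U \<inter> {p \<in> W. V p \<in> U1}" and ?T2 = "U' \<inter> {p \<in> W. V p \<in> U2}"
      have "?T1 \<times> ?T2 \<subseteq> R" using U(1,3) T(5) by (auto simp: R_def G_def disjnt_def)
      moreover have "open (?T1 \<times> ?T2)"
        using loc_open U(1,3) smooth_map_open_preimage[OF A W V T(1)] smooth_map_open_preimage[OF A W V T(2)]
        by (intro open_Times open_Int) auto
      moreover have "x \<in> ?T1 \<times> ?T2" using x U T K(2) by auto
      ultimately show ?thesis by (rule interiorI[rotated 2])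
    qed
  qed
  then obtain e where e: "e > 0" "\<And>x y. x \<in> K \<times> K \<Longrightarrow> dist x y \<le> e \<Longrightarrow> y \<in> interior R"
    using compact_neighbourhood[OF compact_Times[OF K(1) K(1)] open_interior] by metis
  \<comment> \<open>Each coordinate may deviate by \<open>e / 2\<close>, because the distance of
    pairs is at most the sum of the distances of their coordinates.\<close>
  have near: "(p, q) \<in> R" if pq: "p \<in> (\<Union>x\<in>K. ball x (e / 2))" "q \<in> (\<Union>x\<in>K. ball x (e / 2))" for p q
  proof -
    obtain x y where xy: "x \<in> K" "y \<in> K" "dist x p < e / 2" "dist y q < e / 2" using pq by auto
    have "dist (x, y) (p, q) \<le> dist x p + dist y q"
      unfolding dist_Pair_Pair by (rule sqrt_sum_squares_le_sum) auto
    then have "(p, q) \<in> interior R" using xy by (intro e(2)[of "(x, y)"]) auto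
    then show ?thesis using interior_subset by blast
  qed
  show thesis
  proof (rule that[of "e / 2"])
    show "e / 2 > 0" using e by simp
    fix D assume D: "open D" "D \<subseteq> (\<Union>x\<in>K. ball x (e / 2))"
    have nearD: "(p, q) \<in> R" if "p \<in> D" "q \<in> D" for p q
      by (rule near[OF subsetD[OF D(2) that(1)] subsetD[OF D(2) that(2)]])
    have DG: "D \<subseteq> G"
    proof
      fix p assume "p \<in> D"
      then show "p \<in> G" using nearD[of p p] by (simp add: R_def)
    qed
    then have DW: "D \<subseteq> W" using G by blast
    have inj: "inj_on V D"
    proof (rule inj_onI)
      fix p q assume "p \<in> D" "q \<in> D" "V p = V q"
      then show "p = q" using nearD[of p q] by (simp add: R_def)
    qed
    \<comment> \<open>The local inverse comes with its own chart \<phi>, whereas openness and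
      smoothness are required in an arbitrary chart \<psi>; the neighbourhood is shrunk until its
      image lies in both chart domains.\<close>
    have piece: "\<exists>U' g O' \<phi>. open U' \<and> p \<in> U' \<and> U' \<subseteq> D \<and> V ` U' \<subseteq> chart_dom \<psi> \<and> open (chart_map \<psi> ` V ` U') \<and>
        \<phi> \<in> A \<and> V ` U' \<subseteq> chart_dom \<phi> \<and> open O' \<and> smooth_on O' g \<and> (\<forall>q\<in>U'. chart_map \<phi> (V q) \<in> O' \<and> g (chart_map \<phi> (V q)) = q)"
      if p: "p \<in> D" "V p \<in> chart_dom \<psi>" and \<psi>: "\<psi> \<in> A" for p \<psi>
    proof -
      obtain U where "loc U" "p \<in> U" using p DG by (auto simp: G_def)
      then obtain \<phi> O' g where l: "locc U \<phi> O' g" unfolding loc_def by blast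
      have U: "\<phi> \<in> A" "open U" "U \<subseteq> W" "V ` U \<subseteq> chart_dom \<phi>" "open O'"
        "homeomorphism U O' (\<lambda>p. chart_map \<phi> (V p)) g" "smooth_on O' g" "p \<in> U" using l \<open>p \<in> U\<close> by (simp_all add: locc_def)
      define U' where "U' = U \<inter> D \<inter> {p \<in> W. V p \<in> chart_dom \<psi>}"
      have "open {p \<in> W. V p \<in> chart_dom \<psi>}" using V \<psi> by (simp add: smooth_map_open_atlas)
      then have U': "open U'" "U' \<subseteq> U" "U' \<subseteq> D" "V ` U' \<subseteq> chart_dom \<psi>" "p \<in> U'"
        using U(2,8) D(1) p DW by (auto simp: U'_def)
      have "open ((\<lambda>p. chart_map \<phi> (V p)) ` U')" by (rule homeomorphism_image_open[OF U(6) U'(1,2) U(5)])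
      then have "open (chart_map \<phi> ` V ` U')" by (simp add: image_image)
      then have 1: "open (chart_map \<psi> ` V ` U')"
        by (rule chart_image_open_change[OF A U(1) \<psi>, rotated]) (use U' U(4) in blast)
      have 2: "\<forall>q\<in>U'. chart_map \<phi> (V q) \<in> O' \<and> g (chart_map \<phi> (V q)) = q"
        using U(6) U'(2) by (auto simp: homeomorphism_def)
      have 3: "V ` U' \<subseteq> chart_dom \<phi>" using U(4) U'(2) by blast
      show ?thesis
        by (intro exI[of _ U'] exI[of _ g] exI[of _ O'] exI[of _ \<phi>] conjI U'(1,3,4,5) U(1,5,7) 1 2 3)
    qed
    have opD: "open (chart_map \<psi> ` (V ` D \<inter> chart_dom \<psi>))" if \<psi>: "\<psi> \<in> A" for \<psi>
    proof (subst open_subopen, intro ballI)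
      fix x assume "x \<in> chart_map \<psi> ` (V ` D \<inter> chart_dom \<psi>)"
      then obtain p where p: "p \<in> D" "V p \<in> chart_dom \<psi>" "x = chart_map \<psi> (V p)" by blast
      obtain U' where U': "p \<in> U'" "U' \<subseteq> D" "V ` U' \<subseteq> chart_dom \<psi>" "open (chart_map \<psi> ` V ` U')"
        using piece[OF p(1,2) \<psi>] by (elim exE) blast
      then show "\<exists>T. open T \<and> x \<in> T \<and> T \<subseteq> chart_map \<psi> ` (V ` D \<inter> chart_dom \<psi>)"
        using p(3) by (intro exI[of _ "chart_map \<psi> ` V ` U'"]) auto
    qed
    have car: "V ` D \<subseteq> atlas_carrier A" using V DW unfolding smooth_map_open_atlas by auto
    have openin: "openin (atlas_topology A) (V ` D)"
      using opD car by (simp add: openin_atlas_topology[OF A])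
    have cD: "atlas_carrier (open_atlas D) = D" by (simp add: atlas_carrier_def open_atlas_def)
    have cR: "atlas_carrier (restrict_atlas A (V ` D)) = V ` D"
      using car by (auto simp: atlas_carrier_def restrict_atlas_def restrict_chart_def)
    have s1: "smooth_map (open_atlas D) (restrict_atlas A (V ` D)) V"
      unfolding smooth_map_open_atlas cR
    proof (intro conjI ballI)
      fix \<kappa> assume "\<kappa> \<in> restrict_atlas A (V ` D)"
      then obtain \<psi> where \<psi>: "\<psi> \<in> A" "\<kappa> = restrict_chart (V ` D) \<psi>" by (auto simp: restrict_atlas_def)
      have eq: "{p \<in> D. V p \<in> chart_dom \<kappa>} = D \<inter> {p \<in> W. V p \<in> chart_dom \<psi>}"
        using DW by (auto simp: \<psi>(2) restrict_chart_def)
      have E: "open {p \<in> W. V p \<in> chart_dom \<psi>}" "smooth_on {p \<in> W. V p \<in> chart_dom \<psi>} (\<lambda>p. chart_map \<psi> (V p))"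
        using V \<psi>(1) by (auto simp: smooth_map_open_atlas)
      show o: "open {p \<in> D. V p \<in> chart_dom \<kappa>}" unfolding eq using D(1) E(1) by (rule open_Int)
      show "smooth_on {p \<in> D. V p \<in> chart_dom \<kappa>} (\<lambda>p. chart_map \<kappa> (V p))"
        using smooth_on_subset[OF E(2,1) o] unfolding eq by (simp add: \<psi>(2) restrict_chart_def)
    qed simp
    have s2: "smooth_map (restrict_atlas A (V ` D)) (open_atlas D) (inv_into D V)"
      unfolding smooth_map_def cD cR
    proof (intro conjI ballI)
      show "inv_into D V ` V ` D \<subseteq> D" using inj by (simp add: inv_into_image_cancel)
      fix \<kappa> \<theta> assume "\<kappa> \<in> restrict_atlas A (V ` D)" and \<theta>: "\<theta> \<in> open_atlas D"
      then obtain \<psi> where \<psi>: "\<psi> \<in> A" "\<kappa> = restrict_chart (V ` D) \<psi>" by (auto simp: restrict_atlas_def)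
      have \<theta>': "\<theta> = Chart D id" using \<theta> by (simp add: open_atlas_def)
      let ?S = "chart_map \<psi> ` (V ` D \<inter> chart_dom \<psi>)"
      have eq: "chart_map \<kappa> ` {p \<in> chart_dom \<kappa>. inv_into D V p \<in> chart_dom \<theta>} = ?S"
        using inj by (auto simp: \<psi>(2) \<theta>' restrict_chart_def inv_into_f_f)
      show "open (chart_map \<kappa> ` {p \<in> chart_dom \<kappa>. inv_into D V p \<in> chart_dom \<theta>})"
        unfolding eq by (rule opD[OF \<psi>(1)])
      show "smooth_on (chart_map \<kappa> ` {p \<in> chart_dom \<kappa>. inv_into D V p \<in> chart_dom \<theta>}) (chart_map \<theta> \<circ> inv_into D V \<circ> chart_inv \<kappa>)"
        unfolding eq
      proof (rule smooth_on_local[OF opD[OF \<psi>(1)]])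
        fix x assume "x \<in> ?S"
        then obtain p where p: "p \<in> D" "V p \<in> chart_dom \<psi>" "x = chart_map \<psi> (V p)" by blast
        obtain U' g O' \<phi> where U': "p \<in> U'" "U' \<subseteq> D" "V ` U' \<subseteq> chart_dom \<psi>" "open (chart_map \<psi> ` V ` U')"
          "\<phi> \<in> A" "V ` U' \<subseteq> chart_dom \<phi>" "open O'" "smooth_on O' g" "\<forall>q\<in>U'. chart_map \<phi> (V q) \<in> O' \<and> g (chart_map \<phi> (V q)) = q"
          using piece[OF p(1,2) \<psi>(1)] by (elim exE) blast
        let ?N = "chart_map \<psi> ` V ` U'"
        have tr: "transition \<psi> \<phi> (chart_map \<psi> (V q)) = chart_map \<phi> (V q)" if "q \<in> U'" for q
          using transition_map[OF A \<psi>(1)] U'(3) that by blast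
        have trs: "smooth_on ?N (transition \<psi> \<phi>)"
          by (rule smooth_on_subset[OF transition_smooth[OF A \<psi>(1) U'(5)] chart_inter_open[OF A \<psi>(1) U'(5)] U'(4)])
            (use U'(3,6) in blast)
        have gtr: "smooth_on ?N (\<lambda>x. g (transition \<psi> \<phi> x))"
          by (rule smooth_on_compose[OF U'(4,7) _ trs U'(8)]) (use tr U'(9) in auto)
        have inv: "(chart_map \<theta> \<circ> inv_into D V \<circ> chart_inv \<kappa>) x = g (transition \<psi> \<phi> x)" if x: "x \<in> ?N" for x
        proof -
          obtain q where q: "q \<in> U'" "x = chart_map \<psi> (V q)" using x by blast
          have "V q \<in> chart_dom \<psi>" "V q \<in> V ` D" using q U' by auto
          moreover have "inj_on (chart_map \<psi>) (chart_dom \<psi> \<inter> V ` D)" using chart_inj[OF A \<psi>(1)] by (rule inj_on_subset) simp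
          ultimately have "chart_inv \<kappa> x = V q"
            using inv_into_f_f[of "chart_map \<psi>" "chart_dom \<psi> \<inter> V ` D" "V q"]
            by (simp add: chart_inv_def \<psi>(2) restrict_chart_def q(2))
          moreover have "inv_into D V (V q) = q" using inv_into_f_f[OF inj] q(1) U'(2) by blast
          ultimately show ?thesis using U'(9) q tr by (simp add: \<theta>')
        qed
        have "smooth_on ?N (chart_map \<theta> \<circ> inv_into D V \<circ> chart_inv \<kappa>)"
          by (rule smooth_on_cong[THEN iffD2, OF inv gtr])
        moreover have "x \<in> ?N" "?N \<subseteq> ?S" using p U' by auto
        ultimately show "\<exists>N. open N \<and> x \<in> N \<and> N \<subseteq> ?S \<and> smooth_on N (chart_map \<theta> \<circ> inv_into D V \<circ> chart_inv \<kappa>)"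
          using U'(4) by (intro exI[of _ ?N] conjI)
      qed
    qed
    have "diffeomorphism (open_atlas D) (restrict_atlas A (V ` D)) V"
      unfolding diffeomorphism_def cD cR using inj s1 s2 by (simp add: inj_on_imp_bij_betw)
    then show "D \<subseteq> W \<and> openin (atlas_topology A) (V ` D) \<and> diffeomorphism (open_atlas D) (restrict_atlas A (V ` D)) V"
      using DW openin by blast
  qed
qed

subsection \<open>Linear equations along an interval\<close>

lemma linear_family_bounded:
  fixes L :: "'x::topological_space \<Rightarrow> 'f::euclidean_space \<Rightarrow> 'g::real_normed_vector"
  assumes "compact K" "\<And>t. t \<in> K \<Longrightarrow> linear (L t)" "\<And>b. continuous_on K (\<lambda>t. L t b)"
  obtains C where "\<And>t w. t \<in> K \<Longrightarrow> norm (L t w) \<le> C * norm w"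
proof -
  have "\<forall>b. \<exists>C. \<forall>t\<in>K. norm (L t b) \<le> C"
    using compact_imp_bounded[OF compact_continuous_image[OF assms(3,1)]] unfolding bounded_iff by blast
  then obtain C where C: "\<And>b t. t \<in> K \<Longrightarrow> norm (L t b) \<le> C b" by metis
  show thesis
  proof (rule that[of "\<Sum>b\<in>Basis. C b"])
    fix t w assume t: "t \<in> K"
    have "L t w = (\<Sum>b\<in>Basis. (w \<bullet> b) *\<^sub>R L t b)" by (rule linear_sum_Basis[OF assms(2)[OF t]])
    also have "norm \<dots> \<le> (\<Sum>b\<in>Basis. norm w * C b)"
    proof (rule sum_norm_le)
      fix b :: 'f assume b: "b \<in> Basis"
      show "norm ((w \<bullet> b) *\<^sub>R L t b) \<le> norm w * C b"
        using Basis_le_norm[OF b, of w] C[OF t, of b] by (simp add: mult_mono)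
    qed
    also have "\<dots> = (\<Sum>b\<in>Basis. C b) * norm w" by (simp add: sum_distrib_left mult.commute)
    finally show "norm (L t w) \<le> (\<Sum>b\<in>Basis. C b) * norm w" .
  qed
qed

text \<open>The coefficients are bounded on a closed ball around \<open>t\<close> inside
  \<open>Os\<close>, so Gronwall's argument applies there. The conclusion is symmetric in
  \<open>x\<close> and \<open>y\<close>, the form needed for an induction over a connected
  set.\<close>

lemma linear_ode_vanishing_near:
  fixes Q :: "real \<Rightarrow> 'f::euclidean_space"
  assumes Oo: "open Os" and t: "t \<in> {a..b} \<inter> Os"
    and der: "\<And>t. t \<in> {a..b} \<inter> Os \<Longrightarrow> (Q has_vector_derivative L t (Q t)) (at t within {a..b})"
    and lin: "\<And>t. t \<in> {a..b} \<inter> Os \<Longrightarrow> linear (L t)"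
    and cont: "\<And>w. continuous_on ({a..b} \<inter> Os) (\<lambda>t. L t w)"
  obtains r where "r > 0" "ball t r \<subseteq> Os"
    "\<And>x y. x \<in> ball t r \<inter> {a..b} \<Longrightarrow> y \<in> ball t r \<inter> {a..b} \<Longrightarrow> Q x = 0 \<Longrightarrow> Q y = 0"
proof -
  obtain r where r: "r > 0" "cball t r \<subseteq> Os" using Oo t open_contains_cball by blast
  let ?K = "cball t r \<inter> {a..b}"
  have K: "compact ?K" "?K \<subseteq> {a..b} \<inter> Os" "is_interval ?K"
    using r(2) by (auto simp: compact_Int_closed is_interval_cball_1 is_interval_cc intro!: is_interval_Int)
  obtain C where C: "\<And>s w. s \<in> ?K \<Longrightarrow> norm (L s w) \<le> C * norm w"
    using linear_family_bounded[OF K(1) lin continuous_on_subset[OF cont K(2)]] K(2) by blast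
  have "Q y = 0" if xy: "x \<in> ?K" "y \<in> ?K" "Q x = 0" for x y
  proof (rule linear_bound_imp_zero[where d = Q and K = ?K and d' = "\<lambda>s. L s (Q s)" and L = C and ?t0.0 = x])
    fix s assume s: "s \<in> ?K"
    show "(Q has_vector_derivative L s (Q s)) (at s within ?K)"
      by (rule has_vector_derivative_within_subset[OF der]) (use s K(2) in auto)
    show "norm (L s (Q s)) \<le> C * norm (Q s)" by (rule C[OF s])
  qed (use K(3) xy in auto)
  moreover have "ball t r \<subseteq> cball t r" by auto
  ultimately show thesis using r by (intro that[of r]) blast+
qed

text \<open>The coordinates \<open>Q \<phi>\<close> of a solution are compared through a property \<open>P\<close> that does not refer to
  the chart, which carries the vanishing of \<open>Q\<close> from one chart to the next.\<close>

lemma linear_ode_vanishing: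
  fixes Q :: "'i \<Rightarrow> real \<Rightarrow> 'f::euclidean_space"
  assumes cov: "\<And>t. t \<in> {a..b} \<Longrightarrow> \<exists>\<phi>\<in>A. t \<in> Os \<phi>" and Oo: "\<And>\<phi>. \<phi> \<in> A \<Longrightarrow> open (Os \<phi>)"
    and der: "\<And>\<phi> t. \<phi> \<in> A \<Longrightarrow> t \<in> {a..b} \<inter> Os \<phi> \<Longrightarrow> (Q \<phi> has_vector_derivative L \<phi> t (Q \<phi> t)) (at t within {a..b})"
    and lin: "\<And>\<phi> t. \<phi> \<in> A \<Longrightarrow> t \<in> {a..b} \<inter> Os \<phi> \<Longrightarrow> linear (L \<phi> t)"
    and cont: "\<And>\<phi> w. \<phi> \<in> A \<Longrightarrow> continuous_on ({a..b} \<inter> Os \<phi>) (\<lambda>t. L \<phi> t w)"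
    and P1: "\<And>\<phi> t. \<phi> \<in> A \<Longrightarrow> t \<in> {a..b} \<inter> Os \<phi> \<Longrightarrow> P t \<Longrightarrow> Q \<phi> t = 0"
    and P2: "\<And>\<phi> T t. \<phi> \<in> A \<Longrightarrow> open T \<Longrightarrow> T \<subseteq> Os \<phi> \<Longrightarrow> (\<And>s. s \<in> T \<inter> {a..b} \<Longrightarrow> Q \<phi> s = 0) \<Longrightarrow> t \<in> T \<inter> {a..b} \<Longrightarrow> P t"
    and start: "\<phi>0 \<in> A" "t0 \<in> {a..b} \<inter> Os \<phi>0" "Q \<phi>0 t0 = 0" and t: "t \<in> {a..b}"
  shows "P t"
proof -
  have nb: "\<exists>r>0. ball t r \<subseteq> Os \<phi> \<and> (\<forall>x \<in> ball t r \<inter> {a..b}. \<forall>y \<in> ball t r \<inter> {a..b}. Q \<phi> x = 0 \<longrightarrow> Q \<phi> y = 0)"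
    if "\<phi> \<in> A" "t \<in> {a..b} \<inter> Os \<phi>" for \<phi> t
    using linear_ode_vanishing_near[OF Oo[OF that(1)] that(2) der[OF that(1)] lin[OF that(1)] cont[OF that(1)]] by metis
  have con: "connected {a..b}" by simp
  show ?thesis
  proof (rule connected_induction_simple[OF con _ t])
    show "t0 \<in> {a..b}" using start by blast
    obtain r where r: "r > 0" "ball t0 r \<subseteq> Os \<phi>0"
      "\<forall>x \<in> ball t0 r \<inter> {a..b}. \<forall>y \<in> ball t0 r \<inter> {a..b}. Q \<phi>0 x = 0 \<longrightarrow> Q \<phi>0 y = 0"
      using nb[OF start(1,2)] by blast
    show "P t0"
      by (rule P2[OF start(1) open_ball r(2)]) (use r(1,3) start(2,3) in auto)
    fix s assume s: "s \<in> {a..b}"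
    obtain \<phi> where \<phi>: "\<phi> \<in> A" "s \<in> Os \<phi>" using cov[OF s] by blast
    obtain r where r: "r > 0" "ball s r \<subseteq> Os \<phi>"
      "\<forall>x \<in> ball s r \<inter> {a..b}. \<forall>y \<in> ball s r \<inter> {a..b}. Q \<phi> x = 0 \<longrightarrow> Q \<phi> y = 0"
      using nb[OF \<phi>(1)] s \<phi>(2) by blast
    show "\<exists>T. openin (top_of_set {a..b}) T \<and> s \<in> T \<and> (\<forall>x\<in>T. \<forall>y\<in>T. P x \<longrightarrow> P y)"
    proof (intro exI[of _ "{a..b} \<inter> ball s r"] conjI ballI impI)
      show "openin (top_of_set {a..b}) ({a..b} \<inter> ball s r)" by (rule openin_open_Int) simp
      show "s \<in> {a..b} \<inter> ball s r" using s r(1) by simp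
      fix x y assume x: "x \<in> {a..b} \<inter> ball s r" and y: "y \<in> {a..b} \<inter> ball s r" and Px: "P x"
      have "Q \<phi> x = 0" using P1[OF \<phi>(1) _ Px] x r(2) by blast
      then show "P y" using r(3) x y by (intro P2[OF \<phi>(1) open_ball r(2)]) auto
    qed
  qed
qed

section \<open>Derivatives within a closed interval\<close>

lemma vector_derivative_within_eq:
  assumes "a < b" "t \<in> {a..b}" "(f has_vector_derivative D) (at t within {a..b})"
  shows "vector_derivative f (at t within {a..b}) = D"
  using vector_derivative_within_cbox[of a b t f D] assms by simp

lemma has_vector_derivative_within_transform:
  assumes "(f has_vector_derivative D) (at t within T)" "open Os" "t \<in> T \<inter> Os" "\<And>s. s \<in> T \<inter> Os \<Longrightarrow> f s = g s"
  shows "(g has_vector_derivative D) (at t within T)"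
proof -
  obtain d where d: "d > 0" "ball t d \<subseteq> Os" using assms(2,3) open_contains_ball by blast
  show ?thesis
    unfolding has_vector_derivative_def
  proof (rule has_derivative_transform_within[OF assms(1)[unfolded has_vector_derivative_def] d(1)])
    show "t \<in> T" using assms(3) by blast
    show "f s = g s" if "s \<in> T" "dist s t < d" for s
      using that d(2) by (intro assms(4)) (auto simp: dist_commute)
  qed
qed

text \<open>Smoothness along the curve refers to the relatively open set
  \<open>{a..b} \<inter> Os\<close>, but the covariant derivative to derivatives within
  \<open>{a..b}\<close>. The two agree because \<open>Os\<close> is open; a derivative of a function
  of one real variable is its value at 1.\<close>

lemma Ck_on_interval:
  fixes g :: "real \<Rightarrow> 'b::real_normed_vector"
  assumes ab: "a < b" and Oo: "open Os" and g: "Ck_on (Suc k) ({a..b} \<inter> Os) g"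
  shows "t \<in> {a..b} \<inter> Os \<Longrightarrow> (g has_vector_derivative vector_derivative g (at t within {a..b})) (at t within {a..b})"
    and "Ck_on k ({a..b} \<inter> Os) (\<lambda>t. vector_derivative g (at t within {a..b}))"
proof -
  let ?U = "{a..b} \<inter> Os"
  have at: "at t within ?U = at t within {a..b}" if "t \<in> ?U" for t
    using that by (intro at_within_nhd[of t Os]) (auto simp: Oo)
  have d: "(g has_derivative frechet_derivative g (at t within ?U)) (at t within {a..b})" if "t \<in> ?U" for t
  proof -
    have "g differentiable (at t within ?U)" using g that by (auto simp: Ck_on.simps(2) differentiable_on_def)
    then show ?thesis using at[OF that] by (simp add: frechet_derivative_works)
  qed
  have v: "(g has_vector_derivative frechet_derivative g (at t within ?U) 1) (at t within {a..b})" if "t \<in> ?U" for t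
  proof -
    let ?D = "frechet_derivative g (at t within ?U)"
    have "?D \<tau> = \<tau> *\<^sub>R ?D 1" for \<tau>
      using linear_scale[OF has_derivative_linear[OF d[OF that]], of \<tau> 1] by (metis mult.right_neutral real_scaleR_def)
    then show ?thesis
      unfolding has_vector_derivative_def by (intro has_derivative_eq_rhs[OF d[OF that]] ext)
  qed
  have e: "vector_derivative g (at t within {a..b}) = frechet_derivative g (at t within ?U) 1" if "t \<in> ?U" for t
    by (rule vector_derivative_within_eq[OF ab _ v[OF that]]) (use that in simp)
  show "t \<in> ?U \<Longrightarrow> (g has_vector_derivative vector_derivative g (at t within {a..b})) (at t within {a..b})"
    using v e by simp
  have "Ck_on k ?U (\<lambda>t. frechet_derivative g (at t within ?U) 1)"
    using g by (simp add: Ck_on.simps(2))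
  then show "Ck_on k ?U (\<lambda>t. vector_derivative g (at t within {a..b}))"
    using Ck_on_cong[of ?U "\<lambda>t. vector_derivative g (at t within {a..b})" "\<lambda>t. frechet_derivative g (at t within ?U) 1"] e by blast
qed

text \<open>The product rule for a moving matrix and a moving vector, obtained by expansion over the
  basis, since the matrix is differentiated only on fixed vectors.\<close>

lemma has_vector_derivative_linear_family:
  fixes L :: "real \<Rightarrow> 'a::euclidean_space \<Rightarrow> 'b::real_normed_vector"
  assumes Oo: "open Os" and t: "t \<in> T \<inter> Os" and lin: "\<And>s. s \<in> T \<inter> Os \<Longrightarrow> linear (L s)"
    and L: "\<And>w. ((\<lambda>s. L s w) has_vector_derivative L' w) (at t within T)" and L': "linear L'"
    and u: "(u has_vector_derivative u') (at t within T)"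
  shows "((\<lambda>s. L s (u s)) has_vector_derivative L' (u t) + L t u') (at t within T)"
proof -
  have "((\<lambda>s. \<Sum>b\<in>Basis. (u s \<bullet> b) *\<^sub>R L s b) has_vector_derivative (\<Sum>b\<in>Basis. (u t \<bullet> b) *\<^sub>R L' b + (u' \<bullet> b) *\<^sub>R L t b)) (at t within T)"
  proof (rule has_vector_derivative_sum)
    fix b :: 'a assume "b \<in> Basis"
    have "((\<lambda>s. u s \<bullet> b) has_vector_derivative u' \<bullet> b) (at t within T)"
      by (rule bounded_linear.has_vector_derivative[OF bounded_linear_inner_left u])
    then show "((\<lambda>s. (u s \<bullet> b) *\<^sub>R L s b) has_vector_derivative (u t \<bullet> b) *\<^sub>R L' b + (u' \<bullet> b) *\<^sub>R L t b) (at t within T)"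
      by (intro has_vector_derivative_scaleR L) (simp add: has_real_derivative_iff_has_vector_derivative)
  qed
  moreover have "(\<Sum>b\<in>Basis. (u t \<bullet> b) *\<^sub>R L' b + (u' \<bullet> b) *\<^sub>R L t b) = L' (u t) + L t u'"
    using linear_sum_Basis[OF L', of "u t"] linear_sum_Basis[OF lin[OF t], of u'] by (simp add: sum.distrib)
  ultimately have "((\<lambda>s. \<Sum>b\<in>Basis. (u s \<bullet> b) *\<^sub>R L s b) has_vector_derivative L' (u t) + L t u') (at t within T)" by simp
  then show ?thesis
    by (rule has_vector_derivative_within_transform[OF _ Oo t]) (use linear_sum_Basis[OF lin] in metis)
qed

text \<open>Both sides of each linearity equation are derivatives of the same function within a
  nondegenerate interval, where derivatives are unique even at the ends.\<close>

lemma linear_vector_derivative: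
  fixes L :: "real \<Rightarrow> 'a::euclidean_space \<Rightarrow> 'b::real_normed_vector"
  assumes ab: "a < b" and Oo: "open Os" and t: "t \<in> {a..b} \<inter> Os" and lin: "\<And>s. s \<in> {a..b} \<inter> Os \<Longrightarrow> linear (L s)"
    and L: "\<And>w. ((\<lambda>s. L s w) has_vector_derivative L' w) (at t within {a..b})"
  shows "linear L'"
proof (rule linearI)
  have tI: "t \<in> {a..b}" using t by simp
  have u: "D1 = D2" if "((\<lambda>s. L s w) has_vector_derivative D1) (at t within {a..b})" "((\<lambda>s. L s w) has_vector_derivative D2) (at t within {a..b})" for D1 D2 w
    using vector_derivative_within_eq[OF ab tI that(1)] vector_derivative_within_eq[OF ab tI that(2)] by simp
  show "L' (x + y) = L' x + L' y" for x y
  proof (rule u[OF L])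
    show "((\<lambda>s. L s (x + y)) has_vector_derivative L' x + L' y) (at t within {a..b})"
      by (rule has_vector_derivative_within_transform[OF has_vector_derivative_add[OF L L] Oo t])
        (simp add: linear_add[OF lin])
  qed
  show "L' (r *\<^sub>R x) = r *\<^sub>R L' x" for r x
  proof (rule u[OF L])
    show "((\<lambda>s. L s (r *\<^sub>R x)) has_vector_derivative r *\<^sub>R L' x) (at t within {a..b})"
      by (rule has_vector_derivative_within_transform[OF bounded_linear.has_vector_derivative[OF bounded_linear_scaleR_right L] Oo t])
        (simp add: linear_scale[OF lin])
  qed
qed

subsection \<open>The connection in coordinates\<close>

context spray_manifold
begin

abbreviation "N \<equiv> conn_coeff A S"

lemma conn_coeff_eq:
  assumes "\<phi> \<in> A" "z \<in> phase_domain \<phi>"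
  shows "N \<phi> z w = - (1/2) *\<^sub>R frechet_derivative (H \<phi>) (at z) (0, w)"
proof -
  have "((\<lambda>y. (fst z, y)) has_derivative (\<lambda>w. (0, w))) (at (snd z))"
    by (rule has_derivative_Pair[OF has_derivative_const has_derivative_ident])
  from has_derivative_compose[OF this] acceleration_has_derivative[OF assms]
  have "((\<lambda>y. H \<phi> (fst z, y)) has_derivative (\<lambda>w. frechet_derivative (H \<phi>) (at z) (0, w))) (at (snd z))" by simp
  from has_derivative_scaleR_right[OF this, of "- (1/2)"]
  have "((\<lambda>y. spray_coeff A S \<phi> (fst z, y)) has_derivative (\<lambda>w. - (1/2) *\<^sub>R frechet_derivative (H \<phi>) (at z) (0, w))) (at (snd z))"
    by (simp only: spray_coeff_acceleration)
  from fun_cong[OF frechet_derivative_at[OF this], of w] show ?thesis by (simp only: conn_coeff_def)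
qed

lemma conn_coeff_linear:
  assumes "\<phi> \<in> A" "z \<in> phase_domain \<phi>"
  shows "linear (N \<phi> z)"
proof -
  have l: "linear (frechet_derivative (H \<phi>) (at z))" using has_derivative_linear[OF acceleration_has_derivative[OF assms]] .
  show ?thesis
  proof (rule linearI)
    show "N \<phi> z (x + y) = N \<phi> z x + N \<phi> z y" for x y
      using linear_add[OF l, of "(0, x)" "(0, y)"] by (simp add: conn_coeff_eq[OF assms] scaleR_add_right)
    show "N \<phi> z (r *\<^sub>R x) = r *\<^sub>R N \<phi> z x" for r x
      using linear_scale[OF l, of r "(0, x)"] by (simp add: conn_coeff_eq[OF assms])
  qed
qed

text \<open>Euler's relation cancels the factor 1/2. Consequently the equation
  \<open>x'' = H (x, x')\<close> says precisely that the velocity is parallel.\<close>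

lemma conn_coeff_velocity:
  assumes "\<phi> \<in> A" "z \<in> phase_domain \<phi>"
  shows "N \<phi> z (snd z) = - H \<phi> z"
  by (simp add: conn_coeff_eq[OF assms] acceleration_homogeneous[OF assms])

lemma conn_coeff_smooth:
  assumes \<phi>: "\<phi> \<in> A"
  shows "smooth_on (phase_domain \<phi> \<times> UNIV) (\<lambda>q. N \<phi> (fst q) (snd q))"
proof -
  let ?W = "phase_domain \<phi> \<times> (UNIV :: 'e set)"
  have W: "open ?W" using open_phase_domain[OF \<phi>] by (simp add: open_Times)
  have "smooth_on ?W (\<lambda>q. frechet_derivative (H \<phi>) (at (fst q)) (0, snd q))"
    by (rule smooth_on_derivative2[OF acceleration_smooth[OF \<phi>] open_phase_domain[OF \<phi>] W smooth_on_linear[OF bounded_linear_fst W]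
          smooth_on_Pair[OF W smooth_on_const[OF W] smooth_on_linear[OF bounded_linear_snd W]]]) auto
  from smooth_on_scaleR[OF W smooth_on_const[OF W, of "- (1/2)"] this]
  have "smooth_on ?W (\<lambda>q. - (1/2) *\<^sub>R frechet_derivative (H \<phi>) (at (fst q)) (0, snd q))" .
  then show ?thesis
    using smooth_on_cong[of ?W "\<lambda>q. N \<phi> (fst q) (snd q)" "\<lambda>q. - (1/2) *\<^sub>R frechet_derivative (H \<phi>) (at (fst q)) (0, snd q)"]
      conn_coeff_eq[OF \<phi>] by (simp only: mem_Times_iff)
qed

text \<open>The derivative splits into the motion of the base point and the motion of the vector.
  Along the phase curve \<open>z'\<close> is the value of the spray, so the first summand is the
  term \<open>S(N)\<close> of the Jacobi endomorphism.\<close>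

lemma conn_coeff_has_vector_derivative:
  assumes \<phi>: "\<phi> \<in> A" and ph: "z t \<in> phase_domain \<phi>" and z: "(z has_vector_derivative z') (at t within T)"
    and X: "(X has_vector_derivative X') (at t within T)"
  shows "((\<lambda>s. N \<phi> (z s) (X s)) has_vector_derivative
    frechet_derivative (\<lambda>z. N \<phi> z (X t)) (at (z t)) z' + N \<phi> (z t) X') (at t within T)"
proof -
  let ?n = "\<lambda>q. N \<phi> (fst q) (snd q)" and ?W = "phase_domain \<phi> \<times> (UNIV :: 'e set)"
  have W: "open ?W" using open_phase_domain[OF \<phi>] by (simp add: open_Times)
  let ?D = "frechet_derivative ?n (at (z t, X t))"
  have D: "(?n has_derivative ?D) (at (z t, X t))"
    by (rule smooth_on_has_derivative[OF conn_coeff_smooth[OF \<phi>] W]) (use ph in simp)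
  have lD: "linear ?D" by (rule has_derivative_linear[OF D])
  have "((\<lambda>\<zeta>. (\<zeta>, X t)) has_derivative (\<lambda>\<zeta>. (\<zeta>, 0))) (at (z t))"
    by (rule has_derivative_Pair[OF has_derivative_ident has_derivative_const])
  from has_derivative_compose[OF this D]
  have "((\<lambda>\<zeta>. N \<phi> \<zeta> (X t)) has_derivative (\<lambda>\<zeta>. ?D (\<zeta>, 0))) (at (z t))" by simp
  from fun_cong[OF frechet_derivative_at[OF this], of z'] have 1: "?D (z', 0) = frechet_derivative (\<lambda>z. N \<phi> z (X t)) (at (z t)) z'" .
  have "((\<lambda>w. (z t, w)) has_derivative (\<lambda>w. (0, w))) (at (X t))"
    by (rule has_derivative_Pair[OF has_derivative_const has_derivative_ident])
  from has_derivative_compose[OF this D]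
  have "(N \<phi> (z t) has_derivative (\<lambda>w. ?D (0, w))) (at (X t))" by simp
  moreover have "(N \<phi> (z t) has_derivative N \<phi> (z t)) (at (X t))"
    using conn_coeff_linear[OF \<phi> ph] by (simp add: bounded_linear_imp_has_derivative linear_conv_bounded_linear)
  ultimately have "(\<lambda>w. ?D (0, w)) = N \<phi> (z t)" by (rule has_derivative_unique)
  from fun_cong[OF this] have 2: "?D (0, w) = N \<phi> (z t) w" for w .
  have "((\<lambda>s. (z s, X s)) has_derivative (\<lambda>\<tau>. \<tau> *\<^sub>R (z', X'))) (at t within T)"
    using has_vector_derivative_Pair[OF z X] by (simp only: has_vector_derivative_def)
  from has_derivative_compose[OF this D]
  have "((\<lambda>s. N \<phi> (z s) (X s)) has_derivative (\<lambda>\<tau>. ?D (\<tau> *\<^sub>R (z', X')))) (at t within T)" by simp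
  moreover have "?D (\<tau> *\<^sub>R (z', X')) = \<tau> *\<^sub>R (frechet_derivative (\<lambda>z. N \<phi> z (X t)) (at (z t)) z' + N \<phi> (z t) X')" for \<tau>
  proof -
    have "(z', X') = (z', 0) + (0, X')" by simp
    then have "?D (z', X') = ?D (z', 0) + ?D (0, X')" using linear_add[OF lD] by metis
    then show ?thesis by (simp only: linear_scale[OF lD] 1 2)
  qed
  ultimately show ?thesis unfolding has_vector_derivative_def by (simp only:)
qed

lemma jacobi_coeff_eq:
  assumes "\<phi> \<in> A" "z \<in> phase_domain \<phi>"
  shows "jacobi_coeff A S \<phi> z w = - frechet_derivative (H \<phi>) (at z) (w, 0)
    - frechet_derivative (\<lambda>z'. N \<phi> z' w) (at z) (snd z, H \<phi> z) - N \<phi> z (N \<phi> z w)"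
proof -
  have "((\<lambda>x. (x, snd z)) has_derivative (\<lambda>w. (w, 0))) (at (fst z))"
    by (rule has_derivative_Pair[OF has_derivative_ident has_derivative_const])
  from has_derivative_compose[OF this] acceleration_has_derivative[OF assms]
  have "((\<lambda>x. H \<phi> (x, snd z)) has_derivative (\<lambda>w. frechet_derivative (H \<phi>) (at z) (w, 0))) (at (fst z))" by simp
  from has_derivative_scaleR_right[OF this, of "- (1/2)"]
  have "((\<lambda>x. spray_coeff A S \<phi> (x, snd z)) has_derivative (\<lambda>w. - (1/2) *\<^sub>R frechet_derivative (H \<phi>) (at z) (w, 0))) (at (fst z))"
    by (simp only: spray_coeff_acceleration)
  from fun_cong[OF frechet_derivative_at[OF this], of w, symmetric]
  have "2 *\<^sub>R frechet_derivative (\<lambda>x. spray_coeff A S \<phi> (x, snd z)) (at (fst z)) w = 2 *\<^sub>R (- (1/2) *\<^sub>R frechet_derivative (H \<phi>) (at z) (w, 0))"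
    by (simp only:)
  also have "\<dots> = - frechet_derivative (H \<phi>) (at z) (w, 0)" by simp
  finally have "2 *\<^sub>R frechet_derivative (\<lambda>x. spray_coeff A S \<phi> (x, snd z)) (at (fst z)) w = - frechet_derivative (H \<phi>) (at z) (w, 0)" .
  then show ?thesis by (simp only: jacobi_coeff_def spray_components[OF assms])
qed

end

section \<open>Restriction of a map to time and parameter slices\<close>

lemma slice_derivative:
  fixes k :: "real \<times> 's::euclidean_space \<Rightarrow> 'x::euclidean_space"
  assumes k: "smooth_on E k" "open E" "(t, s) \<in> E"
  shows "((\<lambda>s. k (t, s)) has_derivative (\<lambda>\<sigma>. frechet_derivative k (at (t, s)) (0, \<sigma>))) (at s)"
proof -
  have "((\<lambda>s. (t, s)) has_derivative (\<lambda>\<sigma>. (0, \<sigma>))) (at s)"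
    by (rule has_derivative_Pair[OF has_derivative_const has_derivative_ident])
  from has_derivative_compose[OF this smooth_on_has_derivative[OF k]]
  show ?thesis .
qed

lemma slice_vector_derivative:
  fixes k :: "real \<times> 's::euclidean_space \<Rightarrow> 'x::euclidean_space"
  assumes k: "smooth_on E k" "open E" "(t, s) \<in> E"
  shows "((\<lambda>t. k (t, s)) has_vector_derivative frechet_derivative k (at (t, s)) (1, 0)) (at t)"
proof -
  have kd: "(k has_derivative frechet_derivative k (at (t, s))) (at (t, s))"
    by (rule smooth_on_has_derivative[OF k])
  have "((\<lambda>t. (t, s)) has_derivative (\<lambda>\<tau>. (\<tau>, 0))) (at t)"
    by (rule has_derivative_Pair[OF has_derivative_ident has_derivative_const])
  from has_derivative_compose[OF this kd]
  have "((\<lambda>t. k (t, s)) has_derivative (\<lambda>\<tau>. frechet_derivative k (at (t, s)) (\<tau>, 0))) (at t)" .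
  moreover have "(\<lambda>\<tau>. frechet_derivative k (at (t, s)) (\<tau>, 0)) = (\<lambda>\<tau>. \<tau> *\<^sub>R frechet_derivative k (at (t, s)) (1, 0))"
  proof (rule ext)
    show "frechet_derivative k (at (t, s)) (\<tau>, 0) = \<tau> *\<^sub>R frechet_derivative k (at (t, s)) (1, 0)" for \<tau>
      using linear_scale[OF has_derivative_linear[OF kd], of \<tau> "(1, 0)"] by simp
  qed
  ultimately show ?thesis by (simp only: has_vector_derivative_def)
qed

subsection \<open>Fields along the geodesic\<close>

lemma fun_sum_apply: "(\<Sum>i\<in>I. f i) x = (\<Sum>i\<in>I. f i x)"
  for f :: "'i \<Rightarrow> 'x \<Rightarrow> 'b::comm_monoid_add"
  by (induction I rule: infinite_finite_induct) auto

lemma coord_vector_linear: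
  assumes A: "smooth_atlas A" and \<phi>: "\<phi> \<in> A" "p \<in> chart_dom \<phi>"
  shows "coord_vector A \<phi> p (r *\<^sub>R x + q *\<^sub>R y) = r *\<^sub>R coord_vector A \<phi> p x + q *\<^sub>R coord_vector A \<phi> p y"
proof (rule tangent_space_eqI[OF A _ _ \<phi>])
  show "coord_vector A \<phi> p (r *\<^sub>R x + q *\<^sub>R y) \<in> tangent_space A p" by (rule coord_vector_tangent[OF A \<phi>])
  show "r *\<^sub>R coord_vector A \<phi> p x + q *\<^sub>R coord_vector A \<phi> p y \<in> tangent_space A p"
    by (intro subspace_add subspace_scale tangent_space_subspace[OF A] coord_vector_tangent[OF A \<phi>])
  show "coord_vector A \<phi> p (r *\<^sub>R x + q *\<^sub>R y) \<phi> = (r *\<^sub>R coord_vector A \<phi> p x + q *\<^sub>R coord_vector A \<phi> p y) \<phi>"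
    by (simp add: coord_vector_same[OF A \<phi>] scaleR_fun_def)
qed

text \<open>The curve \<open>c\<close> matters only on \<open>{a..b}\<close>; its extension
  \<open>c0\<close> is a geodesic on an open interval and supplies two-sided derivatives, from which
  the one-sided ones of \<open>c\<close> are obtained.\<close>

locale geodesic_segment = spray_manifold A S
  for A :: "('a, 'e::euclidean_space) chart set" and S :: "('a, 'e) slit_field" +
  fixes a b :: real and c c0 :: "real \<Rightarrow> 'a" and I0 :: "real set"
  assumes ab: "a < b" and geo: "geodesic_on A S I0 c0" and sub: "{a..b} \<subseteq> I0" and ceq: "\<And>t. t \<in> {a..b} \<Longrightarrow> c t = c0 t"
begin

definition "chart_times \<phi> = {t \<in> I0. c0 t \<in> chart_dom \<phi>}"
definition "phase_curve \<phi> t = (chart_map \<phi> (c0 t), vector_derivative (\<lambda>s. chart_map \<phi> (c0 s)) (at t))"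

lemma open_chart_times: "\<phi> \<in> A \<Longrightarrow> open (chart_times \<phi>)"
  unfolding chart_times_def by (rule curve_chart(1)[OF atlas geodesic_onD(1)[OF geo] geodesic_onD(3)[OF geo]])

lemma chart_times_cover: "t \<in> {a..b} \<Longrightarrow> \<exists>\<phi>\<in>A. t \<in> chart_times \<phi>"
  using curve_chart_exists[OF atlas geodesic_onD(1)[OF geo] geodesic_onD(3)[OF geo], of t] sub
  unfolding chart_times_def by blast

lemma chart_timesD: "t \<in> {a..b} \<inter> chart_times \<phi> \<Longrightarrow> c t \<in> chart_dom \<phi>"
  using ceq by (auto simp: chart_times_def)

lemma chart_times_eq: "{t \<in> {a..b}. c t \<in> chart_dom \<phi>} = {a..b} \<inter> chart_times \<phi>"
  using ceq sub by (auto simp: chart_times_def)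

lemma phase_curve:
  assumes "\<phi> \<in> A" "t \<in> chart_times \<phi>"
  shows "phase_curve \<phi> t \<in> phase_domain \<phi>"
    "(phase_curve \<phi> has_vector_derivative (snd (phase_curve \<phi> t), H \<phi> (phase_curve \<phi> t))) (at t)"
proof -
  have t: "t \<in> I0" "c0 t \<in> chart_dom \<phi>" using assms(2) by (auto simp: chart_times_def)
  note g = geodesic_coordinates[OF geo assms(1) t]
  show "phase_curve \<phi> t \<in> phase_domain \<phi>" using g(3) by (simp add: phase_curve_def)
  show "(phase_curve \<phi> has_vector_derivative (snd (phase_curve \<phi> t), H \<phi> (phase_curve \<phi> t))) (at t)"
    using has_vector_derivative_Pair[OF g(1,2)] by (simp add: phase_curve_def[abs_def])
qed

lemma continuous_on_phase_curve: "\<phi> \<in> A \<Longrightarrow> continuous_on ({a..b} \<inter> chart_times \<phi>) (phase_curve \<phi>)"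
  by (intro continuous_at_imp_continuous_on ballI has_vector_derivative_continuous[OF phase_curve(2)]) auto

lemma velocity_c:
  assumes t: "t \<in> {a..b}"
  shows "velocity A {a..b} c t = velocity A I0 c0 t"
proof (rule prod_eqI)
  show "fst (velocity A {a..b} c t) = fst (velocity A I0 c0 t)" by (simp add: velocity_def ceq[OF t])
  have tI0: "t \<in> I0" by (rule subsetD[OF sub t])
  show "snd (velocity A {a..b} c t) = snd (velocity A I0 c0 t)"
  proof (rule ext)
    fix \<phi>
    show "snd (velocity A {a..b} c t) \<phi> = snd (velocity A I0 c0 t) \<phi>"
    proof (cases "\<phi> \<in> A \<and> c0 t \<in> chart_dom \<phi>")
      case True
      have "((\<lambda>s. chart_map \<phi> (c0 s)) has_vector_derivative vector_derivative (\<lambda>s. chart_map \<phi> (c0 s)) (at t)) (at t within {a..b})"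
        using geodesic_coordinates(1)[OF geo, of \<phi> t] True tI0 by - (rule has_vector_derivative_at_within, simp)
      then have "(chart_map \<phi> \<circ> c has_vector_derivative vector_derivative (\<lambda>s. chart_map \<phi> (c0 s)) (at t)) (at t within {a..b})"
        by (rule has_vector_derivative_within_transform[OF _ open_UNIV]) (use t ceq in auto)
      from vector_derivative_within_eq[OF ab t this] show ?thesis
        using True ceq[OF t] velocity_component_geodesic[OF geo, of \<phi> t] tI0 by (simp add: velocity_def[of A "{a..b}"] on_charts_def)
    next
      case False
      then show ?thesis using ceq[OF t] by (auto simp: velocity_def on_charts_def)
    qed
  qed
qed

lemma velocity_tangent_c: "t \<in> {a..b} \<Longrightarrow> snd (velocity A {a..b} c t) \<in> tangent_space A (c t)"
  using velocity_tangent_geodesic[OF geo, of t] velocity_c ceq sub by auto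

lemma velocity_chart:
  assumes "\<phi> \<in> A" "t \<in> {a..b} \<inter> chart_times \<phi>"
  shows "chart_map (tangent_chart A \<phi>) (velocity A {a..b} c t) = phase_curve \<phi> t"
    "snd (velocity A {a..b} c t) \<phi> = snd (phase_curve \<phi> t)"
  using velocity_component_geodesic[OF geo assms(1), of t] velocity_c[of t] assms
  by (auto simp: tangent_chart_def phase_curve_def chart_times_def fst_velocity_geodesic)

lemma conn_along_eq:
  assumes "\<phi> \<in> A" "t \<in> {a..b} \<inter> chart_times \<phi>"
  shows "conn_along A S {a..b} c t \<phi> = N \<phi> (phase_curve \<phi> t)"
  by (simp add: conn_along_def velocity_chart(1)[OF assms])

lemma conn_linear_at: "\<phi> \<in> A \<Longrightarrow> t \<in> {a..b} \<inter> chart_times \<phi> \<Longrightarrow> linear (N \<phi> (phase_curve \<phi> t))"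
  by (rule conn_coeff_linear[OF _ phase_curve(1)]) auto

lemma parallel_component:
  assumes e: "parallel_vector A S {a..b} c e" and \<phi>: "\<phi> \<in> A" and t: "t \<in> {a..b} \<inter> chart_times \<phi>"
  shows "((\<lambda>s. e s \<phi>) has_vector_derivative - N \<phi> (phase_curve \<phi> t) (e t \<phi>)) (at t within {a..b})"
proof -
  have "smooth_on ({a..b} \<inter> chart_times \<phi>) (\<lambda>t. e t \<phi>)"
    using e \<phi> unfolding parallel_vector_def vector_field_along_def chart_times_eq by blast
  from Ck_on_interval(1)[OF ab open_chart_times[OF \<phi>] smooth_on_imp_Ck_on[OF this, of "Suc 0"] t]
  have 1: "((\<lambda>s. e s \<phi>) has_vector_derivative vector_derivative (\<lambda>s. e s \<phi>) (at t within {a..b})) (at t within {a..b})" .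
  have "nabla_vector A S {a..b} c e t = 0" using e t by (simp add: parallel_vector_def)
  from fun_cong[OF this, of \<phi>]
  have "vector_derivative (\<lambda>s. e s \<phi>) (at t within {a..b}) + N \<phi> (phase_curve \<phi> t) (e t \<phi>) = 0"
    using \<phi> chart_timesD[OF t] by (simp add: nabla_vector_def on_charts_def conn_along_eq[OF \<phi> t])
  then have "vector_derivative (\<lambda>s. e s \<phi>) (at t within {a..b}) = - N \<phi> (phase_curve \<phi> t) (e t \<phi>)"
    by (simp add: eq_neg_iff_add_eq_0)
  with 1 show ?thesis by simp
qed

lemma velocity_parallel:
  assumes \<phi>: "\<phi> \<in> A" and t: "t \<in> {a..b} \<inter> chart_times \<phi>"
  shows "((\<lambda>s. snd (velocity A {a..b} c s) \<phi>) has_vector_derivative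
    - N \<phi> (phase_curve \<phi> t) (snd (velocity A {a..b} c t) \<phi>)) (at t within {a..b})"
proof -
  have tO: "t \<in> chart_times \<phi>" using t by simp
  have "((\<lambda>s. snd (phase_curve \<phi> s)) has_vector_derivative H \<phi> (phase_curve \<phi> t)) (at t)"
    using bounded_linear.has_vector_derivative[OF bounded_linear_snd phase_curve(2)[OF \<phi> tO]] by simp
  then have "((\<lambda>s. snd (phase_curve \<phi> s)) has_vector_derivative H \<phi> (phase_curve \<phi> t)) (at t within {a..b})"
    by (rule has_vector_derivative_at_within)
  then have "((\<lambda>s. snd (velocity A {a..b} c s) \<phi>) has_vector_derivative H \<phi> (phase_curve \<phi> t)) (at t within {a..b})"
    by (rule has_vector_derivative_within_transform[OF _ open_chart_times[OF \<phi>] t]) (simp add: velocity_chart(2)[OF \<phi>])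
  then show ?thesis
    by (simp add: velocity_chart(2)[OF \<phi> t] conn_coeff_velocity[OF \<phi> phase_curve(1)[OF \<phi> tO]])
qed

text \<open>Vanishing of a tangent vector does not depend on the chart, so it can itself serve as
  the property carried along by \<open>linear_ode_vanishing\<close>.\<close>

lemma parallel_vanishing:
  assumes tan: "\<And>t. t \<in> {a..b} \<Longrightarrow> w t \<in> tangent_space A (c t)"
    and der: "\<And>\<phi> t. \<phi> \<in> A \<Longrightarrow> t \<in> {a..b} \<inter> chart_times \<phi> \<Longrightarrow>
      ((\<lambda>s. w s \<phi>) has_vector_derivative - N \<phi> (phase_curve \<phi> t) (w t \<phi>)) (at t within {a..b})"
    and t0: "t0 \<in> {a..b}" "w t0 = 0" and t: "t \<in> {a..b}"
  shows "w t = 0"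
proof -
  obtain \<phi>0 where \<phi>0: "\<phi>0 \<in> A" "t0 \<in> {a..b} \<inter> chart_times \<phi>0" using chart_times_cover[OF t0(1)] t0(1) by blast
  show ?thesis
  proof (rule linear_ode_vanishing[where Q = "\<lambda>\<phi> t. w t \<phi>" and L = "\<lambda>\<phi> t x. - N \<phi> (phase_curve \<phi> t) x" and P = "\<lambda>t. w t = 0",
        OF chart_times_cover open_chart_times der _ _ _ _ \<phi>0 _ t])
    show "linear (\<lambda>x. - N \<phi> (phase_curve \<phi> t) x)" if "\<phi> \<in> A" "t \<in> {a..b} \<inter> chart_times \<phi>" for \<phi> t
      using conn_linear_at[OF that] by (intro linear_compose_neg)
    show "continuous_on ({a..b} \<inter> chart_times \<phi>) (\<lambda>t. - N \<phi> (phase_curve \<phi> t) x)" if \<phi>: "\<phi> \<in> A" for \<phi> x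
    proof -
      have "continuous_on ({a..b} \<inter> chart_times \<phi>) (\<lambda>t. (\<lambda>q. N \<phi> (fst q) (snd q)) (phase_curve \<phi> t, x))"
        by (rule continuous_on_compose2[OF smooth_on_imp_continuous_on[OF conn_coeff_smooth[OF \<phi>]]
              continuous_on_Pair[OF continuous_on_phase_curve[OF \<phi>] continuous_on_const]]) (use phase_curve(1)[OF \<phi>] in auto)
      then show ?thesis by (simp add: continuous_on_minus)
    qed
    show "w t \<phi> = 0" if "w t = 0" for \<phi> t using that by simp
    show "w t = 0" if "\<phi> \<in> A" "T \<subseteq> chart_times \<phi>" "\<And>s. s \<in> T \<inter> {a..b} \<Longrightarrow> w s \<phi> = 0" "t \<in> T \<inter> {a..b}" for \<phi> T t
    proof (rule tangent_space_eqI[OF atlas _ _ that(1)])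
      show "w t \<in> tangent_space A (c t)" "0 \<in> tangent_space A (c t)"
        using tan[of t] that(4) subspace_0[OF tangent_space_subspace[OF atlas]] by auto
      show "c t \<in> chart_dom \<phi>" using that(2,4) by (intro chart_timesD) auto
      show "w t \<phi> = 0 \<phi>" using that(3,4) by simp
    qed
    show "w t0 \<phi>0 = 0" using t0(2) by simp
  qed
qed

text \<open>A combination of parallel fields with constant coefficients is parallel, and the
  velocity is one of these fields. If the combination vanishes at \<open>t\<close>, it vanishes at
  0, where independence is assumed.\<close>

lemma frame_independent:
  fixes e :: "nat \<Rightarrow> real \<Rightarrow> ('a, 'e) tvec"
  assumes par: "\<And>i. i < n \<Longrightarrow> parallel_vector A S {a..b} c (e i)"
    and 0: "0 \<in> {a..b}" and inj: "inj_on (\<lambda>i. e i 0) {..<n}" and ind: "independent ((\<lambda>i. e i 0) ` {..<n})"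
    and vel: "snd (velocity A {a..b} c 0) \<notin> span ((\<lambda>i. e i 0) ` {..<n})"
    and t: "t \<in> {a..b}" and zero: "(\<Sum>i<n. l i *\<^sub>R e i t) + m *\<^sub>R snd (velocity A {a..b} c t) = 0"
  shows "m = 0" "\<And>i. i < n \<Longrightarrow> l i = 0"
proof -
  define w where "w = (\<lambda>t. (\<Sum>i<n. l i *\<^sub>R e i t) + m *\<^sub>R snd (velocity A {a..b} c t))"
  have wc: "w t \<phi> = (\<Sum>i<n. l i *\<^sub>R e i t \<phi>) + m *\<^sub>R snd (velocity A {a..b} c t) \<phi>" for t \<phi>
    by (simp add: w_def fun_sum_apply scaleR_fun_def)
  have "w 0 = 0"
  proof (rule parallel_vanishing[OF _ _ t _ 0])
    show "w t = 0" using zero by (simp add: w_def)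
    show "w t \<in> tangent_space A (c t)" if "t \<in> {a..b}" for t
      unfolding w_def
      using par that velocity_tangent_c[OF that]
      by (intro subspace_add subspace_scale subspace_sum tangent_space_subspace[OF atlas])
        (auto simp: parallel_vector_def vector_field_along_def)
    fix \<phi> t assume \<phi>: "\<phi> \<in> A" and t: "t \<in> {a..b} \<inter> chart_times \<phi>"
    let ?N = "N \<phi> (phase_curve \<phi> t)"
    note lin = conn_linear_at[OF \<phi> t]
    have "((\<lambda>s. (\<Sum>i<n. l i *\<^sub>R e i s \<phi>) + m *\<^sub>R snd (velocity A {a..b} c s) \<phi>) has_vector_derivative
        (\<Sum>i<n. l i *\<^sub>R (- ?N (e i t \<phi>))) + m *\<^sub>R (- ?N (snd (velocity A {a..b} c t) \<phi>))) (at t within {a..b})"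
      by (intro has_vector_derivative_add has_vector_derivative_sum
          bounded_linear.has_vector_derivative[OF bounded_linear_scaleR_right] velocity_parallel[OF \<phi> t] parallel_component[OF par \<phi> t]) auto
    moreover have "(\<Sum>i<n. l i *\<^sub>R (- ?N (e i t \<phi>))) + m *\<^sub>R (- ?N (snd (velocity A {a..b} c t) \<phi>)) = - ?N (w t \<phi>)"
      unfolding wc by (simp add: linear_add[OF lin] linear_sum[OF lin] linear_scale[OF lin] sum_negf)
    ultimately show "((\<lambda>s. w s \<phi>) has_vector_derivative - ?N (w t \<phi>)) (at t within {a..b})"
      by (simp only: wc)
  qed
  then have w0: "(\<Sum>i<n. l i *\<^sub>R e i 0) + m *\<^sub>R snd (velocity A {a..b} c 0) = 0" by (simp add: w_def)
  show m: "m = 0"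
  proof (rule ccontr)
    assume "m \<noteq> 0"
    have "m *\<^sub>R snd (velocity A {a..b} c 0) = - (\<Sum>i<n. l i *\<^sub>R e i 0)"
      using w0 by (simp only: eq_neg_iff_add_eq_0 add.commute)
    moreover have "(\<Sum>i<n. l i *\<^sub>R e i 0) \<in> span ((\<lambda>i. e i 0) ` {..<n})"
      by (intro span_sum span_scale span_base) auto
    ultimately have "m *\<^sub>R snd (velocity A {a..b} c 0) \<in> span ((\<lambda>i. e i 0) ` {..<n})" by (simp add: span_neg)
    from span_scale[OF this, of "1 / m"] show False using vel \<open>m \<noteq> 0\<close> by simp
  qed
  fix i assume i: "i < n"
  let ?f = "\<lambda>i. e i 0"
  \<comment> \<open>Independence concerns the set of vectors; the injective enumeration transports
    the indexed coefficients to it.\<close>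
  have "(\<Sum>v\<in>?f ` {..<n}. l (inv_into {..<n} ?f v) *\<^sub>R v) = (\<Sum>i<n. l i *\<^sub>R e i 0)"
    by (subst sum.reindex[OF inj]) (simp add: inv_into_f_f[OF inj])
  also have "\<dots> = 0" using w0 m by simp
  finally have "(\<Sum>v\<in>?f ` {..<n}. l (inv_into {..<n} ?f v) *\<^sub>R v) = 0" .
  from independentD[OF ind _ _ this, of "?f i"] i show "l i = 0"
    by (simp add: inv_into_f_f[OF inj])
qed

subsection \<open>Jacobi fields\<close>

text \<open>The linearization of \<open>x'' = H (x, x')\<close> along the curve, as a first order
  system in each chart, with \<open>W\<close> as the coordinate derivative of \<open>X\<close>. No
  connection appears, so that variations of geodesics satisfy it directly.\<close>

definition jacobi_pair :: "(real \<Rightarrow> ('a, 'e) tvec) \<Rightarrow> (('a, 'e) chart \<Rightarrow> real \<Rightarrow> 'e) \<Rightarrow> bool" where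
  "jacobi_pair X W \<longleftrightarrow> (\<forall>t\<in>{a..b}. X t \<in> tangent_space A (c t)) \<and>
    (\<forall>\<phi>\<in>A. \<forall>t \<in> {a..b} \<inter> chart_times \<phi>.
      ((\<lambda>s. X s \<phi>) has_vector_derivative W \<phi> t) (at t within {a..b}) \<and>
      (W \<phi> has_vector_derivative frechet_derivative (H \<phi>) (at (phase_curve \<phi> t)) (X t \<phi>, W \<phi> t)) (at t within {a..b}))"

text \<open>The second components \<open>W \<phi>\<close> do not transform like tangent vectors; hence the comparison runs over
  the condition that \<open>X\<close> and \<open>X'\<close> agree near \<open>t\<close>, which determines them.\<close>

lemma jacobi_pair_unique:
  assumes X: "jacobi_pair X W" "jacobi_pair X' W'" and \<phi>0: "\<phi>0 \<in> A" "t0 \<in> {a..b} \<inter> chart_times \<phi>0"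
    and eq: "X t0 \<phi>0 = X' t0 \<phi>0" "W \<phi>0 t0 = W' \<phi>0 t0" and t: "t \<in> {a..b}"
  shows "X t = X' t"
proof -
  define P where "P = (\<lambda>t. \<exists>T. open T \<and> t \<in> T \<and> (\<forall>s \<in> T \<inter> {a..b}. X s = X' s))"
  let ?Q = "\<lambda>\<phi> t. (X t \<phi> - X' t \<phi>, W \<phi> t - W' \<phi> t)"
  let ?L = "\<lambda>\<phi> t q. (snd q, frechet_derivative (H \<phi>) (at (phase_curve \<phi> t)) q)"
  have dX: "((\<lambda>s. X s \<phi>) has_vector_derivative W \<phi> t) (at t within {a..b})"
    "(W \<phi> has_vector_derivative frechet_derivative (H \<phi>) (at (phase_curve \<phi> t)) (X t \<phi>, W \<phi> t)) (at t within {a..b})"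
    "((\<lambda>s. X' s \<phi>) has_vector_derivative W' \<phi> t) (at t within {a..b})"
    "(W' \<phi> has_vector_derivative frechet_derivative (H \<phi>) (at (phase_curve \<phi> t)) (X' t \<phi>, W' \<phi> t)) (at t within {a..b})"
    if "\<phi> \<in> A" "t \<in> {a..b} \<inter> chart_times \<phi>" for \<phi> t
    using X that by (auto simp: jacobi_pair_def)
  have lH: "linear (frechet_derivative (H \<phi>) (at (phase_curve \<phi> t)))" if "\<phi> \<in> A" "t \<in> {a..b} \<inter> chart_times \<phi>" for \<phi> t
    using has_derivative_linear[OF acceleration_has_derivative[OF that(1) phase_curve(1)[OF that(1)]]] that(2) by simp
  have "P t"
  proof (rule linear_ode_vanishing[where Q = ?Q and L = ?L and P = P, OF chart_times_cover open_chart_times _ _ _ _ _ \<phi>0 _ t])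
    fix \<phi> t assume \<phi>t: "\<phi> \<in> A" "t \<in> {a..b} \<inter> chart_times \<phi>"
    have "((\<lambda>s. (X s \<phi> - X' s \<phi>, W \<phi> s - W' \<phi> s)) has_vector_derivative
        (W \<phi> t - W' \<phi> t, frechet_derivative (H \<phi>) (at (phase_curve \<phi> t)) (X t \<phi>, W \<phi> t) -
          frechet_derivative (H \<phi>) (at (phase_curve \<phi> t)) (X' t \<phi>, W' \<phi> t))) (at t within {a..b})"
      by (intro has_vector_derivative_Pair has_vector_derivative_diff dX[OF \<phi>t])
    then show "(?Q \<phi> has_vector_derivative ?L \<phi> t (?Q \<phi> t)) (at t within {a..b})"
      by (simp add: linear_diff[OF lH[OF \<phi>t], symmetric])
    show "linear (?L \<phi> t)"
      using linear_add[OF lH[OF \<phi>t]] linear_scale[OF lH[OF \<phi>t]] by (intro linearI) (auto simp: prod_eq_iff)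
  next
    fix \<phi> q assume \<phi>: "\<phi> \<in> A"
    have "continuous_on ({a..b} \<inter> chart_times \<phi>) (\<lambda>t. frechet_derivative (H \<phi>) (at (phase_curve \<phi> t)) q)"
      by (rule continuous_on_compose2[OF smooth_on_imp_continuous_on[OF smooth_on_derivative[OF acceleration_smooth[OF \<phi>] open_phase_domain[OF \<phi>]]]
            continuous_on_phase_curve[OF \<phi>]]) (use phase_curve(1)[OF \<phi>] in auto)
    then show "continuous_on ({a..b} \<inter> chart_times \<phi>) (\<lambda>t. ?L \<phi> t q)" by (intro continuous_on_Pair continuous_on_const)
  next
    fix \<phi> t assume \<phi>t: "\<phi> \<in> A" "t \<in> {a..b} \<inter> chart_times \<phi>" and "P t"
    then obtain T where T: "open T" "t \<in> T" "\<forall>s \<in> T \<inter> {a..b}. X s = X' s" unfolding P_def by blast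
    have "((\<lambda>s. X' s \<phi>) has_vector_derivative W \<phi> t) (at t within {a..b})"
      by (rule has_vector_derivative_within_transform[OF dX(1)[OF \<phi>t] T(1)]) (use T \<phi>t(2) in auto)
    from vector_derivative_within_eq[OF ab _ this] vector_derivative_within_eq[OF ab _ dX(3)[OF \<phi>t]] \<phi>t(2)
    have "W \<phi> t = W' \<phi> t" by simp
    then show "?Q \<phi> t = 0" using T \<phi>t(2) by (simp add: zero_prod_def)
  next
    fix \<phi> T t assume \<phi>: "\<phi> \<in> A" and T: "open T" "T \<subseteq> chart_times \<phi>" and z: "\<And>s. s \<in> T \<inter> {a..b} \<Longrightarrow> ?Q \<phi> s = 0" and t: "t \<in> T \<inter> {a..b}"
    have "X s = X' s" if s: "s \<in> T \<inter> {a..b}" for s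
    proof (rule tangent_space_eqI[OF atlas _ _ \<phi>])
      show "X s \<in> tangent_space A (c s)" "X' s \<in> tangent_space A (c s)" using X s by (auto simp: jacobi_pair_def)
      show "c s \<in> chart_dom \<phi>" using s T(2) by (intro chart_timesD) auto
      show "X s \<phi> = X' s \<phi>" using z[OF s] by (simp add: zero_prod_def)
    qed
    then show "P t" unfolding P_def using T t by blast
  next
    show "?Q \<phi>0 t0 = 0" using eq by (simp add: zero_prod_def)
  qed
  then show ?thesis using t unfolding P_def by blast
qed

text \<open>As \<open>e\<close> is parallel, \<nabla> falls on \<open>J\<close> alone. With
  \<open>Y\<close> for the components of the covariant derivative of \<open>X = J e\<close>, the
  Jacobi equation reads \<open>X' = Y - N X\<close>, \<open>Y' = - \<Phi> X - N Y\<close>.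
  Differentiating the first equation and inserting
  \<open>\<Phi> = - DH (\<cdot>, 0) - S(N) - N N\<close>, the terms \<open>S(N) X\<close> and
  \<open>N N X\<close> cancel. There remains \<open>DH (X, 0) - 2 N X'\<close>, which is
  \<open>DH (X, X')\<close> because \<open>- 2 N\<close> is the derivative of \<open>H\<close> in
  the fibre.\<close>

lemma jacobi_tensor_pair:
  assumes J: "jacobi_tensor A S {a..b} c J" and e: "parallel_vector A S {a..b} c e"
  shows "jacobi_pair (\<lambda>t. J t (e t)) (\<lambda>\<phi> t. vector_derivative (\<lambda>s. J s (e s) \<phi>) (at t within {a..b}))"
  unfolding jacobi_pair_def
proof (intro conjI ballI)
  have et: "e t \<in> tangent_space A (c t)" if "t \<in> {a..b}" for t
    using e that by (simp add: parallel_vector_def vector_field_along_def)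
  have Jt: "J t v \<in> tangent_space A (c t)" if "t \<in> {a..b}" "v \<in> tangent_space A (c t)" for t v
    using J that unfolding jacobi_tensor_def endo_tensor_along_def by blast
  have Jlin: "J t (r *\<^sub>R u + q *\<^sub>R v) = r *\<^sub>R J t u + q *\<^sub>R J t v"
    if "t \<in> {a..b}" "u \<in> tangent_space A (c t)" "v \<in> tangent_space A (c t)" for t u v r q
    using J that by (simp add: jacobi_tensor_def endo_tensor_along_def)
  show "J t (e t) \<in> tangent_space A (c t)" if "t \<in> {a..b}" for t by (rule Jt[OF that et[OF that]])
  fix \<phi> t assume \<phi>: "\<phi> \<in> A" and t: "t \<in> {a..b} \<inter> chart_times \<phi>"
  let ?U = "{a..b} \<inter> chart_times \<phi>" and ?n = "\<lambda>s. N \<phi> (phase_curve \<phi> s)"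
  note Oo = open_chart_times[OF \<phi>]
  have UI: "s \<in> {a..b}" "s \<in> chart_times \<phi>" "c s \<in> chart_dom \<phi>" if "s \<in> ?U" for s using that chart_timesD[OF that] by auto
  \<comment> \<open>The matrix of \<open>J\<close> in the chart. The coordinates \<open>w\<close>
    are held fixed while the point moves, as in the definition of \<open>nabla_endo\<close>.\<close>
  define M where "M = (\<lambda>s w. J s (coord_vector A \<phi> (c s) w) \<phi>)"
  define E where "E = (\<lambda>s. e s \<phi>)"
  have eE: "coord_vector A \<phi> (c s) (E s) = e s" if "s \<in> ?U" for s
    unfolding E_def by (rule tangent_space_coord[OF atlas et[OF UI(1)[OF that]] \<phi> UI(3)[OF that]])
  have JM: "J s v \<phi> = M s (v \<phi>)" if "s \<in> ?U" "v \<in> tangent_space A (c s)" for s v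
    by (simp add: M_def tangent_space_coord[OF atlas that(2) \<phi> UI(3)[OF that(1)]])
  have lM: "linear (M s)" if s: "s \<in> ?U" for s
  proof -
    note cv = coord_vector_tangent[OF atlas \<phi> UI(3)[OF s]]
    have g: "M s (r *\<^sub>R x + q *\<^sub>R y) = r *\<^sub>R M s x + q *\<^sub>R M s y" for r q x y
      unfolding M_def coord_vector_linear[OF atlas \<phi> UI(3)[OF s]] Jlin[OF UI(1)[OF s] cv cv]
      by (simp add: scaleR_fun_def)
    show ?thesis using g[of 1 _ 1] g[of _ _ 0] by (intro linearI) simp_all
  qed
  define M' where "M' = (\<lambda>s w. vector_derivative (\<lambda>s. M s w) (at s within {a..b}))"
  have MC: "Ck_on k ?U (\<lambda>s. M s w)" for k w
    using J \<phi> unfolding M_def unfolding jacobi_tensor_def endo_tensor_along_def chart_times_eq by - (rule smooth_on_imp_Ck_on, blast)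
  have hM: "((\<lambda>s. M s w) has_vector_derivative M' s w) (at s within {a..b})" if "s \<in> ?U" for s w
    unfolding M'_def by (rule Ck_on_interval(1)[OF ab Oo MC that])
  have hM': "((\<lambda>s. M' s w) has_vector_derivative vector_derivative (\<lambda>s. M' s w) (at s within {a..b})) (at s within {a..b})" if "s \<in> ?U" for s w
    unfolding M'_def by (rule Ck_on_interval(1)[OF ab Oo Ck_on_interval(2)[OF ab Oo MC[of "Suc (Suc 0)"]] that])
  have lM': "linear (M' s)" if "s \<in> ?U" for s
    by (rule linear_vector_derivative[OF ab Oo that lM hM[OF that]])
  define dn where "dn = (\<lambda>s x. frechet_derivative (\<lambda>z. N \<phi> z x) (at (phase_curve \<phi> s)) (snd (phase_curve \<phi> s), H \<phi> (phase_curve \<phi> s)))"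
  have hn: "((\<lambda>s. ?n s (X s)) has_vector_derivative dn s (X s) + ?n s X') (at s within {a..b})"
    if "s \<in> ?U" "(X has_vector_derivative X') (at s within {a..b})" for s X X'
    unfolding dn_def
    by (rule conn_coeff_has_vector_derivative[OF \<phi> phase_curve(1)[OF \<phi> UI(2)[OF that(1)]]
          has_vector_derivative_at_within[OF phase_curve(2)[OF \<phi> UI(2)[OF that(1)]]] that(2)])
  have ln: "linear (?n s)" if "s \<in> ?U" for s by (rule conn_linear_at[OF \<phi> that])
  \<comment> \<open>The matrix of the covariant derivative of \<open>J\<close>: derivative of the
    matrix plus its commutator with the connection.\<close>
  define M1 where "M1 = (\<lambda>s w. M' s w + ?n s (M s w) - M s (?n s w))"
  have nabla1: "nabla_endo A S {a..b} c J s v \<phi> = M1 s (v \<phi>)" if s: "s \<in> ?U" and v: "v \<in> tangent_space A (c s)" for s v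
    unfolding nabla_endo_def M1_def M'_def
    using \<phi> UI(3)[OF s] JM[OF s v] by (simp add: on_charts_def M_def conn_along_eq[OF \<phi> s])
  have lM1: "linear (M1 s)" if s: "s \<in> ?U" for s
    unfolding M1_def
    by (rule linearI)
      (simp_all add: linear_add[OF lM'[OF s]] linear_add[OF lM[OF s]] linear_add[OF ln[OF s]]
        linear_scale[OF lM'[OF s]] linear_scale[OF lM[OF s]] linear_scale[OF ln[OF s]] scaleR_add_right scaleR_diff_right)
  define M1' where "M1' = (\<lambda>s w. vector_derivative (\<lambda>s. M1 s w) (at s within {a..b}))"
  have hM1: "((\<lambda>s. M1 s w) has_vector_derivative M1' s w) (at s within {a..b})" if s: "s \<in> ?U" for s w
  proof -
    have nw: "((\<lambda>s. ?n s w) has_vector_derivative dn s w + ?n s 0) (at s within {a..b})"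
      by (rule hn[OF s has_vector_derivative_const])
    have "((\<lambda>s. M1 s w) has_vector_derivative
        vector_derivative (\<lambda>s. M' s w) (at s within {a..b}) + (dn s (M s w) + ?n s (M' s w)) - (M' s (?n s w) + M s (dn s w + ?n s 0))) (at s within {a..b})"
      unfolding M1_def
      by (intro has_vector_derivative_diff has_vector_derivative_add hM'[OF s] hn[OF s hM[OF s]]
          has_vector_derivative_linear_family[OF Oo s lM hM[OF s] lM'[OF s] nw])
    from vector_derivative_within_eq[OF ab UI(1)[OF s] this] this show ?thesis unfolding M1'_def by simp
  qed
  have lM1': "linear (M1' s)" if "s \<in> ?U" for s
    by (rule linear_vector_derivative[OF ab Oo that lM1 hM1[OF that]])
  have dE: "(E has_vector_derivative - ?n s (E s)) (at s within {a..b})" if "s \<in> ?U" for s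
    unfolding E_def by (rule parallel_component[OF e \<phi> that])
  define X where "X = (\<lambda>s. J s (e s) \<phi>)"
  have XM: "X s = M s (E s)" if "s \<in> ?U" for s
    unfolding X_def E_def by (rule JM[OF that et[OF UI(1)[OF that]]])
  define Y where "Y = (\<lambda>s. M1 s (E s))"
  have dX: "(X has_vector_derivative Y s - ?n s (X s)) (at s within {a..b})" if s: "s \<in> ?U" for s
  proof -
    have "((\<lambda>s. M s (E s)) has_vector_derivative M' s (E s) + M s (- ?n s (E s))) (at s within {a..b})"
      by (rule has_vector_derivative_linear_family[OF Oo s lM hM[OF s] lM'[OF s] dE[OF s]])
    moreover have "M' s (E s) + M s (- ?n s (E s)) = Y s - ?n s (X s)"
      by (simp add: Y_def M1_def XM[OF s] linear_neg[OF lM[OF s]])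
    ultimately have "((\<lambda>s. M s (E s)) has_vector_derivative Y s - ?n s (X s)) (at s within {a..b})" by simp
    then show ?thesis by (rule has_vector_derivative_within_transform[OF _ Oo s]) (simp add: XM)
  qed
  \<comment> \<open>The outer covariant derivative differentiates the matrix \<open>M1\<close> with
    the components \<open>E s\<close> frozen; the motion of \<open>E\<close> is accounted for
    separately by the product rule for \<open>Y\<close>.\<close>
  have jac: "M1' s (E s) + ?n s (M1 s (E s)) - M1 s (?n s (E s)) + jacobi_coeff A S \<phi> (phase_curve \<phi> s) (X s) = 0" if s: "s \<in> ?U" for s
  proof -
    note cvt = coord_vector_tangent[OF atlas \<phi>]
    have v1: "((\<lambda>r. nabla_endo A S {a..b} c J r (coord_vector A \<phi> (c r) (E s)) \<phi>) has_vector_derivative M1' s (E s)) (at s within {a..b})"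
      by (rule has_vector_derivative_within_transform[OF hM1[OF s] Oo s])
        (simp add: nabla1 cvt coord_vector_same[OF atlas \<phi>] chart_timesD)
    have h1: "nabla_endo A S {a..b} c (nabla_endo A S {a..b} c J) s (e s) \<phi> =
        M1' s (E s) + ?n s (M1 s (E s)) - M1 s (?n s (E s))"
      unfolding nabla_endo_def[of _ _ _ _ "nabla_endo A S {a..b} c J"]
      using \<phi> UI(3)[OF s] vector_derivative_within_eq[OF ab UI(1)[OF s] v1]
      by (simp add: on_charts_def nabla1[OF s] et[OF UI(1)[OF s]] cvt coord_vector_same[OF atlas \<phi>] E_def conn_along_eq[OF \<phi> s])
    have h2: "jacobi_endo A S {a..b} c s (J s (e s)) \<phi> = jacobi_coeff A S \<phi> (phase_curve \<phi> s) (X s)"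
      using \<phi> UI(3)[OF s] by (simp add: jacobi_endo_def on_charts_def velocity_chart(1)[OF \<phi> s] X_def)
    have *: "nabla_endo A S {a..b} c (nabla_endo A S {a..b} c J) s (e s) + jacobi_endo A S {a..b} c s (J s (e s)) = 0"
      using J et[OF UI(1)[OF s]] UI(1)[OF s] unfolding jacobi_tensor_def by blast
    from fun_cong[OF *, of \<phi>]
    have h3: "nabla_endo A S {a..b} c (nabla_endo A S {a..b} c J) s (e s) \<phi> + jacobi_endo A S {a..b} c s (J s (e s)) \<phi> = 0"
      by (simp only: plus_fun_apply zero_fun_apply)
    from h3 show ?thesis unfolding h1 h2 .
  qed
  have dY: "(Y has_vector_derivative - jacobi_coeff A S \<phi> (phase_curve \<phi> s) (X s) - ?n s (Y s)) (at s within {a..b})" if s: "s \<in> ?U" for s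
  proof -
    have "(Y has_vector_derivative M1' s (E s) + M1 s (- ?n s (E s))) (at s within {a..b})"
      unfolding Y_def by (rule has_vector_derivative_linear_family[OF Oo s lM1 hM1[OF s] lM1'[OF s] dE[OF s]])
    moreover have "M1' s (E s) + M1 s (- ?n s (E s)) = - jacobi_coeff A S \<phi> (phase_curve \<phi> s) (X s) - ?n s (Y s)"
      using jac[OF s] unfolding Y_def linear_neg[OF lM1[OF s]] by (simp add: algebra_simps eq_neg_iff_add_eq_0)
    ultimately show ?thesis by simp
  qed
  define \<omega> where "\<omega> = (\<lambda>s. vector_derivative X (at s within {a..b}))"
  have \<omega>: "\<omega> s = Y s - ?n s (X s)" if "s \<in> ?U" for s
    unfolding \<omega>_def by (rule vector_derivative_within_eq[OF ab UI(1)[OF that] dX[OF that]])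
  have d\<omega>: "(\<omega> has_vector_derivative frechet_derivative (H \<phi>) (at (phase_curve \<phi> t)) (X t, \<omega> t)) (at t within {a..b})"
  proof -
    let ?D = "frechet_derivative (H \<phi>) (at (phase_curve \<phi> t))" and ?z = "phase_curve \<phi> t"
    note ph = phase_curve(1)[OF \<phi> UI(2)[OF t]]
    have lD: "linear ?D" using has_derivative_linear[OF acceleration_has_derivative[OF \<phi> ph]] .
    have "((\<lambda>s. Y s - ?n s (X s)) has_vector_derivative (- jacobi_coeff A S \<phi> ?z (X t) - ?n t (Y t)) - (dn t (X t) + ?n t (\<omega> t))) (at t within {a..b})"
      using hn[OF t dX[OF t]] by (intro has_vector_derivative_diff dY[OF t]) (simp add: \<omega>[OF t])
    moreover have "(- jacobi_coeff A S \<phi> ?z (X t) - ?n t (Y t)) - (dn t (X t) + ?n t (\<omega> t)) = ?D (X t, \<omega> t)"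
    proof -
      have Y: "?n t (Y t) = ?n t (\<omega> t) + ?n t (?n t (X t))"
        using linear_add[OF ln[OF t], of "\<omega> t" "?n t (X t)"] by (simp add: \<omega>[OF t])
      have j: "jacobi_coeff A S \<phi> ?z (X t) = - ?D (X t, 0) - dn t (X t) - ?n t (?n t (X t))"
        by (simp only: jacobi_coeff_eq[OF \<phi> ph] dn_def)
      have n: "?n t (\<omega> t) + ?n t (\<omega> t) = - ?D (0, \<omega> t)"
        by (simp only: scaleR_2[symmetric]) (simp add: conn_coeff_eq[OF \<phi> ph])
      have "?D (X t, \<omega> t) = ?D (X t, 0) + ?D (0, \<omega> t)" using linear_add[OF lD, of "(X t, 0)" "(0, \<omega> t)"] by simp
      also have "\<dots> = ?D (X t, 0) - (?n t (\<omega> t) + ?n t (\<omega> t))" by (simp add: n)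
      finally show ?thesis unfolding Y j by (simp add: algebra_simps)
    qed
    ultimately have "((\<lambda>s. Y s - ?n s (X s)) has_vector_derivative ?D (X t, \<omega> t)) (at t within {a..b})" by simp
    then show ?thesis by (rule has_vector_derivative_within_transform[OF _ Oo t]) (simp add: \<omega>)
  qed
  show "((\<lambda>s. J s (e s) \<phi>) has_vector_derivative vector_derivative (\<lambda>s. J s (e s) \<phi>) (at t within {a..b})) (at t within {a..b})"
    using dX[OF t] \<omega>[OF t] by (simp add: X_def[symmetric] \<omega>_def)
  show "((\<lambda>t. vector_derivative (\<lambda>s. J s (e s) \<phi>) (at t within {a..b})) has_vector_derivative
      frechet_derivative (H \<phi>) (at (phase_curve \<phi> t)) (J t (e t) \<phi>, vector_derivative (\<lambda>s. J s (e s) \<phi>) (at t within {a..b}))) (at t within {a..b})"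
    using d\<omega> by (simp add: X_def \<omega>_def)
qed

text \<open>With \<open>g\<close> the time derivative of \<open>f\<close>, every curve of the family
  satisfies that the time derivative of \<open>g\<close> is \<open>H (f, g)\<close>. Differentiating
  this in the direction \<sigma> gives the second equation of the pair; symmetry of second
  derivatives, once for \<open>f\<close> and once for \<open>g\<close>, brings the time derivative
  outside.\<close>

lemma variation_field_pair:
  fixes V :: "real \<times> 's::euclidean_space \<Rightarrow> 'a" and \<sigma> :: 's
  assumes V: "geodesic_family I' B V" and B: "0 \<in> B" and I': "{a..b} \<subseteq> I'" "I' \<subseteq> I0"
    and Vc: "\<And>t. t \<in> I' \<Longrightarrow> V (t, 0) = c0 t"
  defines "f \<equiv> \<lambda>\<phi> p. chart_map \<phi> (V p)"
  shows "jacobi_pair (\<lambda>t. on_charts A (c t) (\<lambda>\<phi>. frechet_derivative (f \<phi>) (at (t, 0)) (0, \<sigma>)))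
    (\<lambda>\<phi> t. frechet_derivative (\<lambda>p. frechet_derivative (f \<phi>) (at p) (1, 0)) (at (t, 0)) (0, \<sigma>))"
proof -
  have Vo: "open I'" "open B" "smooth_map (open_atlas (I' \<times> B)) A V" and Vg: "\<And>s. s \<in> B \<Longrightarrow> geodesic_on A S I' (\<lambda>t. V (t, s))"
    using V by (auto simp: geodesic_family_def)
  define E where "E = (\<lambda>\<phi> :: ('a, 'e) chart. {p \<in> I' \<times> B. V p \<in> chart_dom \<phi>})"
  have Eo: "open (E \<phi>)" and fs: "smooth_on (E \<phi>) (f \<phi>)" if "\<phi> \<in> A" for \<phi>
    using Vo(3) that by (auto simp: smooth_map_open_atlas E_def f_def)
  define g where "g = (\<lambda>\<phi> p. frechet_derivative (f \<phi>) (at p) (1, 0))"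
  have gs: "smooth_on (E \<phi>) (g \<phi>)" if "\<phi> \<in> A" for \<phi>
    unfolding g_def by (rule smooth_on_derivative[OF fs[OF that] Eo[OF that]])
  have gv: "vector_derivative (\<lambda>t. f \<phi> (t, s)) (at t) = g \<phi> (t, s)" if "\<phi> \<in> A" "(t, s) \<in> E \<phi>" for \<phi> t s
    unfolding g_def by (rule vector_derivative_at[OF slice_vector_derivative[OF fs[OF that(1)] Eo[OF that(1)] that(2)]])
  have Eslice: "open ((\<lambda>t. (t, s)) -` E \<phi>)" if "\<phi> \<in> A" for \<phi> s
    using Eo[OF that] by (rule open_vimage) (intro continuous_intros)
  \<comment> \<open>The equation is established on an open set around the points
    \<open>(t, 0)\<close>, not only along the curve, since it is to be differentiated across the
    curves.\<close>
  have eq: "frechet_derivative (g \<phi>) (at p) (1, 0) = H \<phi> (f \<phi> p, g \<phi> p)" "(f \<phi> p, g \<phi> p) \<in> phase_domain \<phi>"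
    if \<phi>: "\<phi> \<in> A" and p: "p \<in> E \<phi>" for \<phi> p
  proof -
    obtain t s where ps: "p = (t, s)" by (cases p)
    have ts: "t \<in> I'" "s \<in> B" "V (t, s) \<in> chart_dom \<phi>" "(t, s) \<in> E \<phi>" using p ps by (auto simp: E_def)
    note gc = geodesic_coordinates[OF Vg[OF ts(2)] \<phi> ts(1,3), folded f_def]
    have "((\<lambda>t. vector_derivative (\<lambda>t. f \<phi> (t, s)) (at t)) has_vector_derivative H \<phi> (f \<phi> (t, s), g \<phi> (t, s))) (at t)"
      using gc(2) gv[OF \<phi> ts(4)] by (simp add: f_def)
    then have "((\<lambda>t. g \<phi> (t, s)) has_vector_derivative H \<phi> (f \<phi> (t, s), g \<phi> (t, s))) (at t)"
      by (rule has_vector_derivative_transform_within_open[OF _ Eslice[OF \<phi>]]) (use ts gv[OF \<phi>] in auto)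
    from vector_derivative_at[OF this] vector_derivative_at[OF slice_vector_derivative[OF gs[OF \<phi>] Eo[OF \<phi>] ts(4)]]
    show "frechet_derivative (g \<phi>) (at p) (1, 0) = H \<phi> (f \<phi> p, g \<phi> p)" by (simp add: ps)
    show "(f \<phi> p, g \<phi> p) \<in> phase_domain \<phi>" using gc(3) gv[OF \<phi> ts(4)] by (simp add: ps f_def)
  qed
  have tE: "(t, 0) \<in> E \<phi>" if "t \<in> {a..b} \<inter> chart_times \<phi>" for t \<phi>
    using that I' B Vc by (auto simp: E_def chart_times_def)
  show ?thesis
    unfolding jacobi_pair_def
  proof (intro conjI ballI)
    fix t assume t: "t \<in> {a..b}"
    have tI': "t \<in> I'" and c: "c t = V (t, 0)" using t I' Vc ceq by auto
    show "on_charts A (c t) (\<lambda>\<phi>. frechet_derivative (f \<phi>) (at (t, 0)) (0, \<sigma>)) \<in> tangent_space A (c t)"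
      unfolding tangent_space_def
    proof (intro CollectI conjI ballI allI impI)
      fix \<phi> \<psi> assume *: "\<phi> \<in> A" "\<psi> \<in> A" "c t \<in> chart_dom \<phi>" "c t \<in> chart_dom \<psi>"
      have p: "(t, 0) \<in> E \<phi>" "(t, 0) \<in> E \<psi>" using * tI' B c by (auto simp: E_def)
      have "((\<lambda>p. transition \<phi> \<psi> (f \<phi> p)) has_derivative
          (\<lambda>v. frechet_derivative (transition \<phi> \<psi>) (at (chart_map \<phi> (c t))) (frechet_derivative (f \<phi>) (at (t, 0)) v))) (at (t, 0))"
        using has_derivative_compose[OF smooth_on_has_derivative[OF fs[OF *(1)] Eo[OF *(1)] p(1)], of "transition \<phi> \<psi>"]
          transition_has_derivative[OF atlas *] c by (simp add: f_def)
      then have "(f \<psi> has_derivative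
          (\<lambda>v. frechet_derivative (transition \<phi> \<psi>) (at (chart_map \<phi> (c t))) (frechet_derivative (f \<phi>) (at (t, 0)) v))) (at (t, 0))"
        by (rule has_derivative_transform_within_open[OF _ open_Int[OF Eo[OF *(1)] Eo[OF *(2)]]])
          (use p transition_map[OF atlas *(1)] in \<open>auto simp: f_def E_def\<close>)
      from fun_cong[OF frechet_derivative_at[OF this], of "(0, \<sigma>)"]
      show "on_charts A (c t) (\<lambda>\<phi>. frechet_derivative (f \<phi>) (at (t, 0)) (0, \<sigma>)) \<psi> =
          frechet_derivative (transition \<phi> \<psi>) (at (chart_map \<phi> (c t))) (on_charts A (c t) (\<lambda>\<phi>. frechet_derivative (f \<phi>) (at (t, 0)) (0, \<sigma>)) \<phi>)"
        using * by (simp add: on_charts_def)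
    qed (auto simp: on_charts_def)
  next
    fix \<phi> t assume \<phi>: "\<phi> \<in> A" and t: "t \<in> {a..b} \<inter> chart_times \<phi>"
    let ?\<xi> = "\<lambda>p. frechet_derivative (f \<phi>) (at p) (0, \<sigma>)" and ?w = "\<lambda>p. frechet_derivative (g \<phi>) (at p) (0, \<sigma>)"
    note p = tE[OF t] and Eo = Eo[OF \<phi>] and fs = fs[OF \<phi>] and gs = gs[OF \<phi>]
    have xs: "on_charts A (c s) (\<lambda>\<phi>. frechet_derivative (f \<phi>) (at (s, 0)) (0, \<sigma>)) \<phi> = ?\<xi> (s, 0)" if "s \<in> {a..b} \<inter> chart_times \<phi>" for s
      using \<phi> chart_timesD[OF that] by (simp add: on_charts_def)
    have "((\<lambda>s. ?\<xi> (s, 0)) has_vector_derivative frechet_derivative ?\<xi> (at (t, 0)) (1, 0)) (at t)"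
      by (rule slice_vector_derivative[OF smooth_on_derivative[OF fs Eo] Eo p])
    also have "frechet_derivative ?\<xi> (at (t, 0)) (1, 0) = ?w (t, 0)"
      unfolding g_def by (rule second_derivative_symmetric[OF Eo fs p])
    finally have "((\<lambda>s. ?\<xi> (s, 0)) has_vector_derivative ?w (t, 0)) (at t within {a..b})"
      by (rule has_vector_derivative_at_within)
    then show "((\<lambda>s. on_charts A (c s) (\<lambda>\<phi>. frechet_derivative (f \<phi>) (at (s, 0)) (0, \<sigma>)) \<phi>) has_vector_derivative
        frechet_derivative (\<lambda>p. frechet_derivative (f \<phi>) (at p) (1, 0)) (at (t, 0)) (0, \<sigma>)) (at t within {a..b})"
      unfolding g_def by (rule has_vector_derivative_within_transform[OF _ open_chart_times[OF \<phi>] t]) (simp add: xs)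
    have zc: "(f \<phi> (t, 0), g \<phi> (t, 0)) = phase_curve \<phi> t"
    proof -
      have tI: "t \<in> I'" using t I' by auto
      have "((\<lambda>s. f \<phi> (s, 0)) has_vector_derivative g \<phi> (t, 0)) (at t)"
        unfolding g_def by (rule slice_vector_derivative[OF fs Eo p])
      then have "((\<lambda>s. chart_map \<phi> (c0 s)) has_vector_derivative g \<phi> (t, 0)) (at t)"
        by (rule has_vector_derivative_transform_within_open[OF _ Vo(1) tI]) (simp add: f_def Vc)
      from vector_derivative_at[OF this] show ?thesis using Vc[OF tI] by (simp add: phase_curve_def f_def)
    qed
    have "((\<lambda>s. ?w (s, 0)) has_vector_derivative frechet_derivative ?w (at (t, 0)) (1, 0)) (at t)"
      by (rule slice_vector_derivative[OF smooth_on_derivative[OF gs Eo] Eo p])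
    also have "frechet_derivative ?w (at (t, 0)) (1, 0) = frechet_derivative (\<lambda>p. frechet_derivative (g \<phi>) (at p) (1, 0)) (at (t, 0)) (0, \<sigma>)"
      by (rule second_derivative_symmetric[OF Eo gs p])
    also have "\<dots> = frechet_derivative (H \<phi>) (at (phase_curve \<phi> t)) (?\<xi> (t, 0), ?w (t, 0))"
    proof -
      have "((\<lambda>p. (f \<phi> p, g \<phi> p)) has_derivative (\<lambda>v. (frechet_derivative (f \<phi>) (at (t, 0)) v, frechet_derivative (g \<phi>) (at (t, 0)) v))) (at (t, 0))"
        by (rule has_derivative_Pair[OF smooth_on_has_derivative[OF fs Eo p] smooth_on_has_derivative[OF gs Eo p]])
      from has_derivative_compose[OF this acceleration_has_derivative[OF \<phi> eq(2)[OF \<phi> p]]]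
      have "((\<lambda>p. H \<phi> (f \<phi> p, g \<phi> p)) has_derivative (\<lambda>v. frechet_derivative (H \<phi>) (at (phase_curve \<phi> t))
          (frechet_derivative (f \<phi>) (at (t, 0)) v, frechet_derivative (g \<phi>) (at (t, 0)) v))) (at (t, 0))"
        unfolding zc .
      then have "((\<lambda>p. frechet_derivative (g \<phi>) (at p) (1, 0)) has_derivative (\<lambda>v. frechet_derivative (H \<phi>) (at (phase_curve \<phi> t))
          (frechet_derivative (f \<phi>) (at (t, 0)) v, frechet_derivative (g \<phi>) (at (t, 0)) v))) (at (t, 0))"
        by (rule has_derivative_transform_within_open[OF _ Eo p]) (simp add: eq(1)[OF \<phi>])
      from fun_cong[OF frechet_derivative_at[OF this], of "(0, \<sigma>)"] show ?thesis by (rule sym)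
    qed
    finally have "((\<lambda>s. ?w (s, 0)) has_vector_derivative frechet_derivative (H \<phi>) (at (phase_curve \<phi> t)) (?\<xi> (t, 0), ?w (t, 0))) (at t within {a..b})"
      by (rule has_vector_derivative_at_within)
    then show "((\<lambda>t. frechet_derivative (\<lambda>p. frechet_derivative (f \<phi>) (at p) (1, 0)) (at (t, 0)) (0, \<sigma>)) has_vector_derivative
        frechet_derivative (H \<phi>) (at (phase_curve \<phi> t)) (on_charts A (c t) (\<lambda>\<phi>. frechet_derivative (f \<phi>) (at (t, 0)) (0, \<sigma>)) \<phi>,
          frechet_derivative (\<lambda>p. frechet_derivative (f \<phi>) (at p) (1, 0)) (at (t, 0)) (0, \<sigma>))) (at t within {a..b})"
      by (simp add: g_def xs[OF t])
  qed
qed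

end

subsection \<open>Geodesic coordinates around the curve\<close>

lemma span_lessThan_image:
  assumes "v \<in> span (f ` {..<n::nat})"
  obtains l where "v = (\<Sum>i<n. l i *\<^sub>R f i)"
proof -
  have "\<exists>l. v = (\<Sum>i<n. l i *\<^sub>R f i)"
    using assms
  proof (induction rule: span_induct_alt)
    case base
    have "0 = (\<Sum>i<n. 0 *\<^sub>R f i)" by simp
    then show ?case by (rule exI[of _ "\<lambda>_. 0"])
  next
    case (step r x y)
    then obtain j l where j: "j < n" "x = f j" and l: "y = (\<Sum>i<n. l i *\<^sub>R f i)" by blast
    have "(\<Sum>i<n. (l i + (if i = j then r else 0)) *\<^sub>R f i) = y + (\<Sum>i<n. (if i = j then r else 0) *\<^sub>R f i)"
      by (simp add: scaleR_add_left sum.distrib l)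
    also have "(\<Sum>i<n. (if i = j then r else 0) *\<^sub>R f i) = (\<Sum>i<n. if i = j then r *\<^sub>R f i else 0)"
      by (rule sum.cong) auto
    also have "\<dots> = r *\<^sub>R x" using j by (simp add: sum.delta)
    finally have "r *\<^sub>R x + y = (\<Sum>i<n. (l i + (if i = j then r else 0)) *\<^sub>R f i)" by (simp add: add.commute)
    then show ?case by (rule exI[of _ "\<lambda>i. l i + (if i = j then r else 0)"])
  qed
  then show thesis using that by blast
qed

lemma (in spray_manifold) geodesic_on_subinterval:
  assumes g: "geodesic_on A S I' c'" and I: "open I" "is_interval I" "I \<subseteq> I'"
  shows "geodesic_on A S I c'"
proof (rule geodesic_on_local[OF I(1,2)])
  fix t assume t: "t \<in> I"
  show "\<exists>J c''. t \<in> J \<and> open J \<and> J \<subseteq> I \<and> (\<exists>J'. J \<subseteq> J' \<and> geodesic_on A S J' c'') \<and> (\<forall>s\<in>J. c' s = c'' s)"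
    by (rule exI[of _ I], rule exI[of _ c']) (use g I t in blast)
qed

context geodesic_segment
begin

text \<open>Initial data of the form base value plus \<open>\<zeta> s\<close> realise any prescribed
  first derivative at \<open>s = 0\<close> in position and velocity.\<close>

lemma geodesic_variation_exists:
  fixes \<zeta> :: "'s::euclidean_space \<Rightarrow> 'e \<times> 'e"
  assumes \<phi>: "\<phi> \<in> A" and t0: "t0 \<in> {a..b} \<inter> chart_times \<phi>" and lin: "linear \<zeta>"
  obtains I' B V where "geodesic_family I' B V" "0 \<in> B" "{a..b} \<subseteq> I'" "I' \<subseteq> I0" "\<And>t. t \<in> I' \<Longrightarrow> V (t, 0) = c0 t"
    "\<And>\<sigma>. frechet_derivative (\<lambda>p. chart_map \<phi> (V p)) (at (t0, 0)) (0, \<sigma>) = fst (\<zeta> \<sigma>)"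
    "\<And>\<sigma>. frechet_derivative (\<lambda>p. frechet_derivative (\<lambda>p. chart_map \<phi> (V p)) (at p) (1, 0)) (at (t0, 0)) (0, \<sigma>) = snd (\<zeta> \<sigma>)"
proof -
  define Z where "Z = (\<lambda>s. phase_curve \<phi> t0 + \<zeta> s)"
  have bl: "bounded_linear \<zeta>" using lin by (rule linear_conv_bounded_linear[THEN iffD1])
  have Zs: "smooth_on U Z" if "open U" for U
    unfolding Z_def by (rule smooth_on_add[OF that smooth_on_const[OF that] smooth_on_linear[OF bl that]])
  have Zd: "(Z has_derivative \<zeta>) (at s)" for s
    unfolding Z_def using has_derivative_add[OF has_derivative_const bounded_linear_imp_has_derivative[OF bl]] by simp
  have Z0: "Z 0 = phase_curve \<phi> t0" using linear_0[OF lin] by (simp add: Z_def)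
  have t0': "t0 \<in> I0" "c0 t0 \<in> chart_dom \<phi>" "t0 \<in> chart_times \<phi>" using t0 by (auto simp: chart_times_def)
  obtain \<delta> Q where \<delta>: "\<delta> > 0" and Q: "open Q" "phase_curve \<phi> t0 \<in> Q" "Q \<subseteq> phase_domain \<phi>"
    and flow: "\<And>(B :: 's set) Z t1. open B \<Longrightarrow> smooth_on B Z \<Longrightarrow> Z ` B \<subseteq> Q \<Longrightarrow>
      \<exists>W. smooth_map (open_atlas ({t1-\<delta><..<t1+\<delta>} \<times> B)) A W \<and>
        (\<forall>s\<in>B. geodesic_on A S {t1-\<delta><..<t1+\<delta>} (\<lambda>t. W (t, s)) \<and>
          W (t1, s) \<in> chart_dom \<phi> \<and> chart_map \<phi> (W (t1, s)) = fst (Z s) \<and>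
          vector_derivative (\<lambda>t. chart_map \<phi> (W (t, s))) (at t1) = snd (Z s))"
    using local_geodesic_flow[where 's = 's, OF \<phi> phase_curve(1)[OF \<phi> t0'(3)]] by blast
  define B0 where "B0 = Z -` Q"
  have "continuous_on UNIV Z" by (rule smooth_on_imp_continuous_on[OF Zs[OF open_UNIV]])
  then have B0: "open B0" unfolding B0_def using Q(1) by (simp add: open_vimage)
  have B00: "0 \<in> B0" using Q(2) Z0 by (simp add: B0_def)
  let ?T = "{t0-\<delta><..<t0+\<delta>}"
  obtain W where W: "smooth_map (open_atlas (?T \<times> B0)) A W"
    and Wg: "\<And>s. s \<in> B0 \<Longrightarrow> geodesic_on A S ?T (\<lambda>t. W (t, s))"
    and W0: "\<And>s. s \<in> B0 \<Longrightarrow> W (t0, s) \<in> chart_dom \<phi>" "\<And>s. s \<in> B0 \<Longrightarrow> chart_map \<phi> (W (t0, s)) = fst (Z s)"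
      "\<And>s. s \<in> B0 \<Longrightarrow> vector_derivative (\<lambda>t. chart_map \<phi> (W (t, s))) (at t0) = snd (Z s)"
    using flow[OF B0 Zs[OF B0], of t0] unfolding B0_def by blast
  \<comment> \<open>The flow may run beyond the domain of \<open>c0\<close>; the continuation is
    carried out inside \<open>I0\<close>.\<close>
  define I1 where "I1 = ?T \<inter> I0"
  have I1: "open I1" "is_interval I1" "I1 \<subseteq> ?T" "I1 \<subseteq> I0" "t0 \<in> I1"
    unfolding I1_def using geodesic_onD(1,2)[OF geo] \<delta> t0'(1) by (auto intro: is_interval_Int simp: is_interval_oo)
  have fam: "geodesic_family I1 B0 W"
    unfolding geodesic_family_def
  proof (intro conjI ballI I1 B0)
    show "smooth_map (open_atlas (I1 \<times> B0)) A W"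
      by (rule smooth_map_open_atlas_restrict[OF atlas W open_Times[OF I1(1) B0]]) (use I1(3) in blast)
    show "geodesic_on A S I1 (\<lambda>t. W (t, s))" if "s \<in> B0" for s
      by (rule geodesic_on_subinterval[OF Wg[OF that] I1(1-3)])
  qed
  have Wc: "W (t, 0) = c0 t" if t: "t \<in> I1" for t
  proof -
    have inj: "inj_on (chart_map \<phi>) (chart_dom \<phi>)" using atlas \<phi> by (simp add: smooth_atlas_def)
    have eq: "W (t0, 0) = c0 t0"
      using inj_onD[OF inj _ W0(1)[OF B00] t0'(2)] W0(2)[OF B00] by (simp add: Z0 phase_curve_def)
    have "velocity A ?T (\<lambda>t. W (t, 0)) t0 = velocity A I0 c0 t0"
      by (rule velocity_eqI[OF Wg[OF B00] geo _ t0'(1) eq \<phi> t0'(2)]) (use \<delta> W0(3)[OF B00] in \<open>auto simp: Z0 phase_curve_def\<close>)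
    from geodesic_unique[OF Wg[OF B00] geo I1(1) _ I1(3,4,5) t this] I1(2)
    have "velocity A ?T (\<lambda>t. W (t, 0)) t = velocity A I0 c0 t" by (simp add: is_interval_connected_1)
    from arg_cong[OF this, of fst] show ?thesis by (simp add: fst_velocity_geodesic)
  qed
  have ab0: "a \<in> I0" "b \<in> I0" using sub ab by auto
  \<comment> \<open>The two ends are reached one after the other; the final interval contains both
    and hence all of \<open>{a..b}\<close>.\<close>
  obtain I2 B2 V2 where 2: "I1 \<subseteq> I2" "I2 \<subseteq> I0" "a \<in> I2" "0 \<in> B2" "B2 \<subseteq> B0" "geodesic_family I2 B2 V2"
    "\<And>t s. t \<in> I1 \<Longrightarrow> s \<in> B2 \<Longrightarrow> V2 (t, s) = W (t, s)" "\<And>t. t \<in> I2 \<Longrightarrow> V2 (t, 0) = c0 t"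
    using geodesic_family_extend[OF geo fam B00 I1(4) Wc I1(5) ab0(1)] by metis
  obtain I3 B V where 3: "I2 \<subseteq> I3" "I3 \<subseteq> I0" "b \<in> I3" "0 \<in> B" "B \<subseteq> B2" "geodesic_family I3 B V"
    "\<And>t s. t \<in> I2 \<Longrightarrow> s \<in> B \<Longrightarrow> V (t, s) = V2 (t, s)" "\<And>t. t \<in> I3 \<Longrightarrow> V (t, 0) = c0 t"
    using geodesic_family_extend[OF geo 2(6,4,2,8) 2(3) ab0(2)] by metis
  \<comment> \<open>The continuations do not change the family near \<open>t0\<close>, so the
    prescribed derivatives survive.\<close>
  have VW: "V (t, s) = W (t, s)" if "t \<in> I1" "s \<in> B" for t s
    using 2(1,7) 3(5,7) that by (metis subsetD)
  have I3: "open I3" "is_interval I3" "open B" "smooth_map (open_atlas (I3 \<times> B)) A V"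
    using 3(6) by (auto simp: geodesic_family_def)
  have BB0: "s \<in> B0" if "s \<in> B" for s using that 3(5) 2(5) by blast
  have t03: "t0 \<in> I3" using I1(5) 2(1) 3(1) by blast
  define f where "f = (\<lambda>p. chart_map \<phi> (V p))"
  define g where "g = (\<lambda>p. frechet_derivative f (at p) (1, 0))"
  define E where "E = {p \<in> I3 \<times> B. V p \<in> chart_dom \<phi>}"
  have E: "open E" and fs: "smooth_on E f"
    using I3(4) \<phi> unfolding smooth_map_open_atlas E_def f_def by blast+
  have gs: "smooth_on E g" unfolding g_def by (rule smooth_on_derivative[OF fs E])
  have tE: "(t0, s) \<in> E" if "s \<in> B" for s
    using that t03 VW[OF I1(5) that] W0(1)[OF BB0[OF that]] by (simp add: E_def)
  have fZ: "f (t0, s) = fst (Z s)" if "s \<in> B" for s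
    using VW[OF I1(5) that] W0(2)[OF BB0[OF that]] by (simp add: f_def)
  have gZ: "g (t0, s) = snd (Z s)" if s: "s \<in> B" for s
  proof -
    have "((\<lambda>t. f (t, s)) has_vector_derivative g (t0, s)) (at t0)"
      unfolding g_def by (rule slice_vector_derivative[OF fs E tE[OF s]])
    then have "((\<lambda>t. chart_map \<phi> (W (t, s))) has_vector_derivative g (t0, s)) (at t0)"
      by (rule has_vector_derivative_transform_within_open[OF _ I1(1,5)]) (simp add: f_def VW[OF _ s])
    from vector_derivative_at[OF this] W0(3)[OF BB0[OF s]] show ?thesis by simp
  qed
  have 4: "frechet_derivative f (at (t0, 0)) (0, \<sigma>) = fst (\<zeta> \<sigma>)" for \<sigma>
  proof -
    have "((\<lambda>s. fst (Z s)) has_derivative (\<lambda>\<sigma>. frechet_derivative f (at (t0, 0)) (0, \<sigma>))) (at 0)"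
      by (rule has_derivative_transform_within_open[OF slice_derivative[OF fs E tE[OF 3(4)]] I3(3) 3(4)]) (simp add: fZ)
    from fun_cong[OF has_derivative_unique[OF this has_derivative_fst[OF Zd]]] show ?thesis .
  qed
  have 5: "frechet_derivative g (at (t0, 0)) (0, \<sigma>) = snd (\<zeta> \<sigma>)" for \<sigma>
  proof -
    have "((\<lambda>s. snd (Z s)) has_derivative (\<lambda>\<sigma>. frechet_derivative g (at (t0, 0)) (0, \<sigma>))) (at 0)"
      by (rule has_derivative_transform_within_open[OF slice_derivative[OF gs E tE[OF 3(4)]] I3(3) 3(4)]) (simp add: gZ)
    from fun_cong[OF has_derivative_unique[OF this has_derivative_snd[OF Zd]]] show ?thesis .
  qed
  have "{a..b} \<subseteq> I3"
    using I3(2) subsetD[OF 3(1) 2(3)] 3(3) by (meson atLeastAtMost_iff is_interval_1 subsetI)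
  from that[OF 3(6,4) this 3(2,8) 4[unfolded f_def] 5[unfolded g_def f_def]] show thesis .
qed

text \<open>At \<open>(t, 0)\<close> the differential sends \<open>(\<tau>, \<sigma>)\<close> to
  \<open>w\<close> plus \<tau> times the velocity, where \<open>w = J t u\<close> and
  \<open>u\<close> is the combination of the frame with coefficients from \<sigma>. Since
  \<open>w\<close> lies in \<open>W_t\<close> and the velocity does not, a zero of the differential
  has \<open>\<tau> = 0\<close> and \<open>w = 0\<close>; injectivity of \<open>J t\<close> on
  \<open>W_t\<close> gives \<open>u = 0\<close>, and independence of the frame gives
  \<open>\<sigma> = 0\<close>.\<close>

lemma coordinates_from_jacobi_tensor:
  fixes e :: "nat \<Rightarrow> real \<Rightarrow> ('a, 'e) tvec" and k :: "'s::euclidean_space \<Rightarrow> nat"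
  assumes 0: "0 \<in> {a..b}" and inj: "inj_on c {a..b}" and J: "jacobi_tensor A S {a..b} c J"
    and vel: "snd (velocity A {a..b} c 0) \<notin> W" and e: "parallel_basis_extension A S {a..b} c W e"
    and trans: "transversal A {a..b} c J (frame_span e)"
    and bij: "\<And>t. t \<in> {a..b} \<Longrightarrow> bij_betw (J t) (frame_span e t) (frame_span e t)"
    and k: "bij_betw k (Basis :: 's set) {..<DIM('e) - 1}" and DIM: "DIM('s) + 1 = DIM('e)"
  obtains I' B r and V :: "real \<times> 's \<Rightarrow> 'a" where "geodesic_family I' B V" "r > 0"
    "\<And>t. t \<in> {a..b} \<Longrightarrow> V (t, 0) = c t"
    "\<And>D. open D \<Longrightarrow> D \<subseteq> (\<Union>x\<in>{a..b} \<times> {0}. ball x r) \<Longrightarrow> D \<subseteq> I' \<times> B \<and>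
      openin (atlas_topology A) (V ` D) \<and> diffeomorphism (open_atlas D) (restrict_atlas A (V ` D)) V"
proof -
  let ?n = "DIM('e) - 1"
  have par: "parallel_vector A S {a..b} c (e i)" if "i < ?n" for i
    using e that by (simp add: parallel_basis_extension_def)
  have e0: "inj_on (\<lambda>i. e i 0) {..<?n}" "independent ((\<lambda>i. e i 0) ` {..<?n})" "span ((\<lambda>i. e i 0) ` {..<?n}) = W"
    using e by (auto simp: parallel_basis_extension_def)
  have kn: "k i < ?n" if "i \<in> Basis" for i using bij_betwE[OF k] that by auto
  obtain \<phi>0 where \<phi>0: "\<phi>0 \<in> A" "0 \<in> {a..b} \<inter> chart_times \<phi>0" using chart_times_cover[OF 0] 0 by blast
  define \<xi> where "\<xi> = (\<lambda>i t. J t (e (k i) t))"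
  define \<omega> where "\<omega> = (\<lambda>i \<phi> t. vector_derivative (\<lambda>s. \<xi> i s \<phi>) (at t within {a..b}))"
  have pair: "jacobi_pair (\<xi> i) (\<omega> i)" if "i \<in> Basis" for i
    unfolding \<xi>_def \<omega>_def by (rule jacobi_tensor_pair[OF J par[OF kn[OF that]]])
  \<comment> \<open>The linear map that assigns to the basis vector \<open>i\<close> the initial
    position and derivative of the field obtained by applying \<open>J\<close> to
    \<open>e (k i)\<close>, both in the chart \<phi>0 at time 0.\<close>
  define \<zeta> where "\<zeta> = (\<lambda>\<sigma> :: 's. \<Sum>i\<in>Basis. (\<sigma> \<bullet> i) *\<^sub>R (\<xi> i 0 \<phi>0, \<omega> i \<phi>0 0))"
  have lin: "linear \<zeta>"
    unfolding \<zeta>_def by (rule linearI)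
      (simp_all add: inner_add_left scaleR_add_left sum.distrib scaleR_sum_right del: scaleR_Pair)
  have \<zeta>B: "\<zeta> i = (\<xi> i 0 \<phi>0, \<omega> i \<phi>0 0)" if i: "i \<in> Basis" for i
  proof -
    have "\<zeta> i = (\<Sum>j\<in>Basis. if j = i then (\<xi> j 0 \<phi>0, \<omega> j \<phi>0 0) else 0)"
      unfolding \<zeta>_def by (rule sum.cong) (use i in \<open>auto simp: inner_Basis zero_prod_def\<close>)
    then show ?thesis using i by (simp add: sum.delta)
  qed
  obtain I' B and V :: "real \<times> 's \<Rightarrow> 'a" where V: "geodesic_family I' B V" and B: "0 \<in> B" and I': "{a..b} \<subseteq> I'" "I' \<subseteq> I0"
    and Vc: "\<And>t. t \<in> I' \<Longrightarrow> V (t, 0) = c0 t"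
    and V1: "\<And>\<sigma>. frechet_derivative (\<lambda>p. chart_map \<phi>0 (V p)) (at (0, 0)) (0, \<sigma>) = fst (\<zeta> \<sigma>)"
    and V2: "\<And>\<sigma>. frechet_derivative (\<lambda>p. frechet_derivative (\<lambda>p. chart_map \<phi>0 (V p)) (at p) (1, 0)) (at (0, 0)) (0, \<sigma>) = snd (\<zeta> \<sigma>)"
    by (rule geodesic_variation_exists[OF \<phi>0 lin], rule that) blast+
  have Vo: "open I'" "open B" "smooth_map (open_atlas (I' \<times> B)) A V"
    using V by (auto simp: geodesic_family_def)
  have Vca: "V (t, 0) = c t" if "t \<in> {a..b}" for t using that I'(1) Vc ceq by auto
  \<comment> \<open>Both fields solve the linearized equation with the same values at time 0 in
    \<phi>0, so they agree at all times and, as tangent vectors, in all charts.\<close>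
  have D\<xi>: "frechet_derivative (\<lambda>p. chart_map \<phi> (V p)) (at (t, 0)) (0, i) = \<xi> i t \<phi>"
    if i: "i \<in> Basis" and \<phi>: "\<phi> \<in> A" and t: "t \<in> {a..b}" "c t \<in> chart_dom \<phi>" for i \<phi> t
  proof -
    have "on_charts A (c t) (\<lambda>\<phi>. frechet_derivative (\<lambda>p. chart_map \<phi> (V p)) (at (t, 0)) (0, i)) = \<xi> i t"
    proof (rule jacobi_pair_unique[OF variation_field_pair[OF V B I' Vc] pair[OF i] \<phi>0 _ _ t(1)])
      show "on_charts A (c 0) (\<lambda>\<phi>. frechet_derivative (\<lambda>p. chart_map \<phi> (V p)) (at (0, 0)) (0, i)) \<phi>0 = \<xi> i 0 \<phi>0"
        using \<phi>0 chart_timesD[OF \<phi>0(2)] \<zeta>B[OF i] by (simp add: on_charts_def V1)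
      show "frechet_derivative (\<lambda>p. frechet_derivative (\<lambda>p. chart_map \<phi>0 (V p)) (at p) (1, 0)) (at (0, 0)) (0, i) = \<omega> i \<phi>0 0"
        using \<zeta>B[OF i] by (simp add: V2)
    qed
    from fun_cong[OF this, of \<phi>] show ?thesis using \<phi> t by (simp add: on_charts_def)
  qed
  have imm: "\<exists>\<phi>\<in>A. V p \<in> chart_dom \<phi> \<and> inj (frechet_derivative (\<lambda>p. chart_map \<phi> (V p)) (at p))"
    if p: "p \<in> {a..b} \<times> {0}" for p
  proof -
    obtain t where t: "t \<in> {a..b}" and pt: "p = (t, 0)" using p by auto
    obtain \<phi> where \<phi>: "\<phi> \<in> A" "t \<in> chart_times \<phi>" using chart_times_cover[OF t] by blast
    have tU: "t \<in> {a..b} \<inter> chart_times \<phi>" using t \<phi> by simp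
    have ct: "c t \<in> chart_dom \<phi>" by (rule chart_timesD[OF tU])
    define E where "E = {p \<in> I' \<times> B. V p \<in> chart_dom \<phi>}"
    have E: "open E" and fs: "smooth_on E (\<lambda>p. chart_map \<phi> (V p))"
      using Vo(3) \<phi>(1) unfolding smooth_map_open_atlas E_def by blast+
    have pE: "(t, 0) \<in> E" using t I' B Vca ct by (auto simp: E_def)
    let ?D = "frechet_derivative (\<lambda>p. chart_map \<phi> (V p)) (at (t, 0))"
    have lD: "linear ?D" by (rule has_derivative_linear[OF smooth_on_has_derivative[OF fs E pE]])
    have tI: "t \<in> I'" using t I' by blast
    have "((\<lambda>t. chart_map \<phi> (V (t, 0))) has_vector_derivative ?D (1, 0)) (at t)"
      by (rule slice_vector_derivative[OF fs E pE])
    then have "((\<lambda>t. chart_map \<phi> (c0 t)) has_vector_derivative ?D (1, 0)) (at t)"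
      by (rule has_vector_derivative_transform_within_open[OF _ Vo(1) tI]) (simp add: Vc)
    from vector_derivative_at[OF this] have D1: "?D (1, 0) = snd (velocity A {a..b} c t) \<phi>"
      unfolding velocity_chart(2)[OF \<phi>(1) tU] by (simp add: phase_curve_def)
    have et: "e j t \<in> tangent_space A (c t)" if "j < ?n" for j
      using par[OF that] t by (simp add: parallel_vector_def vector_field_along_def)
    have Jlin: "J t (r *\<^sub>R u + q *\<^sub>R v) = r *\<^sub>R J t u + q *\<^sub>R J t v"
      if "u \<in> tangent_space A (c t)" "v \<in> tangent_space A (c t)" for u v r q
      using J t that by (simp add: jacobi_tensor_def endo_tensor_along_def)
    have T: "subspace (tangent_space A (c t))" by (rule tangent_space_subspace[OF atlas])
    have J0: "J t 0 = 0" using Jlin[OF subspace_0[OF T] subspace_0[OF T], of 0 0] by simp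
    \<comment> \<open>\<open>J t\<close> is linear on the tangent space only, so the sum is split
      inductively, with each partial sum shown to be a tangent vector.\<close>
    have Jsum: "J t (\<Sum>i\<in>X. q i *\<^sub>R e (k i) t) = (\<Sum>i\<in>X. q i *\<^sub>R J t (e (k i) t))"
      if "finite X" "X \<subseteq> Basis" for X :: "'s set" and q
      using that
    proof (induction X rule: finite_induct)
      case empty
      show ?case using J0 by (simp only: sum.empty)
    next
      case (insert i X)
      have "(\<Sum>i\<in>X. q i *\<^sub>R e (k i) t) \<in> tangent_space A (c t)"
        using insert.prems by (intro subspace_sum[OF T] subspace_scale[OF T] et kn) auto
      from Jlin[OF et this, of "k i" "q i" 1] insert.prems kn[of i]
      have "J t (q i *\<^sub>R e (k i) t + (\<Sum>i\<in>X. q i *\<^sub>R e (k i) t)) =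
          q i *\<^sub>R J t (e (k i) t) + J t (\<Sum>i\<in>X. q i *\<^sub>R e (k i) t)"
        by (simp only: scaleR_one) blast
      moreover have "J t (\<Sum>i\<in>X. q i *\<^sub>R e (k i) t) = (\<Sum>i\<in>X. q i *\<^sub>R J t (e (k i) t))"
        by (rule insert.IH) (use insert.prems in blast)
      ultimately show ?case by (simp only: sum.insert[OF insert.hyps(1,2)])
    qed
    have zero: "x = 0" if Dx: "?D x = 0" for x
    proof -
      obtain \<tau> and \<sigma> :: 's where x: "x = (\<tau>, \<sigma>)" by (cases x)
      define u where "u = (\<Sum>i\<in>Basis. (\<sigma> \<bullet> i) *\<^sub>R e (k i) t)"
      define w where "w = (\<Sum>i\<in>Basis. (\<sigma> \<bullet> i) *\<^sub>R \<xi> i t)"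
      have Ju: "J t u = w" unfolding u_def w_def \<xi>_def by (rule Jsum) auto
      have uspan: "u \<in> frame_span e t"
        unfolding u_def frame_span_def using kn by (intro span_sum span_scale span_base) auto
      have wspan: "w \<in> frame_span e t" using bij_betwE[OF bij[OF t]] uspan Ju by blast
      then obtain l where l: "w = (\<Sum>i<?n. l i *\<^sub>R e i t)"
        unfolding frame_span_def by (rule span_lessThan_image)
      have wT: "w \<in> tangent_space A (c t)"
        unfolding l using et by (intro subspace_sum[OF T] subspace_scale[OF T]) auto
      have D\<sigma>: "?D (0, \<sigma>) = w \<phi>"
      proof -
        have "linear (\<lambda>\<sigma>. ?D (0, \<sigma>))"
          using linear_compose[OF _ lD, of "\<lambda>\<sigma>. (0, \<sigma>)"] by (simp add: o_def linear_iff)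
        from linear_sum_Basis[OF this, of \<sigma>]
        have "?D (0, \<sigma>) = (\<Sum>i\<in>Basis. (\<sigma> \<bullet> i) *\<^sub>R ?D (0, i))" .
        also have "\<dots> = (\<Sum>i\<in>Basis. (\<sigma> \<bullet> i) *\<^sub>R \<xi> i t \<phi>)" using D\<xi>[OF _ \<phi>(1) t ct] by simp
        also have "\<dots> = w \<phi>" by (simp add: w_def fun_sum_apply scaleR_fun_def)
        finally show ?thesis .
      qed
      have "?D x = \<tau> *\<^sub>R ?D (1, 0) + ?D (0, \<sigma>)"
        using linear_add[OF lD, of "(\<tau>, 0)" "(0, \<sigma>)"] linear_scale[OF lD, of \<tau> "(1, 0)"] by (simp add: x)
      then have z: "w \<phi> + \<tau> *\<^sub>R snd (velocity A {a..b} c t) \<phi> = 0" using Dx by (simp add: D1 D\<sigma> add.commute)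
      have "w + \<tau> *\<^sub>R snd (velocity A {a..b} c t) = 0"
      proof (rule tangent_space_eqI[OF atlas _ subspace_0[OF T] \<phi>(1) ct])
        show "w + \<tau> *\<^sub>R snd (velocity A {a..b} c t) \<in> tangent_space A (c t)"
          by (intro subspace_add[OF T] wT subspace_scale[OF T] velocity_tangent_c[OF t])
        show "(w + \<tau> *\<^sub>R snd (velocity A {a..b} c t)) \<phi> = 0 \<phi>" using z by (simp add: scaleR_fun_def)
      qed
      from frame_independent(1)[OF par 0 e0(1,2) _ t this[unfolded l]] vel e0(3) have \<tau>: "\<tau> = 0" by simp
      have "w = 0" using \<open>w + \<tau> *\<^sub>R snd (velocity A {a..b} c t) = 0\<close> \<tau> by simp
      then have "J t u = J t 0" using Ju J0 by simp
      moreover have "0 \<in> frame_span e t" unfolding frame_span_def by (rule span_zero)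
      ultimately have u0: "u = 0" using inj_onD[OF bij_betw_imp_inj_on[OF bij[OF t]]] uspan by blast
      \<comment> \<open>The relation is re-indexed from basis vectors to frame indices, the form in
        which independence of the frame is stated.\<close>
      define k' where "k' = inv_into Basis k"
      have k'k: "k' (k i) = i" if "i \<in> Basis" for i
        unfolding k'_def by (rule inv_into_f_f[OF bij_betw_imp_inj_on[OF k] that])
      have "(\<Sum>j<?n. (\<sigma> \<bullet> k' j) *\<^sub>R e j t) = (\<Sum>i\<in>Basis. (\<sigma> \<bullet> k' (k i)) *\<^sub>R e (k i) t)"
        by (rule sum.reindex_bij_betw[OF k, symmetric])
      also have "\<dots> = u" unfolding u_def by (rule sum.cong) (simp_all add: k'k)
      finally have "(\<Sum>j<?n. (\<sigma> \<bullet> k' j) *\<^sub>R e j t) + 0 *\<^sub>R snd (velocity A {a..b} c t) = 0" using u0 by simp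
      from frame_independent(2)[OF par 0 e0(1,2) _ t this] vel e0(3)
      have "\<sigma> \<bullet> k' j = 0" if "j < ?n" for j using that by simp
      then have "\<sigma> \<bullet> i = 0" if "i \<in> Basis" for i using kn[OF that] k'k[OF that] by metis
      then have "\<sigma> = 0" by (simp add: euclidean_eq_iff[of \<sigma> 0])
      then show ?thesis using x \<tau> by (simp add: zero_prod_def)
    qed
    have "inj ?D" using zero by (simp add: linear_injective_0[OF lD])
    then show ?thesis using \<phi>(1) ct Vca[OF t] by (intro bexI[of _ \<phi>]) (auto simp: pt)
  qed
  have injK: "inj_on V ({a..b} \<times> {0})"
    using inj Vca by (auto simp: inj_on_def)
  have W: "open (I' \<times> B)" "{a..b} \<times> {0} \<subseteq> I' \<times> B" using Vo I' B by (auto intro: open_Times)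
  have K: "compact ({a..b} \<times> {0 :: 's})" by (intro compact_Times) auto
  obtain r where "r > 0" "\<And>D. open D \<Longrightarrow> D \<subseteq> (\<Union>x\<in>{a..b} \<times> {0}. ball x r) \<Longrightarrow> D \<subseteq> I' \<times> B \<and>
      openin (atlas_topology A) (V ` D) \<and> diffeomorphism (open_atlas D) (restrict_atlas A (V ` D)) V"
    by (rule diffeomorphism_near_compact[OF smooth_manifold _ W(1) Vo(3) K W(2) injK imm]) (use DIM in auto)
  then show thesis using that[OF V _ Vca] by blast
qed

end

theorem proposition4p4:
  fixes A :: "('a, 'e::euclidean_space) chart set"
    and S :: "('a, 'e) slit_field"
    and c :: "real \<Rightarrow> 'a"
    and a b :: real
    and J :: "real \<Rightarrow> ('a, 'e) tvec \<Rightarrow> ('a, 'e) tvec"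
  assumes manifold: "smooth_manifold A"
    and dim: "DIM('e) \<ge> 2" "DIM('e) = CARD('m::finite) + 1"
    and spray: "spray A S"
    and I: "a < b" "0 \<in> {a..b}"
    and geodesic: "geodesic_on_closed A S {a..b} c"
    and injective: "inj_on c {a..b}"
    and jacobi: "jacobi_tensor A S {a..b} c J"
    and invertible: "invertible_tensor A S {a..b} c J"
  shows "\<exists>(I' :: real set) (\<epsilon> :: real) (V :: real \<times> (real ^ 'm) \<Rightarrow> 'a).
    open I' \<and> is_interval I' \<and> {a..b} \<subseteq> I' \<and> \<epsilon> > 0 \<and>
    (\<forall>t\<in>{a..b}. V (t, 0) = c t) \<and>
    (let D = I' \<times> {s. \<forall>i. \<bar>s $ i\<bar> < \<epsilon>} in
       openin (atlas_topology A) (V ` D) \<and>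
       diffeomorphism (open_atlas D) (restrict_atlas A (V ` D)) V) \<and>
    (\<forall>s. (\<forall>i. \<bar>s $ i\<bar> < \<epsilon>) \<longrightarrow> geodesic_on A S I' (\<lambda>t. V (t, s)))"
proof -
  obtain I0 c0 where I0: "{a..b} \<subseteq> I0" "geodesic_on A S I0 c0" "\<forall>t\<in>{a..b}. c0 t = c t"
    using geodesic unfolding geodesic_on_closed_def by blast
  interpret geodesic_segment A S a b c c0 I0
    by unfold_locales (use manifold spray I I0 in auto)
  obtain W e where W: "snd (velocity A {a..b} c 0) \<notin> W" "parallel_basis_extension A S {a..b} c W e"
    "transversal A {a..b} c J (frame_span e)"
    "\<And>t. t \<in> {a..b} \<Longrightarrow> bij_betw (J t) (frame_span e t) (frame_span e t)"
    using invertible unfolding invertible_tensor_def by blast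
  have DIM: "DIM(real ^ 'm) + 1 = DIM('e)" using dim(2) by simp
  obtain k where "bij_betw k (Basis :: (real ^ 'm) set) {0..<DIM(real ^ 'm)}"
    using ex_bij_betw_finite_nat[OF finite_Basis] by blast
  then have k: "bij_betw k (Basis :: (real ^ 'm) set) {..<DIM('e) - 1}"
    using dim(2) by (simp add: atLeast0LessThan)
  obtain I1 B r and V :: "real \<times> (real ^ 'm) \<Rightarrow> 'a" where V: "geodesic_family I1 B V" and r: "r > 0"
    and Vc: "\<And>t. t \<in> {a..b} \<Longrightarrow> V (t, 0) = c t"
    and D: "\<And>D. open D \<Longrightarrow> D \<subseteq> (\<Union>x\<in>{a..b} \<times> {0}. ball x r) \<Longrightarrow> D \<subseteq> I1 \<times> B \<and>
      openin (atlas_topology A) (V ` D) \<and> diffeomorphism (open_atlas D) (restrict_atlas A (V ` D)) V"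
    using coordinates_from_jacobi_tensor[OF I(2) injective jacobi W k DIM] by metis
  \<comment> \<open>Half of the tube radius is spent on time and half on the parameters: the
    Euclidean norm is at most the sum of the \<open>CARD('m)\<close> absolute values, each below
    \<epsilon>.\<close>
  define I' where "I' = {a - r / 2<..<b + r / 2}"
  define \<epsilon> where "\<epsilon> = r / (2 * CARD('m))"
  define C where "C = {s :: real ^ 'm. \<forall>i. \<bar>s $ i\<bar> < \<epsilon>}"
  have \<epsilon>: "\<epsilon> > 0" using r by (simp add: \<epsilon>_def)
  have Co: "open C"
  proof -
    have "C = (\<Inter>i. {s. \<bar>s $ i\<bar> < \<epsilon>})" by (auto simp: C_def)
    moreover have "open {s :: real ^ 'm. \<bar>s $ i\<bar> < \<epsilon>}" for i
      by (intro open_Collect_less continuous_intros)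
    ultimately show ?thesis by (simp add: open_INT)
  qed
  have near: "I' \<times> C \<subseteq> (\<Union>x\<in>{a..b} \<times> {0}. ball x r)"
  proof
    fix p assume "p \<in> I' \<times> C"
    then obtain t s where p: "p = (t, s)" "t \<in> I'" "s \<in> C" by blast
    \<comment> \<open>The nearest point of \<open>{a..b}\<close>; its distance to \<open>t\<close>
      is strictly below \<open>r / 2\<close>, which compensates for the non-strict bound on
      \<open>norm s\<close>.\<close>
    define t' where "t' = max a (min b t)"
    have t': "t' \<in> {a..b}" "\<bar>t' - t\<bar> < r / 2" using p(2) I(1) r by (auto simp: t'_def I'_def max_def min_def)
    have "norm s \<le> (\<Sum>i\<in>UNIV. \<bar>s $ i\<bar>)" by (rule norm_le_l1_cart)
    also have "\<dots> \<le> (\<Sum>i\<in>(UNIV :: 'm set). \<epsilon>)" using p(3) by (intro sum_mono) (auto simp: C_def less_imp_le)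
    also have "\<dots> = r / 2" by (simp add: \<epsilon>_def)
    finally have ns: "norm s \<le> r / 2" .
    have "dist (t', 0) p \<le> \<bar>t' - t\<bar> + norm s"
      using sqrt_sum_squares_le_sum_abs[of "dist t' t" "norm s"] by (simp add: p dist_Pair_Pair dist_real_def)
    then have "p \<in> ball (t', 0) r" using t' ns by simp
    then show "p \<in> (\<Union>x\<in>{a..b} \<times> {0}. ball x r)" using t' by blast
  qed
  have I'o: "open I'" "is_interval I'" "{a..b} \<subseteq> I'" using r by (auto simp: I'_def is_interval_oo)
  note DD = D[OF open_Times[OF I'o(1) Co] near]
  have C0: "0 \<in> C" using \<epsilon> by (simp add: C_def)
  have geos: "geodesic_on A S I' (\<lambda>t. V (t, s))" if s: "s \<in> C" for s
  proof (rule geodesic_on_subinterval[OF _ I'o(1,2)])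
    \<comment> \<open>From the inclusion of \<open>I' \<times> C\<close> in
      \<open>I1 \<times> B\<close>, each factor inclusion needs a point in the other factor:
      \<open>a\<close> in \<open>I'\<close> here, and 0 in \<open>C\<close> for the inclusion of the
      intervals.\<close>
    have "a \<in> I'" using I'o(3) I(1) by auto
    then have "s \<in> B" using DD s by blast
    then show "geodesic_on A S I1 (\<lambda>t. V (t, s))" using V by (simp add: geodesic_family_def)
    show "I' \<subseteq> I1" using DD C0 by blast
  qed
  show ?thesis
    by (rule exI[of _ I'], rule exI[of _ \<epsilon>], rule exI[of _ V])
      (use I'o \<epsilon> Vc DD geos in \<open>simp add: Let_def C_def\<close>)
qed

end
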